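(* Let $n\ge3$, let $\mathbb{S}^n_+$ be the open upper unit hemisphere and let $g=\varphi^{\frac4{n-2}}g_{\mathbb{S}^n_+}$ be a metric conformal to the round metric, with $\varphi$ smooth and positive on $\overline{\mathbb{S}^n_+}$; let $\Delta_g$ be its Laplace–Beltrami operator and $\nu$ the $g$-unit outward normal on $\partial\mathbb{S}^n_+$. Let $\tilde f:[0,+\infty)\to[0,+\infty)$ be continuous and satisfy (H1)–(H3) below, and let $\tilde f_1,\tilde f_2:[0,+\infty)^2\to[0,+\infty)$ be continuous and satisfy (F1)–(F4) below. For $\lambda\in\mathbb{R}$ and a real matrix $A=\begin{pmatrix}\lambda_1&\lambda_2\\ \lambda_3&\lambda_4\end{pmatrix}$ consider $$-\Delta_g u=\tilde f(u)-\lambda u\ \text{ in }\mathbb{S}^n_+,\quad \frac{\partial u}{\partial\nu}=0\ \text{ on }\partial\mathbb{S}^n_+,\qquad(P_\lambda)$$ $$-\Delta_g u_1=\tilde f_1(u_1,u_2)-\lambda_1u_1-\lambda_2u_2,\quad -\Delta_g u_2=\tilde f_2(u_1,u_2)-\lambda_3u_1-\lambda_4u_2\ \text{ in }\mathbb{S}^n_+,\quad \frac{\partial u_1}{\partial\nu}=\frac{\partial u_2}{\partial\nu}=0\ \text{ on }\partial\mathbb{S}^n_+.\qquad(S_A)$$ Then there exists $\lambda^*=\lambda^*(n,g,\mathbb{S}^n_+)>0$ such that: (i) for all $0<\lambda<\lambda^*$, any positive continuous solution of $(P_\lambda)$ is constant. In particular, for $\tilde f(t)=t^p$ with $1<p<\frac{n+2}{n-2}$,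 $u\equiv\lambda^{\frac1{p-1}}$ is the only positive solution of $(P_\lambda)$ for $\lambda>0$ small; (ii) for all $A$ with $0<\|A\|<\lambda^*$, any pair $(u_1,u_2)$ of positive continuous solutions of $(S_A)$ consists of constants. Hypotheses: (H1) $\tilde f(t)t^{-\frac{n+2}{n-2}}$ is nonincreasing and positive on $(0,+\infty)$; (H2) there is $1<p<\frac{n+2}{n-2}$ with $\lim_{t\to+\infty}\tilde f(t)t^{-p}=c_1>0$; (H3) there exist $0<\mu\le p-1$ and $C>0$ with $\left|\frac{\tilde f(t)-\tilde f(r)}{t-r}\right|\le C(t^\mu+t^{p-1})$ for all $0\le r<t$; (F1) for $j=1,2$, $\tilde f_j(r,t)$ is nondecreasing in $r$ and in $t$; (F2) for $j=1,2$, $\tilde f_j(r,t)(r+t)^{-\frac{n+2}{n-2}}$ is nonincreasing in each variable with the other fixed; (F3) there exist $1<p<\frac{n+2}{n-2}$, $0<\mu<p-1$ and $C>0$ with $\frac{|\tilde f_j(r_1,t_1)-\tilde f_j(r_2,t_2)|}{|(r_1,t_1)-(r_2,t_2)|}\le C\big[(r_1+t_1)^\mu+(r_1+t_1)^{p-1}\big]$ for all $r_1>r_2\ge0$, $t_1>t_2\ge0$, $j=1,2$; (F4) there exist continuous $\psi_1,\psi_2:[0,+\infty)^2\to[0,+\infty)$ with $\lim_{t\to+\infty}\tilde f_j(a_1t,a_2t)t^{-p}=\psi_j(a_1,a_2)$ for all $a_1,a_2\ge0$ (with $p$ as in (F3)), and $\psi_1(a_1,a_2)+\psi_2(a_1,a_2)>0$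 whenever $a_1+a_2>0$.
   Context: $\|A\|$ denotes any fixed matrix norm (all are equivalent).
   Formalization: λ* may depend on the nonlinearities f̃, f̃₁, f̃₂ as well as on n and g; a λ* depending only on (n, g) fails, e.g. for the flat ball metric with n = 4, 5, 6. *)

theory Defs
  imports "HOL-Analysis.Analysis"
begin

text \<open>Ambient space: real^'m = R^(n+1) with n = CARD('m) - 1.
  The upper hemisphere is taken with respect to a coordinate axis k.\<close>

definition hemi :: "'m \<Rightarrow> (real^'m) set" where
  "hemi k = {x. norm x = 1 \<and> x $ k > 0}"

definition chemi :: "'m \<Rightarrow> (real^'m) set" where
  "chemi k = {x. norm x = 1 \<and> x $ k \<ge> 0}"

definition bdry :: "'m \<Rightarrow> (real^'m) set" where
  "bdry k = {x. norm x = 1 \<and> x $ k = 0}"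

definition hcone :: "'m \<Rightarrow> (real^'m) set" where
  "hcone k = {x. x $ k > 0}"

definition ext :: "(real^'m \<Rightarrow> real) \<Rightarrow> real^'m \<Rightarrow> real" where
  "ext u x = u (x /\<^sub>R norm x)"

definition partial :: "'m \<Rightarrow> (real^'m \<Rightarrow> real) \<Rightarrow> real^'m \<Rightarrow> real" where
  "partial i F x = deriv (\<lambda>t. F (x + t *\<^sub>R axis i (1::real))) 0"

fun partials :: "'m list \<Rightarrow> (real^'m \<Rightarrow> real) \<Rightarrow> real^'m \<Rightarrow> real" where
  "partials [] F = F"
| "partials (i # is) F = partial i (partials is F)"

definition C2_on :: "(real^'m) set \<Rightarrow> (real^'m \<Rightarrow> real) \<Rightarrow> bool" where
  "C2_on S F \<longleftrightarrow>
     (\<forall>i. \<forall>x\<in>S. (\<lambda>t. F (x + t *\<^sub>R axis i (1::real))) differentiable (at 0)) \<and>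
     (\<forall>i. continuous_on S (partial i F)) \<and>
     (\<forall>i j. \<forall>x\<in>S. (\<lambda>t. partial i F (x + t *\<^sub>R axis j (1::real))) differentiable (at 0)) \<and>
     (\<forall>i j. continuous_on S (partial j (partial i F)))"

definition smooth_on :: "(real^'m) set \<Rightarrow> (real^'m \<Rightarrow> real) \<Rightarrow> bool" where
  "smooth_on U F \<longleftrightarrow> open U \<and>
     (\<forall>is. continuous_on U (partials is F) \<and>
       (\<forall>i. \<forall>x\<in>U. (\<lambda>t. partials is F (x + t *\<^sub>R axis i (1::real))) differentiable (at 0)))"

definition conf_factor :: "'m \<Rightarrow> (real^'m \<Rightarrow> real) \<Rightarrow> bool" where
  "conf_factor k \<phi> \<longleftrightarrow> (\<forall>x\<in>chemi k. \<phi> x > 0) \<and>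
     (\<exists>U \<Phi>. chemi k \<subseteq> U \<and> smooth_on U \<Phi> \<and> (\<forall>x\<in>chemi k. \<Phi> x = \<phi> x))"

definition dimn :: "'m itself \<Rightarrow> real" where
  "dimn _ = real CARD('m) - 1"

text \<open>Laplace-Beltrami operator of g = phi^(4/(n-2)) g_round on the sphere:
  Delta_g u = phi^(-4/(n-2)) (Delta_0 u + 2 phi^(-1) <grad_0 phi, grad_0 u>_0),
  where the round Laplacian / gradient pairing are computed through the
  degree-0 homogeneous extensions at points of the unit sphere.\<close>
definition lap_g :: "(real^'m \<Rightarrow> real) \<Rightarrow> (real^'m \<Rightarrow> real) \<Rightarrow> real^'m \<Rightarrow> real" where
  "lap_g \<phi> u x = \<phi> x powr (- 4 / (dimn TYPE('m) - 2)) *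
     ((\<Sum>i\<in>UNIV. partial i (partial i (ext u)) x)
      + 2 / \<phi> x * (\<Sum>i\<in>UNIV. partial i (ext \<phi>) x * partial i (ext u) x))"

text \<open>g-unit outward normal derivative at a boundary point y is N:
  the outward unit normal (round metric) at y is -e_k; the g-unit one is
  phi^(-2/(n-2)) (-e_k).  The derivative is taken one-sidedly along the
  inward great circle t \<mapsto> cos t y + sin t e_k.\<close>
definition has_normal_deriv_g :: "'m \<Rightarrow> (real^'m \<Rightarrow> real) \<Rightarrow> (real^'m \<Rightarrow> real) \<Rightarrow> real^'m \<Rightarrow> real \<Rightarrow> bool" where
  "has_normal_deriv_g k \<phi> u y N \<longleftrightarrow>
     (\<exists>D. ((\<lambda>t. (u (cos t *\<^sub>R y + sin t *\<^sub>R axis k (1::real)) - u y) / t) \<longlongrightarrow> D) (at_right 0)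
          \<and> N = - (\<phi> y powr (- 2 / (dimn TYPE('m) - 2))) * D)"

definition neumann_sol :: "'m \<Rightarrow> (real^'m \<Rightarrow> real) \<Rightarrow> (real^'m \<Rightarrow> real) \<Rightarrow> (real^'m \<Rightarrow> real) \<Rightarrow> bool" where
  "neumann_sol k \<phi> u F \<longleftrightarrow> continuous_on (chemi k) u \<and> C2_on (hcone k) (ext u) \<and>
     (\<forall>x\<in>hemi k. - lap_g \<phi> u x = F x) \<and>
     (\<forall>y\<in>bdry k. has_normal_deriv_g k \<phi> u y 0)"

definition pos_sol_P :: "'m \<Rightarrow> (real^'m \<Rightarrow> real) \<Rightarrow> (real \<Rightarrow> real) \<Rightarrow> real \<Rightarrow> (real^'m \<Rightarrow> real) \<Rightarrow> bool" where
  "pos_sol_P k \<phi> f lam u \<longleftrightarrow> (\<forall>x\<in>hemi k. u x > 0) \<and>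
     neumann_sol k \<phi> u (\<lambda>x. f (u x) - lam * u x)"

definition pos_sol_S :: "'m \<Rightarrow> (real^'m \<Rightarrow> real) \<Rightarrow> (real \<Rightarrow> real \<Rightarrow> real) \<Rightarrow> (real \<Rightarrow> real \<Rightarrow> real)
    \<Rightarrow> real^2^2 \<Rightarrow> (real^'m \<Rightarrow> real) \<Rightarrow> (real^'m \<Rightarrow> real) \<Rightarrow> bool" where
  "pos_sol_S k \<phi> f1 f2 A u1 u2 \<longleftrightarrow> (\<forall>x\<in>hemi k. u1 x > 0 \<and> u2 x > 0) \<and>
     neumann_sol k \<phi> u1 (\<lambda>x. f1 (u1 x) (u2 x) - A$1$1 * u1 x - A$1$2 * u2 x) \<and>
     neumann_sol k \<phi> u2 (\<lambda>x. f2 (u1 x) (u2 x) - A$2$1 * u1 x - A$2$2 * u2 x)"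

definition hypH :: "real \<Rightarrow> (real \<Rightarrow> real) \<Rightarrow> bool" where
  "hypH n f \<longleftrightarrow> continuous_on {0..} f \<and> (\<forall>t\<ge>0. f t \<ge> 0) \<and>
     (\<forall>t>0. f t * t powr (- ((n+2)/(n-2))) > 0) \<and>
     (\<forall>s t. 0 < s \<and> s \<le> t \<longrightarrow> f t * t powr (- ((n+2)/(n-2))) \<le> f s * s powr (- ((n+2)/(n-2)))) \<and>
     (\<exists>p c1. 1 < p \<and> p < (n+2)/(n-2) \<and> c1 > 0 \<and>
        ((\<lambda>t. f t * t powr (- p)) \<longlongrightarrow> c1) at_top \<and>
        (\<exists>\<mu> C. 0 < \<mu> \<and> \<mu> \<le> p - 1 \<and> C > 0 \<and>
           (\<forall>r t. 0 \<le> r \<and> r < t \<longrightarrow> \<bar>(f t - f r) / (t - r)\<bar> \<le> C * (t powr \<mu> + t powr (p - 1)))))"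

definition hypF_single :: "real \<Rightarrow> real \<Rightarrow> real \<Rightarrow> real \<Rightarrow> (real \<Rightarrow> real \<Rightarrow> real) \<Rightarrow> bool" where
  "hypF_single n p \<mu> C g \<longleftrightarrow>
     continuous_on ({0..} \<times> {0..}) (\<lambda>(r,t). g r t) \<and> (\<forall>r\<ge>0. \<forall>t\<ge>0. g r t \<ge> 0) \<and>
     (\<forall>r r' t. 0 \<le> r \<and> r \<le> r' \<and> 0 \<le> t \<longrightarrow> g r t \<le> g r' t) \<and>
     (\<forall>r t t'. 0 \<le> t \<and> t \<le> t' \<and> 0 \<le> r \<longrightarrow> g r t \<le> g r t') \<and>
     (\<forall>r r' t. 0 \<le> r \<and> r \<le> r' \<and> 0 \<le> t \<and> 0 < r + t \<longrightarrow>
        g r' t * (r' + t) powr (- ((n+2)/(n-2))) \<le> g r t * (r + t) powr (- ((n+2)/(n-2)))) \<and>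
     (\<forall>r t t'. 0 \<le> t \<and> t \<le> t' \<and> 0 \<le> r \<and> 0 < r + t \<longrightarrow>
        g r t' * (r + t') powr (- ((n+2)/(n-2))) \<le> g r t * (r + t) powr (- ((n+2)/(n-2)))) \<and>
     (\<forall>r1 r2 t1 t2. r1 > r2 \<and> r2 \<ge> 0 \<and> t1 > t2 \<and> t2 \<ge> 0 \<longrightarrow>
        \<bar>g r1 t1 - g r2 t2\<bar> / sqrt ((r1 - r2)^2 + (t1 - t2)^2)
          \<le> C * ((r1 + t1) powr \<mu> + (r1 + t1) powr (p - 1)))"

definition hypF :: "real \<Rightarrow> (real \<Rightarrow> real \<Rightarrow> real) \<Rightarrow> (real \<Rightarrow> real \<Rightarrow> real) \<Rightarrow> bool" where
  "hypF n f1 f2 \<longleftrightarrow>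
     (\<exists>p \<mu> C. 1 < p \<and> p < (n+2)/(n-2) \<and> 0 < \<mu> \<and> \<mu> < p - 1 \<and> C > 0 \<and>
        hypF_single n p \<mu> C f1 \<and> hypF_single n p \<mu> C f2 \<and>
        (\<exists>\<psi>1 \<psi>2 :: real \<Rightarrow> real \<Rightarrow> real.
           continuous_on ({0..} \<times> {0..}) (\<lambda>(a,b). \<psi>1 a b) \<and>
           continuous_on ({0..} \<times> {0..}) (\<lambda>(a,b). \<psi>2 a b) \<and>
           (\<forall>a\<ge>0. \<forall>b\<ge>0. \<psi>1 a b \<ge> 0 \<and> \<psi>2 a b \<ge> 0) \<and>
           (\<forall>a1\<ge>0. \<forall>a2\<ge>0.
              ((\<lambda>t. f1 (a1 * t) (a2 * t) * t powr (- p)) \<longlongrightarrow> \<psi>1 a1 a2) at_top \<and>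
              ((\<lambda>t. f2 (a1 * t) (a2 * t) * t powr (- p)) \<longlongrightarrow> \<psi>2 a1 a2) at_top) \<and>
           (\<forall>a1\<ge>0. \<forall>a2\<ge>0. a1 + a2 > 0 \<longrightarrow> \<psi>1 a1 a2 + \<psi>2 a1 a2 > 0)))"

end

theory Submission
  imports Defs "HOL-Complex_Analysis.Great_Picard"
begin

text \<open>In stereographic charts the conformal Laplacian becomes a weighted flat Laplacian with a
  bounded first-order term, and even reflection across the equator removes the Neumann condition.
  If solutions with bounded coefficients were unbounded, rescaling at the maximum point would give
  a bounded nonnegative entire solution of the limiting system, whose nonlinearity is homogeneous of
  degree p; the moving-sphere argument, run with the Kelvin transform and the maximum principle
  alone, excludes it as p is subcritical. Hence solutions are bounded a priori, and compactness
  together with the strong maximum principle forces them to be uniformly small when the linear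
  coefficients are small. For a small solution the right-hand side has a small Lipschitz constant in
  the solution, it is nonpositive at minima and nonnegative at maxima, and the oscillation of the
  solution is bounded by a multiple of the size of the right-hand side; this is a contraction,
  so the oscillation vanishes.\<close>

text \<open>The obstacle is regularity at the equator. A solution has there only a one-sided normal
  derivative, so its even reflection is only known to be continuous across the mirror hyperplane,
  and so are all limits of solutions. Estimates and limits are therefore run through touching test
  functions: with a small multiple of the distance to the hyperplane added they never touch on it,
  since the vanishing normal derivative excludes a kink there. Equicontinuity comes from doubling
  the variables; limits are viscosity supersolutions. Viscosity inequalities cannot simply be
  subtracted, so the one for a solution minus its Kelvin transform is proved before the limit and
  carried along. This needs inversions that preserve the hyperplane, hence centres on it; the moving
  spheres then show only that the entire solution depends on the signed distance to the hyperplane,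
  and concavity on the line finishes. The projection poles are put on the equator, so that the
  equator is flat in both charts.\<close>

section \<open>Second-order calculus at a point: gradient fields, Hessians and traces\<close>

definition tr :: "('a::euclidean_space => 'a) => real" where
 "tr H = (\<Sum>b\<in>Basis. H b \<bullet> b)"

text \<open>\<open>G\<close> is a gradient on a neighbourhood but has to be differentiable only at
  \<open>y\<close> itself; maximum arguments along lines through \<open>y\<close> consume just this.
  Symmetry of \<open>H\<close> is not part of the notion.\<close>

definition hess :: "('a::euclidean_space => real) => 'a => ('a => 'a) => ('a => 'a) => bool" where
 "hess v y G H \<longleftrightarrow> (\<forall>\<^sub>F z in nhds y. (v has_derivative (\<lambda>h. G z \<bullet> h)) (at z)) \<and> (G has_derivative H) (at y)"

text \<open>A positive second derivative would make \<open>f'\<close> positive just to the right of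
  the critical point, and the mean value theorem would lift \<open>f\<close> above its
  maximum.\<close>

lemma second_deriv_nonpos_at_max:
 fixes f f' :: "real => real"
 assumes 1: "\<forall>\<^sub>F t in nhds 0. (f has_real_derivative f' t) (at t)"
  and 2: "(f' has_real_derivative D) (at 0)"
  and 3: "\<forall>\<^sub>F t in nhds 0. f t <= f 0"
 shows "f' 0 = 0" "D <= 0"
proof -
 obtain d where d: "d > 0" "\<And>t. \<bar>t\<bar> < d ==> (f has_real_derivative f' t) (at t) \<and> f t <= f 0"
  using eventually_conj[OF 1 3] by (auto simp: eventually_nhds_metric dist_real_def)
 show z: "f' 0 = 0"
  using DERIV_local_max[of f "f' 0" 0 d] d by auto
 show "D <= 0"
 proof (rule ccontr)
  assume "\<not> D <= 0"
  then obtain e where e: "e > 0" "\<And>h. h > 0 ==> h < e ==> f' 0 < f' (0 + h)"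
   using DERIV_pos_inc_right[OF 2] by auto
  define t where "t = min d e / 2"
  have t: "t > 0" "t < d" "t < e" using d e by (auto simp: t_def)
  obtain \<xi> where "\<xi> > 0" "\<xi> < t" "f t - f 0 = (t - 0) * f' \<xi>"
   using MVT2[of 0 t f f'] t d by auto
  then have "f t - f 0 > 0" using e(2)[of \<xi>] t z by simp
  then show False using d(2)[of t] t by simp
 qed
qed

lemma hess_line:
 assumes "hess v y G H"
 shows "\<forall>\<^sub>F t in nhds 0. ((\<lambda>t. v (y + t *\<^sub>R h)) has_real_derivative G (y + t *\<^sub>R h) \<bullet> h) (at t)"
  and "((\<lambda>t. G (y + t *\<^sub>R h) \<bullet> h) has_real_derivative H h \<bullet> h) (at 0)"
proof -
 have 1: "\<forall>\<^sub>F z in nhds y. (v has_derivative (\<lambda>h. G z \<bullet> h)) (at z)"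
  and 2: "(G has_derivative H) (at y)" using assms by (auto simp: hess_def)
 have "((\<lambda>t::real. y + t *\<^sub>R h) \<longlongrightarrow> y) (nhds 0)"
  by (auto intro!: tendsto_eq_intros simp: filterlim_ident)
 then have "\<forall>\<^sub>F t::real in nhds 0. (v has_derivative (\<lambda>k. G (y + t *\<^sub>R h) \<bullet> k)) (at (y + t *\<^sub>R h))"
  using 1 unfolding filterlim_iff by blast
 then show "\<forall>\<^sub>F t in nhds 0. ((\<lambda>t. v (y + t *\<^sub>R h)) has_real_derivative G (y + t *\<^sub>R h) \<bullet> h) (at t)"
 proof eventually_elim
  case (elim t)
  have "((\<lambda>t. y + t *\<^sub>R h) has_derivative (\<lambda>s. s *\<^sub>R h)) (at t)"
   by (auto intro!: derivative_eq_intros)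
  from has_derivative_compose[OF this elim] show ?case
   unfolding has_field_derivative_def by (rule has_derivative_eq_rhs) (auto simp: fun_eq_iff)
 qed
 have "((\<lambda>t. y + t *\<^sub>R h) has_derivative (\<lambda>s. s *\<^sub>R h)) (at 0)"
  by (auto intro!: derivative_eq_intros)
 from has_derivative_compose[OF this, of G H] 2
 have "((\<lambda>t. G (y + t *\<^sub>R h)) has_derivative (\<lambda>s. H (s *\<^sub>R h))) (at 0)" by simp
 then have "((\<lambda>t. G (y + t *\<^sub>R h) \<bullet> h) has_derivative (\<lambda>s. H (s *\<^sub>R h) \<bullet> h)) (at 0)"
  by (rule has_derivative_inner_left)
 moreover have "H (s *\<^sub>R h) = s *\<^sub>R H h" for s
  using has_derivative_linear[OF 2] by (simp add: linear_cmul)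
 ultimately show "((\<lambda>t. G (y + t *\<^sub>R h) \<bullet> h) has_real_derivative H h \<bullet> h) (at 0)"
  unfolding has_field_derivative_def by (auto elim!: has_derivative_eq_rhs simp: fun_eq_iff)
qed

lemma hess_at_max:
 assumes h: "hess v y G H" and m: "\<forall>\<^sub>F z in nhds y. v z <= v y"
 shows "G y = 0" "H h \<bullet> h <= 0" "tr H <= 0"
proof -
 have *: "G y \<bullet> h = 0 \<and> H h \<bullet> h <= 0" for h
 proof -
  have "((\<lambda>t::real. y + t *\<^sub>R h) \<longlongrightarrow> y) (nhds 0)"
   by (auto intro!: tendsto_eq_intros simp: filterlim_ident)
  then have "\<forall>\<^sub>F t::real in nhds 0. v (y + t *\<^sub>R h) <= v (y + 0 *\<^sub>R h)"
   using eventually_compose_filterlim[OF m] by simp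
  from second_deriv_nonpos_at_max[OF hess_line(1)[OF h, of h] hess_line(2)[OF h, of h] this]
  show ?thesis by simp
 qed
 show "G y = 0" using *[of "G y"] by simp
 show "H h \<bullet> h <= 0" using * by simp
 show "tr H <= 0" unfolding tr_def by (intro sum_nonpos) (use * in auto)
qed

lemma hess_add:
 assumes "hess v y G H" "hess w y G' H'"
 shows "hess (\<lambda>z. v z + w z) y (\<lambda>z. G z + G' z) (\<lambda>h. H h + H' h)"
proof -
 have 1: "((\<lambda>z. v z + w z) has_derivative (\<lambda>h. (G z + G' z) \<bullet> h)) (at z)"
  if "(v has_derivative (\<lambda>h. G z \<bullet> h)) (at z)" "(w has_derivative (\<lambda>h. G' z \<bullet> h)) (at z)" for z
  using has_derivative_add[OF that] by (simp add: inner_add_left)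
 have "\<forall>\<^sub>F z in nhds y. ((\<lambda>z. v z + w z) has_derivative (\<lambda>h. (G z + G' z) \<bullet> h)) (at z)"
  using assms[unfolded hess_def, THEN conjunct1] by (rule eventually_elim2) (rule 1)
 then show ?thesis using assms by (simp add: hess_def has_derivative_add)
qed

lemma hess_scale:
 assumes "hess v y G H"
 shows "hess (\<lambda>z. c * v z) y (\<lambda>z. c *\<^sub>R G z) (\<lambda>h. c *\<^sub>R H h)"
proof -
 have 1: "((\<lambda>z. c * v z) has_derivative (\<lambda>h. (c *\<^sub>R G z) \<bullet> h)) (at z)"
  if "(v has_derivative (\<lambda>h. G z \<bullet> h)) (at z)" for z
  using has_derivative_mult_right[OF that, of c] by simp
 have "\<forall>\<^sub>F z in nhds y. ((\<lambda>z. c * v z) has_derivative (\<lambda>h. (c *\<^sub>R G z) \<bullet> h)) (at z)"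
  using assms[unfolded hess_def, THEN conjunct1] by (rule eventually_mono) (rule 1)
 then show ?thesis using assms by (simp add: hess_def has_derivative_scaleR_right)
qed

lemma hess_minus:
 assumes "hess v y G H"
 shows "hess (\<lambda>z. - v z) y (\<lambda>z. - G z) (\<lambda>h. - H h)"
 using hess_scale[OF assms, of "-1"] by simp

lemma hess_diff:
 assumes "hess v y G H" "hess w y G' H'"
 shows "hess (\<lambda>z. v z - w z) y (\<lambda>z. G z - G' z) (\<lambda>h. H h - H' h)"
 using hess_add[OF assms(1) hess_minus[OF assms(2)]] by simp

lemma hess_const: "hess (\<lambda>z. c) y (\<lambda>z. 0) (\<lambda>h. 0)"
 by (auto simp: hess_def)

lemma tr_add: "tr (\<lambda>h. H h + H' h) = tr H + tr H'"
 by (simp add: tr_def inner_add_left sum.distrib)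
lemma tr_diff: "tr (\<lambda>h. H h - H' h) = tr H - tr H'"
 by (simp add: tr_def inner_diff_left sum_subtractf)
lemma tr_minus: "tr (\<lambda>h. - H h) = - tr H"
 by (simp add: tr_def sum_negf)
lemma tr_scale: "tr (\<lambda>h. c *\<^sub>R H h) = c * tr H"
 by (simp add: tr_def sum_distrib_left)
lemma tr_zero: "tr (\<lambda>h. 0) = 0"
 by (simp add: tr_def)
lemma tr_id: "tr (\<lambda>h. h :: 'a::euclidean_space) = DIM('a)"
 by (simp add: tr_def)

lemma hess_linear: "hess (\<lambda>z. a \<bullet> z) y (\<lambda>z. a) (\<lambda>h. 0)"
 unfolding hess_def by (intro conjI always_eventually allI has_derivative_const has_derivative_inner_right has_derivative_ident)

lemma hess_cong:
 assumes "hess v y G H" "\<forall>\<^sub>F z in nhds y. v z = w z"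
 shows "hess w y G H"
proof -
 have "\<forall>\<^sub>F z in nhds y. \<forall>\<^sub>F x in nhds z. v x = w x"
  using assms(2) by (simp add: eventually_eventually)
 then have "\<forall>\<^sub>F z in nhds y. (w has_derivative (\<lambda>h. G z \<bullet> h)) (at z)"
  using assms(1)[unfolded hess_def, THEN conjunct1]
 proof eventually_elim
  case (elim z)
  have "v z = w z" using elim(1) eventually_nhds_x_imp_x by fastforce
  moreover have "\<forall>\<^sub>F x in at z. w x = v x"
   using elim(1) by (auto simp: eventually_at_filter elim: eventually_mono)
  ultimately show ?case using elim(2)
   using has_derivative_transform_eventually[of v _ z UNIV w] by (simp add: eq_commute elim(1))
 qed
 then show ?thesis using assms(1) by (simp add: hess_def)
qed

text \<open>The vector on the left is the adjoint of \<open>f\<close> applied to \<open>g\<close>;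
  it turns the chain rule for derivatives into one for gradients.\<close>

lemma basis_adjoint:
 assumes "linear (f :: 'a::euclidean_space => 'b::real_inner)"
 shows "(\<Sum>b\<in>Basis. (g \<bullet> f b) *\<^sub>R b) \<bullet> h = g \<bullet> f h"
proof -
 have "f h = (\<Sum>b\<in>Basis. (h \<bullet> b) *\<^sub>R f b)"
 proof -
  have "f h = f (\<Sum>b\<in>Basis. (h \<bullet> b) *\<^sub>R b)" by (simp only: euclidean_representation)
  then show ?thesis by (simp add: linear_sum[OF assms] linear_cmul[OF assms])
 qed
 then have "g \<bullet> f h = (\<Sum>b\<in>Basis. (h \<bullet> b) * (g \<bullet> f b))" by (simp add: inner_sum_right)
 moreover have "(\<Sum>b\<in>Basis. (g \<bullet> f b) *\<^sub>R b) \<bullet> h = (\<Sum>b\<in>Basis. (h \<bullet> b) * (g \<bullet> f b))"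
  unfolding inner_sum_left by (intro sum.cong) (auto simp: inner_commute)
 ultimately show ?thesis by simp
qed

text \<open>The trace formula separates the Hessian transported by \<open>T'\<close> from the drift,
  which is \<open>G\<close> paired with the Laplacian of \<open>T\<close>. For inversions and
  reflections \<open>T'\<close> is a multiple of an isometry, so the transported part is a multiple
  of \<open>tr H\<close>.\<close>

lemma hess_compose:
 fixes T :: "'a::euclidean_space => 'b::euclidean_space"
 assumes v: "hess v (T y) G H"
  and T: "\<forall>\<^sub>F z in nhds y. (T has_derivative T' z) (at z)"
  and T2: "\<And>b. b \<in> Basis ==> ((\<lambda>z. T' z b) has_derivative T2 b) (at y)"
 shows "hess (\<lambda>z. v (T z)) y (\<lambda>z. \<Sum>b\<in>Basis. (G (T z) \<bullet> T' z b) *\<^sub>R b)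
     (\<lambda>k. \<Sum>b\<in>Basis. (G (T y) \<bullet> T2 b k + H (T' y k) \<bullet> T' y b) *\<^sub>R b)"
  and "tr (\<lambda>k. \<Sum>b\<in>Basis. (G (T y) \<bullet> T2 b k + H (T' y k) \<bullet> T' y b) *\<^sub>R b)
     = (\<Sum>b\<in>Basis. H (T' y b) \<bullet> T' y b) + G (T y) \<bullet> (\<Sum>b\<in>Basis. T2 b b)"
proof -
 have Ty: "(T has_derivative T' y) (at y)" using eventually_nhds_x_imp_x[OF T] .
 have "isCont T y" using has_derivative_continuous[OF Ty] .
 then have "(T \<longlongrightarrow> T y) (nhds y)"
  by (simp add: continuous_within tendsto_at_iff_tendsto_nhds)
 then have "\<forall>\<^sub>F z in nhds y. (v has_derivative (\<lambda>h. G (T z) \<bullet> h)) (at (T z))"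
  using v unfolding hess_def filterlim_iff by blast
 then have A: "\<forall>\<^sub>F z in nhds y. ((\<lambda>z. v (T z)) has_derivative (\<lambda>h. (\<Sum>b\<in>Basis. (G (T z) \<bullet> T' z b) *\<^sub>R b) \<bullet> h)) (at z)"
  using T
 proof eventually_elim
  case (elim z)
  from has_derivative_compose[OF elim(2) elim(1)]
  show ?case using basis_adjoint[OF has_derivative_linear[OF elim(2)]] by simp
 qed
 have G: "(G has_derivative H) (at (T y))" using v by (simp add: hess_def)
 have GT: "((\<lambda>z. G (T z)) has_derivative (\<lambda>k. H (T' y k))) (at y)"
  using has_derivative_compose[OF Ty G] .
 have B: "((\<lambda>z. \<Sum>b\<in>Basis. (G (T z) \<bullet> T' z b) *\<^sub>R b) has_derivative
  (\<lambda>k. \<Sum>b\<in>Basis. (G (T y) \<bullet> T2 b k + H (T' y k) \<bullet> T' y b) *\<^sub>R b)) (at y)"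
  by (intro has_derivative_sum has_derivative_scaleR_left has_derivative_inner GT T2)
 show "hess (\<lambda>z. v (T z)) y (\<lambda>z. \<Sum>b\<in>Basis. (G (T z) \<bullet> T' z b) *\<^sub>R b)
     (\<lambda>k. \<Sum>b\<in>Basis. (G (T y) \<bullet> T2 b k + H (T' y k) \<bullet> T' y b) *\<^sub>R b)"
  using A B by (simp add: hess_def)
 have "(\<Sum>b\<in>Basis. (c b) *\<^sub>R b) \<bullet> a = c a" if "a \<in> (Basis::'a set)" for c a
  using that by (simp add: inner_sum_left inner_Basis if_distrib sum.delta cong: if_cong)
 then show "tr (\<lambda>k. \<Sum>b\<in>Basis. (G (T y) \<bullet> T2 b k + H (T' y k) \<bullet> T' y b) *\<^sub>R b)
     = (\<Sum>b\<in>Basis. H (T' y b) \<bullet> T' y b) + G (T y) \<bullet> (\<Sum>b\<in>Basis. T2 b b)"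
  by (simp add: tr_def sum.distrib inner_sum_right)
qed

text \<open>In the variable s = |z - p|^2 the Laplacian reads 2 n f' + 4 s f'', without singularity
  at \<open>p\<close>; the radial barriers below are all written in this variable.\<close>

lemma hess_radial:
 fixes f f' :: "real => real" and p y :: "'a::euclidean_space"
 assumes 1: "\<forall>\<^sub>F s in nhds ((y - p) \<bullet> (y - p)). (f has_real_derivative f' s) (at s)"
  and 2: "(f' has_real_derivative f2) (at ((y - p) \<bullet> (y - p)))"
 shows "hess (\<lambda>z. f ((z - p) \<bullet> (z - p))) y (\<lambda>z. (2 * f' ((z-p) \<bullet> (z-p))) *\<^sub>R (z - p))
  (\<lambda>h. (2 * f' ((y-p) \<bullet> (y-p))) *\<^sub>R h + (4 * f2 * ((y - p) \<bullet> h)) *\<^sub>R (y - p))"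
  and "tr (\<lambda>h. (2 * f' ((y-p) \<bullet> (y-p))) *\<^sub>R h + (4 * f2 * ((y - p) \<bullet> h)) *\<^sub>R (y - p))
   = 2 * real DIM('a) * f' ((y-p) \<bullet> (y-p)) + 4 * f2 * ((y-p) \<bullet> (y-p))"
proof -
 let ?q = "\<lambda>z. (z - p) \<bullet> (z - p)"
 have q: "(?q has_derivative (\<lambda>h. 2 * ((z - p) \<bullet> h))) (at z)" for z
  by (auto intro!: derivative_eq_intros simp: inner_commute)
 have "(?q \<longlongrightarrow> ?q y) (nhds y)"
  by (intro tendsto_intros) (auto simp: filterlim_ident)
 then have "\<forall>\<^sub>F z in nhds y. (f has_real_derivative f' (?q z)) (at (?q z))"
  using 1 unfolding filterlim_iff by blast
 then have A: "\<forall>\<^sub>F z in nhds y. ((\<lambda>z. f (?q z)) has_derivative (\<lambda>h. ((2 * f' (?q z)) *\<^sub>R (z - p)) \<bullet> h)) (at z)"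
 proof eventually_elim
  case (elim z)
  from has_derivative_compose[OF q elim[unfolded has_field_derivative_def]]
  show ?case by (simp add: mult_ac)
 qed
 have B: "((\<lambda>z. (2 * f' (?q z)) *\<^sub>R (z - p)) has_derivative
   (\<lambda>h. (2 * f' (?q y)) *\<^sub>R h + (4 * f2 * ((y - p) \<bullet> h)) *\<^sub>R (y - p))) (at y)"
 proof -
  have 1: "((\<lambda>z. 2 * f' (?q z)) has_derivative (\<lambda>h. 2 * (f2 * (2 * ((y - p) \<bullet> h))))) (at y)"
   by (intro has_derivative_mult_right has_derivative_compose[OF q 2[unfolded has_field_derivative_def]])
  have 2: "((\<lambda>z. z - p) has_derivative (\<lambda>h. h)) (at y)"
   by (auto intro!: derivative_eq_intros)
  show ?thesis using has_derivative_scaleR[OF 1 2] by (simp add: mult_ac)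
 qed
 show "hess (\<lambda>z. f (?q z)) y (\<lambda>z. (2 * f' (?q z)) *\<^sub>R (z - p))
  (\<lambda>h. (2 * f' (?q y)) *\<^sub>R h + (4 * f2 * ((y - p) \<bullet> h)) *\<^sub>R (y - p))"
  using A B by (simp add: hess_def)
 have "tr (\<lambda>h. (2 * f' (?q y)) *\<^sub>R h + (4 * f2 * ((y - p) \<bullet> h)) *\<^sub>R (y - p))
  = 2 * f' (?q y) * DIM('a) + 4 * f2 * (\<Sum>b\<in>Basis. ((y-p) \<bullet> b) * ((y-p) \<bullet> b))"
  by (simp add: tr_def inner_add_left sum.distrib sum_distrib_left sum_distrib_right mult_ac inner_Basis)
 then show "tr (\<lambda>h. (2 * f' (?q y)) *\<^sub>R h + (4 * f2 * ((y - p) \<bullet> h)) *\<^sub>R (y - p))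
   = 2 * real DIM('a) * f' (?q y) + 4 * f2 * (?q y)"
  by (simp add: euclidean_inner[of "y-p" "y-p"] mult_ac)
qed

section \<open>Neumann points, solutions across a hyperplane, viscosity supersolutions\<close>

text \<open>The normal derivative of a solution is given only along one great circle, which a chart
  turns into a curve; hence the formulation by curves, one leaving \<open>y\<close> on each side of
  the hyperplane. For an evenly reflected function the second curve is the mirror image of the
  first.\<close>

definition neum :: "('a::euclidean_space => real) => 'a => 'a => bool" where
 "neum v e y \<longleftrightarrow> (\<forall>s\<in>{1,-1::real}. \<exists>\<gamma> c. c > 0 \<and>
  ((\<lambda>t. (\<gamma> t - y) /\<^sub>R t) \<longlongrightarrow> (s * c) *\<^sub>R e) (at_right 0) \<and>
  ((\<lambda>t. (v (\<gamma> t) - v y) / t) \<longlongrightarrow> 0) (at_right 0))"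

text \<open>The equation -Laplace v = F off the hyperplane {y . e = h}, up to a first-order term of
  which only the bound \<beta> on its coefficient is kept, so that the drift vectors of the charts
  need not be tracked. On the hyperplane nothing but the Neumann condition is asked.\<close>

definition nsol :: "('a::euclidean_space => real) => 'a set => 'a => real => ('a => real) => real => bool" where
 "nsol v \<Omega> e h F \<beta> \<longleftrightarrow> continuous_on \<Omega> v \<and>
  (\<forall>y\<in>\<Omega>. if y \<bullet> e = h then neum v e y else \<exists>G H. hess v y G H \<and> \<bar>tr H + F y\<bar> <= \<beta> * norm (G y))"

text \<open>Viscosity form of -Laplace w + \<beta> |grad w| >= c at \<open>y\<close>, tested by
  functions that touch from below up to a constant. Continuity of the Laplacian of the test function
  at \<open>y\<close> allows the contact point to be moved slightly, as stability under limits
  demands.\<close>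

definition vsup :: "real => ('a::euclidean_space => real) => 'a => real => bool" where
 "vsup \<beta> w y c \<longleftrightarrow> (\<forall>\<zeta> G Hf r. r > 0 \<and>
   (\<forall>z\<in>ball y r. (\<zeta> has_derivative (\<lambda>h. G z \<bullet> h)) (at z) \<and> (G has_derivative Hf z) (at z)) \<and>
   isCont (\<lambda>z. tr (Hf z)) y \<and> (\<forall>z\<in>ball y r. \<zeta> z - \<zeta> y <= w z - w y)
   --> c <= - tr (Hf y) + \<beta> * norm (G y))"

lemma neum_minus: "neum v e y ==> neum (\<lambda>z. - v z) e y"
 unfolding neum_def
proof
 fix s :: real assume *: "\<forall>s\<in>{1, - 1}. \<exists>\<gamma> c. 0 < c \<and> ((\<lambda>t. (\<gamma> t - y) /\<^sub>R t) \<longlongrightarrow> (s * c) *\<^sub>R e) (at_right 0) \<and>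
      ((\<lambda>t. (v (\<gamma> t) - v y) / t) \<longlongrightarrow> 0) (at_right 0)" and s: "s \<in> {1, -1}"
 then obtain \<gamma> c where g: "0 < c" "((\<lambda>t. (\<gamma> t - y) /\<^sub>R t) \<longlongrightarrow> (s * c) *\<^sub>R e) (at_right 0)"
  "((\<lambda>t. (v (\<gamma> t) - v y) / t) \<longlongrightarrow> 0) (at_right 0)" by blast
 have "((\<lambda>t. (- v (\<gamma> t) - - v y) / t) \<longlongrightarrow> 0) (at_right 0)"
  using tendsto_minus[OF g(3)] by (simp add: minus_divide_left)
 then show "\<exists>\<gamma> c. 0 < c \<and> ((\<lambda>t. (\<gamma> t - y) /\<^sub>R t) \<longlongrightarrow> (s * c) *\<^sub>R e) (at_right 0) \<and>
      ((\<lambda>t. (- v (\<gamma> t) - - v y) / t) \<longlongrightarrow> 0) (at_right 0)" using g by blast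
qed

lemma nsol_minus:
 assumes "nsol v \<Omega> e h F \<beta>" shows "nsol (\<lambda>y. - v y) \<Omega> e h (\<lambda>y. - F y) \<beta>"
 unfolding nsol_def
proof (intro conjI ballI)
 show "continuous_on \<Omega> (\<lambda>y. - v y)" using assms by (auto simp: nsol_def intro: continuous_intros)
 fix y assume "y \<in> \<Omega>"
 then have *: "if y \<bullet> e = h then neum v e y else \<exists>G H. hess v y G H \<and> \<bar>tr H + F y\<bar> <= \<beta> * norm (G y)"
  using assms by (auto simp: nsol_def)
 show "if y \<bullet> e = h then neum (\<lambda>y. - v y) e y
  else \<exists>G H. hess (\<lambda>y. - v y) y G H \<and> \<bar>tr H + - F y\<bar> <= \<beta> * norm (G y)"
 proof (cases "y \<bullet> e = h")
  case True then show ?thesis using * neum_minus by auto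
 next
  case False
  then obtain G H where "hess v y G H" "\<bar>tr H + F y\<bar> <= \<beta> * norm (G y)" using * by auto
  then have "hess (\<lambda>y. - v y) y (\<lambda>z. - G z) (\<lambda>h. - H h)" "\<bar>tr (\<lambda>h. - H h) + - F y\<bar> <= \<beta> * norm (- G y)"
   using hess_minus by (auto simp: tr_minus)
  then have "\<exists>G H. hess (\<lambda>y. - v y) y G H \<and> \<bar>tr H + - F y\<bar> <= \<beta> * norm (G y)"
   by (intro exI conjI)
  then show ?thesis using False by simp
 qed
qed

text \<open>The existence of a one-sided velocity already forces \<open>\<gamma> t\<close> to tend
  to \<open>y\<close>; writing the remainder of \<zeta> as \<open>R\<close> times the distance then
  gives the chain rule along the curve.\<close>

lemma curve_deriv:
 fixes \<zeta> :: "'a::euclidean_space => real"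
 assumes z: "(\<zeta> has_derivative \<zeta>') (at y)" and g: "((\<lambda>t. (\<gamma> t - y) /\<^sub>R t) \<longlongrightarrow> w) (at_right (0::real))"
 shows "(\<gamma> \<longlongrightarrow> y) (at_right 0)" "((\<lambda>t. (\<zeta> (\<gamma> t) - \<zeta> y) / t) \<longlongrightarrow> \<zeta>' w) (at_right 0)"
proof -
 have pos: "\<forall>\<^sub>F t::real in at_right 0. t > 0" by (simp add: eventually_at_right_less)
 have "((\<lambda>t. y + t *\<^sub>R ((\<gamma> t - y) /\<^sub>R t)) \<longlongrightarrow> y + 0 *\<^sub>R w) (at_right 0)"
  by (intro tendsto_intros g)
 moreover have "\<forall>\<^sub>F t::real in at_right 0. y + t *\<^sub>R ((\<gamma> t - y) /\<^sub>R t) = \<gamma> t"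
  using pos by eventually_elim simp
 ultimately show gy: "(\<gamma> \<longlongrightarrow> y) (at_right 0)" by (simp add: tendsto_cong)
 have lin: "bounded_linear \<zeta>'" using z by (rule has_derivative_bounded_linear)
 define R where "R z = (if z = y then 0 else (\<zeta> z - \<zeta> y - \<zeta>' (z - y)) / norm (z - y))" for z
 have "((\<lambda>z. (\<zeta> z - \<zeta> y - \<zeta>' (z - y)) /\<^sub>R norm (z - y)) \<longlongrightarrow> 0) (at y)"
  using z by (simp add: has_derivative_def netlimit_at Lim_ident_at)
 then have "(R \<longlongrightarrow> 0) (at y)"
  by (rule Lim_transform_eventually) (auto simp: R_def eventually_at_filter divide_inverse mult.commute)
 then have "(R \<longlongrightarrow> 0) (nhds y)" using tendsto_at_iff_tendsto_nhds[of R y] by (simp add: R_def)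
 then have Rg: "((\<lambda>t. R (\<gamma> t)) \<longlongrightarrow> 0) (at_right 0)" using gy filterlim_compose by blast
 have "((\<lambda>t. \<zeta>' ((\<gamma> t - y) /\<^sub>R t) + R (\<gamma> t) * norm ((\<gamma> t - y) /\<^sub>R t)) \<longlongrightarrow> \<zeta>' w + 0 * norm w) (at_right 0)"
  by (intro tendsto_intros Rg g bounded_linear.tendsto[OF lin])
 moreover have "\<forall>\<^sub>F t::real in at_right 0. \<zeta>' ((\<gamma> t - y) /\<^sub>R t) + R (\<gamma> t) * norm ((\<gamma> t - y) /\<^sub>R t) = (\<zeta> (\<gamma> t) - \<zeta> y) / t"
  using pos
 proof eventually_elim
  case (elim t)
  have "\<zeta>' ((\<gamma> t - y) /\<^sub>R t) = \<zeta>' (\<gamma> t - y) / t"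
   using lin by (simp add: linear_simps divide_inverse mult.commute)
  moreover have "norm ((\<gamma> t - y) /\<^sub>R t) = norm (\<gamma> t - y) / t" using elim by (simp add: divide_inverse mult.commute)
  moreover have "\<zeta>' 0 = 0" using lin by (simp add: linear_simps)
  ultimately show ?case by (cases "\<gamma> t = y") (simp_all add: R_def add_divide_distrib[symmetric])
 qed
 ultimately show "((\<lambda>t. (\<zeta> (\<gamma> t) - \<zeta> y) / t) \<longlongrightarrow> \<zeta>' w) (at_right 0)" by (simp add: tendsto_cong)
qed

text \<open>Along the two curves \<open>v\<close> is stationary, so the minimum would give both
  \<zeta>' e <= -\<eta> and -\<zeta>' e <= -\<eta>, whose sum is absurd. This keeps contact points
  off the hyperplane and is the way in which the Neumann condition disappears from limits.\<close>

lemma neum_no_kink_min: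
 fixes v :: "'a::euclidean_space => real"
 assumes n: "neum v e y" and e: "norm e = 1" and h: "y \<bullet> e = h" and \<eta>: "\<eta> > 0"
  and \<zeta>: "(\<zeta> has_derivative \<zeta>') (at y)"
  and m: "\<forall>\<^sub>F z in nhds y. v y - \<zeta> y <= v z - \<zeta> z - \<eta> * \<bar>z \<bullet> e - h\<bar>"
 shows False
proof -
 have lin: "linear \<zeta>'" using \<zeta> by (rule has_derivative_linear)
 have *: "s * \<zeta>' e <= - \<eta>" if s: "s \<in> {1, -1}" for s :: real
 proof -
  obtain \<gamma> c where g: "0 < c" "((\<lambda>t. (\<gamma> t - y) /\<^sub>R t) \<longlongrightarrow> (s * c) *\<^sub>R e) (at_right 0)"
  "((\<lambda>t. (v (\<gamma> t) - v y) / t) \<longlongrightarrow> 0) (at_right 0)" using n s unfolding neum_def by blast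
  note cd = curve_deriv[OF \<zeta> g(2)]
  have "\<forall>\<^sub>F t in at_right 0. v y - \<zeta> y <= v (\<gamma> t) - \<zeta> (\<gamma> t) - \<eta> * \<bar>\<gamma> t \<bullet> e - h\<bar>"
   using eventually_compose_filterlim[OF m cd(1)] .
  moreover have "\<forall>\<^sub>F t::real in at_right 0. t > 0" by (simp add: eventually_at_right_less)
  ultimately have ev: "\<forall>\<^sub>F t in at_right 0. 0 <= (v (\<gamma> t) - v y) / t - (\<zeta> (\<gamma> t) - \<zeta> y) / t - \<eta> * \<bar>((\<gamma> t - y) /\<^sub>R t) \<bullet> e\<bar>"
  proof eventually_elim
   case (elim t)
   have "\<bar>((\<gamma> t - y) /\<^sub>R t) \<bullet> e\<bar> = \<bar>\<gamma> t \<bullet> e - h\<bar> / t"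
    using elim h by (simp add: inner_diff_left abs_mult divide_inverse mult.commute)
   moreover have "0 <= (v (\<gamma> t) - v y - (\<zeta> (\<gamma> t) - \<zeta> y) - \<eta> * \<bar>\<gamma> t \<bullet> e - h\<bar>) / t"
    using elim by (intro divide_nonneg_pos) auto
   ultimately show ?case by (simp add: diff_divide_distrib)
  qed
  have "((\<lambda>t. (v (\<gamma> t) - v y) / t - (\<zeta> (\<gamma> t) - \<zeta> y) / t - \<eta> * \<bar>((\<gamma> t - y) /\<^sub>R t) \<bullet> e\<bar>)
   \<longlongrightarrow> 0 - \<zeta>' ((s * c) *\<^sub>R e) - \<eta> * \<bar>((s * c) *\<^sub>R e) \<bullet> e\<bar>) (at_right 0)"
   by (intro tendsto_intros g cd)
  from tendsto_lowerbound[OF this ev] have "0 <= - \<zeta>' ((s * c) *\<^sub>R e) - \<eta> * \<bar>(s * c) * (e \<bullet> e)\<bar>" by simp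
  moreover have "e \<bullet> e = 1" using e by (simp add: norm_eq_1)
  moreover have "\<bar>s * c\<bar> = c" using s g by auto
  ultimately have "0 <= - (s * c * \<zeta>' e) - \<eta> * c" by (simp add: linear_cmul[OF lin])
  then have "c * (s * \<zeta>' e + \<eta>) <= 0" by (simp add: algebra_simps)
  then show ?thesis using g(1) by (simp add: mult_le_0_iff)
 qed
 show False using *[of 1] *[of "-1"] \<eta> by simp
qed

lemma hess_quad:
 fixes y p :: "'a::euclidean_space"
 shows "hess (\<lambda>z. \<kappa> * ((z - p) \<bullet> (z - p))) y (\<lambda>z. (2 * \<kappa>) *\<^sub>R (z - p)) (\<lambda>h. (2 * \<kappa>) *\<^sub>R h)"
proof -
 have "hess (\<lambda>z. \<kappa> * ((z - p) \<bullet> (z - p))) y (\<lambda>z. (2 * \<kappa>) *\<^sub>R (z - p))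
  (\<lambda>h. (2 * \<kappa>) *\<^sub>R h + (4 * 0 * ((y - p) \<bullet> h)) *\<^sub>R (y - p))"
  by (rule hess_radial(1)[where f = "\<lambda>s. \<kappa> * s" and f' = "\<lambda>s. \<kappa>"]) (auto intro!: derivative_eq_intros always_eventually)
 then show ?thesis by simp
qed

lemma hess_abs_linear:
 fixes e :: "'a::euclidean_space"
 assumes "y \<bullet> e \<noteq> h"
 shows "hess (\<lambda>z. \<eta> * \<bar>z \<bullet> e - h\<bar>) y (\<lambda>z. (\<eta> * sgn (y \<bullet> e - h)) *\<^sub>R e) (\<lambda>k. 0)"
proof -
 let ?s = "sgn (y \<bullet> e - h)"
 have 1: "hess (\<lambda>z. ((\<eta> * ?s) *\<^sub>R e) \<bullet> z + - (\<eta> * ?s * h)) y (\<lambda>z. (\<eta> * ?s) *\<^sub>R e + 0) (\<lambda>k. 0 + 0)"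
  by (intro hess_add hess_linear hess_const)
 have "((\<lambda>z. z \<bullet> e - h) \<longlongrightarrow> y \<bullet> e - h) (nhds y)" by (intro tendsto_intros) (simp add: filterlim_ident)
 then have "\<forall>\<^sub>F z in nhds y. dist (z \<bullet> e - h) (y \<bullet> e - h) < \<bar>y \<bullet> e - h\<bar>"
  using assms by (simp add: tendsto_iff)
 then have "\<forall>\<^sub>F z in nhds y. ((\<eta> * ?s) *\<^sub>R e) \<bullet> z + - (\<eta> * ?s * h) = \<eta> * \<bar>z \<bullet> e - h\<bar>"
 proof eventually_elim
  case (elim z)
  then have "\<bar>z \<bullet> e - h\<bar> = ?s * (z \<bullet> e - h)" by (auto simp: dist_real_def sgn_if abs_if split: if_splits)
  then have "\<eta> * \<bar>z \<bullet> e - h\<bar> = \<eta> * (?s * (z \<bullet> e - h))" by simp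
  also have "... = ((\<eta> * ?s) *\<^sub>R e) \<bullet> z + - (\<eta> * ?s * h)" by (simp add: inner_commute algebra_simps)
  finally show ?case ..
 qed
 from hess_cong[OF 1 this] show ?thesis by simp
qed

text \<open>The test function is lowered by \<kappa> |z - y|^2, which makes the contact strict so
  that it survives for large \<open>m\<close>, and receives the kink \<eta> |z . e - h m|, which
  pushes the new contact point off the hyperplane. There the differential inequality holds
  classically. The hyperplane may move with \<open>m\<close>.\<close>

lemma vsup_lim:
 fixes w :: "nat => 'a::euclidean_space => real"
 assumes e: "norm e = 1" and r: "r > 0" and \<beta>: "\<beta> >= 0"
  and unif: "\<And>\<nu>. \<nu> > 0 ==> \<forall>\<^sub>F m in sequentially. \<forall>z\<in>cball y r. \<bar>w m z - w0 z\<bar> < \<nu>"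
  and cont: "\<forall>\<^sub>F m in sequentially. continuous_on (cball y r) (w m)"
  and sup: "\<And>\<nu>. \<nu> > 0 ==> \<exists>d>0. \<forall>\<^sub>F m in sequentially. \<forall>z\<in>ball y d.
    if z \<bullet> e = h m then neum (w m) e z
    else \<exists>G H. hess (w m) z G H \<and> tr H <= - c + \<nu> + \<beta> * norm (G z)"
 shows "vsup \<beta> w0 y c"
 unfolding vsup_def
proof (intro allI impI, elim conjE)
 fix \<zeta> G Hf R
 assume R: "0 < R" and \<zeta>: "\<forall>z\<in>ball y R. (\<zeta> has_derivative (\<bullet>) (G z)) (at z) \<and> (G has_derivative Hf z) (at z)"
  and Hc: "isCont (\<lambda>z. tr (Hf z)) y" and touch: "\<forall>z\<in>ball y R. \<zeta> z - \<zeta> y <= w0 z - w0 y"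
 let ?n = "real DIM('a)"
 have main: "c <= - tr (Hf y) + \<beta> * norm (G y) + \<kappa> * (2 + 4 * \<beta> + 2 * ?n)" if \<kappa>: "\<kappa> > 0" for \<kappa>
 proof -
  obtain d1 where d1: "d1 > 0" "\<forall>\<^sub>F m in sequentially. \<forall>z\<in>ball y d1.
    if z \<bullet> e = h m then neum (w m) e z
    else \<exists>G H. hess (w m) z G H \<and> tr H <= - c + \<kappa> + \<beta> * norm (G z)"
   using sup[OF \<kappa>] by blast
  obtain d2 where d2: "d2 > 0" "\<And>z. dist z y < d2 ==> dist (tr (Hf z)) (tr (Hf y)) < \<kappa>"
   using Hc[unfolded continuous_at_eps_delta] \<kappa> by metis
  have "isCont G y" using \<zeta> R by (auto intro: has_derivative_continuous)
  then obtain d3 where d3: "d3 > 0" "\<And>z. dist z y < d3 ==> dist (G z) (G y) < \<kappa>"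
   unfolding continuous_at_eps_delta using \<kappa> by metis
  define \<rho> where "\<rho> = Min {1, r, R, d1, d2, d3} / 2"
  have \<rho>: "\<rho> > 0" "\<rho> < 1" "\<rho> < r" "\<rho> < R" "\<rho> < d1" "\<rho> < d2" "\<rho> < d3"
   using r R d1(1) d2(1) d3(1) by (auto simp: \<rho>_def)
  \<comment> \<open>On the sphere of radius \<rho> the quadratic term gains \<kappa> \<rho>^2; the
    kink costs at most \<eta> \<rho> = \<kappa> \<rho>^2 / 4 and the two uniform errors \<kappa>
    \<rho>^2 / 8 each, so the minimum stays inside.\<close>
  define \<eta> where "\<eta> = \<kappa> * \<rho> / 4"
  have \<eta>: "\<eta> > 0" "\<eta> < \<kappa>" using \<kappa> \<rho> by (auto simp: \<eta>_def)
  have "\<kappa> * \<rho>^2 / 8 > 0" using \<kappa> \<rho> by simp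
  from unif[OF this] cont d1(2) have "\<forall>\<^sub>F m in sequentially.
   (\<forall>z\<in>cball y r. \<bar>w m z - w0 z\<bar> < \<kappa> * \<rho>^2 / 8) \<and> continuous_on (cball y r) (w m) \<and>
   (\<forall>z\<in>ball y d1. if z \<bullet> e = h m then neum (w m) e z
    else \<exists>G H. hess (w m) z G H \<and> tr H <= - c + \<kappa> + \<beta> * norm (G z))"
   by (intro eventually_conj)
  then obtain m where m1: "\<forall>z\<in>cball y r. \<bar>w m z - w0 z\<bar> < \<kappa> * \<rho>^2 / 8"
   and m2: "continuous_on (cball y r) (w m)"
   and m3: "\<forall>z\<in>ball y d1. if z \<bullet> e = h m then neum (w m) e z
    else \<exists>G H. hess (w m) z G H \<and> tr H <= - c + \<kappa> + \<beta> * norm (G z)"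
   using eventually_happens'[OF sequentially_bot] by blast
  define \<xi> where "\<xi> z = \<zeta> z - \<kappa> * ((z - y) \<bullet> (z - y))" for z
  define \<Phi> where "\<Phi> z = w m z - \<xi> z - \<eta> * \<bar>z \<bullet> e - h m\<bar>" for z
  have c\<zeta>: "continuous_on (cball y \<rho>) \<zeta>"
   using \<zeta> \<rho> by (intro continuous_at_imp_continuous_on) (auto intro!: has_derivative_continuous)
  have cw: "continuous_on (cball y \<rho>) (w m)" using m2 by (rule continuous_on_subset) (use \<rho> in auto)
  have "continuous_on (cball y \<rho>) \<Phi>" unfolding \<Phi>_def \<xi>_def by (intro continuous_intros c\<zeta> cw)
  then obtain z where z: "z \<in> cball y \<rho>" "\<And>x. x \<in> cball y \<rho> ==> \<Phi> z <= \<Phi> x"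
   using continuous_attains_inf[of "cball y \<rho>" \<Phi>] \<rho> by auto
  have zb: "dist y z < \<rho>"
  proof (rule ccontr)
   assume "\<not> dist y z < \<rho>"
   then have nz: "dist y z = \<rho>" using z(1) by auto
   have "\<Phi> z <= \<Phi> y" using z(2)[of y] \<rho> by simp
   moreover have "w m y - w0 y < \<kappa> * \<rho>^2 / 8" "w0 z - w m z < \<kappa> * \<rho>^2/8"
    using m1 \<rho> z(1) by (smt (verit) mem_cball dist_self)+
   moreover have "\<zeta> z - \<zeta> y <= w0 z - w0 y" using touch nz \<rho> by auto
   moreover have "(z - y) \<bullet> (z - y) = \<rho>^2" using nz by (simp add: dist_norm norm_minus_commute dot_square_norm)
   moreover have "\<bar>z \<bullet> e - h m\<bar> <= \<bar>y \<bullet> e - h m\<bar> + \<rho>"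
    using Cauchy_Schwarz_ineq2[of "z - y" e] nz e by (simp add: dist_norm norm_minus_commute inner_diff_left)
   then have "\<eta> * \<bar>z \<bullet> e - h m\<bar> <= \<eta> * \<bar>y \<bullet> e - h m\<bar> + \<eta> * \<rho>" using \<eta> by (metis distrib_left mult_left_mono less_imp_le)
   moreover have "\<eta> * \<rho> = \<kappa> * \<rho>^2 / 4" by (simp add: \<eta>_def power2_eq_square)
   moreover have "\<kappa> * \<rho>^2 > 0" using \<kappa> \<rho> by simp
   ultimately show False unfolding \<Phi>_def \<xi>_def by simp
  qed
  have zb': "z \<in> ball y d1" "z \<in> ball y R" using zb \<rho> by auto
  have "\<forall>\<^sub>F x in nhds z. x \<in> ball y \<rho>" using zb by (intro eventually_nhds_in_open) auto
  then have lm: "\<forall>\<^sub>F x in nhds z. \<Phi> z <= \<Phi> x" by (rule eventually_mono) (auto intro!: z(2))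
  have "\<forall>\<^sub>F x in nhds z. x \<in> ball y R" using zb' by (intro eventually_nhds_in_open) auto
  then have h\<zeta>: "hess \<zeta> z G (Hf z)" unfolding hess_def using \<zeta> zb' by (auto elim: eventually_mono)
  have h\<xi>: "hess \<xi> z (\<lambda>x. G x - (2*\<kappa>) *\<^sub>R (x - y)) (\<lambda>h. Hf z h - (2*\<kappa>) *\<^sub>R h)"
   unfolding \<xi>_def by (intro hess_diff h\<zeta> hess_quad)
  have nH: "z \<bullet> e \<noteq> h m"
  proof
   assume zh: "z \<bullet> e = h m"
   then have n: "neum (w m) e z" using m3 zb' by auto
   have "(\<xi> has_derivative (\<bullet>) (G z - (2*\<kappa>) *\<^sub>R (z - y))) (at z)"
    using h\<xi> unfolding hess_def by (metis (mono_tags, lifting) eventually_nhds_x_imp_x)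
   from neum_no_kink_min[OF n e zh \<eta>(1) this] lm show False unfolding \<Phi>_def using zh by simp
  qed
  then obtain Gw Hw where Hw: "hess (w m) z Gw Hw" "tr Hw <= - c + \<kappa> + \<beta> * norm (Gw z)"
   using m3[rule_format, OF zb'(1)] by auto
  let ?s = "sgn (z \<bullet> e - h m)"
  have "hess (\<lambda>x. \<xi> x + \<eta> * \<bar>x \<bullet> e - h m\<bar> - w m x) z
   (\<lambda>x. (G x - (2*\<kappa>) *\<^sub>R (x - y)) + (\<eta> * ?s) *\<^sub>R e - Gw x) (\<lambda>h. (Hf z h - (2*\<kappa>) *\<^sub>R h) + 0 - Hw h)"
   by (intro hess_diff hess_add h\<xi> hess_abs_linear nH Hw)
  from hess_at_max[OF this] lm
  have g0: "(G z - (2*\<kappa>) *\<^sub>R (z - y)) + (\<eta> * ?s) *\<^sub>R e - Gw z = 0"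
   and t0: "tr (\<lambda>h. (Hf z h - (2*\<kappa>) *\<^sub>R h) + 0 - Hw h) <= 0"
   unfolding \<Phi>_def by (auto elim: eventually_mono simp: algebra_simps)
  have t1: "tr (Hf z) - 2 * \<kappa> * ?n <= tr Hw"
   using t0 unfolding tr_diff tr_add tr_scale tr_id tr_zero by simp
  have "Gw z = G y + (G z - G y) - (2*\<kappa>) *\<^sub>R (z - y) + (\<eta> * ?s) *\<^sub>R e" using g0 by simp
  then have "norm (Gw z) = norm (G y + (G z - G y) - (2*\<kappa>) *\<^sub>R (z - y) + (\<eta> * ?s) *\<^sub>R e)"
   by (rule arg_cong)
  then have "norm (Gw z) <= norm (G y) + norm (G z - G y) + norm ((2*\<kappa>) *\<^sub>R (z - y)) + norm ((\<eta> * ?s) *\<^sub>R e)"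
   using norm_triangle_ineq[of "G y + (G z - G y) - (2*\<kappa>) *\<^sub>R (z - y)" "(\<eta> * ?s) *\<^sub>R e"]
    norm_triangle_ineq4[of "G y + (G z - G y)" "(2*\<kappa>) *\<^sub>R (z - y)"] norm_triangle_ineq[of "G y" "G z - G y"]
   by linarith
  moreover have "norm (G z - G y) <= \<kappa>" using d3(2)[of z] zb \<rho> by (simp add: dist_norm dist_commute norm_minus_commute)
  moreover have "norm ((2*\<kappa>) *\<^sub>R (z - y)) <= 2 * \<kappa>" using zb \<rho> \<kappa> by (simp add: dist_norm norm_minus_commute)
  moreover have "norm ((\<eta> * ?s) *\<^sub>R e) <= \<kappa>" using \<eta> e by (simp add: abs_mult sgn_if)
  ultimately have "norm (Gw z) <= norm (G y) + 4 * \<kappa>" by linarith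
  then have "\<beta> * norm (Gw z) <= \<beta> * norm (G y) + 4 * \<beta> * \<kappa>"
   using mult_left_mono[OF _ \<beta>, of "norm (Gw z)" "norm (G y) + 4 * \<kappa>"] by (simp add: algebra_simps)
  moreover have "tr (Hf z) >= tr (Hf y) - \<kappa>" using d2(2)[of z] zb \<rho> by (simp add: dist_real_def dist_commute)
  ultimately show ?thesis using t1 Hw(2) by (simp add: algebra_simps)
 qed
 show "c <= - tr (Hf y) + \<beta> * norm (G y)"
 proof (rule ccontr)
  assume a: "\<not> c <= - tr (Hf y) + \<beta> * norm (G y)"
  define K where "K = 2 + 4 * \<beta> + 2 * ?n"
  have K: "K > 0" using \<beta> by (simp add: K_def)
  define \<kappa> where "\<kappa> = (c - (- tr (Hf y) + \<beta> * norm (G y))) / (2 * K)"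
  have "\<kappa> > 0" using a K by (simp add: \<kappa>_def)
  from main[OF this] a have "c - (- tr (Hf y) + \<beta> * norm (G y)) <= \<kappa> * K" by (simp add: K_def)
  also have "\<kappa> * K = (c - (- tr (Hf y) + \<beta> * norm (G y))) / 2" using K by (simp add: \<kappa>_def)
  finally show False using a by simp
 qed
qed

lemma vsup_radial:
 fixes f f' f2 :: "real => real" and p y :: "'a::euclidean_space"
 assumes v: "vsup \<beta> w y c" and U: "open U" "(y - p) \<bullet> (y - p) \<in> U"
  and 1: "\<And>s. s \<in> U ==> (f has_real_derivative f' s) (at s)"
  and 2: "\<And>s. s \<in> U ==> (f' has_real_derivative f2 s) (at s)"
  and c2: "continuous_on U f2"
  and r: "r > 0" "\<And>z. z \<in> ball y r ==> f ((z - p) \<bullet> (z - p)) - f ((y - p) \<bullet> (y - p)) <= w z - w y"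
 shows "c <= - (2 * real DIM('a) * f' ((y-p) \<bullet> (y-p)) + 4 * f2 ((y-p) \<bullet> (y-p)) * ((y-p) \<bullet> (y-p)))
   + \<beta> * (2 * \<bar>f' ((y-p) \<bullet> (y-p))\<bar> * norm (y - p))"
proof -
 let ?q = "\<lambda>z. (z - p) \<bullet> (z - p)"
 have "open (?q -` U)" by (intro open_vimage U continuous_intros)
 then obtain r1 where r1: "r1 > 0" "ball y r1 \<subseteq> ?q -` U" using U by (meson open_contains_ball vimageI)
 define R where "R = min r r1"
 define Hf where "Hf z = (\<lambda>h. (2 * f' (?q z)) *\<^sub>R h + (4 * f2 (?q z) * ((z - p) \<bullet> h)) *\<^sub>R (z - p))" for z
 have hs: "hess (\<lambda>z. f (?q z)) z (\<lambda>z. (2 * f' (?q z)) *\<^sub>R (z - p)) (Hf z)"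
  and tr: "tr (Hf z) = 2 * real DIM('a) * f' (?q z) + 4 * f2 (?q z) * ?q z" if "?q z \<in> U" for z
 proof -
  have ev: "\<forall>\<^sub>F s in nhds (?q z). (f has_real_derivative f' s) (at s)"
   using eventually_nhds_in_open[OF U(1) that] by (rule eventually_mono) (rule 1)
  show "hess (\<lambda>z. f (?q z)) z (\<lambda>z. (2 * f' (?q z)) *\<^sub>R (z - p)) (Hf z)"
   "tr (Hf z) = 2 * real DIM('a) * f' (?q z) + 4 * f2 (?q z) * ?q z"
   unfolding Hf_def using hess_radial[OF ev 2[OF that]] by auto
 qed
 have d: "((\<lambda>z. f (?q z)) has_derivative (\<bullet>) ((2 * f' (?q z)) *\<^sub>R (z - p))) (at z)"
  "((\<lambda>z. (2 * f' (?q z)) *\<^sub>R (z - p)) has_derivative Hf z) (at z)" if "?q z \<in> U" for z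
  using hs[OF that] unfolding hess_def by (auto dest: eventually_nhds_x_imp_x)
 have cf': "continuous_on U f'" using 2 DERIV_continuous_on has_field_derivative_at_within by blast
 have "continuous_on (?q -` U) (\<lambda>z. 2 * real DIM('a) * f' (?q z) + 4 * f2 (?q z) * ?q z)"
  by (intro continuous_intros continuous_on_compose2[OF cf'] continuous_on_compose2[OF c2]) auto
 then have "continuous_on (?q -` U) (\<lambda>z. tr (Hf z))"
  by (rule continuous_on_eq) (use tr in auto)
 then have ic: "isCont (\<lambda>z. tr (Hf z)) y"
  using \<open>open (?q -` U)\<close> U by (simp add: continuous_on_eq_continuous_at)
 have "R > 0" using r r1 by (simp add: R_def)
 have "c <= - tr (Hf y) + \<beta> * norm ((2 * f' (?q y)) *\<^sub>R (y - p))"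
  using v[unfolded vsup_def, rule_format, of R "\<lambda>z. f (?q z)" "\<lambda>z. (2 * f' (?q z)) *\<^sub>R (z - p)" Hf]
  using \<open>R > 0\<close> d ic r(2) r1(2) by (auto simp: R_def subset_iff)
 then show ?thesis using tr[OF U(2)] by (simp add: abs_mult)
qed

lemma vsup_const_min:
 assumes "vsup \<beta> w y c" "r > 0" "\<And>z. z \<in> ball y r ==> w y <= w z"
 shows "c <= 0"
 using vsup_radial[OF assms(1), of UNIV y "\<lambda>_. 0" "\<lambda>_. 0" "\<lambda>_. 0" r] assms(2,3) by simp

lemma nsol_hess:
 assumes "nsol v \<Omega> e h F \<beta>" "y \<in> \<Omega>" "y \<bullet> e \<noteq> h"
 obtains G H where "hess v y G H" "\<bar>tr H + F y\<bar> <= \<beta> * norm (G y)"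
proof -
 have "if y \<bullet> e = h then neum v e y else \<exists>G H. hess v y G H \<and> \<bar>tr H + F y\<bar> <= \<beta> * norm (G y)"
  using assms(1,2) unfolding nsol_def by blast
 then show thesis using assms(3) that by auto
qed

lemma nsol_neum:
 assumes "nsol v \<Omega> e h F \<beta>" "y \<in> \<Omega>" "y \<bullet> e = h"
 shows "neum v e y"
 using assms unfolding nsol_def by (metis (full_types))

section \<open>Hopf's lemma and the strong minimum principle for viscosity supersolutions\<close>

text \<open>Hopf's barrier exp(-\<alpha> |z - p'|^2) - exp(-\<alpha> r'^2) is slid under
  \<open>w\<close> near \<open>q\<close>. As \<open>w\<close> is a supersolution on a full ball
  around \<open>q\<close>, the contact point is interior, and there the barrier is a strict
  subsolution.\<close>

lemma vsup_hopf:
 fixes w :: "'a::euclidean_space => real"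
 assumes \<beta>: "\<beta> >= 0" and r: "dist p q = r" "r > 0" and s: "s > 0"
  and pos: "\<And>z. z \<in> ball p r ==> w z > 0" and wq: "w q = 0"
  and nn: "\<And>z. z \<in> ball q s ==> w z >= 0" and cont: "continuous_on (ball q s) w"
  and vs: "\<And>z. z \<in> ball q s ==> vsup \<beta> w z 0"
 shows False
proof -
 let ?n = "real DIM('a)"
 \<comment> \<open>The ball around \<open>p'\<close> of half the radius meets the original sphere
   only in \<open>q\<close>, so \<open>w\<close> is positive on all of its closure except
   \<open>q\<close>.\<close>
 define p' where "p' = p + (1/2) *\<^sub>R (q - p)"
 define r' where "r' = r / 2"
 have r': "r' > 0" using r by (simp add: r'_def)
 have pp: "dist p p' = r'" using r by (simp add: p'_def r'_def dist_norm norm_minus_commute)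
 have qp: "q - p' = (1/2) *\<^sub>R (q - p)" by (simp add: p'_def algebra_simps) (simp flip: scaleR_left_distrib scaleR_add_left)
 have "dist p' q = norm (q - p')" by (simp add: dist_norm norm_minus_commute)
 then have pq: "dist p' q = r'" using r unfolding qp by (simp add: r'_def dist_norm norm_minus_commute)
 have inball: "w z > 0" if "dist p' z <= r'" "z \<noteq> q" for z
 proof (rule ccontr)
  assume "\<not> w z > 0"
  then have "dist p z >= r" using pos[of z] by (meson mem_ball not_le)
  moreover have "dist p z <= dist p p' + dist p' z" by (rule dist_triangle)
  ultimately have eq: "dist p z = dist p p' + dist p' z" "dist p' z = r'" using that pp by (auto simp: r'_def)
  have "norm ((p - p') + (p' - z)) = norm (p - p') + norm (p' - z)" using eq by (simp add: dist_norm)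
  then have "norm (p - p') *\<^sub>R (p' - z) = norm (p' - z) *\<^sub>R (p - p')" by (rule norm_triangle_eq[THEN iffD1])
  then have "r' *\<^sub>R (p' - z) = r' *\<^sub>R (p - p')" using eq pp by (simp add: dist_norm)
  then have "p' - z = p - p'" using r' by simp
  then have "z = p' + p' - p" by (simp add: algebra_simps)
  also have "... = q" by (simp add: p'_def algebra_simps) (simp flip: scaleR_left_distrib scaleR_add_left)
  finally show False using that by simp
 qed
 define \<rho> where "\<rho> = min (s/2) (r'/2)"
 have \<rho>: "\<rho> > 0" "\<rho> < s" "\<rho> <= r'/2" using s r' by (auto simp: \<rho>_def)
 \<comment> \<open>Contact points have distance d from \<open>p'\<close> with r'/2 <= d <= 2 r'.
   There 4 \<alpha> d^2 >= \<alpha> r'^2 = 2 n + 4 \<beta> r' + 1 exceeds 2 n + 2 \<beta> d, which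
   is strict subharmonicity of the barrier including the gradient term.\<close>
 define \<alpha> where "\<alpha> = (2 * ?n + 4 * \<beta> * r' + 1) / r'^2"
 have \<alpha>: "\<alpha> > 0" using \<beta> r' by (auto simp: \<alpha>_def intro!: divide_pos_pos add_nonneg_pos)
 define f where "f x = exp (- \<alpha> * x) - exp (- \<alpha> * r'^2)" for x
 define Q where "Q z = (z - p') \<bullet> (z - p')" for z
 have Qd: "Q z = (dist p' z)^2" for z by (simp add: Q_def dot_square_norm dist_norm norm_minus_commute)
 have f1: "f (Q z) <= 1" for z
 proof -
  have "exp (- \<alpha> * Q z) <= 1" using \<alpha> by (simp add: Q_def)
  then show ?thesis using exp_gt_zero[of "-\<alpha> * r'^2"] unfolding f_def by linarith
 qed
 have f2: "f (Q z) < 0" if "dist p' z > r'" for z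
 proof -
  have "r'^2 < Q z" using that r' by (simp add: Qd power_strict_mono)
  then show ?thesis using \<alpha> by (simp add: f_def)
 qed
 have fq: "f (Q q) = 0" by (simp add: f_def Qd pq)
 \<comment> \<open>On the small sphere around \<open>q\<close> the barrier is nonnegative only on
   this compact set, where \<open>w\<close> has a positive lower bound; on the rest of that sphere
   the barrier is negative and w >= 0 is enough.\<close>
 define S where "S = sphere q \<rho> \<inter> cball p' r'"
 have cb: "cball q \<rho> \<subseteq> ball q s" using \<rho> by auto
 have cS: "compact S" by (simp add: S_def compact_Int_closed)
 have wS: "\<And>z. z \<in> S ==> w z > 0" using inball \<rho> by (auto simp: S_def)
 obtain \<mu> where \<mu>: "\<mu> > 0" "\<And>z. z \<in> S ==> \<mu> <= w z"
 proof (cases "S = {}")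
  case True then show ?thesis using that[of 1] by simp
 next
  case False
  have "continuous_on S w" by (rule continuous_on_subset[OF cont]) (use cb in \<open>auto simp: S_def\<close>)
  then obtain x where "x \<in> S" "\<forall>y\<in>S. w x <= w y" using continuous_attains_inf[OF cS False] by blast
  then show ?thesis using that[of "w x"] wS by auto
 qed
 define \<nu> where "\<nu> = \<mu> / 2"
 have \<nu>: "\<nu> > 0" "\<nu> < \<mu>" using \<mu> by (auto simp: \<nu>_def)
 define \<Phi> where "\<Phi> z = w z - \<nu> * f (Q z)" for z
 have bd: "\<Phi> z > 0" if "dist q z = \<rho>" for z
 proof (cases "dist p' z <= r'")
  case True
  then have "z \<in> S" using that by (simp add: S_def)
  then have "w z >= \<mu>" using \<mu> by auto
  moreover have "\<nu> * f (Q z) <= \<nu> * 1" by (rule mult_left_mono) (use f1 \<nu> in auto)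
  ultimately show ?thesis using \<nu> unfolding \<Phi>_def by linarith
 next
  case False
  then have "\<nu> * f (Q z) < 0" using f2[of z] \<nu> by (simp add: mult_pos_neg)
  moreover have "w z >= 0" using nn[of z] that \<rho> by simp
  ultimately show ?thesis unfolding \<Phi>_def by linarith
 qed
 have "continuous_on (cball q \<rho>) w" by (rule continuous_on_subset[OF cont cb])
 then have "continuous_on (cball q \<rho>) \<Phi>" unfolding \<Phi>_def f_def Q_def by (intro continuous_intros)
 then obtain z where z: "z \<in> cball q \<rho>" "\<And>x. x \<in> cball q \<rho> ==> \<Phi> z <= \<Phi> x"
  using continuous_attains_inf[of "cball q \<rho>" \<Phi>] \<rho> by auto
 have "\<Phi> z <= \<Phi> q" using z(2)[of q] \<rho> by simp
 then have "\<Phi> z <= 0" using fq wq by (simp add: \<Phi>_def)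
 then have zb: "dist q z < \<rho>" using bd[of z] z(1) by fastforce
 define d where "d = norm (z - p')"
 have d: "r'/2 <= d" "d <= 2 * r'"
  using dist_triangle[of p' q z] dist_triangle[of p' z q] pq zb \<rho>(3) r'
  by (auto simp: d_def dist_norm norm_minus_commute)
 have Qdd: "(z - p') \<bullet> (z - p') = d^2" by (simp add: d_def dot_square_norm)
 obtain R where R: "R > 0" "ball z R \<subseteq> ball q \<rho>" using zb open_contains_ball[of "ball q \<rho>"] by (meson mem_ball open_ball)
 have vz: "vsup \<beta> w z 0" using vs zb \<rho> by auto
 have "0 <= - (2 * ?n * (\<nu> * (- \<alpha> * exp (- \<alpha> * ((z - p') \<bullet> (z - p'))))) + 4 * (\<nu> * (\<alpha>^2 * exp (- \<alpha> * ((z - p') \<bullet> (z - p'))))) * ((z - p') \<bullet> (z - p')))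
   + \<beta> * (2 * \<bar>\<nu> * (- \<alpha> * exp (- \<alpha> * ((z - p') \<bullet> (z - p'))))\<bar> * norm (z - p'))"
 proof (rule vsup_radial[OF vz, of UNIV p' "\<lambda>x. \<nu> * f x" "\<lambda>x. \<nu> * (- \<alpha> * exp (- \<alpha> * x))" "\<lambda>x. \<nu> * (\<alpha>^2 * exp (- \<alpha> * x))" R])
  show "\<nu> * f ((x - p') \<bullet> (x - p')) - \<nu> * f ((z - p') \<bullet> (z - p')) <= w x - w z" if "x \<in> ball z R" for x
   using z(2)[of x] that R(2) by (force simp: \<Phi>_def Q_def)
 qed (use R in \<open>auto simp: f_def power2_eq_square intro!: derivative_eq_intros continuous_intros\<close>)
 also have "... = \<nu> * \<alpha> * exp (- \<alpha> * d^2) * (2 * ?n - 4 * \<alpha> * d^2 + 2 * \<beta> * d)"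
  unfolding Qdd using \<nu> \<alpha> by (simp add: abs_mult d_def algebra_simps power2_eq_square)
 finally have "0 <= \<nu> * \<alpha> * exp (- \<alpha> * d^2) * (2 * ?n - 4 * \<alpha> * d^2 + 2 * \<beta> * d)" .
 moreover have "\<nu> * \<alpha> * exp (- \<alpha> * d^2) > 0" using \<nu> \<alpha> by simp
 ultimately have "0 <= 2 * ?n - 4 * \<alpha> * d^2 + 2 * \<beta> * d"
  by (simp add: zero_le_mult_iff)
 moreover have "(r'/2)^2 <= d^2" using d r' by (intro power_mono) auto
 then have "\<alpha> * r'^2 <= 4 * \<alpha> * d^2" using \<alpha> mult_left_mono[of "(r'/2)^2" "d^2" "4 * \<alpha>"] by (simp add: power_divide)
 moreover have "\<alpha> * r'^2 = 2 * ?n + 4 * \<beta> * r' + 1" using r' by (simp add: \<alpha>_def)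
 moreover have "2 * \<beta> * d <= 4 * \<beta> * r'" using mult_left_mono[OF d(2), of "2 * \<beta>"] \<beta> by simp
 ultimately show False by linarith
qed

text \<open>The zero set is closed by continuity. It is also open: a nonzero point close to a zero
  has a nearest zero, and Hopf's lemma applies there to the ball up to that zero.\<close>

lemma vsup_strong_min:
 fixes w :: "'a::euclidean_space => real"
 assumes \<beta>: "\<beta> >= 0" and \<Omega>: "open \<Omega>" "connected \<Omega>" and cont: "continuous_on \<Omega> w"
  and nn: "\<And>y. y \<in> \<Omega> ==> w y >= 0" and vs: "\<And>y. y \<in> \<Omega> ==> vsup \<beta> w y 0"
  and y0: "y0 \<in> \<Omega>" "w y0 = 0" and y: "y \<in> \<Omega>"
 shows "w y = 0"
proof -
 define Z where "Z = {x\<in>\<Omega>. w x = 0}"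
 have opZ: "open Z" unfolding open_contains_ball
 proof
  fix z assume zZ: "z \<in> Z"
  then have z: "z \<in> \<Omega>" "w z = 0" by (auto simp: Z_def)
  obtain \<delta> where \<delta>: "\<delta> > 0" "ball z \<delta> \<subseteq> \<Omega>" using \<Omega> z open_contains_ball by blast
  have "w p = 0" if p: "p \<in> ball z (\<delta>/2)" for p
  proof (rule ccontr)
   assume wp: "w p \<noteq> 0"
   define D where "D = dist p z"
   have D: "D < \<delta>/2" using p by (simp add: D_def dist_commute)
   have sub: "cball p D \<subseteq> ball z \<delta>"
   proof
    fix x assume "x \<in> cball p D"
    then show "x \<in> ball z \<delta>" using D dist_triangle[of z x p] by (auto simp: D_def dist_commute)
   qed
   have "continuous_on (cball p D) w" using sub \<delta> continuous_on_subset[OF cont] by blast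
   then have "closed (cball p D \<inter> w -` {0})" by (intro continuous_closed_preimage) auto
   moreover have "cball p D \<inter> w -` {0} = Z \<inter> cball p D" using sub \<delta> by (auto simp: Z_def)
   ultimately have "compact (Z \<inter> cball p D)"
    by (metis bounded_Int bounded_cball compact_eq_bounded_closed)
   moreover have "Z \<inter> cball p D \<noteq> {}" using zZ by (auto simp: D_def)
   moreover have "continuous_on (Z \<inter> cball p D) (dist p)" by (intro continuous_intros)
   ultimately obtain q where q: "q \<in> Z \<inter> cball p D" "\<And>x. x \<in> Z \<inter> cball p D ==> dist p q <= dist p x"
    using continuous_attains_inf[of "Z \<inter> cball p D" "dist p"] by metis
   define r where "r = dist p q"
   have rD: "r <= D" using q by (auto simp: r_def)
   have "p \<noteq> q" using wp q by (auto simp: Z_def)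
   then have r: "r > 0" by (simp add: r_def)
   have qO: "q \<in> \<Omega>" "w q = 0" using q by (auto simp: Z_def)
   obtain s where s: "s > 0" "ball q s \<subseteq> \<Omega>" using \<Omega> qO open_contains_ball by blast
   show False
   proof (rule vsup_hopf[OF \<beta> _ r s(1)])
    show "dist p q = r" by (simp add: r_def)
    show "w x > 0" if x: "x \<in> ball p r" for x
    proof -
     have "x \<in> cball p D" using x rD by auto
     then have xO: "x \<in> \<Omega>" using sub \<delta> by blast
     have "x \<notin> Z" using q(2)[of x] \<open>x \<in> cball p D\<close> x by (auto simp: r_def)
     then show ?thesis using nn[OF xO] xO by (auto simp: Z_def less_le)
    qed
   qed (use s nn vs qO continuous_on_subset[OF cont] in auto)
  qed
  moreover have "ball z (\<delta>/2) \<subseteq> \<Omega>" using \<delta> by auto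
  ultimately have "ball z (\<delta>/2) \<subseteq> Z" by (auto simp: Z_def)
  then show "\<exists>e>0. ball z e \<subseteq> Z" using \<delta> by (intro exI[of _ "\<delta>/2"]) auto
 qed
 have op2: "open (\<Omega> \<inter> w -` (- {0}))" by (intro continuous_open_preimage cont \<Omega>) auto
 have "\<Omega> \<inter> w -` (- {0}) = {}"
 proof (rule ccontr)
  assume a: "\<Omega> \<inter> w -` (- {0}) \<noteq> {}"
  have "Z \<inter> \<Omega> \<noteq> {}" using y0 by (auto simp: Z_def)
  then show False using connectedD[OF \<Omega>(2) opZ op2] a by (auto simp: Z_def)
 qed
 then show ?thesis using y by auto
qed

section \<open>Interior Lipschitz estimate by doubling the variables\<close>

text \<open>Moving in the direction of \<open>g\<close> itself gives |g|^2 <= C |g|; the alternative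
  in the conclusion comes from dividing by |g|.\<close>

lemma grad_bound:
 fixes v :: "'a::euclidean_space => real"
 assumes v: "(v has_derivative (\<lambda>h. g \<bullet> h)) (at x)" and b: "\<forall>\<^sub>F z in nhds x. v z - v x <= C * norm (z - x)"
 shows "norm g <= C \<or> g = 0"
proof -
 have "((\<lambda>t. ((x + t *\<^sub>R g) - x) /\<^sub>R t) \<longlongrightarrow> g) (at_right (0::real))"
  by (rule tendsto_eventually) (auto simp: eventually_at_filter)
 note cd = curve_deriv[OF v this]
 have "\<forall>\<^sub>F t in at_right (0::real). t > 0 \<and> v (x + t *\<^sub>R g) - v x <= C * norm ((x + t *\<^sub>R g) - x)"
  using eventually_compose_filterlim[OF b cd(1)] by (auto simp: eventually_at_right_less eventually_conj_iff)
 then have "\<forall>\<^sub>F t in at_right (0::real). (v (x + t *\<^sub>R g) - v x) / t <= C * norm g"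
  by (rule eventually_mono) (auto simp: field_simps)
 from tendsto_upperbound[OF cd(2) this] have "g \<bullet> g <= C * norm g" by simp
 then have "norm g * norm g <= C * norm g" by (simp add: dot_square_norm power2_eq_square)
 then show ?thesis by auto
qed

text \<open>The vectors b - 2 (b . u) u form an orthonormal basis again, and a trace does not depend
  on the basis. The identity serves the mirrored directions of the doubling argument, the derivative
  of an inversion, and the reflection at the equator.\<close>

lemma tr_reflect:
 fixes u :: "'a::euclidean_space"
 assumes H: "linear H" and u: "norm u = 1"
 shows "(\<Sum>b\<in>Basis. H (b - (2 * (b \<bullet> u)) *\<^sub>R u) \<bullet> (b - (2 * (b \<bullet> u)) *\<^sub>R u)) = tr H"
proof -
 have uu: "u \<bullet> u = 1" using u by (simp add: norm_eq_1)
 have rep: "u = (\<Sum>b\<in>Basis. (u \<bullet> b) *\<^sub>R b)" by (simp add: euclidean_representation)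
 have 1: "(\<Sum>b\<in>Basis. (b \<bullet> u) * (H u \<bullet> b)) = H u \<bullet> u"
  by (subst (4) rep) (simp add: inner_sum_right inner_commute)
 have 2: "(\<Sum>b\<in>Basis. (b \<bullet> u) * (H b \<bullet> u)) = H u \<bullet> u"
 proof -
  have "H u = (\<Sum>b\<in>Basis. (u \<bullet> b) *\<^sub>R H b)" by (subst rep) (simp add: linear_sum[OF H] linear_cmul[OF H])
  then have "H u \<bullet> u = (\<Sum>b\<in>Basis. (u \<bullet> b) * (H b \<bullet> u))" by (simp add: inner_sum_left)
  then show ?thesis by (simp add: inner_commute)
 qed
 have 3: "(\<Sum>b\<in>Basis. (b \<bullet> u) * (b \<bullet> u)) = 1" using euclidean_inner[of u u] uu by (simp add: inner_commute)
 have "H (b - (2 * (b \<bullet> u)) *\<^sub>R u) \<bullet> (b - (2 * (b \<bullet> u)) *\<^sub>R u)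
  = H b \<bullet> b - 2 * ((b \<bullet> u) * (H b \<bullet> u)) - 2 * ((b \<bullet> u) * (H u \<bullet> b)) + (4 * (H u \<bullet> u)) * ((b \<bullet> u) * (b \<bullet> u))" for b
  by (simp add: linear_diff[OF H] linear_cmul[OF H] inner_diff_left inner_diff_right algebra_simps)
 then show ?thesis
  by (simp add: sum.distrib sum_subtractf flip: sum_distrib_left) (simp add: 1 2 3 tr_def)
qed

lemma quad_diff_le:
 fixes x x' z :: "'a::real_inner"
 assumes "norm (x - z) <= 1" "norm (x' - z) <= 1"
 shows "(x' - z) \<bullet> (x' - z) - (x - z) \<bullet> (x - z) <= 2 * norm (x' - x)"
proof -
 have "(x' - z) \<bullet> (x' - z) - (x - z) \<bullet> (x - z) = (norm (x' - z) + norm (x - z)) * (norm (x' - z) - norm (x - z))"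
  by (simp add: dot_square_norm power2_eq_square algebra_simps)
 also have "... <= (norm (x' - z) + norm (x - z)) * norm (x' - x)"
  using norm_triangle_ineq3[of "x' - z" "x - z"] by (intro mult_left_mono) auto
 also have "... <= 2 * norm (x' - x)" using assms by (intro mult_right_mono) auto
 finally show ?thesis .
qed

text \<open>Doubling of variables in the manner of Ishii and Lions. When the two points move in
  mirrored directions their difference stays on one line, and concavity of \<omega> contributes the
  large term 8 L \<gamma>. The quadratic terms localise; the kinks enter with a plus sign and so
  keep the maximum off the hyperplane in both variables. Of \<open>v\<close> and \<open>F\<close>
  only bounds are used.\<close>

lemma nsol_lipschitz_aux:
 fixes v :: "'a::euclidean_space => real"
 assumes v: "nsol v \<Omega> e h F \<beta>" and e: "norm e = 1" and zO: "cball z 1 \<subseteq> \<Omega>"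
  and vB: "\<forall>y\<in>\<Omega>. \<bar>v y\<bar> <= B" and FB: "\<forall>y\<in>\<Omega>. \<bar>F y\<bar> <= \<rho>"
  and \<beta>: "\<beta> >= 0" and B: "B >= 0"
  and K: "K = 2 * B + 1" and \<gamma>: "\<gamma> = \<beta> + 1" and s1: "s1 = 1 / (4 * \<gamma>)"
  and L1: "L * (3/4 * s1) >= 2 * B + 1" and L2: "8 * L > 4 * K * real DIM('a) + 2 * \<rho> + 2 * \<beta> * (2 * K + 1)"
  and L0: "L > 0" and x0: "x0 \<in> cball z s1"
 shows "v x0 - v z <= (L + K) * dist x0 z"
proof -
 let ?n = "real DIM('a)"
 \<comment> \<open>Up to s1 = 1 / (4 \<gamma>) this modulus stays above 3 s / 4. Its second
   derivative is -2 \<gamma>, and \<gamma> = \<beta> + 1 is chosen because the gradient terms to be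
   dominated grow like \<beta> L.\<close>
 define \<omega> where "\<omega> s = s - \<gamma> * s^2" for s
 have \<gamma>1: "\<gamma> >= 1" using \<gamma> \<beta> by simp
 have s1p: "s1 > 0" "s1 <= 1/4" "\<gamma> * s1 = 1/4" using \<gamma>1 by (auto simp: s1 field_simps)
 have \<omega>low: "\<omega> s >= 3/4 * s" if "0 <= s" "s <= s1" for s
 proof -
  have "\<gamma> * s <= 1/4" using mult_left_mono[OF that(2), of \<gamma>] s1p(3) \<gamma>1 by linarith
  then have "s * (\<gamma> * s) <= s * (1/4)" using that by (intro mult_left_mono)
  then show ?thesis by (simp add: \<omega>_def power2_eq_square mult.left_commute)
 qed
 have \<omega>lip: "\<omega> s' - \<omega> s <= \<bar>s' - s\<bar>" if "0 <= s" "s <= s1" "0 <= s'" "s' <= s1" for s s'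
 proof -
  have "\<gamma> * (s + s') <= \<gamma> * (2 * s1)" using that \<gamma>1 by (intro mult_left_mono) auto
  then have "\<gamma> * (s + s') <= 1/2" using s1p(3) by simp
  moreover have "\<gamma> * (s + s') >= 0" using that \<gamma>1 by simp
  ultimately have "\<bar>1 - \<gamma> * (s + s')\<bar> <= 1" by simp
  then have "\<bar>s' - s\<bar> * \<bar>1 - \<gamma> * (s + s')\<bar> <= \<bar>s' - s\<bar> * 1" by (intro mult_left_mono) auto
  moreover have "\<omega> s' - \<omega> s = (s' - s) * (1 - \<gamma> * (s + s'))" by (simp add: \<omega>_def power2_eq_square algebra_simps)
  ultimately show ?thesis by (metis abs_le_D1 abs_mult mult.right_neutral)
 qed
 have K1: "K >= 1" using K B by simp
 define m0 where "m0 = v x0 - v z - L * \<omega> (norm (x0 - z)) - K * ((x0 - z) \<bullet> (x0 - z))"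
 have "m0 <= 0"
 proof (rule ccontr)
  assume "\<not> m0 <= 0"
  then have m0: "m0 > 0" by simp
  define \<eta> where "\<eta> = min (1/4) (m0 / 8)"
  have \<eta>: "\<eta> > 0" "\<eta> <= 1/4" "4 * \<eta> < m0" using m0 by (auto simp: \<eta>_def)
  define \<kappa> where "\<kappa> x = \<bar>x \<bullet> e - h\<bar> - \<bar>z \<bullet> e - h\<bar>" for x
  have \<kappa>: "\<bar>\<kappa> x\<bar> <= norm (x - z)" for x
  proof -
   have "\<bar>\<kappa> x\<bar> <= \<bar>(x - z) \<bullet> e\<bar>" by (simp add: \<kappa>_def inner_diff_left)
   also have "... <= norm (x - z)" using Cauchy_Schwarz_ineq2[of "x - z" e] e by simp
   finally show ?thesis .
  qed
  \<comment> \<open>At a maximum, K = 2 B + 1 outweighs v x - v y <= 2 B and the kinks, at most 2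
    \<eta> <= 1/2, so both points lie inside the unit ball; the size of \<open>L\<close> excludes |x
    - y| = s1; and x = y is excluded because the maximum exceeds 3 \<eta>.\<close>
  define \<Psi> where "\<Psi> x y = v x - v y - L * \<omega> (norm (x - y)) - K * ((x - z) \<bullet> (x - z) + (y - z) \<bullet> (y - z)) + \<eta> * (\<kappa> x + \<kappa> y)" for x y
  define D where "D = (cball z 1 \<times> cball z 1) \<inter> {P. norm (fst P - snd P) <= s1}"
  have cD: "compact D" unfolding D_def
   by (intro compact_Int_closed compact_Times compact_cball closed_Collect_le continuous_intros)
  have cv: "continuous_on (cball z 1) v" using v zO continuous_on_subset unfolding nsol_def by blast
  have "continuous_on D (\<lambda>P. \<Psi> (fst P) (snd P))"
   unfolding \<Psi>_def \<omega>_def \<kappa>_def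
   by (intro continuous_intros continuous_on_compose2[OF cv]) (auto simp: D_def)
  moreover have x0D: "(x0, z) \<in> D" using x0 s1p by (auto simp: D_def dist_norm norm_minus_commute)
  ultimately obtain P where P: "P \<in> D" "\<And>Q. Q \<in> D ==> \<Psi> (fst Q) (snd Q) <= \<Psi> (fst P) (snd P)"
   using continuous_attains_sup[OF cD, of "\<lambda>P. \<Psi> (fst P) (snd P)"] by blast
  obtain x y where xy: "P = (x, y)" by (cases P)
  have inD: "norm (x - z) <= 1" "norm (y - z) <= 1" "norm (x - y) <= s1"
   using P xy by (auto simp: D_def dist_norm norm_minus_commute)
  have mx: "\<Psi> x' y' <= \<Psi> x y" if "norm (x' - z) <= 1" "norm (y' - z) <= 1" "norm (x' - y') <= s1" for x' y'
   using P(2)[of "(x', y')"] that xy by (auto simp: D_def dist_norm norm_minus_commute)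
  have "\<Psi> x0 z <= \<Psi> x y" using P(2)[OF x0D] xy by simp
  moreover have "\<Psi> x0 z = m0 + \<eta> * \<kappa> x0" by (simp add: \<Psi>_def m0_def \<kappa>_def)
  moreover have "norm (x0 - z) <= 1" using x0 s1p by (auto simp: dist_norm norm_minus_commute)
  then have "\<bar>\<kappa> x0\<bar> <= 1" using \<kappa>[of x0] by simp
  then have "\<eta> * \<kappa> x0 >= - \<eta>" using \<eta> mult_left_mono[of "-1" "\<kappa> x0" \<eta>] by simp
  ultimately have big: "\<Psi> x y > 3 * \<eta>" using \<eta> by simp
  have kk: "\<eta> * (\<kappa> x + \<kappa> y) <= 2 * \<eta>" using \<kappa>[of x] \<kappa>[of y] inD \<eta> mult_left_mono[of "\<kappa> x + \<kappa> y" 2 \<eta>] by simp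
  have vv: "v x - v y <= 2 * B" using vB zO inD by (smt (verit) dist_commute dist_norm mem_cball subsetD)
  have \<omega>0: "L * \<omega> (norm (x - y)) >= 0"
  proof (rule mult_nonneg_nonneg)
   have "3/4 * norm (x - y) <= \<omega> (norm (x - y))" using \<omega>low inD by simp
   then show "\<omega> (norm (x - y)) >= 0" using norm_ge_zero[of "x - y"] by linarith
  qed (use L0 in simp)
  have nx: "norm (x - z) < 1"
  proof (rule ccontr)
   assume "\<not> norm (x - z) < 1"
   then have "(x - z) \<bullet> (x - z) = 1" using inD by (simp add: dot_square_norm)
   then have "K * ((x - z) \<bullet> (x - z) + (y - z) \<bullet> (y - z)) >= K" using K1 by simp
   then show False using big kk vv \<omega>0 \<eta> K unfolding \<Psi>_def by linarith
  qed
  have ny: "norm (y - z) < 1"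
  proof (rule ccontr)
   assume "\<not> norm (y - z) < 1"
   then have "(y - z) \<bullet> (y - z) = 1" using inD by (simp add: dot_square_norm)
   then have "K * ((x - z) \<bullet> (x - z) + (y - z) \<bullet> (y - z)) >= K" using K1 by simp
   then show False using big kk vv \<omega>0 \<eta> K unfolding \<Psi>_def by linarith
  qed
  have q0: "K * ((x - z) \<bullet> (x - z) + (y - z) \<bullet> (y - z)) >= 0" using K1 by simp
  have ns: "norm (x - y) < s1"
  proof (rule ccontr)
   assume "\<not> norm (x - y) < s1"
   then have "norm (x - y) = s1" using inD by simp
   then have "L * \<omega> (norm (x - y)) >= L * (3/4 * s1)" using \<omega>low[of s1] s1p L0 by (intro mult_left_mono) auto
   then show False using big kk vv \<eta> L1 q0 unfolding \<Psi>_def by linarith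
  qed
  have nxy: "x \<noteq> y"
  proof
   assume xy: "x = y"
   have "L * \<omega> (norm (x - y)) = 0" using xy by (simp add: \<omega>_def)
   moreover have "v x - v y = 0" using xy by simp
   ultimately show False using big kk \<eta> q0 unfolding \<Psi>_def by linarith
  qed
  define s where "s = norm (x - y)"
  have s: "s > 0" "s < s1" using nxy ns by (auto simp: s_def)
  have xO: "x \<in> \<Omega>" "y \<in> \<Omega>" using zO inD by (auto simp: dist_norm norm_minus_commute subset_iff)
  have evx: "\<forall>\<^sub>F x' in nhds x. norm (x' - z) < 1 \<and> norm (x' - y) < s1"
  proof (intro eventually_conj)
   show "\<forall>\<^sub>F x' in nhds x. norm (x' - z) < 1"
    using eventually_nhds_in_open[of "ball z 1" x] nx by (simp add: dist_norm norm_minus_commute)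
   show "\<forall>\<^sub>F x' in nhds x. norm (x' - y) < s1"
    using eventually_nhds_in_open[of "ball y s1" x] ns by (simp add: dist_norm norm_minus_commute)
  qed
  have evy: "\<forall>\<^sub>F y' in nhds y. norm (y' - z) < 1 \<and> norm (x - y') < s1"
  proof (intro eventually_conj)
   show "\<forall>\<^sub>F x' in nhds y. norm (x' - z) < 1"
    using eventually_nhds_in_open[of "ball z 1" y] ny by (simp add: dist_norm norm_minus_commute)
   show "\<forall>\<^sub>F x' in nhds y. norm (x - x') < s1"
    using eventually_nhds_in_open[of "ball x s1" y] ns by (simp add: dist_norm norm_minus_commute)
  qed
  have lmx: "\<forall>\<^sub>F x' in nhds x. \<Psi> x' y <= \<Psi> x y" using evx by (rule eventually_mono) (use mx ny in auto)
  have lmy: "\<forall>\<^sub>F y' in nhds y. \<Psi> x y' <= \<Psi> x y" using evy by (rule eventually_mono) (use mx nx in auto)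
  have dq: "(\<lambda>x'. (x' - z) \<bullet> (x' - z)) differentiable (at a)" for a
   using hess_quad[of 1 z a] unfolding hess_def differentiable_def by (auto dest!: eventually_nhds_x_imp_x)
  have dn: "(\<lambda>x'. norm (x' - y)) differentiable (at x)"
   using nxy by (auto intro!: differentiable_compose[of norm] differentiable_norm_at derivative_intros)
  have xh: "x \<bullet> e \<noteq> h"
  proof
   assume xh: "x \<bullet> e = h"
   define \<zeta> where "\<zeta> x' = - (L * \<omega> (norm (x' - y)) + K * ((x' - z) \<bullet> (x' - z)))" for x'
   have "\<zeta> differentiable (at x)" unfolding \<zeta>_def \<omega>_def
    by (intro derivative_intros dn dq)
   then obtain \<zeta>' where "(\<zeta> has_derivative \<zeta>') (at x)" unfolding differentiable_def by blast
   moreover have "neum (\<lambda>x. - v x) e x" by (rule neum_minus[OF nsol_neum[OF v xO(1) xh]])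
   ultimately show False
    using neum_no_kink_min[of "\<lambda>x. - v x" e x h \<eta> \<zeta> \<zeta>'] e xh \<eta> lmx
    unfolding \<Psi>_def \<zeta>_def \<kappa>_def by (simp add: algebra_simps)
  qed
  have dn2: "(\<lambda>y'. norm (x - y')) differentiable (at y)"
   using nxy by (auto intro!: differentiable_compose[of norm] differentiable_norm_at derivative_intros)
  have yh: "y \<bullet> e \<noteq> h"
  proof
   assume yh: "y \<bullet> e = h"
   define \<zeta> where "\<zeta> y' = - (L * \<omega> (norm (x - y')) + K * ((y' - z) \<bullet> (y' - z)))" for y'
   have "\<zeta> differentiable (at y)" unfolding \<zeta>_def \<omega>_def
    by (intro derivative_intros dn2 dq)
   then obtain \<zeta>' where "(\<zeta> has_derivative \<zeta>') (at y)" unfolding differentiable_def by blast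
   moreover have "neum v e y" using nsol_neum[OF v xO(2) yh] .
   ultimately show False
    using neum_no_kink_min[of v e y h \<eta> \<zeta> \<zeta>'] e yh \<eta> lmy
    unfolding \<Psi>_def \<zeta>_def \<kappa>_def by (simp add: algebra_simps)
  qed
  obtain G H where GH: "hess v x G H" "\<bar>tr H + F x\<bar> <= \<beta> * norm (G x)" using nsol_hess[OF v xO(1) xh] .
  obtain G' H' where GH': "hess v y G' H'" "\<bar>tr H' + F y\<bar> <= \<beta> * norm (G' y)" using nsol_hess[OF v xO(2) yh] .
  have \<kappa>l: "\<kappa> a - \<kappa> b <= norm (b - a)" for a b
  proof -
   have "\<kappa> a - \<kappa> b <= \<bar>(b - a) \<bullet> e\<bar>" by (simp add: \<kappa>_def inner_diff_left)
   also have "... <= norm (b - a)" using Cauchy_Schwarz_ineq2[of "b - a" e] e by simp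
   finally show ?thesis .
  qed
  have gx: "norm (G x) <= L + 2 * K + 1"
  proof -
   have "\<forall>\<^sub>F x' in nhds x. v x' - v x <= (L + 2 * K + 1) * norm (x' - x)"
    using evx lmx
   proof eventually_elim
    case (elim x')
    have "\<omega> (norm (x' - y)) - \<omega> s <= \<bar>norm (x' - y) - s\<bar>" using elim s by (intro \<omega>lip) auto
    also have "... <= norm (x' - x)" unfolding s_def using norm_triangle_ineq3[of "x' - y" "x - y"] by simp
    finally have "L * (\<omega> (norm (x' - y)) - \<omega> s) <= L * norm (x' - x)" using L0 by simp
    moreover have "K * ((x' - z) \<bullet> (x' - z) - (x - z) \<bullet> (x - z)) <= K * (2 * norm (x' - x))"
     using quad_diff_le[of x z x'] nx elim K1 by (intro mult_left_mono) auto
    moreover have "\<eta> * (\<kappa> x - \<kappa> x') <= 1 * norm (x' - x)"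
     using \<kappa>l[of x x'] \<eta> by (intro order_trans[OF mult_left_mono[OF \<kappa>l]] mult_right_mono) auto
    ultimately show ?case using elim(2) unfolding \<Psi>_def s_def by (simp add: algebra_simps)
   qed
   moreover have "(v has_derivative (\<bullet>) (G x)) (at x)" using GH(1) unfolding hess_def by (auto dest: eventually_nhds_x_imp_x)
   ultimately show ?thesis using grad_bound[of v "G x" x] L0 K1 by fastforce
  qed
  have gy: "norm (G' y) <= L + 2 * K + 1"
  proof -
   have "\<forall>\<^sub>F y' in nhds y. (- v y') - (- v y) <= (L + 2 * K + 1) * norm (y' - y)"
    using evy lmy
   proof eventually_elim
    case (elim y')
    have "\<omega> (norm (x - y')) - \<omega> s <= \<bar>norm (x - y') - s\<bar>" using elim s by (intro \<omega>lip) auto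
    also have "... <= norm (y' - y)" unfolding s_def using norm_triangle_ineq3[of "x - y'" "x - y"] by (simp add: norm_minus_commute)
    finally have "L * (\<omega> (norm (x - y')) - \<omega> s) <= L * norm (y' - y)" using L0 by simp
    moreover have "K * ((y' - z) \<bullet> (y' - z) - (y - z) \<bullet> (y - z)) <= K * (2 * norm (y' - y))"
     using quad_diff_le[of y z y'] ny elim K1 by (intro mult_left_mono) auto
    moreover have "\<eta> * (\<kappa> y - \<kappa> y') <= 1 * norm (y' - y)"
     using \<kappa>l[of y y'] \<eta> by (intro order_trans[OF mult_left_mono[OF \<kappa>l]] mult_right_mono) auto
    ultimately show ?case using elim(2) unfolding \<Psi>_def s_def by (simp add: algebra_simps)
   qed
   moreover have "((\<lambda>z. - v z) has_derivative (\<bullet>) (- G' y)) (at y)"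
    using hess_minus[OF GH'(1)] unfolding hess_def by (auto dest: eventually_nhds_x_imp_x)
   ultimately show ?thesis using grad_bound[of "\<lambda>z. - v z" "- G' y" y] L0 K1 by fastforce
  qed
  define u where "u = (x - y) /\<^sub>R s"
  have u1: "norm u = 1" using s by (simp add: u_def s_def)
  have su: "x - y = s *\<^sub>R u" using s by (simp add: u_def)
  \<comment> \<open>With c the mirror image of b in the hyperplane orthogonal to \<open>u\<close>,
    one has x + t b - (y + t c) = (s + 2 t (b . u)) u. The distance is thus affine in t, and
    \<open>\<Psi>\<close> along this motion is the explicit function \<open>W\<close> below.\<close>
  have second: "H b \<bullet> b - H' (b - (2 * (b \<bullet> u)) *\<^sub>R u) \<bullet> (b - (2 * (b \<bullet> u)) *\<^sub>R u) + 8 * L * \<gamma> * ((b \<bullet> u) * (b \<bullet> u)) - 4 * K <= 0"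
   if b: "b \<in> Basis" for b
  proof -
   define a where "a = b \<bullet> u"
   define c where "c = b - (2 * a) *\<^sub>R u"
   have uu: "u \<bullet> u = 1" using u1 by (simp add: norm_eq_1)
   have bb: "b \<bullet> b = 1" using b by simp
   have cc: "c \<bullet> c = 1" using b uu by (simp add: c_def a_def inner_diff_left inner_diff_right inner_commute algebra_simps)
   let ?sx = "sgn (x \<bullet> e - h)" and ?sy = "sgn (y \<bullet> e - h)"
   define W where "W = (\<lambda>t::real. v (x + t *\<^sub>R b) - v (y + t *\<^sub>R c) - L * ((s + 2 * t * a) - \<gamma> * (s + 2 * t * a)^2)
     - K * ((x - z) \<bullet> (x - z) + 2 * t * ((x - z) \<bullet> b) + t^2 + ((y - z) \<bullet> (y - z) + 2 * t * ((y - z) \<bullet> c) + t^2))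
     + \<eta> * (?sx * (x \<bullet> e - h + t * (b \<bullet> e)) + ?sy * (y \<bullet> e - h + t * (c \<bullet> e)) - 2 * \<bar>z \<bullet> e - h\<bar>))"
   define W' where "W' = (\<lambda>t::real. G (x + t *\<^sub>R b) \<bullet> b - G' (y + t *\<^sub>R c) \<bullet> c - L * (2 * a - \<gamma> * (2 * (s + 2 * t * a) * (2 * a)))
     - K * (2 * ((x - z) \<bullet> b) + 2 * t + (2 * ((y - z) \<bullet> c) + 2 * t)) + \<eta> * (?sx * (b \<bullet> e) + ?sy * (c \<bullet> e)))"
   have 1: "\<forall>\<^sub>F t in nhds 0. (W has_real_derivative W' t) (at t)"
    using hess_line(1)[OF GH(1), of b] hess_line(1)[OF GH'(1), of c]
   proof eventually_elim
    case (elim t)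
    show ?case unfolding W_def W'_def
     by (rule derivative_eq_intros elim refl | simp)+ (simp add: algebra_simps)
   qed
   have 2: "(W' has_real_derivative (H b \<bullet> b - H' c \<bullet> c + 8 * L * \<gamma> * (a * a) - 4 * K)) (at 0)"
    unfolding W'_def
    by (rule derivative_eq_intros hess_line(2)[OF GH(1), of b] hess_line(2)[OF GH'(1), of c] refl | simp)+
   have tx: "((\<lambda>t::real. x + t *\<^sub>R b) \<longlongrightarrow> x) (nhds 0)" and ty: "((\<lambda>t::real. y + t *\<^sub>R c) \<longlongrightarrow> y) (nhds 0)"
    by (auto intro!: tendsto_eq_intros simp: filterlim_ident)
   have ts: "((\<lambda>t::real. s + 2 * t * a) \<longlongrightarrow> s) (nhds 0)"
    by (auto intro!: tendsto_eq_intros simp: filterlim_ident)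
   have e1: "\<forall>\<^sub>F t in nhds 0. norm (x + t *\<^sub>R b - z) < 1"
    using eventually_compose_filterlim[OF evx tx] by (auto elim: eventually_mono)
   have e2: "\<forall>\<^sub>F t in nhds 0. norm (y + t *\<^sub>R c - z) < 1"
    using eventually_compose_filterlim[OF evy ty] by (auto elim: eventually_mono)
   have e3: "\<forall>\<^sub>F t in nhds 0. 0 < s + 2 * t * a \<and> s + 2 * t * a < s1"
    using eventually_conj[OF order_tendstoD(1)[OF ts, of 0] order_tendstoD(2)[OF ts, of s1]] s by simp
   have kx: "\<forall>\<^sub>F x' in nhds x. \<bar>x' \<bullet> e - h\<bar> = ?sx * (x' \<bullet> e - h)"
   proof -
    have "((\<lambda>z. z \<bullet> e - h) \<longlongrightarrow> x \<bullet> e - h) (nhds x)" by (intro tendsto_intros) (simp add: filterlim_ident)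
    then have "\<forall>\<^sub>F z in nhds x. dist (z \<bullet> e - h) (x \<bullet> e - h) < \<bar>x \<bullet> e - h\<bar>" using xh by (simp add: tendsto_iff)
    then show ?thesis by (rule eventually_mono) (auto simp: dist_real_def sgn_if abs_if split: if_splits)
   qed
   have ky: "\<forall>\<^sub>F x' in nhds y. \<bar>x' \<bullet> e - h\<bar> = ?sy * (x' \<bullet> e - h)"
   proof -
    have "((\<lambda>z. z \<bullet> e - h) \<longlongrightarrow> y \<bullet> e - h) (nhds y)" by (intro tendsto_intros) (simp add: filterlim_ident)
    then have "\<forall>\<^sub>F z in nhds y. dist (z \<bullet> e - h) (y \<bullet> e - h) < \<bar>y \<bullet> e - h\<bar>" using yh by (simp add: tendsto_iff)
    then show ?thesis by (rule eventually_mono) (auto simp: dist_real_def sgn_if abs_if split: if_splits)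
   qed
   have W: "W t = \<Psi> (x + t *\<^sub>R b) (y + t *\<^sub>R c)" if t: "0 < s + 2 * t * a"
    "\<bar>(x + t *\<^sub>R b) \<bullet> e - h\<bar> = ?sx * ((x + t *\<^sub>R b) \<bullet> e - h)" "\<bar>(y + t *\<^sub>R c) \<bullet> e - h\<bar> = ?sy * ((y + t *\<^sub>R c) \<bullet> e - h)" for t
   proof -
    have "x + t *\<^sub>R b - (y + t *\<^sub>R c) = (s + 2 * t * a) *\<^sub>R u"
     using su by (simp add: c_def algebra_simps)
    then have n: "norm (x + t *\<^sub>R b - (y + t *\<^sub>R c)) = s + 2 * t * a" using t u1 by simp
    have qx: "(x + t *\<^sub>R b - z) \<bullet> (x + t *\<^sub>R b - z) = (x - z) \<bullet> (x - z) + 2 * t * ((x - z) \<bullet> b) + t^2"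
    proof -
     have eq: "x + t *\<^sub>R b - z = (x - z) + t *\<^sub>R b" by simp
     show ?thesis unfolding eq using bb by (simp add: inner_add_left inner_add_right inner_commute power2_eq_square)
    qed
    have qy: "(y + t *\<^sub>R c - z) \<bullet> (y + t *\<^sub>R c - z) = (y - z) \<bullet> (y - z) + 2 * t * ((y - z) \<bullet> c) + t^2"
    proof -
     have eq: "y + t *\<^sub>R c - z = (y - z) + t *\<^sub>R c" by simp
     show ?thesis unfolding eq using cc by (simp add: inner_add_left inner_add_right inner_commute power2_eq_square)
    qed
    have "\<kappa> (x + t *\<^sub>R b) + \<kappa> (y + t *\<^sub>R c) = ?sx * (x \<bullet> e - h + t * (b \<bullet> e)) + ?sy * (y \<bullet> e - h + t * (c \<bullet> e)) - 2 * \<bar>z \<bullet> e - h\<bar>"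
     unfolding \<kappa>_def t(2,3) by (simp add: inner_add_left algebra_simps)
    then show ?thesis unfolding W_def \<Psi>_def n \<omega>_def qx qy by simp
   qed
   have "\<forall>\<^sub>F t in nhds 0. W t <= W 0"
    using e1 e2 e3 eventually_compose_filterlim[OF kx tx] eventually_compose_filterlim[OF ky ty]
   proof eventually_elim
    case (elim t)
    have "x + t *\<^sub>R b - (y + t *\<^sub>R c) = (s + 2 * t * a) *\<^sub>R u"
     using su by (simp add: c_def algebra_simps)
    then have n: "norm (x + t *\<^sub>R b - (y + t *\<^sub>R c)) = s + 2 * t * a" using elim(3) u1 by simp
    have "W t = \<Psi> (x + t *\<^sub>R b) (y + t *\<^sub>R c)" using elim by (intro W) auto
    also have "... <= \<Psi> x y" using elim n by (intro mx) auto
    also have "... = W 0" using W[of 0] s eventually_nhds_x_imp_x[OF kx] eventually_nhds_x_imp_x[OF ky] by simp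
    finally show ?case .
   qed
   from second_deriv_nonpos_at_max(2)[OF 1 2 this] show ?thesis by (simp add: a_def c_def)
  qed
  have linH': "linear H'" using GH'(1) unfolding hess_def by (blast intro: has_derivative_linear)
  have 3: "(\<Sum>b\<in>Basis. (b \<bullet> u) * (b \<bullet> u)) = 1" using euclidean_inner[of u u] u1 by (simp add: inner_commute norm_eq_1)
  \<comment> \<open>Summing over the basis gives tr H - tr H' + 8 L \<gamma> <= 4 K n, while the
    equations bound tr H - tr H' below by -2 \<rho> - 2 \<beta> (L + 2 K + 1). The part 8 L \<beta>
    of 8 L \<gamma> absorbs 2 L \<beta>, and the remaining 8 L contradicts the choice of
    \<open>L\<close>.\<close>
  have "(\<Sum>b\<in>Basis. H b \<bullet> b - H' (b - (2 * (b \<bullet> u)) *\<^sub>R u) \<bullet> (b - (2 * (b \<bullet> u)) *\<^sub>R u) + 8 * L * \<gamma> * ((b \<bullet> u) * (b \<bullet> u)) - 4 * K) <= 0"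
   by (rule sum_nonpos) (rule second)
  then have fin: "tr H - tr H' + 8 * L * \<gamma> - 4 * K * ?n <= 0"
   unfolding sum_subtractf sum.distrib tr_reflect[OF linH' u1] sum_distrib_left[symmetric] 3
   by (simp add: tr_def mult_ac)
  have "\<beta> * norm (G x) <= \<beta> * (L + 2 * K + 1)" "\<beta> * norm (G' y) <= \<beta> * (L + 2 * K + 1)"
   using gx gy \<beta> by (auto intro: mult_left_mono)
  moreover have "\<bar>F x\<bar> <= \<rho>" "\<bar>F y\<bar> <= \<rho>" using FB xO by auto
  ultimately have "tr H - tr H' >= - 2 * \<rho> - 2 * (\<beta> * (L + 2 * K + 1))" using GH(2) GH'(2) by linarith
  then have "8 * L * \<gamma> <= 4 * K * ?n + 2 * \<rho> + 2 * (\<beta> * (L + 2 * K + 1))" using fin by linarith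
  moreover have "8 * L * \<gamma> = 8 * L + 8 * (L * \<beta>)" by (simp add: \<gamma> algebra_simps)
  moreover have "2 * (\<beta> * (L + 2 * K + 1)) = 2 * (L * \<beta>) + 2 * \<beta> * (2 * K + 1)" by (simp add: algebra_simps)
  moreover have "L * \<beta> >= 0" using L0 \<beta> by simp
  ultimately show False using L2 by linarith
 qed
 define d where "d = norm (x0 - z)"
 have d: "0 <= d" "d <= 1" using x0 s1p by (auto simp: d_def dist_norm norm_minus_commute)
 have "\<omega> d <= d" using \<gamma>1 by (simp add: \<omega>_def)
 then have "L * \<omega> d <= L * d" using L0 by simp
 moreover have "d^2 <= d" using d by (simp add: power2_eq_square mult_left_le)
 then have "K * d^2 <= K * d" using K1 by simp
 moreover have "(x0 - z) \<bullet> (x0 - z) = d^2" by (simp add: d_def dot_square_norm)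
 ultimately show ?thesis using \<open>m0 <= 0\<close> unfolding m0_def dist_norm d_def[symmetric] by (simp add: algebra_simps)
qed

text \<open>The order of quantifiers is the point: \<open>L\<close> and \<open>s\<close> are fixed
  before the function, its domain and the position of the hyperplane. The one-sided estimate is
  applied to \<open>v\<close> and to \<open>- v\<close>.\<close>

lemma nsol_lipschitz:
 assumes \<beta>: "\<beta> >= 0" and B: "B >= 0" and \<rho>: "\<rho> >= 0"
 obtains L s where "L > 0" "s > 0" "s <= 1/4"
  "\<And>(v :: 'a::euclidean_space => real) \<Omega> e h F x z. nsol v \<Omega> e h F \<beta> ==> norm e = 1 ==> cball z 1 \<subseteq> \<Omega> ==>
   \<forall>y\<in>\<Omega>. \<bar>v y\<bar> <= B ==> \<forall>y\<in>\<Omega>. \<bar>F y\<bar> <= \<rho> ==> x \<in> cball z s ==> \<bar>v x - v z\<bar> <= L * dist x z"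
proof -
 define K where "K = 2 * B + 1"
 define \<gamma> where "\<gamma> = \<beta> + 1"
 define s1 where "s1 = 1 / (4 * \<gamma>)"
 define L where "L = (2 * B + 1) * (4 / (3 * s1)) + (4 * K * real DIM('a) + 2 * \<rho> + 2 * \<beta> * (2 * K + 1)) + 1"
 have \<gamma>1: "\<gamma> >= 1" using \<beta> by (simp add: \<gamma>_def)
 have s1p: "s1 > 0" "s1 <= 1/4" using \<gamma>1 by (auto simp: s1_def field_simps)
 have a: "(2 * B + 1) * (4 / (3 * s1)) >= 0" using B s1p by (intro mult_nonneg_nonneg) auto
 have b: "4 * K * real DIM('a) + 2 * \<rho> + 2 * \<beta> * (2 * K + 1) >= 0" using B \<rho> \<beta> by (auto simp: K_def)
 have L0: "L > 0" using a b by (simp add: L_def)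
 have "L >= (2 * B + 1) * (4 / (3 * s1))" using b by (simp add: L_def)
 then have "L * (3/4 * s1) >= (2 * B + 1) * (4 / (3 * s1)) * (3/4 * s1)" using s1p by (intro mult_right_mono) auto
 then have L1: "L * (3/4 * s1) >= 2 * B + 1" using s1p by simp
 have L2: "8 * L > 4 * K * real DIM('a) + 2 * \<rho> + 2 * \<beta> * (2 * K + 1)"
 proof -
  have "8 * L > Y" if "X >= 0" "Y >= 0" "L = X + Y + 1" for X Y using that by linarith
  from this[OF a b L_def] show ?thesis .
 qed
 show thesis
 proof (rule that[of "L + K" s1])
  show "L + K > 0" using L0 B by (simp add: K_def)
  fix v :: "'a => real" and \<Omega> e h F x z
  assume v: "nsol v \<Omega> e h F \<beta>" and e: "norm e = 1" and z: "cball z 1 \<subseteq> \<Omega>"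
   and vB: "\<forall>y\<in>\<Omega>. \<bar>v y\<bar> <= B" and FB: "\<forall>y\<in>\<Omega>. \<bar>F y\<bar> <= \<rho>" and x: "x \<in> cball z s1"
  have "v x - v z <= (L + K) * dist x z"
   by (rule nsol_lipschitz_aux[OF v e z vB FB \<beta> B K_def \<gamma>_def s1_def L1 L2 L0 x])
  moreover have "- v x - - v z <= (L + K) * dist x z"
   by (rule nsol_lipschitz_aux[OF nsol_minus[OF v] e z _ _ \<beta> B K_def \<gamma>_def s1_def L1 L2 L0 x]) (use vB FB in auto)
  ultimately show "\<bar>v x - v z\<bar> <= (L + K) * dist x z" by linarith
 qed (use s1p in auto)
qed

section \<open>The Kelvin transform\<close>

lemma hess_mult:
 assumes f: "hess f y G H" and g: "hess g y G' H'"
 shows "hess (\<lambda>z. f z * g z) y (\<lambda>z. f z *\<^sub>R G' z + g z *\<^sub>R G z)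
     (\<lambda>h. (f y *\<^sub>R H' h + (G y \<bullet> h) *\<^sub>R G' y) + (g y *\<^sub>R H h + (G' y \<bullet> h) *\<^sub>R G y))"
  and "tr (\<lambda>h. (f y *\<^sub>R H' h + (G y \<bullet> h) *\<^sub>R G' y) + (g y *\<^sub>R H h + (G' y \<bullet> h) *\<^sub>R G y))
     = f y * tr H' + 2 * (G y \<bullet> G' y) + g y * tr H"
proof -
 have fy: "(f has_derivative (\<bullet>) (G y)) (at y)" and gy: "(g has_derivative (\<bullet>) (G' y)) (at y)"
  using f g unfolding hess_def by (auto dest: eventually_nhds_x_imp_x)
 have 1: "((\<lambda>z. f z * g z) has_derivative (\<bullet>) (f z *\<^sub>R G' z + g z *\<^sub>R G z)) (at z)"
  if "(f has_derivative (\<bullet>) (G z)) (at z)" "(g has_derivative (\<bullet>) (G' z)) (at z)" for z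
  using has_derivative_mult[OF that] by (rule has_derivative_eq_rhs) (simp add: inner_add_left mult.commute fun_eq_iff)
 have A: "\<forall>\<^sub>F z in nhds y. ((\<lambda>z. f z * g z) has_derivative (\<bullet>) (f z *\<^sub>R G' z + g z *\<^sub>R G z)) (at z)"
  using f[unfolded hess_def, THEN conjunct1] g[unfolded hess_def, THEN conjunct1] by (rule eventually_elim2) (rule 1)
 have B: "((\<lambda>z. f z *\<^sub>R G' z + g z *\<^sub>R G z) has_derivative
   (\<lambda>h. (f y *\<^sub>R H' h + (G y \<bullet> h) *\<^sub>R G' y) + (g y *\<^sub>R H h + (G' y \<bullet> h) *\<^sub>R G y))) (at y)"
  using f g unfolding hess_def by (intro has_derivative_add has_derivative_scaleR fy gy) auto
 show "hess (\<lambda>z. f z * g z) y (\<lambda>z. f z *\<^sub>R G' z + g z *\<^sub>R G z)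
     (\<lambda>h. (f y *\<^sub>R H' h + (G y \<bullet> h) *\<^sub>R G' y) + (g y *\<^sub>R H h + (G' y \<bullet> h) *\<^sub>R G y))"
  using A B by (simp add: hess_def)
 have trr: "tr (\<lambda>h. (a \<bullet> h) *\<^sub>R b) = a \<bullet> b" for a b :: 'a
  by (simp add: tr_def euclidean_inner[of a b] inner_commute)
 show "tr (\<lambda>h. (f y *\<^sub>R H' h + (G y \<bullet> h) *\<^sub>R G' y) + (g y *\<^sub>R H h + (G' y \<bullet> h) *\<^sub>R G y))
     = f y * tr H' + 2 * (G y \<bullet> G' y) + g y * tr H"
  unfolding tr_add tr_scale trr by (simp add: inner_commute[of "G' y"])
qed

text \<open>Half of n - 2, because powers are always taken of squared ratios such as l^2 /
  |z|^2.\<close>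

definition kexp :: "'a::euclidean_space itself => real" where
 "kexp _ = (real DIM('a) - 2) / 2"

text \<open>Kelvin transform in the sphere of radius \<open>l\<close> around \<open>x\<close>, that
  is (l/|z|)^(n-2) v(x + l^2 z / |z|^2). The variable \<open>z\<close> is measured from the centre,
  whereas \<open>v\<close> takes absolute positions.\<close>

definition kelvin :: "real => ('a::euclidean_space => real) => 'a => 'a => real" where
 "kelvin l v x z = (l^2 / (z \<bullet> z)) powr kexp TYPE('a) * v (x + (l^2 / (z \<bullet> z)) *\<^sub>R z)"

text \<open>Conformal covariance of the Laplacian. The derivative of the inversion is l^2 / |y|^2
  times a reflection, which yields the main term; the weight (l/|y|)^(n-2) is harmonic, and its
  cross term with the gradient cancels the drift coming from the Laplacian of the inversion.\<close>

lemma kelvin_hess: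
 fixes y x :: "'a::euclidean_space"
 assumes y: "y \<noteq> 0" and l: "l > 0" and V: "hess V (x + (l^2 / (y \<bullet> y)) *\<^sub>R y) G H"
 obtains G' H' where "hess (kelvin l V x) y G' H'"
  "tr H' = (l^2 / (y \<bullet> y)) powr (kexp TYPE('a) + 2) * tr H"
proof -
 let ?a = "kexp TYPE('a)" and ?n = "real DIM('a)"
 define q where "q = y \<bullet> y"
 have q: "q > 0" using y by (simp add: q_def)
 define k where "k = l^2 / q"
 have k: "k > 0" using q l by (simp add: k_def)
 define T where "T z = x + (l^2 / (z \<bullet> z)) *\<^sub>R z" for z :: 'a
 define T' where "T' z h = (l^2 / (z \<bullet> z)) *\<^sub>R h - (2 * l^2 * (z \<bullet> h) / (z \<bullet> z)^2) *\<^sub>R z" for z h :: 'a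
 define T2 where "T2 b h = - (2 * l^2 * (y \<bullet> h) / q^2) *\<^sub>R b
  - ((2 * l^2 * (h \<bullet> b) / q^2 - 8 * l^2 * (y \<bullet> b) * (y \<bullet> h) / q^3) *\<^sub>R y + (2 * l^2 * (y \<bullet> b) / q^2) *\<^sub>R h)" for b h :: 'a
 have inv: "((\<lambda>z. l^2 / (z \<bullet> z)) has_derivative (\<lambda>h. - (2 * l^2 * (z \<bullet> h) / (z \<bullet> z)^2))) (at z)" if "z \<noteq> 0" for z :: 'a
 proof -
  have 1: "((\<lambda>z. z \<bullet> z) has_derivative (\<lambda>h. 2 * (z \<bullet> h))) (at z)"
   by (auto intro!: derivative_eq_intros simp: inner_commute)
  have 2: "((\<lambda>s. l^2 / s) has_real_derivative - (l^2 / (z \<bullet> z)^2)) (at (z \<bullet> z))"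
   using that by (auto intro!: derivative_eq_intros simp: power2_eq_square)
  show ?thesis using has_derivative_compose[OF 1 2[unfolded has_field_derivative_def]]
   by (rule has_derivative_eq_rhs) (auto simp: fun_eq_iff)
 qed
 have dT: "(T has_derivative T' z) (at z)" if "z \<noteq> 0" for z
 proof -
  have "((\<lambda>z. x + (l^2 / (z \<bullet> z)) *\<^sub>R z) has_derivative
   (\<lambda>h. 0 + ((l^2 / (z \<bullet> z)) *\<^sub>R h + (- (2 * l^2 * (z \<bullet> h) / (z \<bullet> z)^2)) *\<^sub>R z))) (at z)"
   by (intro has_derivative_add has_derivative_const has_derivative_scaleR inv[OF that] has_derivative_ident)
  then show ?thesis unfolding T_def T'_def by (simp add: fun_eq_iff)
 qed
 have "\<forall>\<^sub>F z in nhds y. z \<in> - {0}" using y by (intro eventually_nhds_in_open) auto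
 then have evT: "\<forall>\<^sub>F z in nhds y. (T has_derivative T' z) (at z)"
  by (rule eventually_mono) (use dT in auto)
 have dT2: "((\<lambda>z. T' z b) has_derivative T2 b) (at y)" for b
 proof -
  have 1: "((\<lambda>z. 2 * l^2 * (z \<bullet> b)) has_derivative (\<lambda>h. 2 * l^2 * (h \<bullet> b))) (at y)"
   by (intro has_derivative_mult_right has_derivative_inner_left has_derivative_ident)
  have 11: "((\<lambda>z::'a. z \<bullet> z) has_derivative (\<lambda>h. 2 * (y \<bullet> h))) (at y)"
   by (auto intro!: derivative_eq_intros simp: inner_commute)
  have 2: "((\<lambda>s. 1 / s^2) has_real_derivative - (2 / q^3)) (at (y \<bullet> y))"
   using q unfolding q_def by (auto intro!: derivative_eq_intros simp: power2_eq_square power3_eq_cube)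
  have 3: "((\<lambda>z. 1 / (z \<bullet> z)^2) has_derivative (\<lambda>h. - (4 * (y \<bullet> h) / q^3))) (at y)"
   using has_derivative_compose[OF 11 2[unfolded has_field_derivative_def]]
   by (rule has_derivative_eq_rhs) (auto simp: fun_eq_iff)
  have 4: "((\<lambda>z. (2 * l^2 * (z \<bullet> b)) * (1 / (z \<bullet> z)^2)) has_derivative
    (\<lambda>h. 2 * l^2 * (h \<bullet> b) / q^2 - 8 * l^2 * (y \<bullet> b) * (y \<bullet> h) / q^3)) (at y)"
   using has_derivative_mult[OF 1 3]
   by (rule has_derivative_eq_rhs) (auto simp: fun_eq_iff q_def mult_ac)
  have 5: "((\<lambda>z. (2 * l^2 * (z \<bullet> b) / (z \<bullet> z)^2) *\<^sub>R z) has_derivative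
    (\<lambda>h. (2 * l^2 * (y \<bullet> b) / q^2) *\<^sub>R h + (2 * l^2 * (h \<bullet> b) / q^2 - 8 * l^2 * (y \<bullet> b) * (y \<bullet> h) / q^3) *\<^sub>R y)) (at y)"
   using has_derivative_scaleR[OF 4 has_derivative_ident] by (simp add: q_def)
  have 6: "((\<lambda>z. (l^2 / (z \<bullet> z)) *\<^sub>R b) has_derivative (\<lambda>h. (- (2 * l^2 * (y \<bullet> h) / q^2)) *\<^sub>R b)) (at y)"
   using has_derivative_scaleR_left[OF inv[OF y], of b] by (simp add: q_def)
  show ?thesis unfolding T'_def T2_def
   using has_derivative_diff[OF 6 5] by (simp add: add.commute)
 qed
 have Ty: "T y = x + (l^2 / (y \<bullet> y)) *\<^sub>R y" by (simp add: T_def)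
 have V': "hess V (T y) G H" using V Ty by simp
 note hc = hess_compose[OF V' evT dT2]
 define G2 where "G2 = (\<lambda>z. \<Sum>b\<in>Basis. (G (T z) \<bullet> T' z b) *\<^sub>R b)"
 define H2 where "H2 = (\<lambda>k. \<Sum>b\<in>Basis. (G (T y) \<bullet> T2 b k + H (T' y k) \<bullet> T' y b) *\<^sub>R b)"
 have h2: "hess (\<lambda>z. V (T z)) y G2 H2" unfolding G2_def H2_def by (rule hc(1))
 define u where "u = y /\<^sub>R norm y"
 have u1: "norm u = 1" using y by (simp add: u_def)
 have linH: "linear H" using V unfolding hess_def by (blast intro: has_derivative_linear)
 \<comment> \<open>The derivative of the inversion in its conformal form: the reflection along the
   radial direction, scaled by \<open>k\<close>.\<close>
 have T'b: "T' y b = k *\<^sub>R (b - (2 * (b \<bullet> u)) *\<^sub>R u)" for b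
 proof -
  have "(b \<bullet> u) *\<^sub>R u = ((b \<bullet> y) / (norm y * norm y)) *\<^sub>R y" by (simp add: u_def divide_inverse)
  also have "norm y * norm y = q" by (simp add: q_def dot_square_norm power2_eq_square)
  finally have "(2 * (b \<bullet> u)) *\<^sub>R u = (2 * (y \<bullet> b) / q) *\<^sub>R y"
   by (metis (no_types, lifting) inner_commute scaleR_scaleR times_divide_eq_right)
  then show ?thesis unfolding T'_def k_def q_def[symmetric]
   by (simp add: scaleR_diff_right power2_eq_square mult_ac)
 qed
 have s1: "(\<Sum>b\<in>Basis. H (T' y b) \<bullet> T' y b) = k^2 * tr H"
 proof -
  have "H (T' y b) \<bullet> T' y b = k^2 * (H (b - (2 * (b \<bullet> u)) *\<^sub>R u) \<bullet> (b - (2 * (b \<bullet> u)) *\<^sub>R u))" for b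
   unfolding T'b linear_cmul[OF linH] by (simp add: power2_eq_square)
  then show ?thesis using tr_reflect[OF linH u1] by (simp flip: sum_distrib_left)
 qed
 have s2: "(\<Sum>b\<in>Basis. T2 b b) = ((4 - 2 * ?n) * k / q) *\<^sub>R y"
 proof -
  have rep: "(\<Sum>b\<in>Basis. (y \<bullet> b) *\<^sub>R b) = y" by (simp add: euclidean_representation)
  have sq: "(\<Sum>b\<in>Basis. (y \<bullet> b) * (y \<bullet> b)) = q" by (simp add: q_def euclidean_inner[of y y])
  have "T2 b b = (- (4 * l^2 / q^2)) *\<^sub>R ((y \<bullet> b) *\<^sub>R b) + (- (2 * l^2 / q^2) + (8 * l^2 / q^3) * ((y \<bullet> b) * (y \<bullet> b))) *\<^sub>R y"
   if "b \<in> Basis" for b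
  proof -
   have "b \<bullet> b = 1" using that by simp
   then have "T2 b b = (- (2 * l^2 * (y \<bullet> b) / q^2)) *\<^sub>R b - (2 * l^2 * (y \<bullet> b) / q^2) *\<^sub>R b
     - (2 * l^2 / q^2 - 8 * l^2 * (y \<bullet> b) * (y \<bullet> b) / q^3) *\<^sub>R y"
    unfolding T2_def by (simp add: scaleR_diff_left mult_ac)
   also have "(- (2 * l^2 * (y \<bullet> b) / q^2)) *\<^sub>R b - (2 * l^2 * (y \<bullet> b) / q^2) *\<^sub>R b = (- (4 * l^2 / q^2)) *\<^sub>R ((y \<bullet> b) *\<^sub>R b)"
    unfolding scaleR_diff_left[symmetric] scaleR_scaleR by simp
   finally show ?thesis by (simp add: scaleR_diff_left scaleR_add_left mult_ac)
  qed
  then have "(\<Sum>b\<in>Basis. T2 b b) = (\<Sum>b\<in>Basis. (- (4 * l^2 / q^2)) *\<^sub>R ((y \<bullet> b) *\<^sub>R b) + (- (2 * l^2 / q^2) + (8 * l^2 / q^3) * ((y \<bullet> b) * (y \<bullet> b))) *\<^sub>R y)"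
   by (rule sum.cong[OF refl])
  also have "... = (- (4 * l^2 / q^2)) *\<^sub>R y + (- (2 * l^2 / q^2) * ?n + (8 * l^2 / q^3) * q) *\<^sub>R y"
   unfolding sum.distrib scaleR_sum_right[symmetric] scaleR_sum_left[symmetric] sum_distrib_left[symmetric] rep sq
   by (simp add: mult_ac)
  also have "... = ((4 - 2 * ?n) * k / q) *\<^sub>R y"
  proof -
   have "- (4 * l^2 / q^2) + (- (2 * l^2 / q^2) * ?n + (8 * l^2 / q^3) * q) = (4 - 2 * ?n) * k / q"
    using q by (simp add: k_def field_simps power2_eq_square power3_eq_cube)
   then show ?thesis by (metis scaleR_left_distrib)
  qed
  finally show ?thesis .
 qed
 have trH2: "tr H2 = k^2 * tr H + (4 - 2 * ?n) * k / q * (G (T y) \<bullet> y)"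
  unfolding H2_def hc(2) s1 s2 by simp
 define f where "f s = (l^2 / s) powr ?a" for s :: real
 define f' where "f' s = - ?a / s * f s" for s
 have df: "(f has_real_derivative f' s) (at s)" if "s > 0" for s
 proof -
  have eq: "f t = l powr (2 * ?a) * t powr (- ?a)" if "t > 0" for t
  proof -
   have "f t = (l^2) powr ?a / t powr ?a" using that l by (simp add: f_def powr_divide)
   also have "(l^2) powr ?a = l powr (2 * ?a)" using l powr_powr[of l 2 ?a] by (simp add: powr_numeral)
   finally show ?thesis by (simp add: powr_minus divide_inverse)
  qed
  have "((\<lambda>t. l powr (2 * ?a) * t powr (- ?a)) has_real_derivative l powr (2 * ?a) * (- ?a * s powr (- ?a - 1))) (at s)"
   using that by (intro DERIV_cmult has_real_derivative_powr)
  moreover have "l powr (2 * ?a) * (- ?a * s powr (- ?a - 1)) = f' s"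
   using that unfolding f'_def eq[OF that] by (simp add: powr_diff)
  moreover have "\<forall>\<^sub>F t in nhds s. f t = l powr (2 * ?a) * t powr (- ?a)"
   using eventually_nhds_in_open[of "{0<..}" s] that by (auto elim!: eventually_mono intro: eq)
  ultimately show ?thesis by (simp add: DERIV_cong_ev)
 qed
 have df': "(f' has_real_derivative ?a * (?a + 1) / q^2 * f q) (at q)"
 proof -
  have "((\<lambda>s. - ?a / s) has_real_derivative ?a / q^2) (at q)"
   using q by (auto intro!: derivative_eq_intros simp: power2_eq_square)
  from DERIV_mult[OF this df[OF q]] have "((\<lambda>s. - ?a / s * f s) has_real_derivative ?a / q^2 * f q + f' q * (- ?a / q)) (at q)" .
  moreover have "?a / q^2 * f q + f' q * (- ?a / q) = ?a * (?a + 1) / q^2 * f q"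
   using q by (simp add: f'_def field_simps power2_eq_square)
  ultimately show ?thesis by (simp add: f'_def[abs_def])
 qed
 have evf: "\<forall>\<^sub>F s in nhds ((y - 0) \<bullet> (y - 0)). (f has_real_derivative f' s) (at s)"
  using eventually_nhds_in_open[of "{0<..}" q] q by (auto elim!: eventually_mono intro: df simp: q_def)
 have df'2: "(f' has_real_derivative ?a * (?a + 1) / q^2 * f q) (at ((y - 0) \<bullet> (y - 0)))" using df' by (simp add: q_def)
 note hr = hess_radial[OF evf df'2]
 define G1 where "G1 = (\<lambda>z. (2 * f' ((z-0) \<bullet> (z-0))) *\<^sub>R (z - 0 :: 'a))"
 define H1 where "H1 = (\<lambda>h. (2 * f' ((y-0) \<bullet> (y-0))) *\<^sub>R h + (4 * (?a * (?a + 1) / q^2 * f q) * ((y - 0) \<bullet> h)) *\<^sub>R (y - 0))"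
 have h1: "hess (\<lambda>z. f ((z-0) \<bullet> (z-0))) y G1 H1" unfolding G1_def H1_def by (rule hr(1))
 have trH1: "tr H1 = 0"
 proof -
  have "tr H1 = 2 * ?n * f' q + 4 * (?a * (?a + 1) / q^2 * f q) * q" unfolding H1_def hr(2) by (simp add: q_def)
  also have "... = ?a * f q / q * (4 * (?a + 1) - 2 * ?n)" using q by (simp add: f'_def field_simps power2_eq_square)
  also have "4 * (?a + 1) - 2 * ?n = 0" by (simp add: kexp_def field_simps)
  finally show ?thesis by simp
 qed
 have linT: "linear (T' y)" using eventually_nhds_x_imp_x[OF evT] by (rule has_derivative_linear)
 have "G2 y \<bullet> y = G (T y) \<bullet> T' y y" unfolding G2_def using basis_adjoint[OF linT] .
 also have "T' y y = (- k) *\<^sub>R y" using q by (simp add: T'_def k_def q_def[symmetric] power2_eq_square flip: scaleR_diff_left)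
 finally have G2y: "G2 y \<bullet> y = - k * (G (T y) \<bullet> y)" by simp
 have G12: "G1 y \<bullet> G2 y = 2 * ?a / q * f q * k * (G (T y) \<bullet> y)"
 proof -
  have "G1 y \<bullet> G2 y = 2 * f' q * (G2 y \<bullet> y)" by (simp add: G1_def q_def inner_commute)
  then show ?thesis unfolding G2y by (simp add: f'_def)
 qed
 note hm = hess_mult[OF h1 h2]
 have eqk: "(\<lambda>z. f ((z-0) \<bullet> (z-0)) * V (T z)) = kelvin l V x" by (simp add: fun_eq_iff kelvin_def f_def T_def)
 show thesis
 proof (rule that)
  show "hess (kelvin l V x) y (\<lambda>z. f ((z - 0) \<bullet> (z - 0)) *\<^sub>R G2 z + V (T z) *\<^sub>R G1 z)
   (\<lambda>h. (f ((y - 0) \<bullet> (y - 0)) *\<^sub>R H2 h + (G1 y \<bullet> h) *\<^sub>R G2 y) + (V (T y) *\<^sub>R H1 h + (G2 y \<bullet> h) *\<^sub>R G1 y))"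
   using hm(1) unfolding eqk .
  have "f q * tr H2 + 2 * (G1 y \<bullet> G2 y) + V (T y) * tr H1
   = f q * k^2 * tr H + f q * k / q * (G (T y) \<bullet> y) * (4 - 2 * ?n + 4 * ?a)"
   unfolding trH2 G12 trH1 using q by (simp add: field_simps)
  also have "4 - 2 * ?n + 4 * ?a = 0" by (simp add: kexp_def field_simps)
  also have "f q * k^2 = k powr (?a + 2)" using k by (simp add: f_def k_def[symmetric] powr_add)
  finally show "tr (\<lambda>h. (f ((y - 0) \<bullet> (y - 0)) *\<^sub>R H2 h + (G1 y \<bullet> h) *\<^sub>R G2 y) + (V (T y) *\<^sub>R H1 h + (G2 y \<bullet> h) *\<^sub>R G1 y))
   = (l^2 / (y \<bullet> y)) powr (?a + 2) * tr H"
   unfolding hm(2) by (simp add: k_def q_def)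
 qed
qed

lemma vsup_mono:
 assumes v: "vsup \<beta> w y c" and c: "c' <= c" shows "vsup \<beta> w y c'"
 unfolding vsup_def
proof (intro allI impI)
 fix \<zeta> :: "'a => real" and G Hf and r :: real
 assume h: "0 < r \<and> (\<forall>z\<in>ball y r. (\<zeta> has_derivative (\<bullet>) (G z)) (at z) \<and> (G has_derivative Hf z) (at z)) \<and>
   isCont (\<lambda>z. tr (Hf z)) y \<and> (\<forall>z\<in>ball y r. \<zeta> z - \<zeta> y <= w z - w y)"
 from v[unfolded vsup_def, rule_format, OF h] c
 show "c' <= - tr (Hf y) + \<beta> * norm (G y)" by linarith
qed

section \<open>Lower bounds for supersolutions in exterior domains\<close>

lemma DERIV_div_powr:
 assumes "A > 0" "s > (0::real)"
 shows "((\<lambda>t. (A / t) powr b) has_real_derivative - b / s * (A / s) powr b) (at s)"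
proof -
 have 1: "((\<lambda>t. A / t) has_real_derivative - A / s^2) (at s)"
  using assms by (auto intro!: derivative_eq_intros simp: power2_eq_square)
 have "((\<lambda>t. (A / t) powr b) has_real_derivative b * (A / s) powr (b - 1) * (- A / s^2)) (at s)"
  using DERIV_chain2[OF has_real_derivative_powr[of "A / s" b] 1] assms by simp
 moreover have "b * (A / s) powr (b - 1) * (- A / s^2) = - b / s * (A / s) powr b"
  using assms by (simp add: powr_diff power2_eq_square)
 ultimately show ?thesis by simp
qed

text \<open>For exponents above (n-2)/2 the barrier is strictly subharmonic, so it cannot touch a
  supersolution from below. A negative minimum of the difference is attained in a bounded annulus,
  because at infinity the barrier tends to zero and \<open>w\<close> is asymptotically
  nonnegative.\<close>

lemma exterior_bound_aux:
 fixes w :: "'a::euclidean_space => real"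
 assumes n3: "DIM('a) >= 3" and r0: "r0 > 0" and m: "m > 0" and b: "b > kexp TYPE('a)"
  and cont: "continuous_on (- ball 0 r0) w"
  and vs: "\<And>y. norm y > r0 ==> vsup 0 w y 0"
  and bd: "\<And>y. norm y = r0 ==> m <= w y"
  and inf: "\<And>\<nu>. \<nu> > 0 ==> \<exists>R. \<forall>y. norm y >= R --> w y >= - \<nu>"
  and y1: "norm y1 >= r0"
 shows "m * (r0^2 / (y1 \<bullet> y1)) powr b <= w y1"
proof (rule ccontr)
 let ?n = "real DIM('a)" and ?a = "kexp TYPE('a)"
 have a: "?a > 0" using n3 by (simp add: kexp_def)
 have b0: "b > 0" using a b by simp
 define f where "f s = m * (r0^2 / s) powr b" for s
 define \<zeta> where "\<zeta> y = f (y \<bullet> y)" for y :: 'a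
 assume "\<not> m * (r0^2 / (y1 \<bullet> y1)) powr b <= w y1"
 then have neg: "w y1 < \<zeta> y1" by (simp add: \<zeta>_def f_def)
 define \<delta> where "\<delta> = \<zeta> y1 - w y1"
 have \<delta>: "\<delta> > 0" using neg by (simp add: \<delta>_def)
 obtain R1 where R1: "\<And>y. norm y >= R1 ==> w y >= - (\<delta>/3)" using inf[of "\<delta>/3"] \<delta> by auto
 \<comment> \<open>The value of r0^2 / |y|^2 at which the barrier equals \<delta>/3.\<close>
 define t where "t = (\<delta> / (3 * m)) powr (1/b)"
 have t: "t > 0" using \<delta> m by (simp add: t_def)
 define R where "R = Max {R1, norm y1, r0 + 1, r0 / sqrt t}"
 have R: "R >= R1" "R >= norm y1" "R > r0" "R >= r0 / sqrt t" unfolding R_def by (auto simp: Max_ge_iff)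
 have \<zeta>R: "\<zeta> y <= \<delta>/3" if "norm y = R" for y
 proof -
  have "(r0 / sqrt t)^2 <= R^2" using R r0 t by (intro power_mono) auto
  then have "r0^2 / t <= R^2" using t by (simp add: power_divide)
  then have "r0^2 / R^2 <= t" using t r0 R by (simp add: field_simps)
  then have "(r0^2 / R^2) powr b <= t powr b" using b0 by (intro powr_mono2) auto
  also have "... = \<delta> / (3 * m)" using b0 \<delta> m by (simp add: t_def powr_powr)
  finally have "m * (r0^2 / R^2) powr b <= m * (\<delta> / (3 * m))" using m by (intro mult_left_mono) auto
  then show ?thesis using m that by (simp add: \<zeta>_def f_def dot_square_norm)
 qed
 define A where "A = cball (0::'a) R \<inter> - ball 0 r0"
 have cA: "compact A" unfolding A_def by (intro compact_Int_closed) auto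
 have yA: "y1 \<in> A" using y1 R by (auto simp: A_def)
 have ns: "y \<bullet> y > 0" if "y \<in> A" for y using that r0 by (auto simp: A_def)
 have cw: "continuous_on A w" by (rule continuous_on_subset[OF cont]) (auto simp: A_def)
 have "continuous_on A \<zeta>" unfolding \<zeta>_def f_def by (intro continuous_intros) (use ns r0 in force)+
 then have "continuous_on A (\<lambda>y. w y - \<zeta> y)" using cw by (intro continuous_intros)
 then obtain z where z: "z \<in> A" "\<And>y. y \<in> A ==> w z - \<zeta> z <= w y - \<zeta> y"
  using continuous_attains_inf[OF cA, of "\<lambda>y. w y - \<zeta> y"] yA by blast
 have zd: "w z - \<zeta> z <= - \<delta>" using z(2)[OF yA] by (simp add: \<delta>_def)
 have z1: "norm z \<noteq> r0"
 proof
  assume "norm z = r0"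
  then have "w z >= m" "\<zeta> z = m" using bd[of z] r0 by (auto simp: \<zeta>_def f_def dot_square_norm)
  then show False using zd \<delta> by simp
 qed
 have z2: "norm z \<noteq> R"
 proof
  assume eq: "norm z = R"
  have "\<zeta> z <= \<delta>/3" "w z >= - (\<delta>/3)" using \<zeta>R[OF eq] R1[of z] R eq by auto
  then show False using zd \<delta> by linarith
 qed
 have zz: "r0 < norm z" "norm z < R" using z(1) z1 z2 by (auto simp: A_def)
 have "open (ball (0::'a) R \<inter> - cball 0 r0)" by (intro open_Int) auto
 moreover have "z \<in> ball 0 R \<inter> - cball 0 r0" using zz by auto
 ultimately obtain \<nu> where \<nu>: "\<nu> > 0" "ball z \<nu> \<subseteq> ball 0 R \<inter> - cball 0 r0" by (meson open_contains_ball)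
 have vz: "vsup 0 w z 0" using vs zz by simp
 define q where "q = z \<bullet> z"
 have q: "q > 0" using zz r0 by (auto simp: q_def)
 define E where "E = (r0^2 / q) powr b"
 have E: "E > 0" using r0 q by (simp add: E_def)
 have df': "((\<lambda>s. - b / s * (r0^2 / s) powr b) has_real_derivative b * (b + 1) / s^2 * (r0^2 / s) powr b) (at s)" if "s > 0" for s
 proof -
  have "((\<lambda>s. - b / s) has_real_derivative b / s^2) (at s)"
   using that by (auto intro!: derivative_eq_intros simp: power2_eq_square)
  from DERIV_mult[OF this DERIV_div_powr[of "r0^2" s b]] r0 that
  have "((\<lambda>s. - b / s * (r0^2 / s) powr b) has_real_derivative b / s^2 * (r0^2 / s) powr b + - b / s * (r0^2 / s) powr b * (- b / s)) (at s)" by simp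
  moreover have "b / s^2 * (r0^2 / s) powr b + - b / s * (r0^2 / s) powr b * (- b / s) = b * (b + 1) / s^2 * (r0^2 / s) powr b"
   using that by (simp add: field_simps power2_eq_square)
  ultimately show ?thesis by simp
 qed
 have "0 <= - (2 * real DIM('a) * (m * (- b / ((z-0) \<bullet> (z-0)) * (r0^2 / ((z-0) \<bullet> (z-0))) powr b))
   + 4 * (m * (b * (b + 1) / ((z-0) \<bullet> (z-0))^2 * (r0^2 / ((z-0) \<bullet> (z-0))) powr b)) * ((z-0) \<bullet> (z-0)))
   + 0 * (2 * \<bar>m * (- b / ((z-0) \<bullet> (z-0)) * (r0^2 / ((z-0) \<bullet> (z-0))) powr b)\<bar> * norm (z - 0))"
 proof (rule vsup_radial[OF vz, of "{0<..}" 0 f "\<lambda>s. m * (- b / s * (r0^2 / s) powr b)" "\<lambda>s. m * (b * (b + 1) / s^2 * (r0^2 / s) powr b)" \<nu>])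
  show "(f has_real_derivative m * (- b / s * (r0\<^sup>2 / s) powr b)) (at s)" if "s \<in> {0<..}" for s
   unfolding f_def using that r0 by (intro DERIV_cmult DERIV_div_powr) auto
  show "((\<lambda>s. m * (- b / s * (r0\<^sup>2 / s) powr b)) has_real_derivative m * (b * (b + 1) / s\<^sup>2 * (r0\<^sup>2 / s) powr b)) (at s)" if "s \<in> {0<..}" for s
   using that by (intro DERIV_cmult df') auto
  show "continuous_on {0<..} (\<lambda>s. m * (b * (b + 1) / s\<^sup>2 * (r0\<^sup>2 / s) powr b))"
   using r0 by (intro continuous_intros) auto
  show "f ((x - 0) \<bullet> (x - 0)) - f ((z - 0) \<bullet> (z - 0)) <= w x - w z" if "x \<in> ball z \<nu>" for x
  proof -
   have "x \<in> A" using that \<nu> by (force simp: A_def)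
   from z(2)[OF this] show ?thesis by (simp add: \<zeta>_def)
  qed
 qed (use q \<nu> in \<open>auto simp: q_def\<close>)
 then have "0 <= - (2 * ?n * (m * (- b / q * E)) + 4 * (m * (b * (b + 1) / q^2 * E)) * q)" by (simp add: q_def E_def)
 also have "... = - (4 * m * b * E / q) * (b - ?a)"
  using q by (simp add: kexp_def field_simps power2_eq_square)
 also have "... < 0" using m b0 E q b by (intro mult_neg_pos) auto
 finally show False by simp
qed

text \<open>The exponent (n-2)/2, for which the barrier is only harmonic, is reached as a limit of
  larger exponents.\<close>

lemma exterior_bound:
 fixes w :: "'a::euclidean_space => real"
 assumes n3: "DIM('a) >= 3" and r0: "r0 > 0" and m: "m > 0"
  and cont: "continuous_on (- ball 0 r0) w"
  and vs: "\<And>y. norm y > r0 ==> vsup 0 w y 0"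
  and bd: "\<And>y. norm y = r0 ==> m <= w y"
  and inf: "\<And>\<nu>. \<nu> > 0 ==> \<exists>R. \<forall>y. norm y >= R --> w y >= - \<nu>"
  and y1: "norm y1 >= r0"
 shows "m * (r0^2 / (y1 \<bullet> y1)) powr kexp TYPE('a) <= w y1"
proof -
 let ?a = "kexp TYPE('a)"
 have q: "r0^2 / (y1 \<bullet> y1) > 0" using y1 r0 by (auto intro!: divide_pos_pos)
 have lim: "(\<lambda>k. ?a + inverse (real (Suc k))) \<longlonglongrightarrow> ?a + 0"
  by (intro tendsto_intros LIMSEQ_inverse_real_of_nat)
 then have "(\<lambda>k. m * (r0^2 / (y1 \<bullet> y1)) powr (?a + inverse (real (Suc k)))) \<longlonglongrightarrow> m * (r0^2 / (y1 \<bullet> y1)) powr (?a + 0)"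
  using q by (intro tendsto_mult[OF tendsto_const tendsto_powr[OF tendsto_const lim]]) auto
 moreover have "m * (r0^2 / (y1 \<bullet> y1)) powr (?a + inverse (real (Suc k))) <= w y1" for k
  by (rule exterior_bound_aux[OF n3 r0 m _ cont vs bd inf y1]) auto
 ultimately have "m * (r0^2 / (y1 \<bullet> y1)) powr (?a + 0) <= w y1"
  by (intro LIMSEQ_le_const2) auto
 then show ?thesis by simp
qed

section \<open>Moving spheres for the limit system\<close>

text \<open>Nonlinearities left after a blow-up. The boolean index numbers the two components; the
  Lipschitz bound refers to the unit square because rescaled solutions take values in [0,1].\<close>

locale psi =
 fixes \<psi> :: "bool => real => real => real" and p C :: real
 assumes \<psi>nn: "\<And>j a b. 0 <= a ==> 0 <= b ==> 0 <= \<psi> j a b"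
  and \<psi>mono: "\<And>j a b a' b'. 0 <= a ==> a <= a' ==> 0 <= b ==> b <= b' ==> \<psi> j a b <= \<psi> j a' b'"
  and \<psi>hom: "\<And>j t a b. 0 < t ==> 0 <= a ==> 0 <= b ==> \<psi> j (t * a) (t * b) = t powr p * \<psi> j a b"
  and \<psi>lip: "\<And>j a b a' b'. 0 <= a ==> a <= 1 ==> 0 <= b ==> b <= 1 ==> 0 <= a' ==> a' <= 1 ==> 0 <= b' ==> b' <= 1 ==>
    \<bar>\<psi> j a b - \<psi> j a' b'\<bar> <= C * (\<bar>a - a'\<bar> + \<bar>b - b'\<bar>)"
  and C0: "C >= 0"

text \<open>Spheres are centred at the origin here; other centres are reached by translating
  \<open>v\<close>. The inequality \<open>vsk\<close> for the solution minus its Kelvin transform is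
  an assumption, since it is no formal consequence of \<open>vs\<close> and \<open>vsn\<close>; it
  is verified for classical approximations and passed to the limit.\<close>

locale msphere = psi \<psi> p C for \<psi> p C +
 fixes v :: "bool => 'a::euclidean_space => real" and L s a :: real
 assumes adef: "a = kexp TYPE('a)" and n3: "DIM('a) >= 3" and pa: "p * a < a + 2"
  and cont: "\<And>j. continuous_on UNIV (v j)" and v0: "\<And>j y. 0 <= v j y" and v1: "\<And>j y. v j y <= 1"
  and dich: "\<And>j. (\<forall>y. v j y = 0) \<or> (\<forall>y. v j y > 0)"
  and s: "s > 0" and L: "L >= 0" and lip: "\<And>j a b. dist a b <= s ==> \<bar>v j a - v j b\<bar> <= L * dist a b"
  and vs: "\<And>j y. vsup 0 (v j) y (\<psi> j (v True y) (v False y))"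
  and vsn: "\<And>j y. vsup 0 (\<lambda>z. - v j z) y (- \<psi> j (v True y) (v False y))"
  and vsk: "\<And>j l y. l > 0 ==> y \<noteq> 0 ==> vsup 0 (\<lambda>z. v j z - kelvin l (v j) 0 z) y
    (\<psi> j (v True y) (v False y) - (l^2 / (y \<bullet> y)) powr (a + 2) *
     \<psi> j (v True ((l^2 / (y \<bullet> y)) *\<^sub>R y)) (v False ((l^2 / (y \<bullet> y)) *\<^sub>R y)))"
begin

abbreviation "K l j y \<equiv> kelvin l (v j) 0 y"

lemma a0: "a >= 1/2" using n3 by (simp add: adef kexp_def)

lemma kap: assumes "0 < l" "l <= norm y" shows "0 < l^2 / (y \<bullet> y)" "l^2 / (y \<bullet> y) <= 1"
proof -
 have "l^2 <= (norm y)^2" using assms by (intro power_mono) auto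
 moreover have "y \<bullet> y > 0" using assms by auto
 ultimately show "0 < l^2 / (y \<bullet> y)" "l^2 / (y \<bullet> y) <= 1" using assms by (auto simp: dot_square_norm)
qed

lemma Kle: "K l j y <= (l^2 / (y \<bullet> y)) powr a" and K0: "K l j y >= 0"
 unfolding kelvin_def adef[symmetric] using v0 v1 by (auto simp: mult_left_le)

lemma K1: assumes "0 < l" "l <= norm y" shows "K l j y <= 1"
proof -
 have "(l^2 / (y \<bullet> y)) powr a <= 1" using kap[OF assms] a0 by (intro powr_le1) auto
 then show ?thesis using Kle order_trans by blast
qed

lemma Kbd: assumes "0 < l" "norm y = l" shows "K l j y = v j y"
 using assms by (auto simp: kelvin_def adef[symmetric] dot_square_norm)

text \<open>Homogeneity rewrites \<psi> at the inverted point in terms of the Kelvin transforms and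
  leaves the factor (l^2/|y|^2)^(a + 2 - p a). Subcriticality makes this exponent positive, so
  outside the sphere the factor is at most 1.\<close>

lemma vsK:
 assumes "0 < l" "l <= norm y"
 shows "vsup 0 (\<lambda>z. v j z - K l j z) y (\<psi> j (v True y) (v False y) -
  (l^2 / (y \<bullet> y)) powr (a + 2 - p * a) * \<psi> j (K l True y) (K l False y))"
proof -
 define k where "k = l^2 / (y \<bullet> y)"
 have k: "0 < k" "k <= 1" using kap[OF assms] by (auto simp: k_def)
 have "\<psi> j (K l True y) (K l False y) = (k powr a) powr p * \<psi> j (v True (k *\<^sub>R y)) (v False (k *\<^sub>R y))"
  unfolding kelvin_def adef[symmetric] k_def[symmetric] using k v0 by (simp add: \<psi>hom)
 then have "k powr (a + 2 - p * a) * \<psi> j (K l True y) (K l False y) = k powr (a + 2) * \<psi> j (v True (k *\<^sub>R y)) (v False (k *\<^sub>R y))"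
  using k by (simp add: powr_powr mult.commute[of a p] flip: powr_add mult.assoc)
 moreover have "y \<noteq> 0" using assms by auto
 ultimately show ?thesis using vsk[OF assms(1), of y j] by (simp add: k_def)
qed

lemma kap_powr: assumes "0 < l" "l <= norm y"
 shows "(l^2 / (y \<bullet> y)) powr (a + 2 - p * a) <= 1"
 using kap[OF assms] pa by (intro powr_le1) auto

lemma vsK':
 assumes "0 < l" "l <= norm y"
 shows "vsup 0 (\<lambda>z. v j z - K l j z) y (\<psi> j (v True y) (v False y) - \<psi> j (K l True y) (K l False y))"
proof -
 have "(l^2 / (y \<bullet> y)) powr (a + 2 - p * a) * \<psi> j (K l True y) (K l False y) <= 1 * \<psi> j (K l True y) (K l False y)"
  using kap_powr[OF assms] \<psi>nn[OF K0 K0] by (intro mult_right_mono)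
 then show ?thesis by (intro vsup_mono[OF vsK[OF assms]]) simp
qed

lemma contK: assumes "l > 0" shows "continuous_on (- {0}) (K l j)"
 unfolding kelvin_def adef[symmetric] using assms
 by (intro continuous_intros continuous_on_compose2[OF cont]) auto

lemma contKl: assumes "y \<noteq> 0" shows "continuous_on {0<..} (\<lambda>l. K l j y)"
 unfolding kelvin_def adef[symmetric] using assms
 by (intro continuous_intros continuous_on_compose2[OF cont]) auto

text \<open>Near the centre Lipschitz continuity suffices, because k^a <= sqrt k for k = l^2/|y|^2
  <= 1, where a >= 1/2 reflects n >= 3. Farther out the exterior bound keeps \<open>v\<close> above
  a multiple of |y|^(2-n), and since v <= 1 the Kelvin transform falls below that for small
  \<open>l\<close>.\<close>

lemma start:
 obtains \<mu> where "\<mu> > 0" "\<And>l j y. 0 < l ==> l < \<mu> ==> l <= norm y ==> K l j y <= v j y"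
proof -
 have one: "\<exists>\<mu>>0. \<forall>l y. 0 < l --> l < \<mu> --> l <= norm y --> K l j y <= v j y" for j
 proof (cases "\<forall>y. v j y = 0")
  case True
  then show ?thesis by (intro exI[of _ 1]) (auto simp: kelvin_def adef[symmetric])
 next
  case False
  then have pos: "\<And>y. v j y > 0" using dich by blast
  define m where "m = v j 0 / 2"
  have m: "m > 0" using pos by (simp add: m_def)
  \<comment> \<open>On the ball of radius \<open>r0\<close> the component stays above half its
    central value, and the Lipschitz error 2 L r0 stays below that half.\<close>
  define r0 where "r0 = min (s / 2) (m / (2 * L + 1))"
  have r0a: "r0 > 0" using s m L by (simp add: r0_def)
  have r0b: "r0 <= s / 2" unfolding r0_def by (rule min.cobounded1)
  have r0c: "r0 <= m / (2 * L + 1)" unfolding r0_def by (rule min.cobounded2)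
  note r0 = r0a r0b r0c
  have r0': "2 * L * r0 <= m"
  proof -
   have "r0 * (2 * L + 1) <= m" using r0(3) L by (simp add: field_simps)
   then show ?thesis using r0(1) by (simp add: algebra_simps)
  qed
  have vm: "v j y >= m" if "norm y <= r0" for y
  proof -
   have "\<bar>v j y - v j 0\<bar> <= L * dist y 0" using that r0 s by (intro lip) auto
   also have "... <= L * r0" using that L by (intro mult_left_mono) auto
   also have "... <= m" using r0' m by simp
   finally show ?thesis unfolding m_def by linarith
  qed
  have near: "K l j y <= v j y" if l: "0 < l" "l <= norm y" "norm y <= r0" for l y
  proof -
   define k where "k = l^2 / (y \<bullet> y)"
   have k: "0 < k" "k <= 1" using kap[OF l(1,2)] by (auto simp: k_def)
   define t where "t = sqrt k"
   have t: "0 < t" "t <= 1" "t^2 = k" using k by (auto simp: t_def)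
   have "k powr a <= k powr (1/2)" using k a0 by (intro powr_mono') auto
   then have ka: "k powr a <= t" using k by (simp add: t_def powr_half_sqrt)
   have dk: "dist (k *\<^sub>R y) y = (1 - k) * norm y"
   proof -
    have "k *\<^sub>R y - y = - ((1 - k) *\<^sub>R y)" by (simp add: algebra_simps)
    then show ?thesis using k by (simp add: dist_norm)
   qed
   have "(1 - k) * norm y <= 1 * norm y" using k by (intro mult_right_mono) auto
   then have "dist (k *\<^sub>R y) y <= s" using dk l r0 s by simp
   then have "v j (k *\<^sub>R y) <= v j y + L * ((1 - k) * norm y)" using lip[of "k *\<^sub>R y" y j] dk by simp
   also have "L * ((1 - k) * norm y) <= L * ((1 - k) * r0)" using l k L by (intro mult_left_mono) auto
   finally have 1: "v j (k *\<^sub>R y) <= v j y + (1 - k) * (L * r0)" by (simp add: mult_ac)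
   have "K l j y = k powr a * v j (k *\<^sub>R y)" by (simp add: kelvin_def adef[symmetric] k_def)
   also have "... <= t * (v j y + (1 - k) * (L * r0))" using ka 1 v0 k t by (intro mult_mono) auto
   \<comment> \<open>With k = t^2 the error factor 1 - k = (1 - t)(1 + t) contains 1 - t as well, so
     gain and error vanish to the same order at the sphere and only their coefficients have to be
     compared.\<close>
   also have "... = v j y - (1 - t) * (v j y - t * (1 + t) * (L * r0))"
    unfolding t(3)[symmetric] by (simp add: algebra_simps power2_eq_square)
   also have "... <= v j y"
   proof -
    have "t * (1 + t) <= 1 * 2" using t by (intro mult_mono) auto
    then have "t * (1 + t) * (L * r0) <= 2 * (L * r0)" using L r0 by (intro mult_right_mono) auto
    also have "... <= v j y" using r0' vm[of y] l by simp
    finally show ?thesis using t by simp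
   qed
   finally show ?thesis .
  qed
  have ext: "m * (r0^2 / (y \<bullet> y)) powr a <= v j y" if "norm y >= r0" for y
  unfolding adef
  proof (rule exterior_bound[OF n3 r0(1) m _ _ _ _ that])
   show "continuous_on (- ball 0 r0) (v j)" using cont continuous_on_subset by blast
   show "vsup 0 (v j) y 0" for y by (rule vsup_mono[OF vs]) (use \<psi>nn v0 in auto)
   show "\<exists>R. \<forall>y. R <= norm y --> - \<nu> <= v j y" if "\<nu> > 0" for \<nu> using v0 that by (smt (verit))
  qed (use vm in auto)
  \<comment> \<open>The second bound says l^2 <= r0^2 m^(1/a), which places (l^2/|y|^2)^a below the
    exterior bound m (r0^2/|y|^2)^a.\<close>
  define \<mu> where "\<mu> = min r0 (r0 * m powr (1 / (2 * a)))"
  have \<mu>: "\<mu> > 0" "\<mu> <= r0" using r0 m by (auto simp: \<mu>_def)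
  have far: "K l j y <= v j y" if l: "0 < l" "l < \<mu>" "r0 < norm y" for l y
  proof -
   have yy: "y \<bullet> y > 0" using l r0 by auto
   have "l^2 <= (r0 * m powr (1 / (2 * a)))^2" using l by (intro power_mono) (auto simp: \<mu>_def)
   also have "... = r0^2 * m powr (1 / a)"
    using m by (simp add: power_mult_distrib power2_eq_square flip: powr_add)
   finally have "(l^2 / (y \<bullet> y)) powr a <= (m powr (1/a) * (r0^2 / (y \<bullet> y))) powr a"
    using yy a0 by (intro powr_mono2) (auto simp: field_simps divide_right_mono)
   also have "... = (m powr (1/a)) powr a * (r0^2 / (y \<bullet> y)) powr a" by (rule powr_mult)
   also have "(m powr (1/a)) powr a = m" using m a0 by (simp add: powr_powr)
   also have "m * (r0^2 / (y \<bullet> y)) powr a <= v j y" using ext l by simp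
   finally show ?thesis using Kle order_trans by blast
  qed
  show ?thesis using \<mu> near far by (intro exI[of _ \<mu>]) (smt (verit))
 qed
 obtain \<mu>1 where 1: "\<mu>1 > 0" "\<And>l y. 0 < l ==> l < \<mu>1 ==> l <= norm y ==> K l True y <= v True y" using one[of True] by blast
 obtain \<mu>2 where 2: "\<mu>2 > 0" "\<And>l y. 0 < l ==> l < \<mu>2 ==> l <= norm y ==> K l False y <= v False y" using one[of False] by blast
 show thesis
 proof (rule that[of "min \<mu>1 \<mu>2"])
  show "K l j y <= v j y" if "0 < l" "l < min \<mu>1 \<mu>2" "l <= norm y" for l j y
   using that 1 2 by (cases j) auto
 qed (use 1 2 in auto)
qed

end

context msphere begin

text \<open>A decaying component with vanishing right-hand side attains its maximum; the strong
  minimum principle for maximum minus component makes it constant, and decay then makes it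
  zero.\<close>

lemma decay_const_zero:
 assumes \<psi>0: "\<And>y. \<psi> j (v True y) (v False y) = 0" and dec: "\<And>\<nu>. \<nu> > 0 ==> \<exists>R. \<forall>y. norm y >= R --> v j y <= \<nu>"
 shows "v j y = 0"
proof (rule ccontr)
 assume "v j y \<noteq> 0"
 then have pos: "\<And>z. v j z > 0" using dich[of j] by blast
 obtain R where R: "\<And>z. norm z >= R ==> v j z <= v j 0 / 2" using dec[of "v j 0 / 2"] pos by (auto simp: half_gt_zero_iff)
 have "continuous_on (cball 0 \<bar>R\<bar>) (v j)" using cont continuous_on_subset by blast
 then obtain z0 where z0: "z0 \<in> cball 0 \<bar>R\<bar>" "\<And>z. z \<in> cball 0 \<bar>R\<bar> ==> v j z <= v j z0"
  using continuous_attains_sup[of "cball 0 \<bar>R\<bar>" "v j"] by force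
 have mx: "v j z <= v j z0" for z
 proof (cases "z \<in> cball 0 \<bar>R\<bar>")
  case False
  then have "v j z <= v j 0 / 2" using R[of z] by auto
  also have "... <= v j 0" using pos[of 0] by simp
  also have "... <= v j z0" using z0(2)[of 0] by simp
  finally show ?thesis .
 qed (use z0 in auto)
 have vs': "vsup 0 (\<lambda>z. v j z0 - v j z) x 0" for x
  unfolding vsup_def
 proof (intro allI impI)
  fix \<zeta> :: "'a => real" and G Hf and r :: real
  assume h: "0 < r \<and> (\<forall>z\<in>ball x r. (\<zeta> has_derivative (\<bullet>) (G z)) (at z) \<and> (G has_derivative Hf z) (at z)) \<and>
   isCont (\<lambda>z. tr (Hf z)) x \<and> (\<forall>z\<in>ball x r. \<zeta> z - \<zeta> x <= v j z0 - v j z - (v j z0 - v j x))"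
  then have "0 < r \<and> (\<forall>z\<in>ball x r. (\<zeta> has_derivative (\<bullet>) (G z)) (at z) \<and> (G has_derivative Hf z) (at z)) \<and>
   isCont (\<lambda>z. tr (Hf z)) x \<and> (\<forall>z\<in>ball x r. \<zeta> z - \<zeta> x <= - v j z - - v j x)" by auto
  from vsn[of j x, unfolded vsup_def, rule_format, OF this] \<psi>0[of x]
  show "0 <= - tr (Hf x) + 0 * norm (G x)" by simp
 qed
 have c: "v j z0 - v j z = 0" for z
  by (rule vsup_strong_min[of 0 UNIV "\<lambda>z. v j z0 - v j z" z0 z])
   (use vs' mx cont in \<open>auto intro!: continuous_intros\<close>)
 have "norm (\<bar>R\<bar> *\<^sub>R (SOME b. b \<in> Basis) :: 'a) >= R" using someI_ex[of "\<lambda>b::'a. b \<in> Basis"] by auto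
 then have "v j (\<bar>R\<bar> *\<^sub>R (SOME b. b \<in> Basis)) <= v j 0 / 2" by (rule R)
 then show False using c[of 0] c[of "\<bar>R\<bar> *\<^sub>R (SOME b. b \<in> Basis)"] pos[of 0] by simp
qed

text \<open>A zero of the difference would spread over the whole exterior. The subcritical factor,
  now smaller than 1, then forces \<psi> to vanish along the solution: outside the sphere directly,
  inside by inversion and homogeneity, on the sphere and at the centre by continuity. The component
  would be harmonic and, equal to its Kelvin transform, decay at infinity, hence be zero.\<close>

lemma strict:
 assumes l: "l > 0" and ge: "\<And>j y. l <= norm y ==> K l j y <= v j y"
  and pos: "\<And>y. v j y > 0" and y: "norm y > l"
 shows "K l j y < v j y"
proof (rule ccontr)
 assume "\<not> K l j y < v j y"
 then have eq: "v j y - K l j y = 0" using ge[of y j] y by simp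
 define \<Omega> where "\<Omega> = - cball (0::'a) l"
 have oc: "open \<Omega>" "connected \<Omega>" unfolding \<Omega>_def
  using n3 by (auto intro!: connected_complement_bounded_convex)
 have Kc: "continuous_on \<Omega> (K l j)" by (rule continuous_on_subset[OF contK[OF l]]) (use l in \<open>auto simp: \<Omega>_def\<close>)
 have cW: "continuous_on \<Omega> (\<lambda>z. v j z - K l j z)" using continuous_on_subset[OF cont] by (intro continuous_intros Kc) auto
 have pm: "\<psi> j (K l True z) (K l False z) <= \<psi> j (v True z) (v False z)" if "norm z >= l" for z
  using ge that K0 by (intro \<psi>mono) auto
 have z0: "v j z - K l j z = 0" if "z \<in> \<Omega>" for z
 proof (rule vsup_strong_min[of 0 \<Omega> "\<lambda>z. v j z - K l j z" y z])
  show "0 <= v j x - K l j x" if "x \<in> \<Omega>" for x using that ge[of x j] by (auto simp: \<Omega>_def)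
  show "vsup 0 (\<lambda>z. v j z - K l j z) x 0" if "x \<in> \<Omega>" for x
  proof -
   have "norm x >= l" using that by (auto simp: \<Omega>_def)
   then show ?thesis using pm by (intro vsup_mono[OF vsK'[OF l]]) auto
  qed
 qed (use oc cW eq y that in \<open>auto simp: \<Omega>_def\<close>)
 \<comment> \<open>Near \<open>z\<close> the difference is constant, so a constant test function
   gives \<psi>(v) <= k \<psi>(K), while monotonicity gives \<psi>(K) <= \<psi>(v); as k < 1, both
   vanish.\<close>
 have P0: "\<psi> j (v True z) (v False z) = 0 \<and> \<psi> j (K l True z) (K l False z) = 0" if z: "norm z > l" for z
 proof -
  define k where "k = (l^2 / (z \<bullet> z)) powr (a + 2 - p * a)"
  have "l^2 < (norm z)^2" using z l by (intro power_strict_mono) auto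
  moreover have "z \<bullet> z > 0" using z l by auto
  ultimately have q: "0 < l^2 / (z \<bullet> z)" "l^2 / (z \<bullet> z) < 1" using l by (auto simp: dot_square_norm)
  have k: "k < 1" "k > 0" unfolding k_def using powr_less_mono2[of "a + 2 - p * a" "l^2 / (z \<bullet> z)" 1] q pa by auto
  obtain r where r: "r > 0" "ball z r \<subseteq> \<Omega>" using oc(1) z by (metis Compl_iff \<Omega>_def mem_cball_0 not_le open_contains_ball)
  have "v j z - K l j z <= v j x - K l j x" if "x \<in> ball z r" for x
   using z0[of x] z0[of z] that r z by (auto simp: \<Omega>_def subset_iff)
  then have "\<psi> j (v True z) (v False z) - k * \<psi> j (K l True z) (K l False z) <= 0"
   using vsup_const_min[OF vsK[OF l] r(1)] z unfolding k_def by simp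
  moreover have "k * \<psi> j (K l True z) (K l False z) <= k * \<psi> j (v True z) (v False z)"
   using pm[of z] z k by (intro mult_left_mono) auto
  ultimately have "(1 - k) * \<psi> j (v True z) (v False z) <= 0" by (simp add: algebra_simps)
  then have "\<psi> j (v True z) (v False z) <= 0" using k by (simp add: mult_le_0_iff)
  moreover have "\<psi> j (K l True z) (K l False z) >= 0" using \<psi>nn K0 by auto
  ultimately show ?thesis using pm[of z] z \<psi>nn[OF v0[of True z] v0[of False z], of j] by force
 qed
 have c\<psi>: "continuous_on UNIV (\<lambda>z. \<psi> j (v True z) (v False z))"
 proof -
  have lim: "((\<lambda>z. C * (\<bar>v True z - v True x\<bar> + \<bar>v False z - v False x\<bar>)) \<longlongrightarrow> 0) (at x)" for x
  proof -
   have vl: "(v i \<longlongrightarrow> v i x) (at x)" for i using cont[of i] by (simp add: continuous_on_def)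
   have "((\<lambda>z. C * (\<bar>v True z - v True x\<bar> + \<bar>v False z - v False x\<bar>)) \<longlongrightarrow> C * (\<bar>v True x - v True x\<bar> + \<bar>v False x - v False x\<bar>)) (at x)"
    by (intro tendsto_intros vl)
   then show ?thesis by simp
  qed
  have "((\<lambda>z. \<psi> j (v True z) (v False z)) \<longlongrightarrow> \<psi> j (v True x) (v False x)) (at x)" for x
  proof -
   have "\<forall>z. norm (\<psi> j (v True z) (v False z) - \<psi> j (v True x) (v False x)) <= C * (\<bar>v True z - v True x\<bar> + \<bar>v False z - v False x\<bar>)"
    using \<psi>lip v0 v1 by simp
   then show ?thesis by (intro LIM_zero_cancel[OF Lim_null_comparison[OF always_eventually lim[of x]]])
  qed
  then show ?thesis by (simp add: continuous_on_def)
 qed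
 have g0: "\<psi> j (v True z) (v False z) = 0" if "z \<noteq> 0" "norm z \<noteq> l" for z
 proof (cases "norm z > l")
  case True then show ?thesis using P0 by blast
 next
  case False
  then have zl: "norm z < l" using that by simp
  define x where "x = (l^2 / (z \<bullet> z)) *\<^sub>R z"
  have zz: "z \<bullet> z > 0" using that by simp
  have nx: "norm x = l^2 / norm z" using zz by (simp add: x_def dot_square_norm power2_eq_square)
  have "l * norm z < l * l" using zl l by simp
  then have "l * norm z < norm x * norm z" using nx that by (simp add: power2_eq_square)
  then have "norm x > l" by (rule mult_right_less_imp_less) simp
  then have 1: "\<psi> j (K l True x) (K l False x) = 0" using P0 by blast
  have xx: "x \<bullet> x = l^4 / (z \<bullet> z)" using zz by (simp add: x_def power2_eq_square power4_eq_xxxx)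
  have k: "l^2 / (x \<bullet> x) = (z \<bullet> z) / l^2" using l zz by (simp add: xx power2_eq_square power4_eq_xxxx)
  have kx: "(l^2 / (x \<bullet> x)) *\<^sub>R x = z" unfolding k using l zz by (simp add: x_def)
  have "(l^2 / (x \<bullet> x)) powr a > 0" using k zz l by simp
  then have "\<psi> j (K l True x) (K l False x) = ((l^2 / (x \<bullet> x)) powr a) powr p * \<psi> j (v True z) (v False z)"
   unfolding kelvin_def adef[symmetric] kx using v0 by (simp add: \<psi>hom)
  then show ?thesis using 1 k zz l by (auto simp: powr_eq_0_iff)
 qed
 have all0: "\<psi> j (v True z) (v False z) = 0" for z
 proof (cases "norm z = l \<or> z = 0")
  case False then show ?thesis using g0 by blast
 next
  case True
  \<comment> \<open>A direction for which z + t b avoids the origin and the sphere for all small t >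
    0.\<close>
  define b where "b = (if z = 0 then SOME b. b \<in> Basis else z)"
  have b: "b \<noteq> 0" unfolding b_def using nonzero_Basis[OF SOME_Basis[where 'a = 'a]] by auto
  have "l / (2 * norm b) > 0" using b l by simp
  then have "\<forall>\<^sub>F t in at_right (0::real). 0 < t \<and> t < l / (2 * norm b)"
   by (auto simp: eventually_at_right[of 0 "l / (2 * norm b)"])
  then have ev: "\<forall>\<^sub>F t in at_right (0::real). \<psi> j (v True (z + t *\<^sub>R b)) (v False (z + t *\<^sub>R b)) = 0"
  proof eventually_elim
   case (elim t)
   show ?case
   proof (rule g0)
    show "z + t *\<^sub>R b \<noteq> 0"
    proof (cases "z = 0")
     case False
     then have "z + t *\<^sub>R b = (1 + t) *\<^sub>R z" by (simp add: b_def algebra_simps)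
     then show ?thesis using False elim by simp
    qed (use b elim in auto)
    show "norm (z + t *\<^sub>R b) \<noteq> l"
    proof (cases "z = 0")
     case False
     then have "norm z = l" using True by blast
     moreover have "z + t *\<^sub>R b = (1 + t) *\<^sub>R z" using False by (simp add: b_def algebra_simps)
     ultimately show ?thesis using elim l by simp
    next
     case True
     then have "norm (z + t *\<^sub>R b) = t * norm b" using elim by simp
     also have "... < l / (2 * norm b) * norm b" using elim b by (intro mult_strict_right_mono) auto
     also have "... < l" using b l by simp
     finally show ?thesis by simp
    qed
   qed
  qed
  have "isCont (\<lambda>z. \<psi> j (v True z) (v False z)) z" using c\<psi> by (simp add: continuous_on_eq_continuous_at)
  moreover have "((\<lambda>t. z + t *\<^sub>R b) \<longlongrightarrow> z) (at_right (0::real))"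
   by (auto intro!: tendsto_eq_intros)
  ultimately have "((\<lambda>t. \<psi> j (v True (z + t *\<^sub>R b)) (v False (z + t *\<^sub>R b))) \<longlongrightarrow> \<psi> j (v True z) (v False z)) (at_right (0::real))"
   by (rule isCont_tendsto_compose)
  moreover have "((\<lambda>t. \<psi> j (v True (z + t *\<^sub>R b)) (v False (z + t *\<^sub>R b))) \<longlongrightarrow> 0) (at_right (0::real))"
   using ev by (rule tendsto_eventually)
  ultimately show ?thesis using tendsto_unique[OF trivial_limit_at_right_real] by blast
 qed
 have "v j 0 = 0"
 proof (rule decay_const_zero[OF all0])
  fix \<nu> :: real assume \<nu>: "\<nu> > 0"
  define R where "R = max (l + 1) (l / \<nu> powr (1 / (2 * a)))"
  have "v j x <= \<nu>" if x: "norm x >= R" for x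
  proof -
   have xl: "norm x > l" "norm x >= l / \<nu> powr (1 / (2 * a))" using x by (auto simp: R_def)
   then have "v j x = K l j x" using z0[of x] by (auto simp: \<Omega>_def)
   also have "... <= (l^2 / (x \<bullet> x)) powr a" by (rule Kle)
   also have "... <= (\<nu> powr (1 / a)) powr a"
   proof (rule powr_mono2)
    have "l <= norm x * \<nu> powr (1 / (2 * a))" using xl(2) \<nu> by (simp add: field_simps)
    then have "l^2 <= (norm x * \<nu> powr (1 / (2 * a)))^2" using l by (intro power_mono) auto
    also have "... = (x \<bullet> x) * \<nu> powr (1 / a)"
     using \<nu> by (simp add: power_mult_distrib dot_square_norm power2_eq_square flip: powr_add)
    finally have le: "l^2 <= (x \<bullet> x) * \<nu> powr (1 / a)" .
    have "x \<noteq> 0" using xl l by auto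
    then have "x \<bullet> x > 0" by simp
    then show "l^2 / (x \<bullet> x) <= \<nu> powr (1 / a)" using le by (simp add: pos_divide_le_eq mult.commute)
   qed (use a0 in auto)
   also have "... = \<nu>" using \<nu> a0 by (simp add: powr_powr)
   finally show ?thesis .
  qed
  then show "\<exists>R. \<forall>y. norm y >= R --> v j y <= \<nu>" by blast
 qed
 then show False using pos[of 0] by simp
qed

text \<open>Beyond a radius \<rho> slightly larger than \<open>l\<close>, strictness and the
  exterior bound leave a margin proportional to |y|^(2-n), which absorbs a small change of the
  radius. The thin shell below \<rho> is handled by a maximum principle for narrow domains, in which
  both components are minimised together because the system is coupled.\<close>

lemma continue:
 assumes l: "l > 0" and ge: "\<And>j y. l <= norm y ==> K l j y <= v j y"
 obtains \<delta> where "\<delta> > 0" "\<And>l' j y. l <= l' ==> l' < l + \<delta> ==> l' <= norm y ==> K l' j y <= v j y"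
proof -
 \<comment> \<open>\<open>Kc\<close> and \<open>\<eta>\<close> tune the weight \<open>f\<close> used
   on the shell: 8 Kc l^2 > 4 C makes its Laplacian beat the Lipschitz constant of \<psi>, and
   \<eta> keeps it between 1 and 2, since |y|^2 varies on the shell by at most \<eta> (2 l +
   \<eta>).\<close>
 define Kc where "Kc = C / l^2 + 1"
 have Kc: "Kc > 0" "8 * Kc * l^2 > 4 * C" using C0 l by (auto simp: Kc_def field_simps add_nonneg_pos)
 define \<eta> where "\<eta> = min 1 (1 / ((2 * l + 1) * (Kc + 1)))"
 have \<eta>: "\<eta> > 0" "\<eta> <= 1" unfolding \<eta>_def using l Kc by auto
 have \<eta>2: "Kc * (\<eta> * (2 * l + \<eta>))^2 <= 1"
 proof -
  have "\<eta> * (2 * l + \<eta>) <= \<eta> * (2 * l + 1)" using \<eta> by (intro mult_left_mono) auto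
  also have "... <= 1 / ((2 * l + 1) * (Kc + 1)) * (2 * l + 1)" using l by (intro mult_right_mono) (auto simp: \<eta>_def)
  also have "... = 1 / (Kc + 1)" using l by simp
  finally have "(\<eta> * (2 * l + \<eta>))^2 <= (1 / (Kc + 1))^2" using \<eta> l by (intro power_mono) auto
  then have "Kc * (\<eta> * (2 * l + \<eta>))^2 <= Kc * (1 / (Kc + 1))^2" using Kc by (intro mult_left_mono) auto
  also have "... <= 1"
  proof -
   have "Kc <= (Kc + 1)^2" using Kc by (simp add: power2_eq_square algebra_simps)
   then show ?thesis using Kc by (simp add: power_divide divide_le_eq)
  qed
  finally show ?thesis .
 qed
 define \<rho> where "\<rho> = l + \<eta>"
 have \<rho>: "\<rho> > l" "\<rho> > 0" using \<eta> l by (auto simp: \<rho>_def)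
 have outer: "\<exists>\<delta>>0. \<forall>l'. l <= l' --> l' < l + \<delta> --> (\<forall>y. norm y >= \<rho> --> K l' j y <= v j y)" for j
 proof (cases "\<forall>y. v j y = 0")
  case True then show ?thesis by (intro exI[of _ 1]) (auto simp: kelvin_def)
 next
  case False
  then have pos: "\<And>y. v j y > 0" using dich by blast
  have st: "K l j y < v j y" if "norm y > l" for y by (rule strict[OF l ge pos that])
  define W where "W y = v j y - K l j y" for y
  have sub: "- ball (0::'a) \<rho> \<subseteq> - {0}" using \<rho> by auto
  have cW: "continuous_on (- ball 0 \<rho>) W" unfolding W_def
   using continuous_on_subset[OF cont] continuous_on_subset[OF contK[OF l] sub] by (intro continuous_intros) auto
  have "sphere (0::'a) \<rho> \<subseteq> - ball 0 \<rho>" by auto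
  then have "continuous_on (sphere 0 \<rho>) W" using cW continuous_on_subset by blast
  moreover have "sphere (0::'a) \<rho> \<noteq> {}" using \<rho> by simp
  ultimately obtain z where z: "z \<in> sphere 0 \<rho>" "\<And>y. y \<in> sphere 0 \<rho> ==> W z <= W y"
   using continuous_attains_inf[of "sphere 0 \<rho>" W] by (metis compact_sphere)
  define m where "m = W z"
  have m: "m > 0" using st[of z] z(1) \<rho> by (simp add: m_def W_def)
  have low: "m * (\<rho>^2 / (y \<bullet> y)) powr a <= W y" if "norm y >= \<rho>" for y
   unfolding adef
  proof (rule exterior_bound[OF n3 \<rho>(2) m cW _ _ _ that])
   show "vsup 0 W y 0" if "norm y > \<rho>" for y
    unfolding W_def using that \<rho> ge K0
    by (intro vsup_mono[OF vsK'[OF l]]) (auto intro!: \<psi>mono)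
   show "m <= W y" if "norm y = \<rho>" for y using z(2)[of y] that by (simp add: m_def)
   show "\<exists>R. \<forall>y. R <= norm y --> - \<nu> <= W y" if "\<nu> > 0" for \<nu>
   proof (intro exI allI impI)
    fix x :: 'a assume "l <= norm x"
    then show "- \<nu> <= W x" using ge[of x j] that by (simp add: W_def)
   qed
  qed
  \<comment> \<open>In the variable x = y/|y|^2 the exterior becomes a ball with infinity at its
    centre. Up to the factor |y|^(-2a) the Kelvin transform is \<open>Q\<close> at (l^2, x),
    continuous on a compact set and hence uniformly continuous.\<close>
  define Q where "Q P = fst P powr a * v j (fst P *\<^sub>R snd P)" for P :: "real \<times> 'a"
  define D where "D = {l^2..(l+1)^2} \<times> cball (0::'a) (1/\<rho>)"
  have "compact D" unfolding D_def by (intro compact_Times) auto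
  moreover have "continuous_on D Q" unfolding Q_def using l
   by (intro continuous_intros continuous_on_compose2[OF cont]) (auto simp: D_def)
  ultimately have "uniformly_continuous_on D Q" by (rule compact_uniformly_continuous[rotated])
  moreover have "m * (\<rho>^2) powr a > 0" using m \<rho> by simp
  ultimately obtain d where d: "d > 0" "\<And>P P'. P \<in> D ==> P' \<in> D ==> dist P' P < d ==> dist (Q P') (Q P) < m * (\<rho>^2) powr a"
   unfolding uniformly_continuous_on_def by meson
  define \<delta> where "\<delta> = min 1 (d / (2 * l + 2))"
  have \<delta>: "\<delta> > 0" "\<delta> <= 1" unfolding \<delta>_def using d l by auto
  have "K l' j y <= v j y" if l': "l <= l'" "l' < l + \<delta>" and y: "norm y >= \<rho>" for l' y
  proof -
   define q where "q = y \<bullet> y"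
   have q: "q > 0" using y \<rho> by (auto simp: q_def)
   define x where "x = y /\<^sub>R q"
   have nx: "norm x <= 1/\<rho>"
   proof -
    have "norm y > 0" using y \<rho> by linarith
    then have "norm x = 1 / norm y" by (simp add: x_def q_def dot_square_norm power2_eq_square divide_inverse)
    then show ?thesis using y \<rho> by (simp add: frac_le)
   qed
   have Kq: "K l'' j y = q powr (- a) * Q (l''^2, x)" if "l'' > 0" for l''
   proof -
    have "(l''^2 / q) powr a = q powr (-a) * (l''^2) powr a" using q that by (simp add: powr_divide powr_minus_divide)
    moreover have "(l''^2 / q) *\<^sub>R y = l''^2 *\<^sub>R x" by (simp add: x_def divide_inverse)
    ultimately show ?thesis by (simp add: kelvin_def adef[symmetric] q_def[symmetric] Q_def)
   qed
   have ll: "l^2 <= l'^2" "l'^2 <= (l+1)^2" "l^2 <= (l+1)^2" using l' l \<delta> by (auto intro!: power_mono)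
   have "l'^2 - l^2 = (l' - l) * (l' + l)" by (simp add: power2_eq_square algebra_simps)
   also have "... < \<delta> * (2 * l + 2)"
   proof -
    have "(l' - l) * (l' + l) <= (l' - l) * (2 * l + 2)" using l' \<delta> l by (intro mult_left_mono) auto
    also have "... < \<delta> * (2 * l + 2)" using l' l by (intro mult_strict_right_mono) auto
    finally show ?thesis .
   qed
   also have "... <= d / (2 * l + 2) * (2 * l + 2)" using l by (intro mult_right_mono) (auto simp: \<delta>_def)
   also have "... = d" using l by simp
   finally have "dist (l'^2, x) (l^2, x) < d" using ll by (simp add: dist_Pair_Pair dist_real_def)
   then have "dist (Q (l'^2, x)) (Q (l^2, x)) < m * (\<rho>^2) powr a"
    using ll nx by (intro d(2)) (auto simp: D_def)
   then have "Q (l'^2, x) <= Q (l^2, x) + m * (\<rho>^2) powr a" by (simp add: dist_real_def)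
   then have "q powr (-a) * Q (l'^2, x) <= q powr (-a) * (Q (l^2, x) + m * (\<rho>^2) powr a)" by (intro mult_left_mono) auto
   then have "K l' j y <= K l j y + m * (q powr (-a) * (\<rho>^2) powr a)" using Kq[of l'] Kq[of l] l l' by (simp add: algebra_simps)
   also have "q powr (-a) * (\<rho>^2) powr a = (\<rho>^2 / q) powr a" using q \<rho> by (simp add: powr_divide powr_minus_divide)
   also have "K l j y + m * (\<rho>^2 / q) powr a <= v j y" using low[OF y] by (simp add: W_def q_def)
   finally show ?thesis .
  qed
  then show ?thesis using \<delta> by blast
 qed
 obtain \<delta>1 where \<delta>1: "\<delta>1 > 0" "\<And>l' y. l <= l' ==> l' < l + \<delta>1 ==> norm y >= \<rho> ==> K l' True y <= v True y"
  using outer[of True] by blast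
 obtain \<delta>2 where \<delta>2: "\<delta>2 > 0" "\<And>l' y. l <= l' ==> l' < l + \<delta>2 ==> norm y >= \<rho> ==> K l' False y <= v False y"
  using outer[of False] by blast
 define \<delta> where "\<delta> = Min {\<delta>1, \<delta>2, \<eta>}"
 have \<delta>: "\<delta> > 0" "\<delta> <= \<delta>1" "\<delta> <= \<delta>2" "\<delta> <= \<eta>" using \<delta>1 \<delta>2 \<eta> by (auto simp: \<delta>_def)
 have out: "K l' j y <= v j y" if "l <= l'" "l' < l + \<delta>" "norm y >= \<rho>" for l' j y
  using \<delta>1(2)[of l' y] \<delta>2(2)[of l' y] that \<delta> by (cases j) auto
 have "K l' j0 y0 <= v j0 y0" if l': "l <= l'" "l' < l + \<delta>" and y0: "l' <= norm y0" for l' j0 y0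
 proof (rule ccontr)
  assume neg: "\<not> K l' j0 y0 <= v j0 y0"
  have l'0: "l' > 0" using l l' by simp
  have y0\<rho>: "norm y0 < \<rho>" using out[OF l', of y0 j0] neg by force
  define f where "f t = 2 - Kc * (t - l'^2)^2" for t :: real
  define A where "A = cball (0::'a) \<rho> \<inter> - ball 0 l'"
  have cA: "compact A" unfolding A_def by (intro compact_Int_closed) auto
  have yA: "y0 \<in> A" using y0 y0\<rho> by (auto simp: A_def)
  have fA: "1 <= f (y \<bullet> y)" "f (y \<bullet> y) <= 2" if "y \<in> A" for y
  proof -
   have "l' <= norm y" "norm y <= \<rho>" using that by (auto simp: A_def)
   then have "l'^2 <= (norm y)^2" "(norm y)^2 <= \<rho>^2" using l'0 by (auto intro!: power_mono)
   moreover have "l^2 <= l'^2" using l l' by (auto intro!: power_mono)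
   ultimately have "0 <= y \<bullet> y - l'^2" "y \<bullet> y - l'^2 <= \<rho>^2 - l^2" by (auto simp: dot_square_norm)
   moreover have "\<rho>^2 - l^2 = \<eta> * (2 * l + \<eta>)" by (simp add: \<rho>_def power2_eq_square algebra_simps)
   ultimately have "(y \<bullet> y - l'^2)^2 <= (\<eta> * (2 * l + \<eta>))^2" by (intro power_mono) auto
   then have "Kc * (y \<bullet> y - l'^2)^2 <= Kc * (\<eta> * (2 * l + \<eta>))^2" using Kc by (intro mult_left_mono) auto
   then show "1 <= f (y \<bullet> y)" using \<eta>2 by (simp add: f_def)
   show "f (y \<bullet> y) <= 2" using Kc by (simp add: f_def)
  qed
  define g where "g j y = (v j y - K l' j y) / f (y \<bullet> y)" for j y
  have cg: "continuous_on A (g j)" for j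
  proof -
   have "A \<subseteq> - {0}" using l'0 by (auto simp: A_def)
   then have "continuous_on A (K l' j)" using contK[OF l'0] continuous_on_subset by blast
   moreover have "continuous_on A (\<lambda>y. f (y \<bullet> y))" unfolding f_def by (intro continuous_intros)
   ultimately show ?thesis unfolding g_def using continuous_on_subset[OF cont] fA
    by (intro continuous_intros) force+
  qed
  have "\<exists>z\<in>A. \<forall>y\<in>A. g j z <= g j y" for j using continuous_attains_inf[OF cA _ cg] yA by blast
  then obtain Z where Z: "\<And>j. Z j \<in> A" "\<And>j y. y \<in> A ==> g j (Z j) <= g j y" by metis
  \<comment> \<open>The component with the lower minimum. The same \<open>m\<close> then bounds the
    negative part of the other component too, which the coupling term requires.\<close>
  define j where "j = (g True (Z True) <= g False (Z False))"
  define z where "z = Z j"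
  have jmin: "g j z <= g i y" if "y \<in> A" for i y
   using Z(2)[OF that, of i] unfolding z_def j_def by (cases i; cases "g True (Z True) <= g False (Z False)") auto
  have zA: "z \<in> A" using Z by (simp add: z_def)
  define m where "m = - g j z"
  have "g j0 y0 < 0" unfolding g_def using neg fA(1)[OF yA] by (intro divide_neg_pos) auto
  then have m: "m > 0" using jmin[OF yA, of j0] by (simp add: m_def)
  have low: "v i y - K l' i y >= - m * f (y \<bullet> y)" if "y \<in> A" for i y
   using jmin[OF that, of i] fA(1)[OF that] by (simp add: g_def m_def field_simps)
  have eqz: "v j z - K l' j z = - m * f (z \<bullet> z)" using fA(1)[OF zA] by (simp add: g_def m_def field_simps)
  have negz: "v j z - K l' j z < 0" using eqz m fA(1)[OF zA] by simp
  have "norm z \<noteq> l'" using Kbd[OF l'0, of z j] negz by auto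
  moreover have "norm z \<noteq> \<rho>" using out[OF l', of z j] negz by force
  ultimately have zz: "l' < norm z" "norm z < \<rho>" using zA by (auto simp: A_def)
  have "open (ball (0::'a) \<rho> \<inter> - cball 0 l')" by (intro open_Int) auto
  moreover have "z \<in> ball 0 \<rho> \<inter> - cball 0 l'" using zz by auto
  ultimately obtain \<nu> where \<nu>: "\<nu> > 0" "ball z \<nu> \<subseteq> ball 0 \<rho> \<inter> - cball 0 l'" by (meson open_contains_ball)
  have vz: "vsup 0 (\<lambda>z. v j z - K l' j z) z (\<psi> j (v True z) (v False z) - \<psi> j (K l' True z) (K l' False z))"
   using zz by (intro vsK' l'0) auto
  have "\<psi> j (v True z) (v False z) - \<psi> j (K l' True z) (K l' False z) \<le>
   - (2 * real DIM('a) * (m * (2 * Kc * ((z-0) \<bullet> (z-0) - l'^2))) + 4 * (m * (2 * Kc)) * ((z-0) \<bullet> (z-0)))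
   + 0 * (2 * \<bar>m * (2 * Kc * ((z-0) \<bullet> (z-0) - l'^2))\<bar> * norm (z - 0))"
  proof (rule vsup_radial[OF vz, of UNIV 0 "\<lambda>t. - m * f t" "\<lambda>t. m * (2 * Kc * (t - l'^2))" "\<lambda>t. m * (2 * Kc)" \<nu>])
   show "((\<lambda>t. - m * f t) has_real_derivative m * (2 * Kc * (t - l'\<^sup>2))) (at t)" for t
    unfolding f_def by (auto intro!: derivative_eq_intros)
   show "((\<lambda>t. m * (2 * Kc * (t - l'\<^sup>2))) has_real_derivative m * (2 * Kc)) (at t)" for t
    by (auto intro!: derivative_eq_intros)
   show "- m * f ((x - 0) \<bullet> (x - 0)) - - m * f ((z - 0) \<bullet> (z - 0)) <= v j x - K l' j x - (v j z - K l' j z)" if "x \<in> ball z \<nu>" for x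
   proof -
    have "x \<in> A" using that \<nu> by (force simp: A_def)
    from low[OF this, of j] show ?thesis using eqz by simp
   qed
  qed (use \<nu> in auto)
  also have "... <= - (8 * Kc * l^2 * m)"
  proof -
   have 1: "l'^2 <= z \<bullet> z" using zz l'0 by (auto simp: dot_square_norm intro!: power_mono)
   have 2: "l^2 <= l'^2" using l l' by (auto intro!: power_mono)
   have "2 * real DIM('a) * (m * (2 * Kc * (z \<bullet> z - l'^2))) >= 0" using 1 m Kc by simp
   moreover have "8 * Kc * m * (z \<bullet> z) >= 8 * Kc * m * l^2" using 1 2 Kc m by (intro mult_left_mono) auto
   ultimately show ?thesis by (simp add: mult_ac)
  qed
  finally have up: "\<psi> j (v True z) (v False z) - \<psi> j (K l' True z) (K l' False z) <= - (8 * Kc * l^2 * m)" .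
  \<comment> \<open>Monotonicity replaces the Kelvin values by their maxima with \<open>v\<close>.
    These exceed \<open>v\<close> by at most m f <= 2 m in each component and stay in the unit
    square, so the Lipschitz bound costs at most 4 C m.\<close>
  have "\<psi> j (K l' True z) (K l' False z) <= \<psi> j (max (v True z) (K l' True z)) (max (v False z) (K l' False z))"
   using K0 by (intro \<psi>mono) auto
  also have "... <= \<psi> j (v True z) (v False z) + C * (\<bar>max (v True z) (K l' True z) - v True z\<bar> + \<bar>max (v False z) (K l' False z) - v False z\<bar>)"
   using \<psi>lip[of "max (v True z) (K l' True z)" "max (v False z) (K l' False z)" "v True z" "v False z" j]
    v0 v1 K0 K1[OF l'0, of z] zz by (auto simp: max_def split: if_splits)
  also have "... <= \<psi> j (v True z) (v False z) + C * (2 * m + 2 * m)"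
  proof -
   have "\<bar>max (v i z) (K l' i z) - v i z\<bar> <= 2 * m" for i
   proof -
    have "m * f (z \<bullet> z) <= m * 2" using fA(2)[OF zA] m by (intro mult_left_mono) auto
     then have "K l' i z - v i z <= 2 * m" using low[OF zA, of i] by linarith
     then show ?thesis using m by (auto simp: max_def)
   qed
   then show ?thesis using C0 by (intro add_left_mono mult_left_mono add_mono) auto
  qed
  finally have "8 * Kc * l^2 * m <= 4 * C * m" using up by (simp add: mult_ac)
  then show False using Kc m by simp
 qed
 then show thesis by (rule that[OF \<delta>(1)])
qed

text \<open>The supremum of admissible radii is itself admissible by continuity in the radius, and
  \<open>continue\<close> moves beyond it; hence it cannot be finite.\<close>

lemma moving_spheres:
 assumes l: "0 < l" and y: "l <= norm y"
 shows "K l j y <= v j y"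
proof (rule ccontr)
 assume neg: "\<not> K l j y <= v j y"
 define S where "S = {\<mu>. \<mu> > 0 \<and> (\<forall>l j y. 0 < l --> l < \<mu> --> l <= norm y --> K l j y <= v j y)}"
 obtain \<mu>0 where "\<mu>0 > 0" "\<And>l j y. 0 < l ==> l < \<mu>0 ==> l <= norm y ==> K l j y <= v j y"
 proof (rule start)
  fix \<mu> assume "\<mu> > 0" "\<And>l j y. 0 < l ==> l < \<mu> ==> l <= norm y ==> K l j y <= v j y"
  then show thesis by (rule that)
 qed
 then have \<mu>0: "\<mu>0 \<in> S" by (simp add: S_def)
 have ub: "\<mu> <= l" if "\<mu> \<in> S" for \<mu>
 proof (rule ccontr)
  assume "\<not> \<mu> <= l"
  then have "K l j y <= v j y" using that l y by (simp add: S_def)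
  then show False using neg by simp
 qed
 then have bdd: "bdd_above S" by (auto simp: bdd_above_def)
 define lb where "lb = Sup S"
 have lb0: "lb > 0" using cSup_upper[OF \<mu>0 bdd] \<mu>0 unfolding lb_def S_def by auto
 have less: "K l' j y <= v j y" if lt: "0 < l'" "l' < lb" "l' <= norm y" for l' j y
 proof -
  have "S \<noteq> {}" using \<mu>0 by auto
  then obtain \<mu> where "\<mu> \<in> S" "l' < \<mu>" using lt(2) less_cSup_iff[OF _ bdd] unfolding lb_def by auto
  then show ?thesis using lt unfolding S_def by auto
 qed
 have at: "K lb j y <= v j y" if y: "lb <= norm y" for j y
 proof -
  have "y \<noteq> 0" using y lb0 by auto
  from contKl[OF this, of j] have "isCont (\<lambda>l. K l j y) lb"
   using lb0 by (simp add: continuous_on_eq_continuous_at)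
  then have "((\<lambda>l. K l j y) \<longlongrightarrow> K lb j y) (at_left lb)"
   by (simp add: continuous_within filterlim_at_split)
  moreover have "\<forall>\<^sub>F l in at_left lb. K l j y <= v j y"
   using less y lb0 by (auto simp: eventually_at_left[OF lb0])
  ultimately show ?thesis using tendsto_upperbound trivial_limit_at_left_real by blast
 qed
 obtain \<delta> where \<delta>: "\<delta> > 0" "\<And>l' j y. lb <= l' ==> l' < lb + \<delta> ==> l' <= norm y ==> K l' j y <= v j y"
 proof (rule continue[OF lb0 at])
  fix \<delta> assume "\<delta> > 0" "\<And>l' j y. lb <= l' ==> l' < lb + \<delta> ==> l' <= norm y ==> K l' j y <= v j y"
  then show thesis by (rule that)
 qed
 have "K l' j y <= v j y" if "0 < l'" "l' < lb + \<delta>" "l' <= norm y" for l' j y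
  using less[of l' y j] \<delta>(2)[of l' y j] that by (cases "l' < lb") auto
 then have "lb + \<delta> \<in> S" unfolding S_def using \<delta> lb0 by auto
 then have "lb + \<delta> <= lb" unfolding lb_def by (rule cSup_upper[OF _ bdd])
 then show False using \<delta> by simp
qed

end

section \<open>The Liouville theorem on the whole space\<close>

lemma vsup_translate:
 fixes w :: "'a::euclidean_space => real"
 assumes v: "vsup \<beta> w (x + y) c" shows "vsup \<beta> (\<lambda>z. w (x + z)) y c"
 unfolding vsup_def
proof (intro allI impI, elim conjE)
 fix \<zeta> :: "'a => real" and G Hf and r :: real
 assume r: "0 < r" and d: "\<forall>z\<in>ball y r. (\<zeta> has_derivative (\<bullet>) (G z)) (at z) \<and> (G has_derivative Hf z) (at z)"
  and ic: "isCont (\<lambda>z. tr (Hf z)) y" and t: "\<forall>z\<in>ball y r. \<zeta> z - \<zeta> y <= w (x + z) - w (x + y)"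
 have s: "((\<lambda>z. z - x) has_derivative (\<lambda>h. h)) (at z)" for z :: 'a
  by (auto intro!: derivative_eq_intros)
 have b: "z - x \<in> ball y r" if "z \<in> ball (x + y) r" for z
  using that by (simp add: dist_norm algebra_simps)
 have "\<forall>z\<in>ball (x + y) r. ((\<lambda>z. \<zeta> (z - x)) has_derivative (\<bullet>) (G (z - x))) (at z) \<and> ((\<lambda>z. G (z - x)) has_derivative Hf (z - x)) (at z)"
  using d b has_derivative_compose[OF s, of \<zeta>] has_derivative_compose[OF s, of G] by blast
 moreover have "isCont (\<lambda>z. tr (Hf (z - x))) (x + y)"
  by (rule isCont_o2[where f = "\<lambda>z. z - x" and g = "\<lambda>z. tr (Hf z)"]) (use ic in auto)
 moreover have "\<forall>z\<in>ball (x + y) r. \<zeta> (z - x) - \<zeta> (x + y - x) <= w z - w (x + y)"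
 proof
  fix z assume "z \<in> ball (x + y) r"
  from t[rule_format, OF b[OF this]] show "\<zeta> (z - x) - \<zeta> (x + y - x) <= w z - w (x + y)" by simp
 qed
 ultimately have "c <= - tr (Hf (x + y - x)) + \<beta> * norm (G (x + y - x))"
  using v[unfolded vsup_def, rule_format, of r "\<lambda>z. \<zeta> (z - x)" "\<lambda>z. G (z - x)" "\<lambda>z. Hf (z - x)"] r by blast
 then show "c <= - tr (Hf y) + \<beta> * norm (G y)" by simp
qed

text \<open>A superharmonic function of one linear variable is concave, and a nonnegative concave
  function cannot decrease in either direction. Concretely \<open>w\<close> is compared with the
  line falling from w y to 0 at distance T, bent by \<delta> t (T - t) to be strictly convex; then
  \<delta> tends to 0 and T to infinity.\<close>

lemma ridge_superharmonic_mono: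
 fixes w :: "'a::euclidean_space => real"
 assumes e: "norm e = 1" and vs: "\<And>y. vsup 0 w y 0" and w0: "\<And>y. 0 <= w y"
  and ridge: "\<And>y z. y \<bullet> e = z \<bullet> e ==> w y = w z" and cont: "continuous_on UNIV w" and d: "d > 0"
 shows "w y <= w (y + d *\<^sub>R e)"
proof -
 have ee: "e \<bullet> e = 1" using e by (simp add: norm_eq_1)
 have main: "w y * (1 - d / T) - \<delta> * (d * (T - d)) <= w (y + d *\<^sub>R e)" if T: "T > d" and \<delta>: "\<delta> > 0" for T \<delta>
 proof (rule ccontr)
  assume neg: "\<not> ?thesis"
  define g where "g t = w (y + t *\<^sub>R e) - (w y * (1 - t / T) - \<delta> * (t * (T - t)))" for t :: real
  have "continuous_on {0..T} g" unfolding g_def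
   using T d by (intro continuous_intros continuous_on_compose2[OF cont]) auto
  then obtain t where t: "t \<in> {0..T}" "\<And>s. s \<in> {0..T} ==> g t <= g s"
   using continuous_attains_inf[of "{0..T}" g] T d by auto
  have "g d < 0" using neg by (simp add: g_def)
  then have gt: "g t < 0" using t(2)[of d] T d by simp
  have "g 0 = 0" by (simp add: g_def)
  moreover have "g T >= 0" using w0 T d by (simp add: g_def)
  ultimately have tt: "0 < t" "t < T" using gt t(1) by (auto simp: less_le)
  define z0 where "z0 = y + t *\<^sub>R e"
  define \<tau> where "\<tau> z = (z - y) \<bullet> e" for z
  have \<tau>0: "\<tau> z0 = t" by (simp add: \<tau>_def z0_def ee)
  define \<zeta> where "\<zeta> z = w y * (1 - \<tau> z / T) - \<delta> * (\<tau> z * (T - \<tau> z))" for z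
  define G where "G z = (- (w y / T) - \<delta> * (T - 2 * \<tau> z)) *\<^sub>R e" for z
  define Hf where "Hf z h = (2 * \<delta> * (h \<bullet> e)) *\<^sub>R e" for z h :: 'a
  define r where "r = min t (T - t)"
  have "c <= 0" if "c = 2 * \<delta>" for c :: real
  proof -
   have "0 <= - tr (Hf z0) + 0 * norm (G z0)"
   proof (rule vs[of z0, unfolded vsup_def, rule_format], intro conjI ballI)
    show "0 < r" using tt by (simp add: r_def)
    have d\<tau>: "(\<tau> has_derivative (\<lambda>h. h \<bullet> e)) (at z)" for z
     unfolding \<tau>_def by (auto intro!: derivative_eq_intros)
    show "(\<zeta> has_derivative (\<bullet>) (G z)) (at z)" for z
    proof -
     have "(\<zeta> has_derivative (\<lambda>h. w y * (0 - (h \<bullet> e) / T) - \<delta> * (\<tau> z * (0 - h \<bullet> e) + (h \<bullet> e) * (T - \<tau> z)))) (at z)"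
      unfolding \<zeta>_def using T d by (auto intro!: derivative_eq_intros d\<tau> simp: divide_inverse)
     moreover have "w y * (0 - (h \<bullet> e) / T) - \<delta> * (\<tau> z * (0 - h \<bullet> e) + (h \<bullet> e) * (T - \<tau> z)) = G z \<bullet> h" for h
      unfolding G_def using T d by (simp add: inner_commute field_simps)
     ultimately show ?thesis by simp
    qed
    show "(G has_derivative Hf z) (at z)" for z
     unfolding G_def Hf_def by (auto intro!: derivative_eq_intros d\<tau> simp: fun_eq_iff)
    show "isCont (\<lambda>z. tr (Hf z)) z0" unfolding Hf_def by simp
    \<comment> \<open>As \<open>w\<close> and the test function depend only on the component along
      \<open>e\<close>, a minimum along the line is a minimum on a full ball.\<close>
    show "\<zeta> z - \<zeta> z0 <= w z - w z0" if z: "z \<in> ball z0 r" for z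
    proof -
     have "\<bar>\<tau> z - t\<bar> = \<bar>(z - z0) \<bullet> e\<bar>" by (simp add: \<tau>_def z0_def inner_diff_left inner_add_left ee)
     also have "... <= norm (z - z0)" using Cauchy_Schwarz_ineq2[of "z - z0" e] e by simp
     also have "... < r" using z by (simp add: dist_norm norm_minus_commute)
     finally have "\<tau> z \<in> {0..T}" unfolding r_def by (auto simp: abs_less_iff)
     from t(2)[OF this] have "g t <= g (\<tau> z)" .
     moreover have "w (y + \<tau> z *\<^sub>R e) = w z" by (rule ridge) (simp add: \<tau>_def inner_add_left inner_diff_left ee)
     ultimately show ?thesis unfolding g_def \<zeta>_def \<tau>0 by (simp add: z0_def)
    qed
   qed
   moreover have "tr (Hf z0) = 2 * \<delta>"
   proof -
    have "tr (Hf z0) = 2 * \<delta> * (\<Sum>b\<in>Basis. (e \<bullet> b) * (e \<bullet> b))"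
     by (simp add: tr_def Hf_def sum_distrib_left inner_commute mult_ac)
    then show ?thesis using euclidean_inner[of e e] ee by simp
   qed
   ultimately show ?thesis using that by simp
  qed
  then show False using \<delta> by force
 qed
 have main2: "w y * (1 - d / T) <= w (y + d *\<^sub>R e)" if T: "T > d" for T
 proof (rule field_le_epsilon)
  fix \<nu> :: real assume \<nu>: "\<nu> > 0"
  define \<delta> where "\<delta> = \<nu> / (d * (T - d))"
  have "d * (T - d) > 0" using T d by simp
  then have "\<delta> > 0" "\<delta> * (d * (T - d)) = \<nu>" using \<nu> by (auto simp: \<delta>_def)
  from main[OF T this(1)] this(2) show "w y * (1 - d / T) <= w (y + d *\<^sub>R e) + \<nu>" by simp
 qed
 show ?thesis
 proof (rule field_le_epsilon)
  fix \<nu> :: real assume \<nu>: "\<nu> > 0"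
  define T where "T = (w y * d + 1) / \<nu> + d + 1"
  have wd: "w y * d >= 0" using w0 d by simp
  then have "(w y * d + 1) / \<nu> > 0" using \<nu> by (intro divide_pos_pos) auto
  then have T: "T > d" "T > 0" unfolding T_def using d by linarith+
  have "(w y * d + 1) / \<nu> <= T" unfolding T_def using d by simp
  then have "w y * d + 1 <= \<nu> * T" using \<nu> by (simp add: field_simps)
  then have "w y * d / T <= \<nu>" using T by (simp add: field_simps)
  moreover have "w y * (1 - d / T) = w y - w y * d / T" by (simp add: algebra_simps)
  ultimately show "w y <= w (y + d *\<^sub>R e) + \<nu>" using main2[OF T(1)] by linarith
 qed
qed

context psi begin

text \<open>Inversions are available only with centre on {x . e = 0}. Spheres whose centre runs to
  infinity along this hyperplane compare points of equal height, so each component is a function of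
  y . e; it is then constant by concavity, and the inequality for a constant forces \<psi> and so
  the solution to vanish.\<close>

theorem liouville:
 fixes v :: "bool => 'a::euclidean_space => real"
 assumes n3: "DIM('a) >= 3" and pa: "p * kexp TYPE('a) < kexp TYPE('a) + 2" and e: "norm e = 1"
  and \<psi>pos: "\<And>a b. 0 <= a ==> 0 <= b ==> 0 < a + b ==> \<psi> True a b + \<psi> False a b > 0"
  and cont: "\<And>j. continuous_on UNIV (v j)" and v0: "\<And>j y. 0 <= v j y" and v1: "\<And>j y. v j y <= 1"
  and s: "s > 0" and L: "L >= 0" and lip: "\<And>j a b. dist a b <= s ==> \<bar>v j a - v j b\<bar> <= L * dist a b"
  and vs: "\<And>j y. vsup 0 (v j) y (\<psi> j (v True y) (v False y))"
  and vsn: "\<And>j y. vsup 0 (\<lambda>z. - v j z) y (- \<psi> j (v True y) (v False y))"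
  and vsk: "\<And>j l x y. x \<bullet> e = 0 ==> l > 0 ==> y \<noteq> 0 ==> vsup 0 (\<lambda>z. v j (x + z) - kelvin l (v j) x z) y
    (\<psi> j (v True (x + y)) (v False (x + y)) - (l^2 / (y \<bullet> y)) powr (kexp TYPE('a) + 2) *
     \<psi> j (v True (x + (l^2 / (y \<bullet> y)) *\<^sub>R y)) (v False (x + (l^2 / (y \<bullet> y)) *\<^sub>R y)))"
 shows "v True y + v False y = 0"
proof -
 let ?a = "kexp TYPE('a)"
 have ee: "e \<bullet> e = 1" using e by (simp add: norm_eq_1)
 have vs0: "vsup 0 (v j) y 0" for j y by (rule vsup_mono[OF vs]) (use \<psi>nn v0 in auto)
 have dich: "(\<forall>y. v j y = 0) \<or> (\<forall>y. v j y > 0)" for j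
 proof (cases "\<exists>y0. v j y0 = 0")
  case True
  then obtain y0 where "v j y0 = 0" by blast
  then have "v j y = 0" for y
   by (intro vsup_strong_min[of 0 UNIV "v j" y0 y]) (use vs0 v0 cont in auto)
  then show ?thesis by blast
 next
  case False
  then show ?thesis using v0 by (metis less_le)
 qed
 have ms: "kelvin l (v j) x y <= v j (x + y)" if x: "x \<bullet> e = 0" and l: "0 < l" "l <= norm y" for x y l j
 proof -
  interpret msphere \<psi> p C "\<lambda>j z. v j (x + z)" L s ?a
  proof
   show "continuous_on UNIV (\<lambda>z. v j (x + z))" for j
    by (intro continuous_on_compose2[OF cont] continuous_intros) auto
   show "(\<forall>y. v j (x + y) = 0) \<or> (\<forall>y. 0 < v j (x + y))" for j using dich[of j] by blast
   show "vsup 0 (\<lambda>z. v j (x + z)) y (\<psi> j (v True (x + y)) (v False (x + y)))" for j y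
    by (rule vsup_translate[OF vs])
   show "vsup 0 (\<lambda>z. - v j (x + z)) y (- \<psi> j (v True (x + y)) (v False (x + y)))" for j y
    by (rule vsup_translate[OF vsn])
   show "vsup 0 (\<lambda>z. v j (x + z) - kelvin l (\<lambda>z. v j (x + z)) 0 z) y
    (\<psi> j (v True (x + y)) (v False (x + y)) - (l^2 / (y \<bullet> y)) powr (?a + 2) *
     \<psi> j (v True (x + (l^2 / (y \<bullet> y)) *\<^sub>R y)) (v False (x + (l^2 / (y \<bullet> y)) *\<^sub>R y)))"
    if "l > 0" "y \<noteq> 0" for j l y
    using vsk[OF x that] by (simp add: kelvin_def)
   show "\<bar>v j (x + a) - v j (x + b)\<bar> <= L * dist a b" if "dist a b <= s" for j a b
    using lip[of "x + a" "x + b"] that by simp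
  qed (use n3 pa v0 v1 s L in auto)
  from moving_spheres[OF l, of j] show ?thesis by (simp add: kelvin_def)
 qed
 have step: "v j a <= v j b" if eq: "a \<bullet> e = b \<bullet> e" and ne: "a \<bullet> e \<noteq> 0" for j a b
 proof -
  define \<sigma> where "\<sigma> = a \<bullet> e"
  \<comment> \<open>The points \<open>a\<close> and b + (\<sigma>/n) e are placed at x + n d and x +
    (n+1) d on a ray from the centre \<open>x\<close>; the correction (\<sigma>/n) e in
    \<open>d\<close> is what puts \<open>x\<close> on the hyperplane. The inversion of radius sqrt(n
    (n+1)) |d| exchanges the two, and its weight tends to 1.\<close>
  have k: "(real (Suc k) / real (Suc (Suc k))) powr ?a * v j a <= v j (b + (\<sigma> / real (Suc k)) *\<^sub>R e)" for k
  proof -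
   define n where "n = real (Suc k)"
   have n: "n > 0" "real (Suc (Suc k)) = n + 1" by (auto simp: n_def)
   define d where "d = (b - a) + (\<sigma> / n) *\<^sub>R e"
   define x where "x = a - n *\<^sub>R d"
   have de: "d \<bullet> e = \<sigma> / n" using eq by (simp add: d_def inner_add_left inner_diff_left ee)
   have xe: "x \<bullet> e = 0" using n by (simp add: x_def inner_diff_left de \<sigma>_def)
   have d0: "d \<noteq> 0" using de ne n by (auto simp: \<sigma>_def)
   define l where "l = sqrt (n * (n + 1)) * norm d"
   have l: "l > 0" using n d0 by (simp add: l_def)
   have l2: "l^2 = n * (n + 1) * (d \<bullet> d)" using n by (simp add: l_def power_mult_distrib dot_square_norm)
   have "sqrt (n * (n + 1)) <= n + 1" using n by (intro real_le_lsqrt) (auto simp: power2_eq_square algebra_simps)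
   then have ln: "l <= norm ((n + 1) *\<^sub>R d)" using n by (simp add: l_def mult_right_mono)
   have q: "l^2 / (((n + 1) *\<^sub>R d) \<bullet> ((n + 1) *\<^sub>R d)) = n / (n + 1)"
   proof -
    have 1: "((n + 1) *\<^sub>R d) \<bullet> ((n + 1) *\<^sub>R d) = (n + 1) * (n + 1) * (d \<bullet> d)" by (simp only: inner_scaleR_left inner_scaleR_right mult_ac)
    have "n * m * D / (m * m * D) = n / m" if "m \<noteq> 0" "D \<noteq> 0" for m D :: real using that by simp
    from this[of "n + 1" "d \<bullet> d"] show ?thesis unfolding l2 1 using n d0 by simp
   qed
   have "kelvin l (v j) x ((n + 1) *\<^sub>R d) = (n / (n + 1)) powr ?a * v j (x + n *\<^sub>R d)"
    unfolding kelvin_def q using n by simp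
   also have "x + n *\<^sub>R d = a" by (simp add: x_def)
   finally have "(n / (n + 1)) powr ?a * v j a <= v j (x + (n + 1) *\<^sub>R d)" using ms[OF xe l ln, of j] by simp
   also have "x + (n + 1) *\<^sub>R d = b + (\<sigma> / n) *\<^sub>R e"
   proof -
    have "x + (n + 1) *\<^sub>R d = a + d" by (simp add: x_def scaleR_add_left)
    then show ?thesis by (simp add: d_def)
   qed
   finally show ?thesis using n by (simp add: n_def)
  qed
  have "(\<lambda>k. real (Suc k) / real (Suc (Suc k))) \<longlonglongrightarrow> 1" by (rule LIMSEQ_Suc[OF LIMSEQ_n_over_Suc_n])
  then have lim1: "(\<lambda>k. (real (Suc k) / real (Suc (Suc k))) powr ?a * v j a) \<longlonglongrightarrow> 1 powr ?a * v j a"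
   by (intro tendsto_mult[OF tendsto_powr[OF _ tendsto_const] tendsto_const]) auto
  have lim2: "(\<lambda>k. v j (b + (\<sigma> / real (Suc k)) *\<^sub>R e)) \<longlonglongrightarrow> v j b"
  proof -
   have "(\<lambda>k. b + (\<sigma> * inverse (real (Suc k))) *\<^sub>R e) \<longlonglongrightarrow> b + (\<sigma> * 0) *\<^sub>R e"
    by (intro tendsto_intros LIMSEQ_inverse_real_of_nat)
   then have "(\<lambda>k. b + (\<sigma> / real (Suc k)) *\<^sub>R e) \<longlonglongrightarrow> b" by (simp add: divide_inverse)
   moreover have "isCont (v j) b" using cont by (simp add: continuous_on_eq_continuous_at)
   ultimately show ?thesis by (rule isCont_tendsto_compose[rotated])
  qed
  have "1 powr ?a * v j a <= v j b" by (rule LIMSEQ_le[OF lim1 lim2]) (use k in blast)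
  then show ?thesis by simp
 qed
 have step2: "v j a <= v j b" if eq: "a \<bullet> e = b \<bullet> e" for j a b
 proof (cases "a \<bullet> e = 0")
  case False then show ?thesis using step eq by blast
 next
  case True
  have l: "(\<lambda>k. v j (b + inverse (real (Suc k)) *\<^sub>R e)) \<longlonglongrightarrow> v j b" for b
  proof -
   have "(\<lambda>k. b + inverse (real (Suc k)) *\<^sub>R e) \<longlonglongrightarrow> b + 0 *\<^sub>R e"
    by (intro tendsto_intros LIMSEQ_inverse_real_of_nat)
   then have "(\<lambda>k. b + inverse (real (Suc k)) *\<^sub>R e) \<longlonglongrightarrow> b" by simp
   moreover have "isCont (v j) b" using cont by (simp add: continuous_on_eq_continuous_at)
   ultimately show ?thesis by (rule isCont_tendsto_compose[rotated])
  qed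
  have "v j (a + inverse (real (Suc k)) *\<^sub>R e) <= v j (b + inverse (real (Suc k)) *\<^sub>R e)" for k
   using eq True by (intro step) (auto simp: inner_add_left ee)
  then show ?thesis using LIMSEQ_le[OF l[of a] l[of b]] by blast
 qed
 have ridge: "v j a = v j b" if "a \<bullet> e = b \<bullet> e" for j a b
  by (rule antisym[OF step2[OF that] step2[OF that[symmetric]]])
 have const: "v j a <= v j b" for j a b
 proof -
  define d where "d = (b - a) \<bullet> e"
  have b: "v j b = v j (a + d *\<^sub>R e)" by (rule ridge) (simp add: d_def inner_add_left inner_diff_left ee)
  consider "d > 0" | "d = 0" | "d < 0" by linarith
  then show ?thesis
  proof cases
   case 1
   then show ?thesis unfolding b
    by (intro ridge_superharmonic_mono[OF e vs0 v0 _ cont]) (rule ridge)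
  next
   case 3
   have "v j a <= v j (a + (- d) *\<^sub>R (- e))"
   proof (rule ridge_superharmonic_mono[OF _ vs0 v0 _ cont])
    show "norm (- e) = 1" using e by simp
    show "0 < - d" using 3 by simp
    show "v j y = v j z" if "y \<bullet> - e = z \<bullet> - e" for y z
     by (rule ridge) (use that in simp)
   qed
   then show ?thesis unfolding b by simp
  qed (simp add: b)
 qed
 have "\<psi> j (v True y) (v False y) <= 0" for j
  by (rule vsup_const_min[OF vs[of j y] zero_less_one const])
 then have "\<psi> True (v True y) (v False y) + \<psi> False (v True y) (v False y) <= 0" by (simp add: add_nonpos_nonpos)
 then have "\<not> 0 < v True y + v False y" using \<psi>pos[OF v0 v0] by fastforce
 then show ?thesis using v0[of True y] v0[of False y] by linarith
qed

end

section \<open>Neumann points along arbitrary normal curves and under inversion\<close>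

text \<open>After rescaling time by \<alpha>, two curves with the same velocity separate by o(t),
  and a Lipschitz function changes by o(t) between them. Stationarity along one curve on each side
  therefore extends to every curve leaving along \<open>e\<close>, the velocity zero
  included.\<close>

lemma neum_lipschitz:
 fixes V :: "'a::euclidean_space => real"
 assumes n: "neum V e y" and r: "r > 0" and L: "L >= 0"
  and lip: "\<And>a b. a \<in> ball y r ==> b \<in> ball y r ==> \<bar>V a - V b\<bar> <= L * dist a b"
  and g: "((\<lambda>t. (\<gamma> t - y) /\<^sub>R t) \<longlongrightarrow> c *\<^sub>R e) (at_right (0::real))"
 shows "((\<lambda>t. (V (\<gamma> t) - V y) / t) \<longlongrightarrow> 0) (at_right 0)"
proof -
 define s where "s = (if c < 0 then -1 else 1 :: real)"
 have s: "s \<in> {1, -1}" "s * \<bar>c\<bar> = c" by (auto simp: s_def)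
 obtain \<gamma>0 c0 where g0: "c0 > 0" "((\<lambda>t. (\<gamma>0 t - y) /\<^sub>R t) \<longlongrightarrow> (s * c0) *\<^sub>R e) (at_right 0)"
  "((\<lambda>t. (V (\<gamma>0 t) - V y) / t) \<longlongrightarrow> 0) (at_right 0)" using n s(1) unfolding neum_def by blast
 define \<alpha> where "\<alpha> = \<bar>c\<bar> / c0"
 have \<alpha>: "\<alpha> >= 0" "\<alpha> * (s * c0) = c" using g0(1) s(2) by (auto simp: \<alpha>_def mult_ac)
 have pos: "\<forall>\<^sub>F t::real in at_right 0. t > 0" by (simp add: eventually_at_right_less)
 have cl: "(\<gamma> \<longlongrightarrow> y) (at_right 0)" using curve_deriv(1)[OF has_derivative_const g] .
 show ?thesis
 proof (cases "\<alpha> = 0")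
  case True
  then have c0: "c = 0" using \<alpha> by simp
  have "\<forall>\<^sub>F t in at_right 0. \<gamma> t \<in> ball y r"
   using cl topological_tendstoD[OF cl, of "ball y r"] r by auto
  then have "\<forall>\<^sub>F t in at_right 0. norm ((V (\<gamma> t) - V y) / t) <= L * norm ((\<gamma> t - y) /\<^sub>R t)"
   using pos
  proof eventually_elim
   case (elim t)
   have "\<bar>V (\<gamma> t) - V y\<bar> <= L * norm (\<gamma> t - y)" using lip[of "\<gamma> t" y] elim r by (simp add: dist_norm)
   then have "\<bar>V (\<gamma> t) - V y\<bar> / t <= L * norm (\<gamma> t - y) / t" using elim by (simp add: divide_right_mono)
   then show ?case using elim by (simp add: divide_inverse abs_mult mult_ac)
  qed
  moreover have "((\<lambda>t. L * norm ((\<gamma> t - y) /\<^sub>R t)) \<longlongrightarrow> L * norm (c *\<^sub>R e)) (at_right 0)"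
   by (intro tendsto_intros g)
  then have "((\<lambda>t. L * norm ((\<gamma> t - y) /\<^sub>R t)) \<longlongrightarrow> 0) (at_right 0)" using c0 by simp
  ultimately show ?thesis by (rule Lim_null_comparison)
 next
  case False
  then have a: "\<alpha> > 0" using \<alpha> by simp
  have fl: "filterlim (\<lambda>t. \<alpha> * t) (at_right 0) (at_right (0::real))"
   unfolding filterlim_at using a pos
   by (auto intro!: tendsto_eq_intros elim!: eventually_mono)
  have g1: "((\<lambda>t. (\<gamma>0 (\<alpha> * t) - y) /\<^sub>R (\<alpha> * t)) \<longlongrightarrow> (s * c0) *\<^sub>R e) (at_right 0)"
   using filterlim_compose[OF g0(2) fl] .
  have "((\<lambda>t. \<alpha> *\<^sub>R ((\<gamma>0 (\<alpha> * t) - y) /\<^sub>R (\<alpha> * t))) \<longlongrightarrow> \<alpha> *\<^sub>R ((s * c0) *\<^sub>R e)) (at_right 0)"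
   by (intro tendsto_intros g1)
  then have g2: "((\<lambda>t. (\<gamma>0 (\<alpha> * t) - y) /\<^sub>R t) \<longlongrightarrow> c *\<^sub>R e) (at_right 0)"
  proof -
   have "\<alpha> *\<^sub>R (u /\<^sub>R (\<alpha> * t)) = u /\<^sub>R t" for u :: 'a and t
   proof -
    have "\<alpha> * inverse (\<alpha> * t) = inverse t" using a by (simp add: mult.assoc[symmetric])
    then show ?thesis by simp
   qed
   moreover have "\<alpha> *\<^sub>R ((s * c0) *\<^sub>R e) = c *\<^sub>R e" using \<alpha>(2) by simp
   moreover assume "((\<lambda>t. \<alpha> *\<^sub>R ((\<gamma>0 (\<alpha> * t) - y) /\<^sub>R (\<alpha> * t))) \<longlongrightarrow> \<alpha> *\<^sub>R ((s * c0) *\<^sub>R e)) (at_right 0)"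
   ultimately show ?thesis by (simp only:)
  qed
  have cl0: "((\<lambda>t. \<gamma>0 (\<alpha> * t)) \<longlongrightarrow> y) (at_right 0)" using curve_deriv(1)[OF has_derivative_const g2] .
  have V1: "((\<lambda>t. (V (\<gamma>0 (\<alpha> * t)) - V y) / (\<alpha> * t)) \<longlongrightarrow> 0) (at_right 0)"
   using filterlim_compose[OF g0(3) fl] .
  have V2: "((\<lambda>t. \<alpha> * ((V (\<gamma>0 (\<alpha> * t)) - V y) / (\<alpha> * t))) \<longlongrightarrow> \<alpha> * 0) (at_right 0)"
   by (intro tendsto_intros V1)
  then have V3: "((\<lambda>t. (V (\<gamma>0 (\<alpha> * t)) - V y) / t) \<longlongrightarrow> 0) (at_right 0)" using a by simp
  have "\<forall>\<^sub>F t in at_right 0. \<gamma> t \<in> ball y r" "\<forall>\<^sub>F t in at_right 0. \<gamma>0 (\<alpha> * t) \<in> ball y r"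
   using topological_tendstoD[OF cl, of "ball y r"] topological_tendstoD[OF cl0, of "ball y r"] r by auto
  then have "\<forall>\<^sub>F t in at_right 0. norm ((V (\<gamma> t) - V (\<gamma>0 (\<alpha> * t))) / t) <= L * norm ((\<gamma> t - y) /\<^sub>R t - (\<gamma>0 (\<alpha> * t) - y) /\<^sub>R t)"
   using pos
  proof eventually_elim
   case (elim t)
   have "\<bar>V (\<gamma> t) - V (\<gamma>0 (\<alpha> * t))\<bar> <= L * norm (\<gamma> t - \<gamma>0 (\<alpha> * t))" using lip elim by (simp add: dist_norm)
   then have "\<bar>V (\<gamma> t) - V (\<gamma>0 (\<alpha> * t))\<bar> / t <= L * norm (\<gamma> t - \<gamma>0 (\<alpha> * t)) / t" using elim by (simp add: divide_right_mono)
   moreover have "(\<gamma> t - y) /\<^sub>R t - (\<gamma>0 (\<alpha> * t) - y) /\<^sub>R t = (\<gamma> t - \<gamma>0 (\<alpha> * t)) /\<^sub>R t"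
    by (simp flip: scaleR_diff_right)
   ultimately show ?case using elim by (simp add: divide_inverse abs_mult mult_ac)
  qed
  moreover have "((\<lambda>t. L * norm ((\<gamma> t - y) /\<^sub>R t - (\<gamma>0 (\<alpha> * t) - y) /\<^sub>R t)) \<longlongrightarrow> L * norm (c *\<^sub>R e - c *\<^sub>R e)) (at_right 0)"
   by (intro tendsto_intros g g2)
  then have "((\<lambda>t. L * norm ((\<gamma> t - y) /\<^sub>R t - (\<gamma>0 (\<alpha> * t) - y) /\<^sub>R t)) \<longlongrightarrow> 0) (at_right 0)" by simp
  ultimately have "((\<lambda>t. (V (\<gamma> t) - V (\<gamma>0 (\<alpha> * t))) / t) \<longlongrightarrow> 0) (at_right 0)" by (rule Lim_null_comparison)
  from tendsto_add[OF this V3] show ?thesis by (simp add: add_divide_distrib diff_divide_distrib)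
 qed
qed

text \<open>Since z is orthogonal to \<open>e\<close>, |z + s t e|^2 = |z|^2 + t^2, so the inversion
  factor is stationary at t = 0 and the inverted curve again leaves with velocity along
  \<open>e\<close>.\<close>

lemma kelvin_neum:
 fixes V :: "'a::euclidean_space => real"
 assumes e: "norm e = 1" and z: "z \<bullet> e = 0" "z \<noteq> 0" and l: "l > 0" and L: "L >= 0" and r: "r > 0"
  and n1: "neum V e (x + z)" and n2: "neum V e (x + (l^2 / (z \<bullet> z)) *\<^sub>R z)"
  and lip1: "\<And>a b. a \<in> ball (x + z) r ==> b \<in> ball (x + z) r ==> \<bar>V a - V b\<bar> <= L * dist a b"
  and lip2: "\<And>a b. a \<in> ball (x + (l^2 / (z \<bullet> z)) *\<^sub>R z) r ==> b \<in> ball (x + (l^2 / (z \<bullet> z)) *\<^sub>R z) r ==> \<bar>V a - V b\<bar> <= L * dist a b"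
 shows "neum (\<lambda>z. V (x + z) - kelvin l V x z) e z"
 unfolding neum_def
proof (intro ballI exI conjI)
 fix s :: real assume s: "s \<in> {1, -1}"
 let ?a = "kexp TYPE('a)"
 define \<gamma> where "\<gamma> t = z + (s * t) *\<^sub>R e" for t
 have pos: "\<forall>\<^sub>F t::real in at_right 0. t > 0" by (simp add: eventually_at_right_less)
 show "(0::real) < 1" by simp
 show g: "((\<lambda>t. (\<gamma> t - z) /\<^sub>R t) \<longlongrightarrow> (s * 1) *\<^sub>R e) (at_right 0)"
 proof (rule tendsto_eventually)
  show "\<forall>\<^sub>F t in at_right 0. (\<gamma> t - z) /\<^sub>R t = (s * 1) *\<^sub>R e"
   using pos by (rule eventually_mono) (simp add: \<gamma>_def mult.commute)
 qed
 then have g1: "((\<lambda>t. (x + \<gamma> t - (x + z)) /\<^sub>R t) \<longlongrightarrow> s *\<^sub>R e) (at_right 0)" by simp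
 have A: "((\<lambda>t. (V (x + \<gamma> t) - V (x + z)) / t) \<longlongrightarrow> 0) (at_right 0)"
  by (rule neum_lipschitz[OF n1 r L lip1 g1])
 define q where "q = z \<bullet> z"
 have q: "q > 0" using z by (simp add: q_def)
 have ss: "s * s = 1" using s by auto
 have ee: "e \<bullet> e = 1" using e by (simp add: norm_eq_1)
 have gg: "\<gamma> t \<bullet> \<gamma> t = q + t^2" for t
 proof -
  have "\<gamma> t \<bullet> \<gamma> t = q + (s * s) * t^2 * (e \<bullet> e)"
   using z(1) by (simp add: \<gamma>_def q_def inner_add_left inner_add_right inner_commute power2_eq_square mult_ac)
  then show ?thesis using ss ee by simp
 qed
 define k where "k t = l^2 / (q + t^2)" for t
 have k0: "k 0 = l^2 / q" by (simp add: k_def)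
 have dk: "(k has_real_derivative 0) (at 0)"
  unfolding k_def using q by (auto intro!: derivative_eq_intros)
 have kr: "((\<lambda>t. (k t - k 0) / t) \<longlongrightarrow> 0) (at_right 0)"
 proof -
  have "(k has_real_derivative 0) (at 0 within {0<..})" using dk by (rule has_field_derivative_at_within)
  then show ?thesis by (simp add: has_field_derivative_iff)
 qed
 have k00: "k 0 > 0" using q l by (simp add: k0)
 have dka: "((\<lambda>t. k t powr ?a) has_real_derivative 0) (at 0)"
  using DERIV_chain2[OF has_real_derivative_powr[OF k00, of ?a] dk] by simp
 have kar: "((\<lambda>t. (k t powr ?a - k 0 powr ?a) / t) \<longlongrightarrow> 0) (at_right 0)"
 proof -
  have "((\<lambda>t. k t powr ?a) has_real_derivative 0) (at 0 within {0<..})" using dka by (rule has_field_derivative_at_within)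
  then show ?thesis by (simp add: has_field_derivative_iff)
 qed
 have kc: "(k \<longlongrightarrow> k 0) (at_right 0)"
  using DERIV_isCont[OF dk] by (simp add: isCont_def filterlim_at_split)
 have "((\<lambda>t. k t *\<^sub>R ((\<gamma> t - z) /\<^sub>R t) + ((k t - k 0) / t) *\<^sub>R z) \<longlongrightarrow> k 0 *\<^sub>R ((s * 1) *\<^sub>R e) + 0 *\<^sub>R z) (at_right 0)"
  by (intro tendsto_intros kc g kr)
 moreover have "k t *\<^sub>R ((\<gamma> t - z) /\<^sub>R t) + ((k t - k 0) / t) *\<^sub>R z = (x + k t *\<^sub>R \<gamma> t - (x + k 0 *\<^sub>R z)) /\<^sub>R t" for t
  by (simp add: algebra_simps divide_inverse)
 ultimately have g2: "((\<lambda>t. (x + k t *\<^sub>R \<gamma> t - (x + (l^2 / (z \<bullet> z)) *\<^sub>R z)) /\<^sub>R t) \<longlongrightarrow> (k 0 * s) *\<^sub>R e) (at_right 0)"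
  by (simp add: k0 q_def)
 have B: "((\<lambda>t. (V (x + k t *\<^sub>R \<gamma> t) - V (x + (l^2 / (z \<bullet> z)) *\<^sub>R z)) / t) \<longlongrightarrow> 0) (at_right 0)"
  by (rule neum_lipschitz[OF n2 r L lip2 g2])
 let ?V0 = "V (x + (l^2 / (z \<bullet> z)) *\<^sub>R z)"
 have ka: "((\<lambda>t. k t powr ?a) \<longlongrightarrow> k 0 powr ?a) (at_right 0)"
  using k00 by (intro tendsto_powr kc tendsto_const) auto
 have "((\<lambda>t. (V (x + \<gamma> t) - V (x + z)) / t - (k t powr ?a * ((V (x + k t *\<^sub>R \<gamma> t) - ?V0) / t) + ?V0 * ((k t powr ?a - k 0 powr ?a) / t)))
  \<longlongrightarrow> 0 - (k 0 powr ?a * 0 + ?V0 * 0)) (at_right 0)"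
  by (intro tendsto_intros A B ka kar)
 moreover have "(V (x + \<gamma> t) - V (x + z)) / t - (k t powr ?a * ((V (x + k t *\<^sub>R \<gamma> t) - ?V0) / t) + ?V0 * ((k t powr ?a - k 0 powr ?a) / t))
  = (V (x + \<gamma> t) - kelvin l V x (\<gamma> t) - (V (x + z) - kelvin l V x z)) / t" for t
 proof -
  have 1: "kelvin l V x (\<gamma> t) = k t powr ?a * V (x + k t *\<^sub>R \<gamma> t)" unfolding kelvin_def gg k_def ..
  have 2: "kelvin l V x z = k 0 powr ?a * ?V0" by (simp add: kelvin_def k0 q_def)
  show ?thesis unfolding 1 2 by (simp add: diff_divide_distrib add_divide_distrib algebra_simps)
 qed
 ultimately show "((\<lambda>t. (V (x + \<gamma> t) - kelvin l V x (\<gamma> t) - (V (x + z) - kelvin l V x z)) / t) \<longlongrightarrow> 0) (at_right 0)"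
  by simp
qed

section \<open>Compactness and passage to the limit in a blow-up\<close>

text \<open>Arzela-Ascoli on growing domains. On a given ball the functions are controlled only for
  large \<open>m\<close>; the cut-off \<open>f'\<close> supplies a bound for all indices while
  pointwise limits are extracted on a countable dense set.\<close>

lemma locally_uniform_subsequence:
 fixes f :: "nat => 'a::euclidean_space => 'b::euclidean_space"
 assumes bd: "\<And>N. \<forall>\<^sub>F m in sequentially. \<forall>x\<in>ball 0 N. norm (f m x) <= B"
  and eq: "\<And>N. \<forall>\<^sub>F m in sequentially. \<forall>x\<in>ball 0 N. \<forall>y\<in>ball 0 N. dist x y <= s --> dist (f m x) (f m y) <= L * dist x y"
  and s: "s > 0" and L: "L >= 0"
 obtains r g where "strict_mono (r :: nat => nat)"
  "\<And>N \<nu>. \<nu> > 0 ==> \<forall>\<^sub>F m in sequentially. \<forall>x\<in>ball 0 N. dist (f (r m) x) (g x) < \<nu>"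
proof -
 obtain D :: "'a set" where D: "countable D" "\<And>X. open X ==> X \<noteq> {} ==> \<exists>d\<in>D. d \<in> X"
  using countable_dense_exists by blast
 define f' where "f' m x = (if norm (f m x) <= B then f m x else 0)" for m x
 have "norm (f' n x) <= max B 0" if "x \<in> D" for n x by (auto simp: f'_def le_max_iff_disj)
 then obtain r where r: "strict_mono (r::nat=>nat)" "\<And>x. x \<in> D ==> \<exists>l. (\<lambda>n. f' (r n) x) \<longlonglongrightarrow> l"
  using function_convergent_subsequence[OF D(1)] by blast
 have sub: "\<forall>\<^sub>F m in sequentially. P (r m)" if "\<forall>\<^sub>F m in sequentially. P m" for P
  using that eventually_subseq[OF r(1)] by blast
 have cD: "Cauchy (\<lambda>n. f (r n) x)" if xD: "x \<in> D" for x
 proof -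
  obtain l where l: "(\<lambda>n. f' (r n) x) \<longlonglongrightarrow> l" using r(2)[OF xD] by blast
  have "\<forall>\<^sub>F m in sequentially. f' (r m) x = f (r m) x"
   using sub[OF bd[of "norm x + 1"]] by (rule eventually_mono) (auto simp: f'_def)
  then have "(\<lambda>n. f (r n) x) \<longlonglongrightarrow> l" using l by (simp add: tendsto_cong)
  then show ?thesis using LIMSEQ_imp_Cauchy by blast
 qed
 have uc: "\<exists>M. \<forall>m\<ge>M. \<forall>n\<ge>M. \<forall>x\<in>ball 0 N. dist (f (r m) x) (f (r n) x) < \<nu>" if \<nu>: "\<nu> > 0" for N \<nu>
 proof -
  define \<delta> where "\<delta> = min 1 (min s (\<nu> / (4 * (L + 1))))"
  have \<delta>: "\<delta> > 0" "\<delta> <= s" "\<delta> <= 1" unfolding \<delta>_def using s L \<nu> by auto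
  have L\<delta>: "L * \<delta> <= \<nu> / 4"
  proof -
   have "L * \<delta> <= (L + 1) * (\<nu> / (4 * (L + 1)))" using L \<delta> \<nu> by (intro mult_mono) (auto simp: \<delta>_def)
   also have "... = \<nu> / 4" using L by (simp add: divide_simps)
   finally show ?thesis .
  qed
  have "cball 0 N \<subseteq> (\<Union>d\<in>D. ball d \<delta>)"
  proof
   fix x :: 'a
   obtain d where "d \<in> D" "d \<in> ball x \<delta>" using D(2)[of "ball x \<delta>"] \<delta> by auto
   then show "x \<in> (\<Union>d\<in>D. ball d \<delta>)" by (auto simp: dist_commute)
  qed
  then obtain T where T: "T \<subseteq> D" "finite T" "cball 0 N \<subseteq> (\<Union>d\<in>T. ball d \<delta>)"
   using compactE_image[OF compact_cball, of D "\<lambda>d. ball d \<delta>" 0 N] by (metis open_ball)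
  have "\<forall>d\<in>T. \<exists>M. \<forall>m\<ge>M. \<forall>n\<ge>M. dist (f (r m) d) (f (r n) d) < \<nu> / 4"
   using cD T(1) \<nu> unfolding Cauchy_def by (metis subsetD zero_less_divide_iff zero_less_numeral)
  then obtain MM where MM: "\<And>d m n. d \<in> T ==> m >= MM d ==> n >= MM d ==> dist (f (r m) d) (f (r n) d) < \<nu> / 4"
   by metis
  obtain M0 where M0: "\<And>m x y. m >= M0 ==> x \<in> ball 0 (N + 1) ==> y \<in> ball 0 (N + 1) ==> dist x y <= s ==> dist (f (r m) x) (f (r m) y) <= L * dist x y"
   using sub[OF eq[of "N + 1"]] unfolding eventually_sequentially by blast
  define M where "M = Max (insert M0 (MM ` T))"
  have M: "M0 <= M" "\<And>d. d \<in> T ==> MM d <= M" unfolding M_def using T(2) by auto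
  have "dist (f (r m) x) (f (r n) x) < \<nu>" if mn: "m >= M" "n >= M" and x: "x \<in> ball 0 N" for m n x
  proof -
   obtain d where d: "d \<in> T" "dist d x < \<delta>"
   proof -
    have "x \<in> cball 0 N" using x by simp
    then have "x \<in> (\<Union>d\<in>T. ball d \<delta>)" using T(3) by blast
    then show thesis using that by auto
   qed
   have dd: "d \<in> ball 0 (N + 1)" "x \<in> ball 0 (N + 1)"
    using x d(2) \<delta> dist_triangle[of 0 d x] by (auto simp: dist_commute)
   have "L * dist x d <= \<nu> / 4" using L\<delta> d(2) L mult_left_mono[of "dist x d" \<delta> L] by (simp add: dist_commute)
   then have 1: "dist (f (r i) x) (f (r i) d) <= \<nu> / 4" if "i >= M" for i
    using M0[of i x d] that M dd d(2) \<delta> by (simp add: dist_commute)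
   have 2: "dist (f (r m) d) (f (r n) d) < \<nu> / 4" using MM[OF d(1)] M(2)[OF d(1)] mn by simp
   have "dist (f (r m) x) (f (r n) x) <= dist (f (r m) x) (f (r m) d) + (dist (f (r m) d) (f (r n) d) + dist (f (r n) d) (f (r n) x))"
    by (meson add_left_mono dist_triangle order_trans)
   also have "... < \<nu>" using 1[OF mn(1)] 1[OF mn(2)] 2 \<nu> by (simp add: dist_commute)
   finally show ?thesis .
  qed
  then show ?thesis by blast
 qed
 have conv: "convergent (\<lambda>n. f (r n) x)" for x
 proof -
  have "Cauchy (\<lambda>n. f (r n) x)" unfolding Cauchy_def
  proof (intro allI impI)
   fix \<nu> :: real assume "\<nu> > 0"
   from uc[OF this, of "norm x + 1"] show "\<exists>M. \<forall>m\<ge>M. \<forall>n\<ge>M. dist (f (r m) x) (f (r n) x) < \<nu>" by fastforce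
  qed
  then show ?thesis by (rule Cauchy_convergent)
 qed
 define g where "g x = lim (\<lambda>n. f (r n) x)" for x
 have g: "(\<lambda>n. f (r n) x) \<longlonglongrightarrow> g x" for x using conv[of x] by (simp add: g_def convergent_LIMSEQ_iff)
 show thesis
 proof (rule that[OF r(1)])
  fix N \<nu> :: real assume \<nu>: "\<nu> > 0"
  obtain M where M: "\<And>m n x. m >= M ==> n >= M ==> x \<in> ball 0 N ==> dist (f (r m) x) (f (r n) x) < \<nu> / 2"
   using uc[OF half_gt_zero[OF \<nu>], of N] by blast
  have "dist (f (r m) x) (g x) < \<nu>" if "m >= M" "x \<in> ball 0 N" for m x
  proof -
   have "dist (f (r m) x) (g x) <= \<nu> / 2"
   proof (rule tendsto_upperbound)
    show "(\<lambda>n. dist (f (r m) x) (f (r n) x)) \<longlonglongrightarrow> dist (f (r m) x) (g x)" by (intro tendsto_intros g)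
    show "\<forall>\<^sub>F n in sequentially. dist (f (r m) x) (f (r n) x) <= \<nu> / 2"
     unfolding eventually_sequentially using M[OF that(1) _ that(2)] less_imp_le by blast
   qed simp
   then show ?thesis using \<nu> by simp
  qed
  then show "\<forall>\<^sub>F m in sequentially. \<forall>x\<in>ball 0 N. dist (f (r m) x) (g x) < \<nu>"
   unfolding eventually_sequentially by blast
 qed
qed

lemma nsol_subset: "nsol v \<Omega> e h F \<beta> ==> \<Omega>' \<subseteq> \<Omega> ==> nsol v \<Omega>' e h F \<beta>"
 unfolding nsol_def using continuous_on_subset by blast

lemma nsol_beta_mono:
 assumes "nsol v \<Omega> e h F \<beta>" "\<beta> <= \<beta>'" shows "nsol v \<Omega> e h F \<beta>'"
 unfolding nsol_def
proof (intro conjI ballI)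
 show "continuous_on \<Omega> v" using assms by (simp add: nsol_def)
 fix y assume y: "y \<in> \<Omega>"
 show "if y \<bullet> e = h then neum v e y else \<exists>G H. hess v y G H \<and> \<bar>tr H + F y\<bar> <= \<beta>' * norm (G y)"
 proof (cases "y \<bullet> e = h")
  case True then show ?thesis using nsol_neum[OF assms(1) y] by simp
 next
  case False
  obtain G H where GH: "hess v y G H" "\<bar>tr H + F y\<bar> <= \<beta> * norm (G y)" using nsol_hess[OF assms(1) y False] .
  have "\<beta> * norm (G y) <= \<beta>' * norm (G y)" using assms(2) by (intro mult_right_mono) auto
  then have "\<bar>tr H + F y\<bar> <= \<beta>' * norm (G y)" using GH(2) by linarith
  then have "\<exists>G H. hess v y G H \<and> \<bar>tr H + F y\<bar> <= \<beta>' * norm (G y)" using GH(1) by blast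
  then show ?thesis using False by simp
 qed
qed

lemma hess_translate:
 fixes V :: "'a::euclidean_space => real"
 assumes "hess V (x + z) G H"
 shows "hess (\<lambda>z. V (x + z)) z (\<lambda>z. G (x + z)) H"
proof -
 have s: "((\<lambda>z. x + z) has_derivative (\<lambda>h. h)) (at z)" for z :: 'a
  by (auto intro!: derivative_eq_intros)
 have "((\<lambda>z. x + z) \<longlongrightarrow> x + z) (nhds z)" by (intro tendsto_intros) (simp add: filterlim_ident)
 then have "\<forall>\<^sub>F u in nhds z. (V has_derivative (\<bullet>) (G (x + u))) (at (x + u))"
  using assms unfolding hess_def filterlim_iff by blast
 then have "\<forall>\<^sub>F u in nhds z. ((\<lambda>z. V (x + z)) has_derivative (\<bullet>) (G (x + u))) (at u)"
  by (rule eventually_mono) (use has_derivative_compose[OF s] in blast)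
 moreover have "((\<lambda>z. G (x + z)) has_derivative H) (at z)"
  using has_derivative_compose[OF s] assms unfolding hess_def by blast
 ultimately show ?thesis by (simp add: hess_def)
qed

text \<open>Bounds the gradients uniformly along a blow-up sequence, so that the first-order term
  vanishes together with its coefficient.\<close>

lemma hess_grad_lipschitz:
 assumes h: "hess V y G H" and r: "r > 0" and L: "L >= 0"
  and lip: "\<And>a. a \<in> ball y r ==> \<bar>V a - V y\<bar> <= L * dist a y"
 shows "norm (G y) <= L"
proof -
 have "\<forall>\<^sub>F z in nhds y. z \<in> ball y r" using r by (intro eventually_nhds_in_open) auto
 then have "\<forall>\<^sub>F z in nhds y. V z - V y <= L * norm (z - y)"
  by (rule eventually_mono) (use lip in \<open>force simp: dist_norm\<close>)
 moreover have "(V has_derivative (\<bullet>) (G y)) (at y)" using h unfolding hess_def by (auto dest: eventually_nhds_x_imp_x)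
 ultimately show ?thesis using grad_bound[of V "G y" y L] L by auto
qed

lemma lipschitz_isCont:
 fixes f :: "'a::metric_space => real"
 assumes s: "s > 0" and L: "L >= 0" and lip: "\<And>a b. dist a b <= s ==> \<bar>f a - f b\<bar> <= L * dist a b"
 shows "isCont f x"
 unfolding continuous_at_eps_delta
proof (intro allI impI)
 fix \<nu> :: real assume \<nu>: "\<nu> > 0"
 define d where "d = min s (\<nu> / (L + 1))"
 have d: "d > 0" "d <= s" "d <= \<nu> / (L + 1)" unfolding d_def using s L \<nu> by auto
 have "dist (f y) (f x) < \<nu>" if "dist y x < d" for y
 proof -
  have "\<bar>f y - f x\<bar> <= L * dist y x" using that d by (intro lip) auto
  also have "... <= L * d" using that L by (intro mult_left_mono) auto
  also have "... < (L + 1) * d" using d by simp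
  also have "... <= (L + 1) * (\<nu> / (L + 1))" using d L by (intro mult_left_mono) auto
  also have "... = \<nu>" using L by simp
  finally show ?thesis by (simp add: dist_real_def)
 qed
 then show "\<exists>d>0. \<forall>x'. dist x' x < d --> dist (f x') (f x) < \<nu>" using d by blast
qed

context psi begin

text \<open>Every viscosity inequality required by \<open>liouville\<close> is a limit of classical
  ones. The hyperplane passes through the origin for all \<open>m\<close> or escapes to infinity: in
  the first case inversions centred on it preserve it, in the second a bounded region eventually
  contains no Neumann point. The points \<open>P m\<close> keep the limit from being zero.\<close>

theorem blowup_limit:
 fixes W :: "nat => bool => 'a::euclidean_space => real"
 assumes n3: "DIM('a) >= 3" and pa: "p * kexp TYPE('a) < kexp TYPE('a) + 2" and e: "norm e = 1"
  and \<psi>pos: "\<And>a b. 0 <= a ==> 0 <= b ==> 0 < a + b ==> \<psi> True a b + \<psi> False a b > 0"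
  and R: "filterlim R at_top sequentially"
  and sol: "\<And>m j. nsol (W m j) (ball 0 (R m)) e (h m) (F m j) (\<beta> m)"
  and \<beta>0: "\<And>m. \<beta> m >= 0" and \<beta>: "\<beta> \<longlonglongrightarrow> 0"
  and W01: "\<And>m j y. y \<in> ball 0 (R m) ==> 0 <= W m j y \<and> W m j y <= 1"
  and hh: "(\<forall>m. h m = 0) \<or> filterlim (\<lambda>m. \<bar>h m\<bar>) at_top sequentially"
  and FF: "\<And>N \<nu> j. \<nu> > 0 ==> \<forall>\<^sub>F m in sequentially. \<forall>y\<in>ball 0 N. \<bar>F m j y - \<psi> j (W m True y) (W m False y)\<bar> <= \<nu>"
  and P: "\<And>m. norm (P m) <= D" "\<And>m. W m True (P m) + W m False (P m) >= 1"
 shows False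
proof -
 let ?a = "kexp TYPE('a)"
 have evR: "\<forall>\<^sub>F m in sequentially. N < R m" for N using R by (simp add: filterlim_at_top_dense)
 \<comment> \<open>Values lie in [0,1], so monotonicity bounds \<psi> by its value at (1,1); the
   added 1 is the deviation of \<open>F\<close> from \<psi> that is tolerated.\<close>
 define BF where "BF = \<psi> True 1 1 + \<psi> False 1 1 + 1"
 have \<psi>1: "\<psi> j a b <= BF - 1" if "0 <= a" "a <= 1" "0 <= b" "b <= 1" for j a b
 proof -
  have "\<psi> j a b <= \<psi> j 1 1" using that by (intro \<psi>mono) auto
  also have "... <= BF - 1" using \<psi>nn[of 1 1 True] \<psi>nn[of 1 1 False] unfolding BF_def by (cases j) auto
  finally show ?thesis .
 qed
 have BF: "BF >= 0" using \<psi>nn[of 1 1 True] \<psi>nn[of 1 1 False] unfolding BF_def by simp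
 obtain L s where L: "L > 0" and s: "s > 0" "s <= 1/4" and
  lip: "\<And>(v :: 'a => real) \<Omega> e h F x z. nsol v \<Omega> e h F 1 ==> norm e = 1 ==> cball z 1 \<subseteq> \<Omega> ==>
   \<forall>y\<in>\<Omega>. \<bar>v y\<bar> <= 1 ==> \<forall>y\<in>\<Omega>. \<bar>F y\<bar> <= BF ==> x \<in> cball z s ==> \<bar>v x - v z\<bar> <= L * dist x z"
  using nsol_lipschitz[of 1 1 BF, where 'a = 'a] BF by (metis zero_le_one)
 have lipW: "\<forall>\<^sub>F m in sequentially. \<forall>z\<in>ball 0 N. \<forall>x\<in>cball z s. \<bar>W m j x - W m j z\<bar> <= L * dist x z" for N j
 proof -
  have "\<forall>\<^sub>F m in sequentially. \<beta> m < 1" using \<beta> by (rule order_tendstoD) simp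
  with evR[of "N + 2"] FF[of 1 "N + 2" j, OF zero_less_one] show ?thesis
  proof eventually_elim
   case (elim m)
   have sub: "ball (0::'a) (N + 2) \<subseteq> ball 0 (R m)" using elim by auto
   have n: "nsol (W m j) (ball 0 (N + 2)) e (h m) (F m j) 1"
    by (rule nsol_beta_mono[OF nsol_subset[OF sol sub]]) (use elim in simp)
   have w: "0 <= W m i y \<and> W m i y <= 1" if "y \<in> ball 0 (N + 2)" for i y using that sub by (intro W01) auto
   have FB: "\<forall>y\<in>ball 0 (N + 2). \<bar>F m j y\<bar> <= BF"
   proof
    fix y :: 'a assume y: "y \<in> ball 0 (N + 2)"
    have "\<bar>F m j y - \<psi> j (W m True y) (W m False y)\<bar> <= 1" using elim y by blast
    moreover have "0 <= \<psi> j (W m True y) (W m False y)" "\<psi> j (W m True y) (W m False y) <= BF - 1"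
     using w[OF y] by (auto intro!: \<psi>nn \<psi>1)
    ultimately show "\<bar>F m j y\<bar> <= BF" by linarith
   qed
   show ?case
   proof (intro ballI)
    fix z x :: 'a assume z: "z \<in> ball 0 N" and x: "x \<in> cball z s"
    have "cball z 1 \<subseteq> ball 0 (N + 2)"
    proof
     fix u assume "u \<in> cball z 1"
     then show "u \<in> ball 0 (N + 2)" using z norm_triangle_ineq2[of u z] by (simp add: dist_norm norm_minus_commute)
    qed
    then show "\<bar>W m j x - W m j z\<bar> <= L * dist x z"
     using w by (intro lip[OF n e _ _ FB x]) auto
   qed
  qed
 qed
 define f where "f m y = (W m True y, W m False y)" for m y
 obtain r g where r: "strict_mono (r :: nat => nat)"
  and g: "\<And>N \<nu>. \<nu> > 0 ==> \<forall>\<^sub>F m in sequentially. \<forall>x\<in>ball 0 N. dist (f (r m) x) (g x) < \<nu>"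
 proof (rule locally_uniform_subsequence[of f 2 s "2 * L"])
  show "\<forall>\<^sub>F m in sequentially. \<forall>x\<in>ball 0 N. norm (f m x) <= 2" for N
   using evR[of N]
  proof eventually_elim
   case (elim m)
   show ?case
   proof
    fix x :: 'a assume "x \<in> ball 0 N"
    then have x: "x \<in> ball 0 (R m)" using elim by auto
    have "norm (f m x) <= norm (W m True x) + norm (W m False x)" unfolding f_def by (rule norm_Pair_le)
    also have "... <= 2" using W01[OF x, of True] W01[OF x, of False] by simp
    finally show "norm (f m x) <= 2" .
   qed
  qed
  show "\<forall>\<^sub>F m in sequentially. \<forall>x\<in>ball 0 N. \<forall>y\<in>ball 0 N. dist x y <= s --> dist (f m x) (f m y) <= 2 * L * dist x y" for N
   using lipW[of N True] lipW[of N False]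
  proof eventually_elim
   case (elim m)
   show ?case
   proof (intro ballI impI)
    fix x y :: 'a assume x: "x \<in> ball 0 N" and y: "y \<in> ball 0 N" and d: "dist x y <= s"
    have "dist (f m x) (f m y) = norm (W m True x - W m True y, W m False x - W m False y)"
     by (simp add: f_def dist_norm)
    also have "... <= norm (W m True x - W m True y) + norm (W m False x - W m False y)" by (rule norm_Pair_le)
    also have "... <= L * dist x y + L * dist x y"
     using elim(1)[rule_format, OF y, of x] elim(2)[rule_format, OF y, of x] d
     by (intro add_mono) (auto simp: dist_commute)
    finally show "dist (f m x) (f m y) <= 2 * L * dist x y" by simp
   qed
  qed
 qed (use s L in auto)
 define v where "v j y = (if j then fst (g y) else snd (g y))" for j y
 have sub: "\<forall>\<^sub>F m in sequentially. Q (r m)" if "\<forall>\<^sub>F m in sequentially. Q m" for Q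
  using that eventually_subseq[OF r] by blast
 have conv: "\<forall>\<^sub>F m in sequentially. \<forall>x\<in>ball 0 N. \<bar>W (r m) j x - v j x\<bar> < \<nu>" if "\<nu> > 0" for N \<nu> j
  using g[OF that, of N]
 proof eventually_elim
  case (elim m)
  show ?case
  proof
   fix x :: 'a assume "x \<in> ball 0 N"
   then have "dist (f (r m) x) (g x) < \<nu>" using elim by blast
   then have "dist (fst (f (r m) x)) (fst (g x)) < \<nu>" "dist (snd (f (r m) x)) (snd (g x)) < \<nu>"
    using dist_fst_le[of "f (r m) x" "g x"] dist_snd_le[of "f (r m) x" "g x"] by linarith+
   then show "\<bar>W (r m) j x - v j x\<bar> < \<nu>" by (cases j) (auto simp: v_def f_def dist_real_def)
  qed
 qed
 have v01: "0 <= v j y \<and> v j y <= 1" for j y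
 proof -
  have "0 <= v j y + \<nu> \<and> v j y <= 1 + \<nu>" if \<nu>: "\<nu> > 0" for \<nu>
  proof -
   have "\<forall>\<^sub>F m in sequentially. (\<forall>x\<in>ball 0 (norm y + 1). \<bar>W (r m) j x - v j x\<bar> < \<nu>) \<and> norm y + 1 < R (r m)"
    by (intro eventually_conj conv sub[OF evR] \<nu>)
   then obtain m where m: "\<forall>x\<in>ball 0 (norm y + 1). \<bar>W (r m) j x - v j x\<bar> < \<nu>" "norm y + 1 < R (r m)"
    using eventually_happens'[OF sequentially_bot] by blast
   have "y \<in> ball 0 (R (r m))" using m by simp
   then show ?thesis using W01[of y "r m" j] m(1)[rule_format, of y] by (simp add: abs_less_iff)
  qed
  then show ?thesis by (meson field_le_epsilon)
 qed
 have v0: "0 <= v j y" and v1: "v j y <= 1" for j y using v01 by auto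
 have lipv: "\<bar>v j x - v j y\<bar> <= L * dist x y" if d: "dist x y <= s" for j x y
 proof (rule field_le_epsilon)
  fix \<nu> :: real assume \<nu>: "\<nu> > 0"
  define N where "N = norm x + norm y + 1"
  have "\<forall>\<^sub>F m in sequentially. (\<forall>x\<in>ball 0 N. \<bar>W (r m) j x - v j x\<bar> < \<nu> / 2) \<and> (\<forall>z\<in>ball 0 N. \<forall>x\<in>cball z s. \<bar>W (r m) j x - W (r m) j z\<bar> <= L * dist x z)"
   by (intro eventually_conj conv sub[OF lipW]) (use \<nu> in auto)
  then obtain m where m: "\<forall>x\<in>ball 0 N. \<bar>W (r m) j x - v j x\<bar> < \<nu> / 2" "\<forall>z\<in>ball 0 N. \<forall>x\<in>cball z s. \<bar>W (r m) j x - W (r m) j z\<bar> <= L * dist x z"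
   using eventually_happens'[OF sequentially_bot] by blast
  have xy: "x \<in> ball 0 N" "y \<in> ball 0 N" by (auto simp: N_def add_nonneg_pos)
  have "\<bar>W (r m) j x - W (r m) j y\<bar> <= L * dist x y" using m(2)[rule_format, OF xy(2), of x] d by (simp add: dist_commute)
  then show "\<bar>v j x - v j y\<bar> <= L * dist x y + \<nu>" using m(1)[rule_format, OF xy(1)] m(1)[rule_format, OF xy(2)] by linarith
 qed
 have isc: "isCont (v j) x" for j x by (rule lipschitz_isCont[OF s(1) _ lipv]) (use L in auto)
 have contv: "continuous_on UNIV (v j)" for j using isc by (simp add: continuous_on_eq_continuous_at)
 define Fl where "Fl j y = \<psi> j (v True y) (v False y)" for j y
 have iscF: "isCont (Fl j) x" for j x
 proof (rule lipschitz_isCont[OF s(1)])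
  show "\<bar>Fl j a - Fl j b\<bar> <= (C * (2 * L)) * dist a b" if "dist a b <= s" for a b
  proof -
   have "\<bar>Fl j a - Fl j b\<bar> <= C * (\<bar>v True a - v True b\<bar> + \<bar>v False a - v False b\<bar>)"
    unfolding Fl_def by (intro \<psi>lip v0 v1)
   also have "... <= C * (L * dist a b + L * dist a b)" using lipv[OF that] C0 by (intro mult_left_mono add_mono) auto
   finally show ?thesis by (simp add: algebra_simps)
  qed
 qed (use C0 L in auto)
 \<comment> \<open>The rescaled solutions satisfy the limit equation up to \<nu>: the error consists
   of the first-order term, the deviation \<open>FF\<close>, and the change of \<psi> caused by
   uniform convergence.\<close>
 have key: "\<forall>\<^sub>F m in sequentially. \<forall>z\<in>ball 0 N. if z \<bullet> e = h (r m) then neum (W (r m) j) e z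
   else \<exists>G H. hess (W (r m) j) z G H \<and> \<bar>tr H + Fl j z\<bar> <= \<nu>" if \<nu>: "\<nu> > 0" for N \<nu> j
 proof -
  have p1: "\<nu> / (8 * (C + 1)) > 0" "\<nu> / (4 * (L + 1)) > 0" "\<nu> / 4 > 0" using \<nu> C0 L by auto
  have "\<forall>\<^sub>F m in sequentially. \<beta> m < \<nu> / (4 * (L + 1))" using \<beta> by (rule order_tendstoD) (use p1 in simp)
  from sub[OF this] sub[OF evR[of N]] sub[OF FF[OF p1(3), of N j]] sub[OF lipW[of N j]] conv[OF p1(1), of N True] conv[OF p1(1), of N False]
  show ?thesis
  proof eventually_elim
   case (elim m)
   show ?case
   proof
    fix z :: 'a assume z: "z \<in> ball 0 N"
    then have zR: "z \<in> ball 0 (R (r m))" using elim by auto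
    show "if z \<bullet> e = h (r m) then neum (W (r m) j) e z
     else \<exists>G H. hess (W (r m) j) z G H \<and> \<bar>tr H + Fl j z\<bar> <= \<nu>"
    proof (cases "z \<bullet> e = h (r m)")
     case True then show ?thesis using nsol_neum[OF sol zR] by simp
    next
     case False
     obtain G H where GH: "hess (W (r m) j) z G H" "\<bar>tr H + F (r m) j z\<bar> <= \<beta> (r m) * norm (G z)"
      using nsol_hess[OF sol zR False] .
     have "norm (G z) <= L"
      by (rule hess_grad_lipschitz[OF GH(1) s(1)]) (use L elim(4) z in \<open>auto\<close>)
     then have "\<beta> (r m) * norm (G z) <= \<nu> / (4 * (L + 1)) * (L + 1)"
      using elim(1) p1(2) \<open>norm (G z) <= L\<close> norm_ge_zero[of "G z"] by (intro mult_mono) linarith+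
     also have "... = \<nu> / 4" using L by (simp add: divide_simps)
     finally have 1: "\<bar>tr H + F (r m) j z\<bar> <= \<nu> / 4" using GH(2) by simp
     have 2: "\<bar>F (r m) j z - \<psi> j (W (r m) True z) (W (r m) False z)\<bar> <= \<nu> / 4" using elim(3) z by blast
     have "\<bar>\<psi> j (W (r m) True z) (W (r m) False z) - Fl j z\<bar> <= C * (\<bar>W (r m) True z - v True z\<bar> + \<bar>W (r m) False z - v False z\<bar>)"
      unfolding Fl_def using W01[OF zR] v0 v1 by (intro \<psi>lip) auto
     also have "... <= (C + 1) * (\<nu> / (8 * (C + 1)) + \<nu> / (8 * (C + 1)))"
      using elim(5,6) z C0 by (intro mult_mono add_mono) (auto simp: less_imp_le)
     also have "... = \<nu> / 4" using C0 by (simp add: divide_simps)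
     finally have 3: "\<bar>\<psi> j (W (r m) True z) (W (r m) False z) - Fl j z\<bar> <= \<nu> / 4" .
     have "\<bar>tr H + Fl j z\<bar> <= \<nu>" using 1 2 3 \<nu> by linarith
     then have "\<exists>G H. hess (W (r m) j) z G H \<and> \<bar>tr H + Fl j z\<bar> <= \<nu>" using GH(1) by blast
     then show ?thesis using False by simp
    qed
   qed
  qed
 qed
 have cW: "\<forall>\<^sub>F m in sequentially. continuous_on (ball 0 N) (W (r m) j)" for N j
  using sub[OF evR[of N]]
 proof eventually_elim
  case (elim m)
  then have "ball (0::'a) N \<subseteq> ball 0 (R (r m))" by auto
  then show ?case using sol[of "r m" j] continuous_on_subset unfolding nsol_def by blast
 qed
 \<comment> \<open>Both signs at once: \<sigma> = 1 yields the supersolution and \<sigma> = -1 the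
   subsolution property of the limit.\<close>
 have sgn: "vsup 0 (\<lambda>z. \<sigma> * v j z) y (\<sigma> * Fl j y)" if \<sigma>: "\<sigma> \<in> {1, -1}" for \<sigma> j y
 proof (rule vsup_lim[where w = "\<lambda>m z. \<sigma> * W (r m) j z" and r = 1 and e = e and h = "\<lambda>m. h (r m)"])
  have cb: "cball y 1 \<subseteq> ball 0 (norm y + 2)"
  proof
   fix u assume "u \<in> cball y 1"
   then show "u \<in> ball 0 (norm y + 2)" using norm_triangle_ineq2[of u y] by (simp add: dist_norm norm_minus_commute)
  qed
  show "\<forall>\<^sub>F m in sequentially. \<forall>z\<in>cball y 1. \<bar>\<sigma> * W (r m) j z - \<sigma> * v j z\<bar> < \<nu>" if "\<nu> > 0" for \<nu>
   using conv[OF that, of "norm y + 2" j]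
  proof eventually_elim
   case (elim m)
   have eq: "\<bar>\<sigma> * W (r m) j z - \<sigma> * v j z\<bar> = \<bar>W (r m) j z - v j z\<bar>" for z using \<sigma> by auto
   show ?case
   proof
    fix z assume "z \<in> cball y 1"
    then have "z \<in> ball 0 (norm y + 2)" using cb by blast
    from elim[rule_format, OF this] eq[of z] show "\<bar>\<sigma> * W (r m) j z - \<sigma> * v j z\<bar> < \<nu>" by linarith
   qed
  qed
  show "\<forall>\<^sub>F m in sequentially. continuous_on (cball y 1) (\<lambda>z. \<sigma> * W (r m) j z)"
   using cW[of "norm y + 2" j] by (rule eventually_mono) (intro continuous_intros continuous_on_subset[OF _ cb])
  fix \<nu> :: real assume \<nu>: "\<nu> > 0"
  obtain d where d: "d > 0" "\<And>z. dist z y < d ==> dist (Fl j z) (Fl j y) < \<nu> / 2"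
   using iscF[of y j] \<nu> unfolding continuous_at_eps_delta by (metis half_gt_zero)
  show "\<exists>d>0. \<forall>\<^sub>F m in sequentially. \<forall>z\<in>ball y d. if z \<bullet> e = h (r m) then neum (\<lambda>z. \<sigma> * W (r m) j z) e z
    else \<exists>G H. hess (\<lambda>z. \<sigma> * W (r m) j z) z G H \<and> tr H <= - (\<sigma> * Fl j y) + \<nu> + 0 * norm (G z)"
  proof (intro exI conjI)
   show "min d 1 > 0" using d by simp
   have "\<nu> / 2 > 0" using \<nu> by simp
   from key[OF this, of "norm y + 2" j]
   show "\<forall>\<^sub>F m in sequentially. \<forall>z\<in>ball y (min d 1). if z \<bullet> e = h (r m) then neum (\<lambda>z. \<sigma> * W (r m) j z) e z
    else \<exists>G H. hess (\<lambda>z. \<sigma> * W (r m) j z) z G H \<and> tr H <= - (\<sigma> * Fl j y) + \<nu> + 0 * norm (G z)"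
   proof eventually_elim
    case (elim m)
    show ?case
    proof
     fix z assume z: "z \<in> ball y (min d 1)"
     then have "z \<in> cball y 1" by auto
     then have zN: "z \<in> ball 0 (norm y + 2)" using cb by blast
     note k = elim[rule_format, OF zN]
     show "if z \<bullet> e = h (r m) then neum (\<lambda>z. \<sigma> * W (r m) j z) e z
      else \<exists>G H. hess (\<lambda>z. \<sigma> * W (r m) j z) z G H \<and> tr H <= - (\<sigma> * Fl j y) + \<nu> + 0 * norm (G z)"
     proof (cases "z \<bullet> e = h (r m)")
      case True then show ?thesis using k \<sigma> neum_minus[of "W (r m) j" e z] by auto
     next
      case False
      then obtain G H where GH: "hess (W (r m) j) z G H" "\<bar>tr H + Fl j z\<bar> <= \<nu> / 2" using k by auto
      have Fd: "\<bar>Fl j z - Fl j y\<bar> < \<nu> / 2" using d(2)[of z] z by (simp add: dist_real_def dist_commute)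
      have "\<sigma> * tr H <= - (\<sigma> * Fl j y) + \<nu> + 0"
      proof (cases "\<sigma> = 1")
       case True
       show ?thesis unfolding True using Fd GH(2) by linarith
      next
       case False
       then have m1: "\<sigma> = -1" using \<sigma> by simp
       show ?thesis unfolding m1 using Fd GH(2) by linarith
      qed
      then have "tr (\<lambda>h. \<sigma> *\<^sub>R H h) <= - (\<sigma> * Fl j y) + \<nu> + 0 * norm (\<sigma> *\<^sub>R G z)" by (simp add: tr_scale)
      with hess_scale[OF GH(1), of \<sigma>] have "\<exists>G H. hess (\<lambda>z. \<sigma> * W (r m) j z) z G H \<and> tr H <= - (\<sigma> * Fl j y) + \<nu> + 0 * norm (G z)"
       by blast
      then show ?thesis using False by simp
     qed
    qed
   qed
  qed
 qed (use e in auto)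
 have vs: "vsup 0 (v j) y (\<psi> j (v True y) (v False y))" for j y
  using sgn[of 1 j y] by (simp add: Fl_def)
 have vsn: "vsup 0 (\<lambda>z. - v j z) y (- \<psi> j (v True y) (v False y))" for j y
  using sgn[of "-1" j y] by (simp add: Fl_def)
 \<comment> \<open>The subtraction takes place before the limit: off the hyperplane the
   approximating solutions and their Kelvin transforms have Hessians that may be subtracted, and on
   it \<open>kelvin_neum\<close> applies.\<close>
 have vsk: "vsup 0 (\<lambda>z. v j (x + z) - kelvin l (v j) x z) y
    (Fl j (x + y) - (l^2 / (y \<bullet> y)) powr (?a + 2) * Fl j (x + (l^2 / (y \<bullet> y)) *\<^sub>R y))"
  if x: "x \<bullet> e = 0" and l: "l > 0" and y: "y \<noteq> 0" for j l x y
 proof -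
  define r1 where "r1 = norm y / 2"
  have r1: "r1 > 0" using y by (simp add: r1_def)
  define \<kappa>M where "\<kappa>M = 4 * l^2 / (norm y)^2"
  have \<kappa>M: "\<kappa>M > 0" using y l by (simp add: \<kappa>M_def)
  have zlow: "norm z >= r1" "norm z <= 3 * r1" "z \<noteq> 0" if "z \<in> cball y r1" for z
  proof -
   have "norm (y - z) <= r1" using that by (simp add: dist_norm)
   then show "norm z >= r1" "norm z <= 3 * r1" using norm_triangle_ineq2[of y z] norm_triangle_ineq2[of z y]
    by (auto simp: r1_def norm_minus_commute)
   then show "z \<noteq> 0" using r1 by auto
  qed
  have \<kappa>: "0 < l^2 / (z \<bullet> z)" "l^2 / (z \<bullet> z) <= \<kappa>M" if "z \<in> cball y r1" for z
  proof -
   show "0 < l^2 / (z \<bullet> z)" using zlow[OF that] l by simp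
   have "r1^2 <= (norm z)^2" using zlow[OF that] r1 by (intro power_mono) auto
   then have "l^2 / (norm z)^2 <= l^2 / r1^2" using r1 l using zlow(3)[OF that] by (intro divide_left_mono) auto
   also have "l^2 / r1^2 = \<kappa>M" by (simp add: r1_def \<kappa>M_def power_divide)
   finally show "l^2 / (z \<bullet> z) <= \<kappa>M" by (simp add: dot_square_norm)
  qed
  \<comment> \<open>The points z near \<open>y\<close>, their translates x + z and their inverted
    images all stay in the ball of this radius, so one radius serves all locally uniform
    bounds.\<close>
  define N where "N = norm x + 3 * r1 + \<kappa>M * (3 * r1) + 2"
  have inN: "z \<in> ball 0 N" "x + z \<in> ball 0 N" "x + (l^2 / (z \<bullet> z)) *\<^sub>R z \<in> ball 0 N" if z: "z \<in> cball y r1" for z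
  proof -
   have a: "\<kappa>M * (3 * r1) >= 0" using \<kappa>M r1 by simp
   show "z \<in> ball 0 N" using zlow(2)[OF z] a norm_ge_zero[of x] by (simp add: N_def del: norm_ge_zero)
   show "x + z \<in> ball 0 N" using zlow(2)[OF z] a norm_triangle_ineq[of x z] by (simp add: N_def)
   have "norm ((l^2 / (z \<bullet> z)) *\<^sub>R z) = (l^2 / (z \<bullet> z)) * norm z" using \<kappa>(1)[OF z] by simp
   also have "... <= \<kappa>M * (3 * r1)" using \<kappa>[OF z] zlow[OF z] \<kappa>M by (intro mult_mono) auto
   finally show "x + (l^2 / (z \<bullet> z)) *\<^sub>R z \<in> ball 0 N" using r1 norm_triangle_ineq[of x "(l^2 / (z \<bullet> z)) *\<^sub>R z"] by (simp add: N_def)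
  qed
  define M1 where "M1 = \<kappa>M powr ?a"
  define M2 where "M2 = \<kappa>M powr (?a + 2)"
  have a0: "?a > 0" using n3 by (simp add: kexp_def)
  have M1: "(l^2 / (z \<bullet> z)) powr ?a <= M1" and M2: "(l^2 / (z \<bullet> z)) powr (?a + 2) <= M2" if "z \<in> cball y r1" for z
   unfolding M1_def M2_def using \<kappa>[OF that] a0 by (auto intro!: powr_mono2)
  have M0: "M1 >= 0" "M2 >= 0" by (auto simp: M1_def M2_def)
  have hN: "\<forall>\<^sub>F m in sequentially. h (r m) = 0 \<or> \<bar>h (r m)\<bar> > N"
  proof (cases "\<forall>m. h m = 0")
   case False
   then have "filterlim (\<lambda>m. \<bar>h m\<bar>) at_top sequentially" using hh by blast
   then have "\<forall>\<^sub>F m in sequentially. N < \<bar>h m\<bar>" by (simp add: filterlim_at_top_dense)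
   from sub[OF this] show ?thesis by (rule eventually_mono) auto
  qed auto
  define T where "T z = Fl j (x + z) - (l^2 / (z \<bullet> z)) powr (?a + 2) * Fl j (x + (l^2 / (z \<bullet> z)) *\<^sub>R z)" for z
  have "vsup 0 (\<lambda>z. v j (x + z) - kelvin l (v j) x z) y (T y)"
  proof (rule vsup_lim[where w = "\<lambda>m z. W (r m) j (x + z) - kelvin l (W (r m) j) x z" and r = r1 and e = e and h = "\<lambda>m. h (r m)"])
   show "\<forall>\<^sub>F m in sequentially. \<forall>z\<in>cball y r1. \<bar>W (r m) j (x + z) - kelvin l (W (r m) j) x z - (v j (x + z) - kelvin l (v j) x z)\<bar> < \<nu>"
    if \<nu>: "\<nu> > 0" for \<nu>
   proof -
    define \<nu>' where "\<nu>' = \<nu> / (2 * (1 + M1))"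
    have \<nu>': "\<nu>' > 0" using \<nu> M0 by (simp add: \<nu>'_def)
    show ?thesis using conv[OF \<nu>', of N j]
    proof eventually_elim
     case (elim m)
     show ?case
     proof
      fix z assume z: "z \<in> cball y r1"
      define u where "u = x + (l^2 / (z \<bullet> z)) *\<^sub>R z"
      have 1: "\<bar>W (r m) j (x + z) - v j (x + z)\<bar> < \<nu>'" "\<bar>W (r m) j u - v j u\<bar> < \<nu>'"
       using elim inN[OF z] by (auto simp: u_def)
      have "kelvin l (W (r m) j) x z - kelvin l (v j) x z = (l^2 / (z \<bullet> z)) powr ?a * (W (r m) j u - v j u)"
       by (simp add: kelvin_def u_def algebra_simps)
      moreover have "\<bar>(l^2 / (z \<bullet> z)) powr ?a * (W (r m) j u - v j u)\<bar> <= M1 * \<nu>'"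
       unfolding abs_mult using M1[OF z] 1(2) M0 by (intro mult_mono) auto
      ultimately have "\<bar>W (r m) j (x + z) - kelvin l (W (r m) j) x z - (v j (x + z) - kelvin l (v j) x z)\<bar> < \<nu>' + M1 * \<nu>'"
       using 1(1) by linarith
      also have "... = (1 + M1) * \<nu>'" by (simp add: algebra_simps)
      also have "... = \<nu> / 2" using M0 by (simp add: \<nu>'_def divide_simps)
      finally show "\<bar>W (r m) j (x + z) - kelvin l (W (r m) j) x z - (v j (x + z) - kelvin l (v j) x z)\<bar> < \<nu>" using \<nu> by simp
     qed
    qed
   qed
   show "\<forall>\<^sub>F m in sequentially. continuous_on (cball y r1) (\<lambda>z. W (r m) j (x + z) - kelvin l (W (r m) j) x z)"
    using cW[of N j]
   proof eventually_elim
    case (elim m)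
    show ?case unfolding kelvin_def using inN zlow \<kappa>
     by (intro continuous_intros continuous_on_compose2[OF elim]) (force simp: less_imp_neq)+
   qed
   fix \<nu> :: real assume \<nu>: "\<nu> > 0"
   have "isCont T y"
   proof -
    have "isCont (\<lambda>z. l^2 / (z \<bullet> z)) y" using y by (intro continuous_intros) auto
    moreover have "l^2 / (y \<bullet> y) \<noteq> 0" using y l by simp
    ultimately show ?thesis unfolding T_def
     by (intro continuous_intros isCont_o2[OF _ iscF]) auto
   qed
   then obtain d where d: "d > 0" "\<And>z. dist z y < d ==> dist (T z) (T y) < \<nu> / 2"
    using \<nu> unfolding continuous_at_eps_delta by (metis half_gt_zero)
   define \<nu>' where "\<nu>' = \<nu> / (2 * (1 + M2))"
   have \<nu>': "\<nu>' > 0" using \<nu> M0 by (simp add: \<nu>'_def)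
   have \<nu>'2: "\<nu>' + M2 * \<nu>' = \<nu> / 2"
   proof -
    have "\<nu>' + M2 * \<nu>' = (1 + M2) * \<nu>'" by (simp add: algebra_simps)
    also have "... = \<nu> / 2" using M0 by (simp add: \<nu>'_def divide_simps)
    finally show ?thesis .
   qed
   show "\<exists>d>0. \<forall>\<^sub>F m in sequentially. \<forall>z\<in>ball y d. if z \<bullet> e = h (r m) then neum (\<lambda>z. W (r m) j (x + z) - kelvin l (W (r m) j) x z) e z
    else \<exists>G H. hess (\<lambda>z. W (r m) j (x + z) - kelvin l (W (r m) j) x z) z G H \<and> tr H <= - T y + \<nu> + 0 * norm (G z)"
   proof (intro exI conjI)
    show "min d r1 > 0" using d r1 by simp
    show "\<forall>\<^sub>F m in sequentially. \<forall>z\<in>ball y (min d r1). if z \<bullet> e = h (r m) then neum (\<lambda>z. W (r m) j (x + z) - kelvin l (W (r m) j) x z) e z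
     else \<exists>G H. hess (\<lambda>z. W (r m) j (x + z) - kelvin l (W (r m) j) x z) z G H \<and> tr H <= - T y + \<nu> + 0 * norm (G z)"
     using key[OF \<nu>', of N j] sub[OF lipW[of "N + 1" j]] hN
    proof eventually_elim
     case (elim m)
     show ?case
     proof
      fix z assume z: "z \<in> ball y (min d r1)"
      then have zc: "z \<in> cball y r1" by auto
      define k where "k = l^2 / (z \<bullet> z)"
      have k0: "k > 0" using \<kappa>(1)[OF zc] by (simp add: k_def)
      note iN = inN[OF zc, folded k_def]
      have se: "(x + z) \<bullet> e = z \<bullet> e" "(x + k *\<^sub>R z) \<bullet> e = k * (z \<bullet> e)" using x by (auto simp: inner_add_left)
      have far: "u \<bullet> e \<noteq> h (r m)" if "h (r m) \<noteq> 0" "u \<in> ball 0 N" for u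
       using elim(3) that Cauchy_Schwarz_ineq2[of u e] e by auto
      have key1: "if (x + z) \<bullet> e = h (r m) then neum (W (r m) j) e (x + z)
       else \<exists>G H. hess (W (r m) j) (x + z) G H \<and> \<bar>tr H + Fl j (x + z)\<bar> <= \<nu>'"
       and key2: "if (x + k *\<^sub>R z) \<bullet> e = h (r m) then neum (W (r m) j) e (x + k *\<^sub>R z)
       else \<exists>G H. hess (W (r m) j) (x + k *\<^sub>R z) G H \<and> \<bar>tr H + Fl j (x + k *\<^sub>R z)\<bar> <= \<nu>'"
       using elim(1) iN by blast+
      show "if z \<bullet> e = h (r m) then neum (\<lambda>z. W (r m) j (x + z) - kelvin l (W (r m) j) x z) e z
       else \<exists>G H. hess (\<lambda>z. W (r m) j (x + z) - kelvin l (W (r m) j) x z) z G H \<and> tr H <= - T y + \<nu> + 0 * norm (G z)"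
      proof (cases "z \<bullet> e = h (r m)")
       case True
       then have h0: "h (r m) = 0" using far iN(1) by blast
       \<comment> \<open>Radius s/2, so that any two points of the ball lie within the range
         \<open>s\<close> of the local Lipschitz bound.\<close>
       have lp: "\<bar>W (r m) j a - W (r m) j b\<bar> <= L * dist a b" if "c \<in> ball 0 N" "a \<in> ball c (s/2)" "b \<in> ball c (s/2)" for a b c
       proof -
        have "norm b < N + 1" using that s norm_triangle_ineq2[of b c] by (auto simp: dist_norm norm_minus_commute)
        moreover have "dist b a <= s" using that dist_triangle_half_r[of c b s a] by auto
        ultimately show ?thesis using elim(2)[rule_format, of b a] by (simp add: dist_commute)
       qed
       have "neum (\<lambda>z. W (r m) j (x + z) - kelvin l (W (r m) j) x z) e z"
       proof (rule kelvin_neum[OF e _ _ l, of z L "s/2"])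
        show "neum (W (r m) j) e (x + z)" using key1 True se by simp
        show "neum (W (r m) j) e (x + (l\<^sup>2 / (z \<bullet> z)) *\<^sub>R z)" using key2 True h0 se by (simp add: k_def)
        show "\<bar>W (r m) j a - W (r m) j b\<bar> <= L * dist a b" if "a \<in> ball (x + z) (s/2)" "b \<in> ball (x + z) (s/2)" for a b
         by (rule lp[OF iN(2) that])
        show "\<bar>W (r m) j a - W (r m) j b\<bar> <= L * dist a b" if "a \<in> ball (x + (l\<^sup>2 / (z \<bullet> z)) *\<^sub>R z) (s/2)" "b \<in> ball (x + (l\<^sup>2 / (z \<bullet> z)) *\<^sub>R z) (s/2)" for a b
         by (rule lp[OF iN(3)[unfolded k_def] that])
       qed (use True h0 zlow[OF zc] L s in auto)
       then show ?thesis using True by simp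
      next
       case False
       have ne1: "(x + z) \<bullet> e \<noteq> h (r m)" using False se by simp
       have ne2: "(x + k *\<^sub>R z) \<bullet> e \<noteq> h (r m)"
        using far[OF _ iN(3)] se False k0 by (cases "h (r m) = 0") auto
       obtain G1 H1 where 1: "hess (W (r m) j) (x + z) G1 H1" "\<bar>tr H1 + Fl j (x + z)\<bar> <= \<nu>'" using key1 ne1 by auto
       obtain G2 H2 where 2: "hess (W (r m) j) (x + k *\<^sub>R z) G2 H2" "\<bar>tr H2 + Fl j (x + k *\<^sub>R z)\<bar> <= \<nu>'" using key2 ne2 by auto
       obtain G3 H3 where 3: "hess (kelvin l (W (r m) j) x) z G3 H3" "tr H3 = k powr (?a + 2) * tr H2"
        using kelvin_hess[OF zlow(3)[OF zc] l 2(1)[unfolded k_def]] unfolding k_def by metis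
       have kM: "k powr (?a + 2) <= M2" using M2[OF zc] by (simp add: k_def)
       have "\<bar>k powr (?a + 2) * (tr H2 + Fl j (x + k *\<^sub>R z))\<bar> <= M2 * \<nu>'"
        unfolding abs_mult using kM 2(2) M0 by (intro mult_mono) auto
       moreover have "k powr (?a + 2) * (tr H2 + Fl j (x + k *\<^sub>R z)) = tr H3 + k powr (?a + 2) * Fl j (x + k *\<^sub>R z)"
        by (simp add: 3(2) algebra_simps)
       moreover have "T z = Fl j (x + z) - k powr (?a + 2) * Fl j (x + k *\<^sub>R z)" by (simp add: T_def k_def)
       moreover have "\<bar>T z - T y\<bar> < \<nu> / 2" using d(2)[of z] z by (simp add: dist_real_def dist_commute)
       ultimately have "tr H1 - tr H3 <= - T y + \<nu>" using 1(2) \<nu>'2 by linarith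
       then have "tr (\<lambda>h. H1 h - H3 h) <= - T y + \<nu> + 0 * norm (G1 (x + z) - G3 z)" by (simp add: tr_diff)
       with hess_diff[OF hess_translate[OF 1(1)] 3(1)]
       have "\<exists>G H. hess (\<lambda>z. W (r m) j (x + z) - kelvin l (W (r m) j) x z) z G H \<and> tr H <= - T y + \<nu> + 0 * norm (G z)"
        by blast
       then show ?thesis using False by simp
      qed
     qed
    qed
   qed
  qed (use e r1 in auto)
  then show ?thesis by (simp add: T_def)
 qed
 have zero: "v True y + v False y = 0" for y
  by (rule liouville[OF n3 pa e \<psi>pos contv v0 v1 s(1) _ lipv vs vsn vsk[unfolded Fl_def]]) (use L in auto)
 have "\<forall>\<^sub>F m in sequentially. (\<forall>x\<in>ball 0 (D + 1). \<bar>W (r m) True x - v True x\<bar> < 1/2) \<and> (\<forall>x\<in>ball 0 (D + 1). \<bar>W (r m) False x - v False x\<bar> < 1/2)"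
  by (intro eventually_conj conv) auto
 then obtain m where m: "\<forall>x\<in>ball 0 (D + 1). \<bar>W (r m) True x - v True x\<bar> < 1/2" "\<forall>x\<in>ball 0 (D + 1). \<bar>W (r m) False x - v False x\<bar> < 1/2"
  using eventually_happens'[OF sequentially_bot] by blast
 have "P (r m) \<in> ball 0 (D + 1)" using P(1)[of "r m"] by simp
 then have "W (r m) True (P (r m)) + W (r m) False (P (r m)) < 1"
  using m zero[of "P (r m)"] by (smt (verit) field_sum_of_halves)
 then show False using P(2)[of "r m"] by simp
qed

end

section \<open>Rescaling, and the class of nonlinearities\<close>

lemma hess_affine:
 fixes V :: "'a::euclidean_space => real"
 assumes h: "hess V (c + \<nu> *\<^sub>R z) G H"
 shows "hess (\<lambda>z. V (c + \<nu> *\<^sub>R z)) z (\<lambda>z. \<nu> *\<^sub>R G (c + \<nu> *\<^sub>R z)) (\<lambda>h. (\<nu> * \<nu>) *\<^sub>R H h)"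
proof -
 have s: "((\<lambda>z. c + \<nu> *\<^sub>R z) has_derivative (\<lambda>h. \<nu> *\<^sub>R h)) (at z)" for z :: 'a
  by (auto intro!: derivative_eq_intros)
 have "((\<lambda>z. c + \<nu> *\<^sub>R z) \<longlongrightarrow> c + \<nu> *\<^sub>R z) (nhds z)" by (intro tendsto_intros) (simp add: filterlim_ident)
 then have "\<forall>\<^sub>F u in nhds z. (V has_derivative (\<bullet>) (G (c + \<nu> *\<^sub>R u))) (at (c + \<nu> *\<^sub>R u))"
  using h unfolding hess_def filterlim_iff by blast
 then have 1: "\<forall>\<^sub>F u in nhds z. ((\<lambda>z. V (c + \<nu> *\<^sub>R z)) has_derivative (\<bullet>) (\<nu> *\<^sub>R G (c + \<nu> *\<^sub>R u))) (at u)"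
 proof (rule eventually_mono)
  fix u assume "(V has_derivative (\<bullet>) (G (c + \<nu> *\<^sub>R u))) (at (c + \<nu> *\<^sub>R u))"
  from has_derivative_compose[OF s this]
  show "((\<lambda>z. V (c + \<nu> *\<^sub>R z)) has_derivative (\<bullet>) (\<nu> *\<^sub>R G (c + \<nu> *\<^sub>R u))) (at u)"
   by (rule has_derivative_eq_rhs) (simp add: fun_eq_iff)
 qed
 have GH: "(G has_derivative H) (at (c + \<nu> *\<^sub>R z))" using h by (simp add: hess_def)
 have "((\<lambda>z. \<nu> *\<^sub>R G (c + \<nu> *\<^sub>R z)) has_derivative (\<lambda>h. \<nu> *\<^sub>R H (\<nu> *\<^sub>R h))) (at z)"
  by (intro has_derivative_scaleR_right has_derivative_compose[OF s GH])
 then have 2: "((\<lambda>z. \<nu> *\<^sub>R G (c + \<nu> *\<^sub>R z)) has_derivative (\<lambda>h. (\<nu> * \<nu>) *\<^sub>R H h)) (at z)"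
  by (simp add: linear_cmul[OF has_derivative_linear[OF GH]])
 show ?thesis unfolding hess_def using 1 2 by (rule conjI)
qed

text \<open>The coefficient of the first-order term is multiplied by \<nu>; this is why blow-up
  limits carry no first-order term.\<close>

lemma nsol_rescale:
 fixes V :: "'a::euclidean_space => real"
 assumes V: "nsol V \<Omega> e h F \<beta>" and \<nu>: "\<nu> > 0" and M: "M > 0"
  and \<Omega>': "\<And>y. y \<in> \<Omega>' ==> c + \<nu> *\<^sub>R y \<in> \<Omega>"
 shows "nsol (\<lambda>y. V (c + \<nu> *\<^sub>R y) / M) \<Omega>' e ((h - c \<bullet> e) / \<nu>) (\<lambda>y. \<nu>^2 / M * F (c + \<nu> *\<^sub>R y)) (\<nu> * \<beta>)"
 unfolding nsol_def
proof (intro conjI ballI)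
 have cV: "continuous_on \<Omega> V" using V by (simp add: nsol_def)
 have "continuous_on \<Omega>' (\<lambda>y. c + \<nu> *\<^sub>R y)" by (intro continuous_intros)
 then have "continuous_on \<Omega>' (\<lambda>y. V (c + \<nu> *\<^sub>R y))"
  by (rule continuous_on_compose2[OF cV]) (use \<Omega>' in blast)
 then show "continuous_on \<Omega>' (\<lambda>y. V (c + \<nu> *\<^sub>R y) / M)"
  by (rule continuous_on_divide[OF _ continuous_on_const]) (use M in simp)
 fix y assume y: "y \<in> \<Omega>'"
 have hy: "y \<bullet> e = (h - c \<bullet> e) / \<nu> \<longleftrightarrow> (c + \<nu> *\<^sub>R y) \<bullet> e = h" using \<nu> by (auto simp: inner_add_left field_simps)
 show "if y \<bullet> e = (h - c \<bullet> e) / \<nu> then neum (\<lambda>y. V (c + \<nu> *\<^sub>R y) / M) e y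
  else \<exists>G H. hess (\<lambda>y. V (c + \<nu> *\<^sub>R y) / M) y G H \<and> \<bar>tr H + \<nu>^2 / M * F (c + \<nu> *\<^sub>R y)\<bar> <= \<nu> * \<beta> * norm (G y)"
 proof (cases "y \<bullet> e = (h - c \<bullet> e) / \<nu>")
  case True
  then have n: "neum V e (c + \<nu> *\<^sub>R y)" using nsol_neum[OF V \<Omega>'[OF y]] hy by simp
  have "neum (\<lambda>y. V (c + \<nu> *\<^sub>R y) / M) e y" unfolding neum_def
  proof
   fix s :: real assume "s \<in> {1, -1}"
   then obtain \<gamma> k where g: "k > 0" "((\<lambda>t. (\<gamma> t - (c + \<nu> *\<^sub>R y)) /\<^sub>R t) \<longlongrightarrow> (s * k) *\<^sub>R e) (at_right 0)"
    "((\<lambda>t. (V (\<gamma> t) - V (c + \<nu> *\<^sub>R y)) / t) \<longlongrightarrow> 0) (at_right 0)" using n unfolding neum_def by blast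
   define \<gamma>' where "\<gamma>' t = (\<gamma> t - c) /\<^sub>R \<nu>" for t
   have gc: "c + \<nu> *\<^sub>R \<gamma>' t = \<gamma> t" for t using \<nu> by (simp add: \<gamma>'_def)
   have "((\<lambda>t. (1/\<nu>) *\<^sub>R ((\<gamma> t - (c + \<nu> *\<^sub>R y)) /\<^sub>R t)) \<longlongrightarrow> (1/\<nu>) *\<^sub>R ((s * k) *\<^sub>R e)) (at_right 0)"
    by (intro tendsto_intros g)
   moreover have "(1/\<nu>) *\<^sub>R ((\<gamma> t - (c + \<nu> *\<^sub>R y)) /\<^sub>R t) = (\<gamma>' t - y) /\<^sub>R t" for t
   proof -
    have "\<gamma>' t - y = (1/\<nu>) *\<^sub>R (\<gamma> t - (c + \<nu> *\<^sub>R y))" using \<nu> by (simp add: \<gamma>'_def divide_inverse algebra_simps)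
    then show ?thesis by (simp add: mult.commute)
   qed
   ultimately have 1: "((\<lambda>t. (\<gamma>' t - y) /\<^sub>R t) \<longlongrightarrow> (s * (k / \<nu>)) *\<^sub>R e) (at_right 0)" by simp
   have "((\<lambda>t. (1/M) * ((V (\<gamma> t) - V (c + \<nu> *\<^sub>R y)) / t)) \<longlongrightarrow> (1/M) * 0) (at_right 0)"
    by (intro tendsto_intros g)
   then have 2: "((\<lambda>t. (V (c + \<nu> *\<^sub>R \<gamma>' t) / M - V (c + \<nu> *\<^sub>R y) / M) / t) \<longlongrightarrow> 0) (at_right 0)"
    unfolding gc by (simp add: diff_divide_distrib mult.commute)
   show "\<exists>\<gamma> c'. 0 < c' \<and> ((\<lambda>t. (\<gamma> t - y) /\<^sub>R t) \<longlongrightarrow> (s * c') *\<^sub>R e) (at_right 0) \<and>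
    ((\<lambda>t. (V (c + \<nu> *\<^sub>R \<gamma> t) / M - V (c + \<nu> *\<^sub>R y) / M) / t) \<longlongrightarrow> 0) (at_right 0)"
    using 1 2 g(1) \<nu> by (intro exI[of _ \<gamma>'] exI[of _ "k / \<nu>"]) simp
  qed
  then show ?thesis using True by simp
 next
  case False
  then have ne: "(c + \<nu> *\<^sub>R y) \<bullet> e \<noteq> h" using hy by simp
  obtain G H where GH: "hess V (c + \<nu> *\<^sub>R y) G H" "\<bar>tr H + F (c + \<nu> *\<^sub>R y)\<bar> <= \<beta> * norm (G (c + \<nu> *\<^sub>R y))"
   using nsol_hess[OF V \<Omega>'[OF y] ne] .
  have h1: "hess (\<lambda>z. (1/M) * V (c + \<nu> *\<^sub>R z)) y (\<lambda>z. (1/M) *\<^sub>R (\<nu> *\<^sub>R G (c + \<nu> *\<^sub>R z))) (\<lambda>h. (1/M) *\<^sub>R ((\<nu> * \<nu>) *\<^sub>R H h))"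
   by (intro hess_scale hess_affine GH)
  have eqA: "tr (\<lambda>h. (1/M) *\<^sub>R ((\<nu> * \<nu>) *\<^sub>R H h)) + \<nu>^2 / M * F (c + \<nu> *\<^sub>R y) = \<nu>^2 / M * (tr H + F (c + \<nu> *\<^sub>R y))"
   unfolding tr_scale by (simp add: power2_eq_square algebra_simps)
  have leB: "\<nu>^2 / M * \<bar>tr H + F (c + \<nu> *\<^sub>R y)\<bar> <= \<nu>^2 / M * (\<beta> * norm (G (c + \<nu> *\<^sub>R y)))"
   using GH(2) M by (intro mult_left_mono) auto
  have eqC: "\<nu>^2 / M * (\<beta> * norm (G (c + \<nu> *\<^sub>R y))) = \<nu> * \<beta> * norm ((1/M) *\<^sub>R (\<nu> *\<^sub>R G (c + \<nu> *\<^sub>R y)))"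
   using \<nu> M by (simp add: power2_eq_square)
  have eqD: "\<bar>\<nu>^2 / M * (tr H + F (c + \<nu> *\<^sub>R y))\<bar> = \<nu>^2 / M * \<bar>tr H + F (c + \<nu> *\<^sub>R y)\<bar>"
   using M by (simp add: abs_mult)
  have "\<bar>tr (\<lambda>h. (1/M) *\<^sub>R ((\<nu> * \<nu>) *\<^sub>R H h)) + \<nu>^2 / M * F (c + \<nu> *\<^sub>R y)\<bar> <= \<nu> * \<beta> * norm ((1/M) *\<^sub>R (\<nu> *\<^sub>R G (c + \<nu> *\<^sub>R y)))"
   unfolding eqA eqD eqC[symmetric] by (rule leB)
  with h1 have "\<exists>G H. hess (\<lambda>z. (1/M) * V (c + \<nu> *\<^sub>R z)) y G H \<and> \<bar>tr H + \<nu>^2 / M * F (c + \<nu> *\<^sub>R y)\<bar> <= \<nu> * \<beta> * norm (G y)" by blast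
  then show ?thesis using False by simp
 qed
qed

text \<open>Common ground of the scalar equation and the system. The Lipschitz constant on [0,s]^2
  tends to zero with s, which drives the final contraction, and is of order s^(p-1) for large s,
  which fits the blow-up. \<open>\<psi>\<close> is the rescaled limit of \<open>G\<close> at
  infinity along rays.\<close>

locale nonlin =
 fixes G \<psi> :: "bool => real => real => real" and p \<mu> C :: real
 assumes p1: "p > 1" and \<mu>: "0 < \<mu>" "\<mu> <= p - 1" and C0: "C >= 0"
  and Gnn: "\<And>j a b. 0 <= a ==> 0 <= b ==> 0 <= G j a b"
  and Glip: "\<And>j a b a' b' s. 0 <= a ==> a <= s ==> 0 <= b ==> b <= s ==> 0 <= a' ==> a' <= s ==> 0 <= b' ==> b' <= s ==>
    \<bar>G j a b - G j a' b'\<bar> <= C * (s powr \<mu> + s powr (p - 1)) * (\<bar>a - a'\<bar> + \<bar>b - b'\<bar>)"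
  and Glim: "\<And>j a b. 0 <= a ==> 0 <= b ==> ((\<lambda>t. G j (a * t) (b * t) * t powr (- p)) \<longlongrightarrow> \<psi> j a b) at_top"
  and \<psi>mono: "\<And>j a b a' b'. 0 <= a ==> a <= a' ==> 0 <= b ==> b <= b' ==> \<psi> j a b <= \<psi> j a' b'"
  and \<psi>pos: "\<And>a b. 0 <= a ==> 0 <= b ==> 0 < a + b ==> \<psi> True a b + \<psi> False a b > 0"
  and Gpos: "\<And>a b. 0 <= a ==> 0 <= b ==> 0 < a + b ==> G True a b + G False a b > 0"
begin

definition "Gs t j a b = G j (a * t) (b * t) * t powr (- p)"

text \<open>For t >= 1 the condition \<mu> <= p - 1 lets t^(p-1) dominate, and t^(-p) cancels it
  together with the factor t from the arguments. The bound is uniform in t and passes to the limit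
  \<psi>.\<close>

lemma Gs_lip:
 assumes t: "t >= 1" and "0 <= a" "a <= 1" "0 <= b" "b <= 1" "0 <= a'" "a' <= 1" "0 <= b'" "b' <= 1"
 shows "\<bar>Gs t j a b - Gs t j a' b'\<bar> <= 2 * C * (\<bar>a - a'\<bar> + \<bar>b - b'\<bar>)"
proof -
 have "\<bar>G j (a * t) (b * t) - G j (a' * t) (b' * t)\<bar> <= C * (t powr \<mu> + t powr (p - 1)) * (\<bar>a * t - a' * t\<bar> + \<bar>b * t - b' * t\<bar>)"
  using assms by (intro Glip) auto
 also have "\<bar>a * t - a' * t\<bar> + \<bar>b * t - b' * t\<bar> = (\<bar>a - a'\<bar> + \<bar>b - b'\<bar>) * t"
  using t by (simp add: abs_mult distrib_right flip: left_diff_distrib)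
 also have "C * (t powr \<mu> + t powr (p - 1)) * ((\<bar>a - a'\<bar> + \<bar>b - b'\<bar>) * t) <= C * (t powr (p - 1) + t powr (p - 1)) * ((\<bar>a - a'\<bar> + \<bar>b - b'\<bar>) * t)"
  using t C0 \<mu> by (intro mult_right_mono mult_left_mono add_right_mono powr_mono) auto
 also have "... = 2 * C * (\<bar>a - a'\<bar> + \<bar>b - b'\<bar>) * t powr p"
  using t by (simp add: powr_diff field_simps)
 finally have "\<bar>G j (a * t) (b * t) - G j (a' * t) (b' * t)\<bar> * t powr (- p) <= 2 * C * (\<bar>a - a'\<bar> + \<bar>b - b'\<bar>) * t powr p * t powr (- p)"
  by (intro mult_right_mono) auto
 also have "... = 2 * C * (\<bar>a - a'\<bar> + \<bar>b - b'\<bar>)" using t by (simp add: powr_minus)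
 finally show ?thesis unfolding Gs_def by (simp add: abs_mult flip: left_diff_distrib)
qed

lemma Gs_lim: assumes "0 <= a" "0 <= b" shows "((\<lambda>t. Gs t j a b) \<longlongrightarrow> \<psi> j a b) at_top"
 unfolding Gs_def using Glim assms by blast

lemma psi_lip:
 assumes "0 <= a" "a <= 1" "0 <= b" "b <= 1" "0 <= a'" "a' <= 1" "0 <= b'" "b' <= 1"
 shows "\<bar>\<psi> j a b - \<psi> j a' b'\<bar> <= 2 * C * (\<bar>a - a'\<bar> + \<bar>b - b'\<bar>)"
proof (rule tendsto_upperbound)
 show "((\<lambda>t. \<bar>Gs t j a b - Gs t j a' b'\<bar>) \<longlongrightarrow> \<bar>\<psi> j a b - \<psi> j a' b'\<bar>) at_top"
  using assms by (intro tendsto_intros Gs_lim) auto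
 show "\<forall>\<^sub>F t in at_top. \<bar>Gs t j a b - Gs t j a' b'\<bar> <= 2 * C * (\<bar>a - a'\<bar> + \<bar>b - b'\<bar>)"
  using eventually_ge_at_top[of 1] by (rule eventually_mono) (use assms Gs_lip in auto)
qed simp

text \<open>Substituting t s for s in the limit that defines \<psi> extracts the factor t^p.\<close>

lemma psi_hom:
 assumes t: "0 < t" and ab: "0 <= a" "0 <= b"
 shows "\<psi> j (t * a) (t * b) = t powr p * \<psi> j a b"
proof (rule tendsto_unique[of at_top])
 show "((\<lambda>s. G j (t * a * s) (t * b * s) * s powr (- p)) \<longlongrightarrow> \<psi> j (t * a) (t * b)) at_top"
  using t ab by (intro Glim) auto
 have fl: "filterlim (\<lambda>s. t * s) at_top at_top"
  using t by (rule filterlim_tendsto_pos_mult_at_top[OF tendsto_const _ filterlim_ident])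
 have "((\<lambda>s. t powr p * (G j (a * (t * s)) (b * (t * s)) * (t * s) powr (- p))) \<longlongrightarrow> t powr p * \<psi> j a b) at_top"
  by (intro tendsto_intros filterlim_compose[OF Glim fl] ab)
 moreover have "\<forall>\<^sub>F s in at_top. t powr p * (G j (a * (t * s)) (b * (t * s)) * (t * s) powr (- p)) = G j (t * a * s) (t * b * s) * s powr (- p)"
  using eventually_gt_at_top[of 0]
 proof eventually_elim
  case (elim s)
  have "t powr p * (t * s) powr (- p) = s powr (- p)" using t elim by (simp add: powr_mult powr_minus)
  then show ?case by (simp add: mult_ac)
 qed
 ultimately show "((\<lambda>s. G j (t * a * s) (t * b * s) * s powr (- p)) \<longlongrightarrow> t powr p * \<psi> j a b) at_top"
  by (rule Lim_transform_eventually)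
qed simp

lemma psi_nn: assumes "0 <= a" "0 <= b" shows "0 <= \<psi> j a b"
proof (rule tendsto_lowerbound[OF Gs_lim[OF assms]])
 show "\<forall>\<^sub>F t in at_top. 0 <= Gs t j a b"
  using eventually_ge_at_top[of 0] by (rule eventually_mono) (use assms Gnn in \<open>auto simp: Gs_def\<close>)
qed simp

lemma psi_locale: assumes "\<rho> >= 0" shows "psi (\<lambda>j a b. \<rho> * \<psi> j a b) p (\<rho> * (2 * C))"
proof
 show "\<rho> * \<psi> j (t * a) (t * b) = t powr p * (\<rho> * \<psi> j a b)" if "0 < t" "0 <= a" "0 <= b" for j t a b
  using psi_hom[OF that] by simp
 show "\<bar>\<rho> * \<psi> j a b - \<rho> * \<psi> j a' b'\<bar> <= \<rho> * (2 * C) * (\<bar>a - a'\<bar> + \<bar>b - b'\<bar>)"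
  if "0 <= a" "a <= 1" "0 <= b" "b <= 1" "0 <= a'" "a' <= 1" "0 <= b'" "b' <= 1" for j a b a' b'
 proof -
  have "\<bar>\<rho> * \<psi> j a b - \<rho> * \<psi> j a' b'\<bar> = \<rho> * \<bar>\<psi> j a b - \<psi> j a' b'\<bar>" using assms by (simp add: abs_mult flip: right_diff_distrib)
  also have "... <= \<rho> * (2 * C * (\<bar>a - a'\<bar> + \<bar>b - b'\<bar>))" using psi_lip[OF that] assms by (intro mult_left_mono)
  finally show ?thesis by simp
 qed
qed (use assms psi_nn \<psi>mono C0 in \<open>auto intro: mult_left_mono\<close>)

text \<open>Convergence is given for each fixed pair only; the equi-Lipschitz bound makes it uniform
  through a finite grid.\<close>

lemma Gs_unif:
 assumes \<nu>: "\<nu> > 0"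
 shows "\<forall>\<^sub>F t in at_top. \<forall>a b. 0 <= a --> a <= 1 --> 0 <= b --> b <= 1 --> \<bar>Gs t j a b - \<psi> j a b\<bar> < \<nu>"
proof -
 \<comment> \<open>Passing to the nearest point of a grid of mesh 1/N changes \<open>Gs\<close> and
   \<psi> by at most 4 C / N, a third of the allowed error.\<close>
 obtain N :: nat where N: "real N > 12 * C / \<nu>" "N > 0"
 proof -
  obtain N :: nat where "real N > max 1 (12 * C / \<nu>)" using reals_Archimedean2 by blast
  then show thesis by (intro that[of N]) auto
 qed
 have N': "4 * C / real N < \<nu> / 3"
 proof -
  have "12 * C < \<nu> * real N" using N \<nu> by (simp add: field_simps)
  then show ?thesis using N by (simp add: field_simps)
 qed
 have "\<forall>\<^sub>F t in at_top. \<forall>i\<in>{..N} \<times> {..N}. \<bar>Gs t j (real (fst i) / N) (real (snd i) / N) - \<psi> j (real (fst i) / N) (real (snd i) / N)\<bar> < \<nu> / 3"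
 proof (rule eventually_ball_finite)
  show "\<forall>i\<in>{..N} \<times> {..N}. \<forall>\<^sub>F t in at_top. \<bar>Gs t j (real (fst i) / N) (real (snd i) / N) - \<psi> j (real (fst i) / N) (real (snd i) / N)\<bar> < \<nu> / 3"
  proof
   fix i assume "i \<in> {..N} \<times> {..N}"
   have "((\<lambda>t. Gs t j (real (fst i) / N) (real (snd i) / N)) \<longlongrightarrow> \<psi> j (real (fst i) / N) (real (snd i) / N)) at_top"
    by (intro Gs_lim) auto
   from tendstoD[OF this, of "\<nu> / 3"] \<nu>
   show "\<forall>\<^sub>F t in at_top. \<bar>Gs t j (real (fst i) / N) (real (snd i) / N) - \<psi> j (real (fst i) / N) (real (snd i) / N)\<bar> < \<nu> / 3"
    by (simp add: dist_real_def)
  qed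
 qed auto
 with eventually_ge_at_top[of 1] show ?thesis
 proof eventually_elim
  case (elim t)
  show ?case
  proof (intro allI impI)
   fix a b :: real assume ab: "0 <= a" "a <= 1" "0 <= b" "b <= 1"
   have ap: "\<exists>i\<le>N. \<bar>x - real i / N\<bar> <= 1 / N" if x: "0 <= x" "x <= 1" for x
   proof -
    define i where "i = nat \<lfloor>x * N\<rfloor>"
    have fl: "real i = \<lfloor>x * N\<rfloor>" using x by (simp add: i_def)
    have "real i <= x * N" "x * N < real i + 1" unfolding fl by linarith+
    moreover have "x * N <= N" using x by (simp add: mult_left_le_one_le)
    ultimately have "real i <= N" by linarith
    moreover have "\<bar>x - real i / N\<bar> <= 1 / N"
    proof -
     have "x - real i / N = (x * N - real i) / N" using N by (simp add: field_simps)
     moreover have "\<bar>x * N - real i\<bar> <= 1" using \<open>real i <= x * N\<close> \<open>x * N < real i + 1\<close> by linarith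
     ultimately show ?thesis using N by (simp add: divide_right_mono)
    qed
    ultimately show ?thesis by (intro exI[of _ i]) simp
   qed
   obtain i where i: "i <= N" "\<bar>a - real i / N\<bar> <= 1 / N" using ap ab by blast
   obtain k where k: "k <= N" "\<bar>b - real k / N\<bar> <= 1 / N" using ap ab by blast
   define a' where "a' = real i / N" define b' where "b' = real k / N"
   have ab': "0 <= a'" "a' <= 1" "0 <= b'" "b' <= 1" using i k N by (auto simp: a'_def b'_def)
   have "2 * C * (\<bar>a - a'\<bar> + \<bar>b - b'\<bar>) <= 2 * C * (1 / N + 1 / N)"
    using i k C0 unfolding a'_def b'_def by (intro mult_left_mono add_mono) auto
   also have "... < \<nu> / 3" using N' by (simp add: mult_ac)
   finally have s: "2 * C * (\<bar>a - a'\<bar> + \<bar>b - b'\<bar>) < \<nu> / 3" .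
   have 1: "\<bar>Gs t j a b - Gs t j a' b'\<bar> < \<nu> / 3" using Gs_lip[OF elim(1) ab ab', of j] s by linarith
   have 2: "\<bar>\<psi> j a b - \<psi> j a' b'\<bar> < \<nu> / 3" using psi_lip[OF ab ab', of j] s by linarith
   have 3: "\<bar>Gs t j a' b' - \<psi> j a' b'\<bar> < \<nu> / 3" using elim(2) i k by (auto simp: a'_def b'_def)
   show "\<bar>Gs t j a b - \<psi> j a b\<bar> < \<nu>" using 1 2 3 by linarith
  qed
 qed
qed

end

section \<open>A priori bound in a chart by blow-up\<close>

lemma bounded_or_unbounded_subsequence:
 fixes d :: "nat => real"
 obtains r D where "strict_mono (r :: nat => nat)" "\<And>m. d (r m) <= D"
 | "filterlim d at_top sequentially"
proof (cases "\<exists>D. infinite {m. d m <= D}")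
 case True
 then obtain D where D: "infinite {m. d m <= D}" by blast
 obtain r :: "nat => nat" where r: "strict_mono r" "\<And>m. r m \<in> {m. d m <= D}"
  using infinite_enumerate[OF D] by blast
 then show ?thesis using that(1)[of r D] by simp
next
 case False
 have "\<forall>\<^sub>F m in sequentially. Z < d m" for Z
 proof -
  have "finite {m. d m <= Z}" using False by blast
  then have "finite {m. \<not> Z < d m}" by (simp add: not_less)
  then show ?thesis by (simp add: eventually_cofinite cofinite_eq_sequentially[symmetric])
 qed
 then show ?thesis using that(2) by (simp add: filterlim_at_top_dense)
qed

context nonlin begin

text \<open>Maximum points will be kept in the unit ball, so radius 3 leaves room 2 around them and
  the rescaled domains exhaust the space.\<close>

definition csol :: "('a::euclidean_space => real) => 'a => real => (bool => bool => real) => (bool => 'a => real) => bool" where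
 "csol \<rho> e \<beta> A V \<longleftrightarrow> (\<forall>j. nsol (V j) (ball 0 3) e 0
  (\<lambda>y. \<rho> y * (G j (V True y) (V False y) - (A j True * V True y + A j False * V False y))) \<beta>) \<and>
  (\<forall>j. \<forall>y\<in>ball 0 3. 0 <= V j y)"

text \<open>The alternative \<open>dd\<close> decides the shape of the limit. If the maximum points
  stay at bounded rescaled distance from the hyperplane, the blow-up is centred at their projections
  to it, which puts the hyperplane exactly at height 0; otherwise it is centred at the maximum
  points and the hyperplane recedes to infinity.\<close>

lemma chart_apriori_seq:
 fixes V :: "nat => bool => 'a::euclidean_space => real"
 assumes n3: "DIM('a) >= 3" and pa: "p * kexp TYPE('a) < kexp TYPE('a) + 2" and e: "norm e = 1"
  and \<rho>c: "continuous_on (ball 0 3) \<rho>" and \<rho>p: "\<And>y. y \<in> ball 0 3 ==> \<rho> y > 0" and \<beta>: "\<beta> >= 0"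
  and sol: "\<And>m. csol \<rho> e \<beta> (A m) (V m)" and A1: "\<And>m j i. \<bar>A m j i\<bar> <= 1"
  and M: "\<And>m. M m = V m True (y0 m) + V m False (y0 m)" and Mm: "\<And>m. M m > 0"
  and Minf: "filterlim M at_top sequentially"
  and mx: "\<And>m y. y \<in> ball 0 3 ==> V m True y + V m False y <= M m"
  and y0: "\<And>m. y0 m \<in> cball 0 1" and y0l: "y0 \<longlonglongrightarrow> yl"
  and dd: "(\<forall>m. \<bar>y0 m \<bullet> e\<bar> / (M m powr (- (p - 1) / 2)) <= D) \<or>
      filterlim (\<lambda>m. \<bar>y0 m \<bullet> e\<bar> / (M m powr (- (p - 1) / 2))) at_top sequentially"
 shows False
proof -
 \<comment> \<open>The scale with \<nu>^2 M^(p-1) = 1: the superlinear term keeps its size, while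
   the linear term is multiplied by M^(1-p) and vanishes in the limit.\<close>
 define \<nu> where "\<nu> m = M m powr (- (p - 1) / 2)" for m
 have \<nu>: "\<nu> m > 0" for m using Mm[of m] by (simp add: \<nu>_def)
 have \<nu>l: "\<nu> \<longlonglongrightarrow> 0"
 proof -
  have "((\<lambda>x. x powr (- (p - 1) / 2)) \<longlongrightarrow> 0) at_top" using p1 by (intro tendsto_neg_powr filterlim_ident) auto
  from filterlim_compose[OF this Minf] show ?thesis by (simp add: \<nu>_def[abs_def])
 qed
 define bnd where "bnd \<longleftrightarrow> (\<forall>m. \<bar>y0 m \<bullet> e\<bar> / \<nu> m <= D)"
 define c where "c m = (if bnd then y0 m - (y0 m \<bullet> e) *\<^sub>R e else y0 m)" for m
 have ee: "e \<bullet> e = 1" using e by (simp add: norm_eq_1)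
 have ny0: "norm (y0 m) <= 1" for m using y0[of m] by simp
 have nc: "norm (c m) <= 1" for m
 proof (cases bnd)
  case True
  have "(norm (c m))^2 = (norm (y0 m))^2 - (y0 m \<bullet> e)^2"
  proof -
   have cm: "c m = y0 m - (y0 m \<bullet> e) *\<^sub>R e" using True by (simp add: c_def)
   have "c m \<bullet> c m = y0 m \<bullet> y0 m - (y0 m \<bullet> e)^2"
    unfolding cm using ee by (simp add: inner_diff_left inner_diff_right inner_commute power2_eq_square)
   then show ?thesis by (simp only: dot_square_norm)
  qed
  also have "... <= (norm (y0 m))^2" by simp
  finally have "norm (c m) <= norm (y0 m)" by (rule power2_le_imp_le) simp
  then show ?thesis using ny0[of m] by simp
 qed (use ny0 in \<open>simp add: c_def\<close>)
 have cl: "c \<longlonglongrightarrow> yl"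
 proof (cases bnd)
  case True
  have "norm ((y0 m \<bullet> e) *\<^sub>R e) <= D * \<nu> m" for m
  proof -
   have "\<bar>y0 m \<bullet> e\<bar> / \<nu> m <= D" using True by (simp add: bnd_def)
   then show ?thesis using \<nu>[of m] e by (simp add: pos_divide_le_eq)
  qed
  moreover have "(\<lambda>m. D * \<nu> m) \<longlonglongrightarrow> D * 0" by (intro tendsto_intros \<nu>l)
  then have "(\<lambda>m. D * \<nu> m) \<longlonglongrightarrow> 0" by simp
  ultimately have "(\<lambda>m. (y0 m \<bullet> e) *\<^sub>R e) \<longlonglongrightarrow> 0"
   by (intro Lim_null_comparison[of "\<lambda>m. (y0 m \<bullet> e) *\<^sub>R e" "\<lambda>m. D * \<nu> m"]) auto
  from tendsto_diff[OF y0l this] show ?thesis using True by (simp add: c_def[abs_def])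
 next
  case False then show ?thesis using y0l by (simp add: c_def[abs_def])
 qed
 have nyl: "norm yl <= 1" using tendsto_upperbound[OF tendsto_norm[OF y0l]] ny0 by simp
 define \<rho>l where "\<rho>l = \<rho> yl"
 have \<rho>l: "\<rho>l > 0" using \<rho>p[of yl] nyl by (simp add: \<rho>l_def)
 define W where "W m j y = V m j (c m + \<nu> m *\<^sub>R y) / M m" for m j y
 define R where "R m = 2 / \<nu> m" for m
 define h where "h m = (0 - c m \<bullet> e) / \<nu> m" for m
 define F where "F m j y = (\<nu> m)^2 / M m * (\<rho> (c m + \<nu> m *\<^sub>R y) * (G j (V m True (c m + \<nu> m *\<^sub>R y)) (V m False (c m + \<nu> m *\<^sub>R y))
  - (A m j True * V m True (c m + \<nu> m *\<^sub>R y) + A m j False * V m False (c m + \<nu> m *\<^sub>R y))))" for m j y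
 have inb: "c m + \<nu> m *\<^sub>R y \<in> ball 0 3" if "y \<in> ball 0 (R m)" for m y
 proof -
  have "norm y < 2 / \<nu> m" using that by (simp add: R_def)
  then have "\<nu> m * norm y < 2" using \<nu>[of m] by (simp add: field_simps)
  then have "norm (\<nu> m *\<^sub>R y) < 2" using \<nu>[of m] by simp
  then show ?thesis using nc[of m] norm_triangle_ineq[of "c m" "\<nu> m *\<^sub>R y"] by simp
 qed
 have V0: "0 <= V m j y" if "y \<in> ball 0 3" for m j y using sol[of m] that unfolding csol_def by blast
 have V1: "V m j y <= M m" if "y \<in> ball 0 3" for m j y
  using mx[OF that, of m] V0[OF that, of m True] V0[OF that, of m False] by (cases j) auto
 have W01: "0 <= W m j y \<and> W m j y <= 1" if "y \<in> ball 0 (R m)" for m j y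
  unfolding W_def using V0[OF inb[OF that]] V1[OF inb[OF that]] Mm[of m] by simp
 have nsW: "nsol (W m j) (ball 0 (R m)) e (h m) (F m j) (\<nu> m * \<beta>)" for m j
 proof -
  have "nsol (V m j) (ball 0 3) e 0 (\<lambda>y. \<rho> y * (G j (V m True y) (V m False y) - (A m j True * V m True y + A m j False * V m False y))) \<beta>"
   using sol[of m] unfolding csol_def by blast
  from nsol_rescale[OF this \<nu>[of m] Mm[of m], of "ball 0 (R m)" "c m"] inb
  show ?thesis unfolding W_def[abs_def] h_def F_def[abs_def] by blast
 qed
 have Rinf: "filterlim R at_top sequentially" unfolding filterlim_at_top_dense
 proof
  fix Z :: real
  have "\<forall>\<^sub>F m in sequentially. \<nu> m < 2 / (\<bar>Z\<bar> + 1)" by (rule order_tendstoD(2)[OF \<nu>l]) simp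
  then show "\<forall>\<^sub>F m in sequentially. Z < R m"
  proof eventually_elim
   case (elim m)
   then have "\<nu> m * (\<bar>Z\<bar> + 1) < 2" by (simp add: field_simps)
   then have "\<bar>Z\<bar> + 1 < R m" using \<nu>[of m] by (simp add: R_def field_simps)
   then show ?case by simp
  qed
 qed
 show False
 proof (rule psi.blowup_limit[OF psi_locale[of \<rho>l], where W = W and R = R and h = h and F = F and \<beta> = "\<lambda>m. \<nu> m * \<beta>" and P = "\<lambda>m. (y0 m - c m) /\<^sub>R \<nu> m" and D = "max D 0" and e = e])
  show "0 <= \<rho>l" using \<rho>l by simp
  show "0 < \<rho>l * \<psi> True a b + \<rho>l * \<psi> False a b" if "0 <= a" "0 <= b" "0 < a + b" for a b
   using \<psi>pos[OF that] \<rho>l by (simp flip: distrib_left)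
  show "0 <= \<nu> m * \<beta>" for m using \<nu>[of m] \<beta> by simp
  have "(\<lambda>m. \<nu> m * \<beta>) \<longlonglongrightarrow> 0 * \<beta>" by (intro tendsto_intros \<nu>l)
  then show "(\<lambda>m. \<nu> m * \<beta>) \<longlonglongrightarrow> 0" by simp
  show "(\<forall>m. h m = 0) \<or> filterlim (\<lambda>m. \<bar>h m\<bar>) at_top sequentially"
  proof (cases bnd)
   case True
   then have "h m = 0" for m using ee by (simp add: h_def c_def inner_diff_left)
   then show ?thesis by blast
  next
   case False
   then have "filterlim (\<lambda>m. \<bar>y0 m \<bullet> e\<bar> / \<nu> m) at_top sequentially" using dd unfolding bnd_def \<nu>_def by blast
   moreover have "\<bar>h m\<bar> = \<bar>y0 m \<bullet> e\<bar> / \<nu> m" for m using False \<nu>[of m] by (simp add: h_def c_def abs_minus_commute)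
   ultimately show ?thesis by simp
  qed
  show "norm ((y0 m - c m) /\<^sub>R \<nu> m) <= max D 0" for m
  proof (cases bnd)
   case True
   then have "norm ((y0 m - c m) /\<^sub>R \<nu> m) = \<bar>y0 m \<bullet> e\<bar> / \<nu> m" using \<nu>[of m] e by (simp add: c_def divide_inverse mult.commute abs_mult)
   also have "... <= D" using True by (simp add: bnd_def)
   finally show ?thesis by simp
  qed (simp add: c_def)
  show "1 <= W m True ((y0 m - c m) /\<^sub>R \<nu> m) + W m False ((y0 m - c m) /\<^sub>R \<nu> m)" for m
  proof -
   have "c m + \<nu> m *\<^sub>R ((y0 m - c m) /\<^sub>R \<nu> m) = y0 m" using \<nu>[of m] by simp
   then show ?thesis unfolding W_def using M[of m] Mm[of m] by (simp flip: add_divide_distrib)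
  qed
  fix N \<eta> :: real and j assume \<eta>: "\<eta> > 0"
  define BF where "BF = \<psi> j 1 1 + 1"
  have BF: "BF >= 1" using psi_nn[of 1 1 j] by (simp add: BF_def)
  \<comment> \<open>Budget for the right-hand side: freezing the weight costs \<delta> (BF + 2) <=
    \<eta>/4, and replacing \<open>X\<close> by \<psi> costs 2 \<delta> \<rho>l <= \<eta>/2.\<close>
  define \<delta> where "\<delta> = Min {1, \<eta> / (4 * (\<rho>l + 1)), \<eta> / (4 * (BF + 2))}"
  have \<delta>: "\<delta> > 0" "\<delta> <= 1" "\<delta> <= \<eta> / (4 * (\<rho>l + 1))" "\<delta> <= \<eta> / (4 * (BF + 2))" using \<eta> \<rho>l BF by (auto simp: \<delta>_def)
  have "yl \<in> ball 0 3" using nyl by simp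
  then have "isCont \<rho> yl" using \<rho>c by (simp add: continuous_on_eq_continuous_at)
  then obtain d where d: "d > 0" "\<And>y. dist y yl < d ==> dist (\<rho> y) (\<rho> yl) < \<delta>"
   using \<delta>(1) unfolding continuous_at_eps_delta by metis
  have e1: "\<forall>\<^sub>F m in sequentially. dist (c m) yl < d / 2" using tendstoD[OF cl, of "d/2"] d by simp
  have e2: "\<forall>\<^sub>F m in sequentially. \<nu> m < d / (2 * (\<bar>N\<bar> + 1))" using order_tendstoD(2)[OF \<nu>l] d by simp
  have e3: "\<forall>\<^sub>F m in sequentially. \<forall>a b. 0 <= a --> a <= 1 --> 0 <= b --> b <= 1 --> \<bar>Gs (M m) j a b - \<psi> j a b\<bar> < \<delta>"
   using eventually_compose_filterlim[OF Gs_unif[OF \<delta>(1), of j] Minf] .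
  have "((\<lambda>x. x powr (1 - p)) \<longlongrightarrow> 0) at_top" using p1 by (intro tendsto_neg_powr filterlim_ident) auto
  from filterlim_compose[OF this Minf] have "(\<lambda>m. M m powr (1 - p)) \<longlonglongrightarrow> 0" .
  then have e4: "\<forall>\<^sub>F m in sequentially. M m powr (1 - p) < \<delta> / 2" using \<delta> by (intro order_tendstoD) auto
  have e5: "\<forall>\<^sub>F m in sequentially. N < R m" using Rinf by (simp add: filterlim_at_top_dense)
  show "\<forall>\<^sub>F m in sequentially. \<forall>y\<in>ball 0 N. \<bar>F m j y - \<rho>l * \<psi> j (W m True y) (W m False y)\<bar> <= \<eta>"
   using e1 e2 e3 e4 e5
  proof eventually_elim
   case (elim m)
   show ?case
   proof
    fix y :: 'a assume y: "y \<in> ball 0 N"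
    then have yR: "y \<in> ball 0 (R m)" using elim(5) by auto
    define Y where "Y = c m + \<nu> m *\<^sub>R y"
    have "dist Y (c m) = \<nu> m * norm y" using \<nu>[of m] by (simp add: Y_def dist_norm)
    also have "... <= d / (2 * (\<bar>N\<bar> + 1)) * (\<bar>N\<bar> + 1)" using elim(2) \<nu>[of m] y d by (intro mult_mono) auto
    also have "... = d / 2" by (simp add: divide_simps)
    finally have "dist Y yl < d" using elim(1) dist_triangle[of Y yl "c m"] by simp
    then have \<rho>Y: "\<bar>\<rho> Y - \<rho>l\<bar> < \<delta>" using d(2)[of Y] by (simp add: dist_real_def \<rho>l_def)
    define a where "a = W m True y" define b where "b = W m False y"
    have ab: "0 <= a" "a <= 1" "0 <= b" "b <= 1" using W01[OF yR] by (auto simp: a_def b_def)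
    have Va: "V m True Y = a * M m" "V m False Y = b * M m" using Mm[of m] by (auto simp: a_def b_def W_def Y_def)
    define X where "X = Gs (M m) j a b - M m powr (1 - p) * (A m j True * a + A m j False * b)"
    have sc: "(\<nu> m)^2 / M m = M m powr (- p)"
    proof -
     have "(\<nu> m)^2 = M m powr (- (p - 1))" using Mm[of m] by (simp add: \<nu>_def power2_eq_square flip: powr_add)
     moreover have "M m = M m powr 1" using Mm[of m] by simp
     ultimately have "(\<nu> m)^2 / M m = M m powr (- (p - 1) - 1)" by (metis powr_diff)
     then show ?thesis by simp
    qed
    have mp: "M m powr (- p) * M m = M m powr (1 - p)"
     using Mm[of m] by (simp add: powr_diff powr_minus field_simps)
    have FX: "F m j y = \<rho> Y * X"
    proof -
     have "F m j y = M m powr (- p) * (\<rho> Y * (G j (a * M m) (b * M m) - (A m j True * (a * M m) + A m j False * (b * M m))))"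
      unfolding F_def sc Y_def[symmetric] Va ..
     also have "... = \<rho> Y * (Gs (M m) j a b - (M m powr (- p) * M m) * (A m j True * a + A m j False * b))"
      unfolding Gs_def by (simp add: algebra_simps)
     finally show ?thesis unfolding mp X_def .
    qed
    have "\<bar>A m j True * a + A m j False * b\<bar> <= 1 * 1 + 1 * 1"
    proof -
     have "\<bar>A m j i * t\<bar> <= 1" if "0 <= t" "t <= 1" for i t
      using mult_mono[OF A1[of m j i], of "\<bar>t\<bar>" 1] that by (simp add: abs_mult)
     from this[OF ab(1,2), of True] this[OF ab(3,4), of False] show ?thesis by linarith
    qed
    then have "\<bar>M m powr (1 - p) * (A m j True * a + A m j False * b)\<bar> <= \<delta> / 2 * 2"
     unfolding abs_mult using elim(4) \<delta> by (intro mult_mono) auto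
    moreover have "\<bar>Gs (M m) j a b - \<psi> j a b\<bar> < \<delta>" using elim(3) ab by blast
    ultimately have X: "\<bar>X - \<psi> j a b\<bar> <= 2 * \<delta>" unfolding X_def by linarith
    have \<psi>b: "0 <= \<psi> j a b" "\<psi> j a b <= BF" using psi_nn[OF ab(1,3)] \<psi>mono[of a 1 b 1 j] ab by (auto simp: BF_def)
    have Xb: "\<bar>X\<bar> <= BF + 2" using X \<psi>b \<delta> by linarith
    have "F m j y - \<rho>l * \<psi> j a b = (\<rho> Y - \<rho>l) * X + \<rho>l * (X - \<psi> j a b)" unfolding FX by (simp add: algebra_simps)
    moreover have "\<bar>(\<rho> Y - \<rho>l) * X\<bar> <= \<delta> * (BF + 2)" unfolding abs_mult using \<rho>Y Xb \<delta> by (intro mult_mono) auto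
    moreover have "\<delta> * (BF + 2) <= \<eta> / (4 * (BF + 2)) * (BF + 2)" using \<delta> BF by (intro mult_right_mono) auto
    moreover have "\<eta> / (4 * (BF + 2)) * (BF + 2) = \<eta> / 4" using BF by (simp add: divide_simps)
    moreover have "\<bar>\<rho>l * (X - \<psi> j a b)\<bar> <= \<rho>l * (2 * \<delta>)" unfolding abs_mult using X \<rho>l by (intro mult_mono) auto
    moreover have "\<rho>l * (2 * \<delta>) <= (\<rho>l + 1) * (2 * (\<eta> / (4 * (\<rho>l + 1))))" using \<delta> \<rho>l \<eta> by (intro mult_mono) auto
    moreover have "(\<rho>l + 1) * (2 * (\<eta> / (4 * (\<rho>l + 1)))) = \<eta> / 2" using \<rho>l by (simp add: divide_simps)
    ultimately show "\<bar>F m j y - \<rho>l * \<psi> j (W m True y) (W m False y)\<bar> <= \<eta>"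
     unfolding a_def[symmetric] b_def[symmetric] using \<eta> by linarith
   qed
  qed
 qed (use n3 pa e Rinf nsW W01 in auto)
qed

text \<open>By contradiction: unbounded maxima yield a sequence whose maximum points converge and
  for which, along a subsequence, the rescaled distance to the hyperplane is bounded or tends to
  infinity.\<close>

theorem chart_apriori:
 fixes \<rho> :: "'a::euclidean_space => real"
 assumes n3: "DIM('a) >= 3" and pa: "p * kexp TYPE('a) < kexp TYPE('a) + 2" and e: "norm e = 1"
  and \<rho>c: "continuous_on (ball 0 3) \<rho>" and \<rho>p: "\<And>y. y \<in> ball 0 3 ==> \<rho> y > 0" and \<beta>: "\<beta> >= 0"
 shows "\<exists>Kb. \<forall>A V y0. csol \<rho> e \<beta> A V --> (\<forall>j i. \<bar>A j i\<bar> <= 1) --> y0 \<in> cball 0 1 -->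
  (\<forall>y\<in>ball 0 3. V True y + V False y <= V True y0 + V False y0) --> V True y0 + V False y0 <= Kb"
proof (rule ccontr)
 assume neg: "\<not> ?thesis"
 have "\<exists>A V y0. csol \<rho> e \<beta> A V \<and> (\<forall>j i. \<bar>A j i\<bar> <= 1) \<and> y0 \<in> cball 0 1 \<and>
  (\<forall>y\<in>ball 0 3. V True y + V False y <= V True y0 + V False y0) \<and> V True y0 + V False y0 > real m" for m :: nat
  using neg by (meson not_le)
 then obtain A V y0 where sol: "\<And>m. csol \<rho> e \<beta> (A m) (V m)" and A1: "\<And>m j i. \<bar>A m j i\<bar> <= 1"
  and y0: "\<And>m. y0 m \<in> cball 0 1"
  and mx: "\<And>m y. y \<in> ball 0 3 ==> V m True y + V m False y <= V m True (y0 m) + V m False (y0 m)"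
  and big: "\<And>m. V m True (y0 m) + V m False (y0 m) > real m" by metis
 define M where "M m = V m True (y0 m) + V m False (y0 m)" for m
 have Mm: "M m > real m" for m using big by (simp add: M_def)
 have Minf: "filterlim M at_top sequentially"
 proof (rule filterlim_at_top_mono[OF filterlim_real_sequentially])
  show "\<forall>\<^sub>F m in sequentially. real m <= M m" using Mm by (simp add: less_imp_le)
 qed
 obtain yl r where r: "strict_mono (r :: nat => nat)" "(y0 \<circ> r) \<longlonglongrightarrow> yl"
 proof -
  have "\<exists>l\<in>cball (0::'a) 1. \<exists>r. strict_mono (r :: nat => nat) \<and> (y0 \<circ> r) \<longlonglongrightarrow> l"
   using compact_cball[of "0::'a" 1, unfolded compact_eq_seq_compact_metric seq_compact_def] y0 by blast
  then show thesis using that by blast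
 qed
 have Mr: "filterlim (M \<circ> r) at_top sequentially"
  unfolding o_def by (rule filterlim_compose[OF Minf filterlim_subseq[OF r(1)]])
 have Mp: "M m > 0" for m using Mm[of m] by (meson le_less_trans of_nat_0_le_iff)
 define dm where "dm m = \<bar>y0 (r m) \<bullet> e\<bar> / (M (r m) powr (- (p - 1) / 2))" for m
 show False
 proof (rule bounded_or_unbounded_subsequence[of dm])
  fix q D assume q: "strict_mono (q :: nat => nat)" "\<And>m. dm (q m) <= D"
  show False
  proof (rule chart_apriori_seq[OF n3 pa e \<rho>c \<rho>p \<beta>, where V = "\<lambda>m. V (r (q m))" and A = "\<lambda>m. A (r (q m))" and M = "\<lambda>m. M (r (q m))" and ?y0.0 = "\<lambda>m. y0 (r (q m))" and yl = yl and D = D])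
   show "filterlim (\<lambda>m. M (r (q m))) at_top sequentially"
    using filterlim_compose[OF Mr filterlim_subseq[OF q(1)]] by (simp add: o_def)
   show "(\<lambda>m. y0 (r (q m))) \<longlonglongrightarrow> yl" using filterlim_compose[OF r(2) filterlim_subseq[OF q(1)]] by (simp add: o_def)
   show "(\<forall>m. \<bar>y0 (r (q m)) \<bullet> e\<bar> / M (r (q m)) powr (- (p - 1) / 2) <= D) \<or>
    filterlim (\<lambda>m. \<bar>y0 (r (q m)) \<bullet> e\<bar> / M (r (q m)) powr (- (p - 1) / 2)) at_top sequentially"
    using q(2) unfolding dm_def by blast
  qed (use sol A1 y0 mx Mp in \<open>auto simp: M_def\<close>)
 next
  assume q: "filterlim dm at_top sequentially"
  show False
  proof (rule chart_apriori_seq[OF n3 pa e \<rho>c \<rho>p \<beta>, where V = "\<lambda>m. V (r m)" and A = "\<lambda>m. A (r m)" and M = "\<lambda>m. M (r m)" and ?y0.0 = "\<lambda>m. y0 (r m)" and yl = yl and D = 0])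
   show "filterlim (\<lambda>m. M (r m)) at_top sequentially" using Mr by (simp add: o_def)
   show "(\<lambda>m. y0 (r m)) \<longlonglongrightarrow> yl" using r(2) by (simp add: o_def)
   show "(\<forall>m. \<bar>y0 (r m) \<bullet> e\<bar> / M (r m) powr (- (p - 1) / 2) <= 0) \<or>
    filterlim (\<lambda>m. \<bar>y0 (r m) \<bullet> e\<bar> / M (r m) powr (- (p - 1) / 2)) at_top sequentially"
    using q unfolding dm_def by blast
  qed (use sol A1 y0 mx Mp in \<open>auto simp: M_def\<close>)
 qed
qed

end

section \<open>From partial derivatives to Hessians, and Euler relations\<close>

lemma Basis_real_vec: "(Basis :: (real^'m) set) = range (\<lambda>i. axis i 1)"
 by (auto simp: Basis_vec_def)

lemma sum_Basis_real_vec: "(\<Sum>b\<in>(Basis :: (real^'m) set). f b) = (\<Sum>i\<in>UNIV. f (axis i 1))"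
proof -
 have "inj (\<lambda>i::'m. axis i (1::real))" by (auto simp: inj_def axis_eq_axis)
 then show ?thesis unfolding Basis_real_vec by (simp add: sum.reindex)
qed

lemma tr_real_vec: "tr (H :: real^'m => real^'m) = (\<Sum>i\<in>UNIV. H (axis i 1) $ i)"
 unfolding tr_def sum_Basis_real_vec by (simp add: inner_axis)

lemma has_derivative_cong_nhds:
 assumes "(f has_derivative f') (at x)" "\<forall>\<^sub>F y in nhds x. f y = g y"
 shows "(g has_derivative f') (at x)"
proof -
 have "f x = g x" using eventually_nhds_x_imp_x[OF assms(2)] .
 moreover have "\<forall>\<^sub>F y in at x. f y = g y" using assms(2) by (auto simp: eventually_at_filter elim: eventually_mono)
 ultimately show ?thesis using has_derivative_transform_eventually[of f f' x UNIV g] assms(1) by simp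
qed

lemma partial_DERIV:
 assumes "\<And>t. t \<in> D ==> (\<lambda>s. F (w + t *\<^sub>R axis j (1::real) + s *\<^sub>R axis j (1::real))) differentiable (at 0)" and t: "t \<in> D"
 shows "((\<lambda>t. F (w + t *\<^sub>R axis j (1::real))) has_real_derivative partial j F (w + t *\<^sub>R axis j 1)) (at t)"
proof -
 have "((\<lambda>s. F (w + t *\<^sub>R axis j (1::real) + s *\<^sub>R axis j (1::real))) has_real_derivative partial j F (w + t *\<^sub>R axis j 1)) (at 0)"
  using assms(1)[OF t] unfolding partial_def by (simp add: DERIV_deriv_iff_real_differentiable)
 moreover have "w + t *\<^sub>R axis j (1::real) + s *\<^sub>R axis j (1::real) = w + (s + t) *\<^sub>R axis j 1" for s
  by (simp add: scaleR_add_left)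
 ultimately have "((\<lambda>s. F (w + (s + t) *\<^sub>R axis j 1)) has_real_derivative partial j F (w + t *\<^sub>R axis j 1)) (at 0)" by simp
 then show ?thesis using DERIV_shift[of "\<lambda>t. F (w + t *\<^sub>R axis j 1)" _ 0 t] by simp
qed

text \<open>\<open>C2_on\<close> speaks of one-variable derivatives only. The coordinates are
  switched on one at a time, \<open>P I h\<close> keeping those in \<open>I\<close>; the mean value
  inequality in each new coordinate has small error because the partial derivative is
  continuous.\<close>

lemma has_derivative_of_partials:
 fixes F :: "real^'m => real"
 assumes S: "open S" "x \<in> S"
  and d: "\<And>i y. y \<in> S ==> (\<lambda>t. F (y + t *\<^sub>R axis i (1::real))) differentiable (at 0)"
  and c: "\<And>i. continuous_on S (partial i F)"
 shows "(F has_derivative (\<lambda>h. (\<chi> i. partial i F x) \<bullet> h)) (at x)"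
proof -
 define P where "P I h = (\<chi> i. if i \<in> I then h $ i else 0)" for I :: "'m set" and h :: "real^'m"
 have Pn: "norm (P I h) <= norm h" for I h unfolding norm_vec_def P_def by (intro L2_set_mono) auto
 obtain r where r: "r > 0" "ball x r \<subseteq> S" using S open_contains_ball by blast
 have claim: "\<forall>\<nu>>0. \<exists>\<delta>>0. \<forall>h. norm h < \<delta> --> \<bar>F (x + P I h) - F x - (\<Sum>i\<in>I. partial i F x * h $ i)\<bar> <= \<nu> * norm h"
  if "finite I" for I using that
 proof (induction I rule: finite_induct)
  case empty
  have "P {} h = 0" for h by (simp add: P_def vec_eq_iff)
  then show ?case by (auto intro!: exI[of _ 1])
 next
  case (insert j I)
  show ?case
  proof (intro allI impI)
   fix \<nu> :: real assume \<nu>: "\<nu> > 0"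
   obtain \<delta>1 where \<delta>1: "\<delta>1 > 0" "\<And>h. norm h < \<delta>1 ==> \<bar>F (x + P I h) - F x - (\<Sum>i\<in>I. partial i F x * h $ i)\<bar> <= \<nu> / 2 * norm h"
    using insert.IH \<nu> by (metis half_gt_zero)
   have "isCont (partial j F) x" using c[of j] S by (simp add: continuous_on_eq_continuous_at)
   then obtain \<delta>2 where \<delta>2: "\<delta>2 > 0" "\<And>y. dist y x < \<delta>2 ==> dist (partial j F y) (partial j F x) < \<nu> / 2"
    using \<nu> unfolding continuous_at_eps_delta by (metis half_gt_zero)
   define \<delta> where "\<delta> = min \<delta>1 (min (\<delta>2 / 2) (r / 2))"
   have \<delta>: "\<delta> > 0" "\<delta> <= \<delta>1" "2 * \<delta> <= \<delta>2" "2 * \<delta> <= r" using \<delta>1 \<delta>2 r by (auto simp: \<delta>_def)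
   have "\<bar>F (x + P (insert j I) h) - F x - (\<Sum>i\<in>insert j I. partial i F x * h $ i)\<bar> <= \<nu> * norm h" if h: "norm h < \<delta>" for h
   proof -
    define w where "w = x + P I h"
    define D where "D = {- \<bar>h $ j\<bar> .. \<bar>h $ j\<bar>}"
    have nr: "norm (w + t *\<^sub>R axis j 1 - x) < 2 * \<delta>" if "t \<in> D" for t
    proof -
     have "norm (w + t *\<^sub>R axis j 1 - x) <= norm (P I h) + norm (t *\<^sub>R (axis j 1 :: real^'m))"
      unfolding w_def using norm_triangle_ineq[of "P I h" "t *\<^sub>R axis j 1"] by simp
     also have "... <= norm h + \<bar>h $ j\<bar>" using Pn[of I h] that by (auto simp: D_def norm_axis_1)
     also have "... < 2 * \<delta>" using component_le_norm_cart[of h j] h by simp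
     finally show ?thesis .
    qed
    have inS: "w + t *\<^sub>R axis j 1 \<in> S" if "t \<in> D" for t
     using nr[OF that] r \<delta> by (auto simp: dist_norm norm_minus_commute)
    have der: "((\<lambda>t. F (w + t *\<^sub>R axis j 1) - t * partial j F x) has_real_derivative
     partial j F (w + t *\<^sub>R axis j 1) - partial j F x) (at t within D)" if "t \<in> D" for t
    proof -
     have "((\<lambda>t. F (w + t *\<^sub>R axis j 1)) has_real_derivative partial j F (w + t *\<^sub>R axis j 1)) (at t)"
      by (rule partial_DERIV[where D = D]) (use d inS that in auto)
     then have "((\<lambda>t. F (w + t *\<^sub>R axis j 1) - t * partial j F x) has_real_derivative
     partial j F (w + t *\<^sub>R axis j 1) - partial j F x) (at t)"
      by (auto intro!: derivative_eq_intros)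
     then show ?thesis by (rule has_field_derivative_at_within)
    qed
    have bnd: "norm (partial j F (w + t *\<^sub>R axis j 1) - partial j F x) <= \<nu> / 2" if "t \<in> D" for t
     using \<delta>2(2)[of "w + t *\<^sub>R axis j 1"] nr[OF that] \<delta> by (auto simp: dist_norm less_imp_le)
    have mv: "norm ((F (w + (h $ j) *\<^sub>R axis j 1) - (h $ j) * partial j F x) - (F (w + 0 *\<^sub>R axis j 1) - 0 * partial j F x)) <= \<nu> / 2 * norm (h $ j - 0)"
     by (rule field_differentiable_bound[where S = D, OF _ der bnd]) (auto simp: D_def)
    have eqP: "x + P (insert j I) h = w + (h $ j) *\<^sub>R axis j 1"
     using insert.hyps by (auto simp: w_def P_def vec_eq_iff axis_def)
    have "\<bar>F (x + P (insert j I) h) - F (x + P I h) - partial j F x * h $ j\<bar> <= \<nu> / 2 * \<bar>h $ j\<bar>"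
     unfolding eqP w_def[symmetric] using mv by (simp add: algebra_simps)
    also have "... <= \<nu> / 2 * norm h" using component_le_norm_cart[of h j] \<nu> by (intro mult_left_mono) auto
    finally have 1: "\<bar>F (x + P (insert j I) h) - F (x + P I h) - partial j F x * h $ j\<bar> <= \<nu> / 2 * norm h" .
    have 2: "\<bar>F (x + P I h) - F x - (\<Sum>i\<in>I. partial i F x * h $ i)\<bar> <= \<nu> / 2 * norm h" using \<delta>1(2)[of h] h \<delta> by simp
    have "(\<Sum>i\<in>insert j I. partial i F x * h $ i) = partial j F x * h $ j + (\<Sum>i\<in>I. partial i F x * h $ i)"
     using insert.hyps by simp
    then show ?thesis using 1 2 by linarith
   qed
   then show "\<exists>\<delta>>0. \<forall>h. norm h < \<delta> --> \<bar>F (x + P (insert j I) h) - F x - (\<Sum>i\<in>insert j I. partial i F x * h $ i)\<bar> <= \<nu> * norm h"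
    using \<delta>(1) by blast
  qed
 qed
 have PU: "P UNIV h = h" for h by (simp add: P_def vec_eq_iff)
 show ?thesis unfolding has_derivative_at_alt
 proof (intro conjI allI impI)
  show "bounded_linear ((\<bullet>) (\<chi> i. partial i F x))" by (rule bounded_linear_inner_right)
  fix \<nu> :: real assume "\<nu> > 0"
  then obtain \<delta> where \<delta>: "\<delta> > 0" "\<And>h. norm h < \<delta> ==> \<bar>F (x + P UNIV h) - F x - (\<Sum>i\<in>UNIV. partial i F x * h $ i)\<bar> <= \<nu> * norm h"
   using claim[OF finite_class.finite_UNIV] by blast
  have "norm (F y - F x - (\<chi> i. partial i F x) \<bullet> (y - x)) <= \<nu> * norm (y - x)" if "norm (y - x) < \<delta>" for y
   using \<delta>(2)[OF that] by (simp add: PU inner_vec_def)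
  then show "\<exists>d>0. \<forall>y. norm (y - x) < d --> norm (F y - F x - (\<chi> i. partial i F x) \<bullet> (y - x)) <= \<nu> * norm (y - x)"
   using \<delta>(1) by blast
 qed
qed

lemma C2_on_hess:
 fixes F :: "real^'m => real"
 assumes S: "open S" "x \<in> S" and C: "C2_on S F"
 obtains H where "hess F x (\<lambda>y. \<chi> i. partial i F y) H" "tr H = (\<Sum>i\<in>UNIV. partial i (partial i F) x)"
proof -
 note c = C[unfolded C2_on_def]
 have 1: "(F has_derivative (\<lambda>h. (\<chi> i. partial i F y) \<bullet> h)) (at y)" if "y \<in> S" for y
  by (rule has_derivative_of_partials[OF S(1) that c[THEN conjunct1, rule_format] c[THEN conjunct2, THEN conjunct1, rule_format]])
 have 2: "(partial i F has_derivative (\<lambda>h. (\<chi> j. partial j (partial i F) x) \<bullet> h)) (at x)" for i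
  by (rule has_derivative_of_partials[OF S c[THEN conjunct2, THEN conjunct2, THEN conjunct1, rule_format] c[THEN conjunct2, THEN conjunct2, THEN conjunct2, rule_format]])
 define H where "H h = (\<chi> i. (\<chi> j. partial j (partial i F) x) \<bullet> h)" for h
 have "((\<lambda>y. \<chi> i. partial i F y) has_derivative H) (at x)"
 proof (rule has_derivative_componentwise_within[THEN iffD2], rule ballI)
  fix b :: "real^'m" assume "b \<in> Basis"
  then obtain i where b: "b = axis i 1" unfolding Basis_real_vec by blast
  show "((\<lambda>y. (\<chi> i. partial i F y) \<bullet> b) has_derivative (\<lambda>h. H h \<bullet> b)) (at x)"
   unfolding b H_def inner_axis using 2[of i] by simp
 qed
 then have "hess F x (\<lambda>y. \<chi> i. partial i F y) H"
  unfolding hess_def by (intro conjI eventually_mono[OF eventually_nhds_in_open[OF S]] 1)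
 moreover have "tr H = (\<Sum>i\<in>UNIV. partial i (partial i F) x)"
  unfolding tr_real_vec H_def by (simp add: inner_axis)
 ultimately show thesis by (rule that)
qed

lemma ext_scale: "s > 0 ==> ext u (s *\<^sub>R x) = ext u x"
proof -
 assume s: "s > 0"
 have "(s *\<^sub>R x) /\<^sub>R norm (s *\<^sub>R x) = (inverse (s * norm x) * s) *\<^sub>R x" using s by simp
 also have "inverse (s * norm x) * s = inverse (norm x)" using s by (simp add: field_simps)
 finally show ?thesis unfolding ext_def by (simp only:)
qed

lemma hcone_open: "open (hcone k)"
 unfolding hcone_def by (intro open_Collect_less continuous_intros)

text \<open>Euler relations for degree 0: differentiate U(s y) in s, then the resulting identity G y
  . y = 0 in y, and finally use G(s x) = G(x)/s. As \<open>hess\<close> does not record symmetry of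
  \<open>H\<close>, both contractions with \<open>x\<close> are derived.\<close>

lemma hess_homogeneous:
 fixes U :: "real^'m => real"
 assumes h: "hess U x G H" and hom: "\<And>s y. s > 0 ==> U (s *\<^sub>R y) = U y"
 shows "G x \<bullet> x = 0" "H a \<bullet> x = - (G x \<bullet> a)" "H x = - G x"
proof -
 have ev: "\<forall>\<^sub>F y in nhds x. (U has_derivative (\<bullet>) (G y)) (at y)" and GH: "(G has_derivative H) (at x)"
  using h by (auto simp: hess_def)
 have z: "G y \<bullet> y = 0" if "(U has_derivative (\<bullet>) (G y)) (at y)" for y
 proof -
  have 1: "((\<lambda>s. s *\<^sub>R y) has_derivative (\<lambda>s. s *\<^sub>R y)) (at 1)" by (auto intro!: derivative_eq_intros)
  have "(U has_derivative (\<bullet>) (G y)) (at (1 *\<^sub>R y))" using that by simp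
  from has_derivative_compose[OF 1 this]
  have "((\<lambda>s::real. U (s *\<^sub>R y)) has_derivative (\<lambda>s. G y \<bullet> (s *\<^sub>R y))) (at 1)" .
  moreover have "\<forall>\<^sub>F s in nhds (1::real). U (s *\<^sub>R y) = U y"
   using eventually_nhds_in_open[of "{0<..}" "1::real"] by (auto elim!: eventually_mono intro: hom)
  ultimately have "((\<lambda>s::real. U y) has_derivative (\<lambda>s. G y \<bullet> (s *\<^sub>R y))) (at 1)"
   by (rule has_derivative_cong_nhds)
  moreover have "((\<lambda>s::real. U y) has_derivative (\<lambda>s. 0)) (at 1)" by simp
  ultimately have "(\<lambda>s::real. G y \<bullet> (s *\<^sub>R y)) = (\<lambda>s. 0)" by (rule has_derivative_unique)
  from fun_cong[OF this, of 1] show ?thesis by simp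
 qed
 show "G x \<bullet> x = 0" using z eventually_nhds_x_imp_x[OF ev] by blast
 have evz: "\<forall>\<^sub>F y in nhds x. G y \<bullet> y = 0" using ev by (rule eventually_mono) (rule z)
 have "((\<lambda>y. G y \<bullet> y) has_derivative (\<lambda>h. G x \<bullet> h + H h \<bullet> x)) (at x)"
  by (intro has_derivative_inner GH has_derivative_ident)
 then have "((\<lambda>y. 0::real) has_derivative (\<lambda>h. G x \<bullet> h + H h \<bullet> x)) (at x)"
  using evz by (rule has_derivative_cong_nhds)
 then have "(\<lambda>h. G x \<bullet> h + H h \<bullet> x) = (\<lambda>h. 0)" by (rule has_derivative_unique[OF _ has_derivative_const])
 from fun_cong[OF this, of a] show "H a \<bullet> x = - (G x \<bullet> a)" by simp
 have "((\<lambda>s::real. s *\<^sub>R x) \<longlongrightarrow> 1 *\<^sub>R x) (nhds 1)" by (intro tendsto_intros) (simp add: filterlim_ident)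
 then have lim: "((\<lambda>s::real. s *\<^sub>R x) \<longlongrightarrow> x) (nhds 1)" by simp
 have e2: "\<forall>\<^sub>F s in nhds (1::real). s \<in> {0<..}" by (rule eventually_nhds_in_open) auto
 have Gs: "\<forall>\<^sub>F s in nhds (1::real). G (s *\<^sub>R x) = inverse s *\<^sub>R G x"
  using eventually_compose_filterlim[OF ev lim] e2
 proof (rule eventually_elim2)
  fix s :: real assume U: "(U has_derivative (\<bullet>) (G (s *\<^sub>R x))) (at (s *\<^sub>R x))" and "s \<in> {0<..}"
  then have s: "s > 0" by simp
  have 1: "((\<lambda>y. s *\<^sub>R y) has_derivative (\<lambda>h. s *\<^sub>R h)) (at x)" by (auto intro!: derivative_eq_intros)
  have "((\<lambda>y. U (s *\<^sub>R y)) has_derivative (\<lambda>h. G (s *\<^sub>R x) \<bullet> (s *\<^sub>R h))) (at x)"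
   using has_derivative_compose[OF 1 U] .
  then have "(U has_derivative (\<lambda>h. G (s *\<^sub>R x) \<bullet> (s *\<^sub>R h))) (at x)" using hom[OF s] by simp
  moreover have "(U has_derivative (\<bullet>) (G x)) (at x)" using eventually_nhds_x_imp_x[OF ev] .
  ultimately have "(\<lambda>h. G (s *\<^sub>R x) \<bullet> (s *\<^sub>R h)) = (\<bullet>) (G x)" by (rule has_derivative_unique)
  then have "\<forall>h. (s *\<^sub>R G (s *\<^sub>R x)) \<bullet> h = G x \<bullet> h" by (simp add: fun_eq_iff)
  then have "s *\<^sub>R G (s *\<^sub>R x) = G x" using vector_eq_rdot by blast
  then have "inverse s *\<^sub>R (s *\<^sub>R G (s *\<^sub>R x)) = inverse s *\<^sub>R G x" by simp
  then show "G (s *\<^sub>R x) = inverse s *\<^sub>R G x" using s by simp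
 qed
 have 1: "((\<lambda>s. s *\<^sub>R x) has_derivative (\<lambda>s. s *\<^sub>R x)) (at 1)" by (auto intro!: derivative_eq_intros)
 have d1: "((\<lambda>s::real. G (s *\<^sub>R x)) has_derivative (\<lambda>s. H (s *\<^sub>R x))) (at 1)"
 proof -
  have "(G has_derivative H) (at (1 *\<^sub>R x))" using GH by simp
  from has_derivative_compose[OF 1 this] show ?thesis .
 qed
 have "((\<lambda>s::real. inverse s *\<^sub>R G x) has_derivative (\<lambda>s. (- s) *\<^sub>R G x)) (at 1)"
  by (auto intro!: derivative_eq_intros)
 then have d2: "((\<lambda>s::real. G (s *\<^sub>R x)) has_derivative (\<lambda>s. (- s) *\<^sub>R G x)) (at 1)"
  by (rule has_derivative_cong_nhds) (use Gs in \<open>auto elim: eventually_mono\<close>)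
 from fun_cong[OF has_derivative_unique[OF d1 d2], of 1] show "H x = - G x" by simp
qed

section \<open>Stereographic charts with poles on the equator\<close>

text \<open>\<open>k\<close> is the height coordinate of the hemisphere, \<open>k'\<close> the same
  coordinate in the chart, and \<open>l\<close> the axis through the two projection poles, which lie
  on the equator because l and k differ. Hence the equator is the hyperplane {y . e = 0} in the
  chart and the hemisphere a half-space; \<sigma> selects the pole.\<close>

locale chart =
 fixes k l :: "'m::finite" and k' :: "'n::finite" and \<iota> :: "'n => 'm" and \<sigma> :: real
 assumes \<iota>: "bij_betw \<iota> UNIV (UNIV - {l})" and kk: "\<iota> k' = k" and \<sigma>: "\<sigma> \<in> {1, -1}"
begin

lemma \<iota>_inj: "inj \<iota>" and \<iota>_range: "range \<iota> = UNIV - {l}" and \<iota>_l: "\<iota> i \<noteq> l"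
 using \<iota> by (auto simp: bij_betw_def)

lemma kl: "k \<noteq> l" using \<iota>_l kk by blast

lemma sum_split: "(\<Sum>j\<in>UNIV. f j :: real) = f l + (\<Sum>i\<in>UNIV. f (\<iota> i))"
proof -
 have "UNIV = insert l (range \<iota>)" using \<iota>_range by auto
 then have "(\<Sum>j\<in>UNIV. f j) = (\<Sum>j\<in>insert l (range \<iota>). f j)" by simp
 also have "... = f l + (\<Sum>j\<in>range \<iota>. f j)" using \<iota>_range by (intro sum.insert) auto
 also have "(\<Sum>j\<in>range \<iota>. f j) = (\<Sum>i\<in>UNIV. f (\<iota> i))" using \<iota>_inj by (simp add: sum.reindex)
 finally show ?thesis .
qed

definition J :: "real^'n => real^'m" where "J y = (\<chi> i. if i = l then 0 else y $ inv \<iota> i)"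
definition Q :: "real^'m => real^'n" where "Q x = (\<chi> i. x $ \<iota> i)"
text \<open>The point over the chart origin; the projection is taken from the opposite pole.\<close>

definition z :: "real^'m" where "z = \<sigma> *\<^sub>R axis l 1"
definition e :: "real^'n" where "e = axis k' 1"
text \<open>The parametrisation without its denominator: it is polynomial, and a function extended
  homogeneously of degree 0 does not see the factor 1 + |y|^2.\<close>

definition T :: "real^'n => real^'m" where "T y = 2 *\<^sub>R J y + (1 - y \<bullet> y) *\<^sub>R z"
definition \<tau> :: "real^'n => real^'m" where "\<tau> y = T y /\<^sub>R (1 + y \<bullet> y)"
definition rf :: "real^'n => real^'n" where "rf y = y - (2 * (y \<bullet> e)) *\<^sub>R e"
text \<open>Folds the chart onto the closed upper half-space, so that functions composed with it are
  evenly reflected.\<close>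

definition ab :: "real^'n => real^'n" where "ab y = (if y \<bullet> e < 0 then rf y else y)"

lemma J_comp [simp]: "J y $ \<iota> i = y $ i" "J y $ l = 0"
 using \<iota>_l \<iota>_inj by (auto simp: J_def)

lemma J_linear: "linear J"
 by (auto simp: linear_iff J_def vec_eq_iff)

lemma ss: "\<sigma> * \<sigma> = 1" using \<sigma> by auto

lemma e1: "norm e = 1" "e \<bullet> e = 1" by (auto simp: e_def inner_axis norm_axis_1)

lemma ye: "y \<bullet> e = y $ k'" by (simp add: e_def inner_axis)

lemma J_inner: "J y \<bullet> x = y \<bullet> Q x"
 unfolding inner_vec_def using sum_split[of "\<lambda>i. J y $ i \<bullet> x $ i"] by (simp add: Q_def)

lemma QJ: "Q (J y) = y" by (simp add: Q_def vec_eq_iff)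

lemma JJ: "J y \<bullet> J x = y \<bullet> x" by (simp add: J_inner QJ)

lemma xz: "x \<bullet> z = \<sigma> * x $ l" by (simp add: z_def inner_axis)

lemma Jz: "J y \<bullet> z = 0" by (simp add: xz)

lemma zz: "z \<bullet> z = 1" using ss by (simp add: xz) (simp add: z_def axis_def)

lemma zk: "z $ k = 0" using kl by (simp add: z_def axis_def)

lemma Jk: "J y $ k = y $ k'" using J_comp(1)[of y k'] kk by simp

lemma Je: "J e = axis k 1"
proof (subst vec_eq_iff, rule allI)
 fix i show "J e $ i = axis k 1 $ i"
 proof (cases "i = l")
  case True then show ?thesis using kl by (simp add: axis_def)
 next
  case False
  then obtain i' where i: "i = \<iota> i'" using \<iota>_range by blast
  show ?thesis unfolding i J_comp using kk inj_eq[OF \<iota>_inj, of i' k'] by (auto simp: e_def axis_def)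
 qed
qed

lemma Jaxis: "J (axis i 1) = axis (\<iota> i) 1"
proof (subst vec_eq_iff, rule allI)
 fix j show "J (axis i 1) $ j = axis (\<iota> i) 1 $ j"
 proof (cases "j = l")
  case True then show ?thesis using \<iota>_l[of i] by (simp add: axis_def)
 next
  case False
  then obtain i' where j: "j = \<iota> i'" using \<iota>_range by blast
  show ?thesis unfolding j J_comp using inj_eq[OF \<iota>_inj, of i' i] by (auto simp: axis_def)
 qed
qed

lemma decomp: "x = J (Q x) + (x \<bullet> z) *\<^sub>R z"
proof (subst vec_eq_iff, rule allI)
 fix j show "x $ j = (J (Q x) + (x \<bullet> z) *\<^sub>R z) $ j"
 proof (cases "j = l")
  case True
  have "z $ l = \<sigma>" by (simp add: z_def axis_def)
  then have "(x \<bullet> z) * z $ l = (\<sigma> * \<sigma>) * x $ l" unfolding xz by simp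
  then show ?thesis using True ss by simp
 next
  case False
  then obtain i where j: "j = \<iota> i" using \<iota>_range by blast
  have "z $ \<iota> i = 0" using \<iota>_l[of i] by (simp add: z_def axis_def)
  then show ?thesis unfolding j by (simp add: Q_def)
 qed
qed

lemma T_norm: "norm (T y) = 1 + y \<bullet> y"
proof -
 have "T y \<bullet> T y = (1 + y \<bullet> y)^2"
  unfolding T_def by (simp add: inner_add_left inner_add_right JJ Jz zz inner_commute[of z "J y"] power2_eq_square algebra_simps)
 then have "(norm (T y))^2 = (1 + y \<bullet> y)^2" by (simp only: dot_square_norm)
 then show ?thesis by (rule power2_eq_imp_eq) (auto simp: add_nonneg_nonneg)
qed

lemma q1: "1 + y \<bullet> y > 0" for y :: "real^'n" by (simp add: add_pos_nonneg)

lemma \<tau>_norm: "norm (\<tau> y) = 1" using q1[of y] by (simp add: \<tau>_def T_norm)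

lemma \<tau>_k: "\<tau> y $ k = 2 * (y \<bullet> e) / (1 + y \<bullet> y)"
 by (simp add: \<tau>_def T_def Jk zk ye divide_inverse)

lemma \<tau>_chemi: "y \<bullet> e >= 0 ==> \<tau> y \<in> chemi k" and \<tau>_hemi: "y \<bullet> e > 0 ==> \<tau> y \<in> hemi k" and \<tau>_bdry: "y \<bullet> e = 0 ==> \<tau> y \<in> bdry k"
 using q1[of y] by (auto simp: chemi_def hemi_def bdry_def \<tau>_norm \<tau>_k)

lemma ext_T: "ext u (T y) = u (\<tau> y)" by (simp add: ext_def \<tau>_def T_norm)

lemma rf_inner: "rf x \<bullet> rf y = x \<bullet> y" and rf_e: "rf y \<bullet> e = - (y \<bullet> e)" and rf_rf: "rf (rf y) = y"
 by (auto simp: rf_def inner_diff_left inner_diff_right e1 inner_commute algebra_simps)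

lemma rf_linear: "linear rf"
 by (auto simp: linear_iff rf_def inner_add_left algebra_simps scaleR_add_left)

lemma rf_norm: "norm (rf y) = norm y" by (simp add: norm_eq_sqrt_inner rf_inner)

lemma ab_e: "ab y \<bullet> e = \<bar>y \<bullet> e\<bar>" and ab_ab: "ab y \<bullet> ab y = y \<bullet> y" and ab_pos: "y \<bullet> e >= 0 ==> ab y = y"
 and ab_rf: "ab (rf y) = ab y" and ab_norm: "norm (ab y) = norm y"
proof -
 show "ab y \<bullet> e = \<bar>y \<bullet> e\<bar>" "ab y \<bullet> ab y = y \<bullet> y" "y \<bullet> e >= 0 ==> ab y = y" "norm (ab y) = norm y"
  by (auto simp: ab_def rf_e rf_inner rf_norm)
 show "ab (rf y) = ab y"
 proof (cases "y \<bullet> e = 0")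
  case True then show ?thesis by (simp add: ab_def rf_def)
 qed (auto simp: ab_def rf_e rf_rf)
qed

lemma ab_alt: "ab y = y + (\<bar>y \<bullet> e\<bar> - y \<bullet> e) *\<^sub>R e"
 by (auto simp: ab_def rf_def algebra_simps simp flip: scaleR_add_left)

lemma J_cont: "continuous_on X J"
 using linear_continuous_on linear_conv_bounded_linear J_linear by blast

lemma \<tau>_ab_cont: "continuous_on X (\<lambda>y. \<tau> (ab y))"
proof -
 have c1: "continuous_on X ab" unfolding ab_alt[abs_def] by (intro continuous_intros)
 have "continuous_on UNIV \<tau>" unfolding \<tau>_def[abs_def] T_def[abs_def]
  using q1 by (intro continuous_intros J_cont) (metis less_irrefl)
 then show ?thesis by (rule continuous_on_compose2[OF _ c1]) auto
qed

text \<open>The Euler relations trade second derivatives in the direction \<open>z\<close> for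
  first-order terms, which leaves 4 tr H and a multiple of G . z. Because G (T y) is orthogonal to T
  y, it can be recovered from the chart gradient \<open>G2\<close> at the price of the factor |y| +
  2.\<close>

lemma chart_hess:
 assumes U: "hess U (T y) G H" and hom: "\<And>s x. s > 0 ==> U (s *\<^sub>R x) = U x"
 obtains G2 H2 where "hess (\<lambda>y. U (T y)) y G2 H2"
  "tr H2 = 4 * tr H + (4 - 2 * real CARD('n)) * (G (T y) \<bullet> z)"
  "norm (G (T y)) <= (norm y + 2) * norm (G2 y)"
proof -
 define T' where "T' w h = 2 *\<^sub>R J h - (2 * (w \<bullet> h)) *\<^sub>R z" for w h
 define T2 where "T2 b h = - ((2 * (h \<bullet> b)) *\<^sub>R z)" for b h :: "real^'n"
 have bl: "bounded_linear J" using J_linear linear_conv_bounded_linear by blast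
 have dJ: "(J has_derivative J) (at w)" for w using bounded_linear_imp_has_derivative[OF bl] .
 have dT: "(T has_derivative T' w) (at w)" for w
 proof -
  have 1: "((\<lambda>y. 2 *\<^sub>R J y) has_derivative (\<lambda>h. 2 *\<^sub>R J h)) (at w)" by (intro has_derivative_scaleR_right dJ)
  have 2: "((\<lambda>y::real^'n. 1 - y \<bullet> y) has_derivative (\<lambda>h. - (2 * (w \<bullet> h)))) (at w)"
   by (auto intro!: derivative_eq_intros simp: inner_commute)
  show ?thesis unfolding T_def[abs_def] T'_def using has_derivative_add[OF 1 has_derivative_scaleR_left[OF 2, of z]] by simp
 qed
 have dT2: "((\<lambda>w. T' w b) has_derivative T2 b) (at y)" for b
 proof -
  have 2: "((\<lambda>w. - (2 * (w \<bullet> b))) has_derivative (\<lambda>h. - (2 * (h \<bullet> b)))) (at y)"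
   by (auto intro!: derivative_eq_intros)
  show ?thesis unfolding T'_def T2_def
   using has_derivative_add[OF has_derivative_const[of "2 *\<^sub>R J b"] has_derivative_scaleR_left[OF 2, of z]] by simp
 qed
 note hc = hess_compose[OF U always_eventually[of "\<lambda>w. (T has_derivative T' w) (at w)", OF allI[OF dT]] dT2]
 define G2 where "G2 = (\<lambda>w. \<Sum>b\<in>Basis. (G (T w) \<bullet> T' w b) *\<^sub>R b)"
 define H2 where "H2 = (\<lambda>h. \<Sum>b\<in>Basis. (G (T y) \<bullet> T2 b h + H (T' y h) \<bullet> T' y b) *\<^sub>R b)"
 have h2: "hess (\<lambda>w. U (T w)) y G2 H2" unfolding G2_def H2_def by (rule hc(1))
 define a where "a = G (T y) \<bullet> z"
 define q where "q = y \<bullet> y"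
 have linH: "linear H" using U unfolding hess_def by (blast intro: has_derivative_linear)
 note hm = hess_homogeneous[OF U hom]
 define hzz where "hzz = H z \<bullet> z"
 have H1: "2 * (H (J y) \<bullet> z) + (1 - q) * hzz = - a"
 proof -
  have "H (T y) \<bullet> z = - a" using hm(3) by (simp add: a_def)
  moreover have "H (T y) = 2 *\<^sub>R H (J y) + (1 - q) *\<^sub>R H z"
   unfolding T_def q_def by (simp add: linear_add[OF linH] linear_cmul[OF linH])
  ultimately show ?thesis by (simp add: inner_add_left hzz_def)
 qed
 have H2': "2 * (H z \<bullet> J y) + (1 - q) * hzz = - a"
 proof -
  have "H z \<bullet> T y = - a" using hm(2)[of z] by (simp add: a_def)
  then show ?thesis unfolding T_def q_def[symmetric] by (simp add: inner_add_right hzz_def)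
 qed
 have rep: "(\<Sum>b\<in>Basis. (y \<bullet> b) *\<^sub>R b) = y" by (simp add: euclidean_representation)
 have Jrep: "(\<Sum>b\<in>Basis. (y \<bullet> b) *\<^sub>R J b) = J y"
 proof -
  have "J y = J (\<Sum>b\<in>Basis. (y \<bullet> b) *\<^sub>R b)" by (simp only: rep)
  then show ?thesis by (simp add: linear_sum[OF J_linear] linear_cmul[OF J_linear])
 qed
 have s1: "(\<Sum>b\<in>Basis. H (J b) \<bullet> J b) = tr H - hzz"
 proof -
  have "tr H = H (axis l 1) $ l + (\<Sum>i\<in>UNIV. H (axis (\<iota> i) 1) $ \<iota> i)" unfolding tr_real_vec by (rule sum_split)
  moreover have "hzz = H (axis l 1) $ l"
   using ss by (simp add: hzz_def z_def linear_cmul[OF linH] inner_axis flip: mult.assoc)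
  moreover have "(\<Sum>b\<in>Basis. H (J b) \<bullet> J b) = (\<Sum>i\<in>UNIV. H (axis (\<iota> i) 1) $ \<iota> i)"
   unfolding sum_Basis_real_vec Jaxis by (simp add: inner_axis)
  ultimately show ?thesis by simp
 qed
 have s2: "(\<Sum>b\<in>Basis. (y \<bullet> b) * (H (J b) \<bullet> z)) = H (J y) \<bullet> z"
 proof -
  have "H (J y) = (\<Sum>b\<in>Basis. (y \<bullet> b) *\<^sub>R H (J b))"
   unfolding Jrep[symmetric] by (simp add: linear_sum[OF linH] linear_cmul[OF linH])
  then show ?thesis by (simp add: inner_sum_left)
 qed
 have s3: "(\<Sum>b\<in>Basis. (y \<bullet> b) * (H z \<bullet> J b)) = H z \<bullet> J y"
  unfolding Jrep[symmetric] by (simp add: inner_sum_right)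
 have s4: "(\<Sum>b\<in>Basis. (y \<bullet> b) * (y \<bullet> b)) = q" unfolding q_def by (rule euclidean_inner[symmetric])
 have trm: "H (T' y b) \<bullet> T' y b = 4 * (H (J b) \<bullet> J b) - 4 * ((y \<bullet> b) * (H (J b) \<bullet> z)) - 4 * ((y \<bullet> b) * (H z \<bullet> J b)) + 4 * hzz * ((y \<bullet> b) * (y \<bullet> b))" for b
  unfolding T'_def hzz_def by (simp add: linear_diff[OF linH] linear_cmul[OF linH] inner_diff_left inner_diff_right algebra_simps)
 have "(\<Sum>b\<in>Basis. H (T' y b) \<bullet> T' y b) = 4 * (tr H - hzz) - 4 * (H (J y) \<bullet> z) - 4 * (H z \<bullet> J y) + 4 * hzz * q"
  unfolding trm sum.distrib sum_subtractf sum_distrib_left[symmetric] s1 s2 s3 s4 ..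
 also have "... = 4 * tr H + 4 * a" using H1 H2' by (simp add: algebra_simps)
 finally have S1: "(\<Sum>b\<in>Basis. H (T' y b) \<bullet> T' y b) = 4 * tr H + 4 * a" .
 have "(\<Sum>b\<in>(Basis::(real^'n) set). T2 b b) = (- (2 * real CARD('n))) *\<^sub>R z"
 proof -
  have "(\<Sum>b\<in>(Basis::(real^'n) set). T2 b b) = (\<Sum>b\<in>(Basis::(real^'n) set). - (2 *\<^sub>R z))"
   by (rule sum.cong) (auto simp: T2_def)
  also have "... = (- (2 * real CARD('n))) *\<^sub>R z" unfolding sum_constant_scaleR by (simp add: mult.commute)
  finally show ?thesis .
 qed
 then have trH2: "tr H2 = 4 * tr H + (4 - 2 * real CARD('n)) * a"
  unfolding H2_def hc(2) S1 by (simp add: a_def algebra_simps)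
 have linT: "linear (T' y)" using dT by (rule has_derivative_linear)
 have G2h: "G2 y \<bullet> h = 2 * (G (T y) \<bullet> J h) - 2 * (y \<bullet> h) * a" for h
 proof -
  have "G2 y \<bullet> h = G (T y) \<bullet> T' y h" unfolding G2_def by (rule basis_adjoint[OF linT])
  then show ?thesis by (simp add: T'_def inner_diff_right a_def)
 qed
 have "2 * (G (T y) \<bullet> J y) + (1 - q) * a = 0"
 proof -
  have "G (T y) \<bullet> (2 *\<^sub>R J y + (1 - q) *\<^sub>R z) = 0" using hm(1) unfolding T_def q_def .
  then show ?thesis by (simp add: inner_add_right a_def)
 qed
 then have "G2 y \<bullet> y = - ((1 + q) * a)" unfolding G2h by (simp add: q_def algebra_simps)
 then have "(1 + q) * \<bar>a\<bar> = \<bar>G2 y \<bullet> y\<bar>" using q1[of y] by (simp add: abs_mult q_def)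
 also have "... <= norm (G2 y) * norm y" by (rule Cauchy_Schwarz_ineq2)
 also have "... <= norm (G2 y) * (1 + q)"
 proof (rule mult_left_mono)
  have "0 <= (norm y - 1)^2" by simp
  then have "2 * norm y <= q + 1" by (simp add: q_def dot_square_norm power2_eq_square algebra_simps)
  then show "norm y <= 1 + q" using norm_ge_zero[of y] by linarith
 qed simp
 finally have an: "\<bar>a\<bar> <= norm (G2 y)" using q1[of y] by (simp add: q_def mult.commute)
 \<comment> \<open>The gradient is split into its component along \<open>z\<close>, already bounded
   by |G2|, and the remaining part \<open>g\<close>, which is bounded by pairing it with
   \<open>G2\<close>.\<close>
 define g where "g = Q (G (T y))"
 have "norm g * norm g = g \<bullet> g" by (simp add: dot_square_norm power2_eq_square)
 also have "g \<bullet> g = G (T y) \<bullet> J g" using J_inner[of g "G (T y)"] by (simp add: g_def inner_commute)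
 also have "... = (G2 y \<bullet> g) / 2 + (y \<bullet> g) * a" unfolding G2h by (simp add: field_simps)
 also have "... <= norm (G2 y) * norm g / 2 + (norm y * norm g) * norm (G2 y)"
 proof (rule add_mono)
  show "(G2 y \<bullet> g) / 2 <= norm (G2 y) * norm g / 2" using norm_cauchy_schwarz[of "G2 y" g] by simp
  have "\<bar>(y \<bullet> g) * a\<bar> <= (norm y * norm g) * norm (G2 y)" unfolding abs_mult
   using Cauchy_Schwarz_ineq2[of y g] an by (intro mult_mono) auto
  then show "(y \<bullet> g) * a <= (norm y * norm g) * norm (G2 y)" by linarith
 qed
 also have "... = ((1/2 + norm y) * norm (G2 y)) * norm g" by (simp add: algebra_simps)
 finally have gn: "norm g <= (1/2 + norm y) * norm (G2 y)"
  by (cases "norm g = 0") (auto simp: mult_le_cancel_right intro!: mult_nonneg_nonneg add_nonneg_nonneg)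
 have "G (T y) = J g + a *\<^sub>R z" using decomp[of "G (T y)"] by (simp add: g_def a_def)
 then have "norm (G (T y)) <= norm (J g) + norm (a *\<^sub>R z)" using norm_triangle_ineq by metis
 moreover have "norm (J g) = norm g" by (simp add: norm_eq_sqrt_inner JJ)
 moreover have "norm (a *\<^sub>R z) = \<bar>a\<bar>" using zz by (simp add: norm_eq_1)
 moreover have "(norm y + 2) * norm (G2 y) = (1/2 + norm y) * norm (G2 y) + 3/2 * norm (G2 y)" by (simp add: algebra_simps)
 ultimately have Gn: "norm (G (T y)) <= (norm y + 2) * norm (G2 y)" using gn an norm_ge_zero[of "G2 y"] by linarith
 show thesis by (rule that[OF h2 trH2[unfolded a_def] Gn])
qed

end

lemma nsol_shift:
 assumes "nsol v \<Omega> e h F \<beta>" shows "nsol (\<lambda>y. v y - b) \<Omega> e h F \<beta>"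
 unfolding nsol_def
proof (intro conjI ballI)
 show "continuous_on \<Omega> (\<lambda>y. v y - b)" using assms by (auto simp: nsol_def intro!: continuous_intros)
 fix y assume y: "y \<in> \<Omega>"
 show "if y \<bullet> e = h then neum (\<lambda>y. v y - b) e y else \<exists>G H. hess (\<lambda>y. v y - b) y G H \<and> \<bar>tr H + F y\<bar> <= \<beta> * norm (G y)"
 proof (cases "y \<bullet> e = h")
  case True
  then have "neum v e y" by (rule nsol_neum[OF assms y])
  then show ?thesis using True by (simp add: neum_def)
 next
  case False
  obtain G H where GH: "hess v y G H" "\<bar>tr H + F y\<bar> <= \<beta> * norm (G y)" using nsol_hess[OF assms y False] .
  have "hess (\<lambda>y. v y - b) y (\<lambda>y. G y - 0) (\<lambda>h. H h - 0)" by (intro hess_diff GH hess_const)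
  then have "\<exists>G H. hess (\<lambda>y. v y - b) y G H \<and> \<bar>tr H + F y\<bar> <= \<beta> * norm (G y)" using GH(2) by auto
  then show ?thesis using False by simp
 qed
qed

section \<open>The conformal factor up to the equator\<close>

lemma chemi_compact: "compact (chemi k)"
proof -
 have "chemi k = sphere 0 1 \<inter> {x. x $ k >= 0}" by (auto simp: chemi_def)
 moreover have "closed {x::real^'a. x $ k >= 0}" by (intro closed_Collect_le continuous_intros)
 ultimately show ?thesis by (simp add: compact_Int_closed)
qed

text \<open>\<open>lap_g\<close> differentiates the degree-0 extension of \<phi>, whose gradient at
  a point of the hemisphere is the tangential part of the gradient of the smooth extension
  \<open>\<Phi>\<close>. Compactness of the closed hemisphere bounds the latter, hence the
  drift.\<close>

lemma conf_factor_bound: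
 fixes \<phi> :: "real^'m => real"
 assumes "conf_factor k \<phi>"
 obtains \<beta> where "\<beta> >= 0" "\<And>x v. x \<in> hemi k ==> \<bar>2 / \<phi> x * (\<Sum>i\<in>UNIV. partial i (ext \<phi>) x * v $ i)\<bar> <= \<beta> * norm v"
  and "continuous_on (chemi k) \<phi>"
proof -
 obtain U \<Phi> where U: "chemi k \<subseteq> U" "smooth_on U \<Phi>" "\<And>x. x \<in> chemi k ==> \<Phi> x = \<phi> x" and pos: "\<And>x. x \<in> chemi k ==> \<phi> x > 0"
  using assms unfolding conf_factor_def by blast
 have oU: "open U" and sm: "\<And>is. continuous_on U (partials is \<Phi>)"
  and sd: "\<And>is i x. x \<in> U ==> (\<lambda>t. partials is \<Phi> (x + t *\<^sub>R axis i (1::real))) differentiable (at 0)"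
  using U(2) unfolding smooth_on_def by blast+
 have c\<Phi>: "continuous_on U \<Phi>" using sm[of "[]"] by simp
 have c\<phi>: "continuous_on (chemi k) \<phi>"
  using continuous_on_subset[OF c\<Phi> U(1)] U(3) by (rule continuous_on_eq)
 have hc: "x \<in> chemi k" if "x \<in> hemi k" for x using that by (auto simp: chemi_def hemi_def)
 have d\<Phi>: "(\<Phi> has_derivative (\<lambda>h. (\<chi> i. partial i \<Phi> x) \<bullet> h)) (at x)" if "x \<in> U" for x
  by (rule has_derivative_of_partials[OF oU that]) (use sd[of _ "[]"] sm[of "[_]"] in auto)
 have \<phi>0: "\<forall>x\<in>chemi k. \<phi> x \<noteq> 0" using pos by force
 have "\<exists>M. \<forall>x\<in>chemi k. norm (2 / \<phi> x * norm (\<chi> i. partial i \<Phi> x)) <= M"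
 proof -
  have "continuous_on (chemi k) (\<lambda>x. 2 / \<phi> x * norm (\<chi> i. partial i \<Phi> x))"
   using sm[of "[_]"] by (intro continuous_intros c\<phi> continuous_on_subset[OF _ U(1)] \<phi>0) auto
  then have "bounded ((\<lambda>x. 2 / \<phi> x * norm (\<chi> i. partial i \<Phi> x)) ` chemi k)"
   using compact_continuous_image[OF _ chemi_compact] compact_imp_bounded by blast
  then show ?thesis unfolding bounded_iff by blast
 qed
 then obtain M where M: "\<And>x. x \<in> chemi k ==> norm (2 / \<phi> x * norm (\<chi> i. partial i \<Phi> x)) <= M" by blast
 \<comment> \<open>At positive height the normalised line \<open>w\<close> stays in the hemisphere
   for small t, where \<Phi> and \<phi> agree; its velocity at 0 is the tangential part of the
   coordinate vector.\<close>
 have pe: "partial i (ext \<phi>) x = (\<chi> i. partial i \<Phi> x) \<bullet> (axis i 1 - (x $ i) *\<^sub>R x)" if x: "x \<in> hemi k" for x i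
 proof -
  have nx: "norm x = 1" and xk: "x $ k > 0" using x by (auto simp: hemi_def)
  have x0: "x \<noteq> 0" using nx by auto
  define w where "w t = (x + t *\<^sub>R axis i 1) /\<^sub>R norm (x + t *\<^sub>R axis i 1)" for t :: real
  have dl: "((\<lambda>t. x + t *\<^sub>R axis i 1) has_derivative (\<lambda>s. s *\<^sub>R axis i 1)) (at (0::real))" by (auto intro!: derivative_eq_intros)
  have dn: "((\<lambda>t. norm (x + t *\<^sub>R axis i 1)) has_derivative (\<lambda>s. s * (x $ i))) (at (0::real))"
  proof -
   have "(norm has_derivative (\<lambda>h. h \<bullet> sgn x)) (at (x + 0 *\<^sub>R axis i 1))" using has_derivative_norm[OF x0] x0 by simp
   from has_derivative_compose[OF dl this] show ?thesis using nx by (simp add: sgn_div_norm inner_axis inner_commute[of "axis i 1"])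
  qed
  have "norm (x + 0 *\<^sub>R axis i 1) \<noteq> 0" using x0 by simp
  from Deriv.has_derivative_inverse[OF this dn] have di: "((\<lambda>t. inverse (norm (x + t *\<^sub>R axis i 1))) has_derivative (\<lambda>s. - (s * (x $ i)))) (at 0)" using nx by simp
  have "(w has_derivative (\<lambda>s. inverse (norm (x + 0 *\<^sub>R axis i 1)) *\<^sub>R (s *\<^sub>R axis i 1) + (- (s * (x $ i))) *\<^sub>R (x + 0 *\<^sub>R axis i 1))) (at 0)"
   unfolding w_def by (rule has_derivative_scaleR[OF di dl])
  then have dw: "(w has_derivative (\<lambda>s. s *\<^sub>R (axis i 1 - (x $ i) *\<^sub>R x))) (at 0)" using nx by (simp add: algebra_simps)
  have w0: "w 0 = x" using nx by (simp add: w_def)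
  have xU: "x \<in> U" using U(1) hc[OF x] by blast
  have "(\<Phi> has_derivative (\<lambda>h. (\<chi> i. partial i \<Phi> x) \<bullet> h)) (at (w 0))" using d\<Phi>[OF xU] w0 by simp
  from has_derivative_compose[OF dw this]
  have 1: "((\<lambda>t. \<Phi> (w t)) has_derivative (\<lambda>s. (\<chi> i. partial i \<Phi> x) \<bullet> (s *\<^sub>R (axis i 1 - (x $ i) *\<^sub>R x)))) (at 0)" .
  have "((\<lambda>t::real. (x + t *\<^sub>R axis i 1) $ k) \<longlongrightarrow> (x + 0 *\<^sub>R axis i 1) $ k) (nhds 0)"
   by (intro tendsto_intros) (simp add: filterlim_ident)
  from order_tendstoD(1)[OF this, of 0] xk
  have "\<forall>\<^sub>F t in nhds (0::real). (x + t *\<^sub>R axis i 1) $ k > 0" by simp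
  then have "\<forall>\<^sub>F t in nhds (0::real). \<Phi> (w t) = ext \<phi> (x + t *\<^sub>R axis i 1)"
  proof eventually_elim
   case (elim t)
   have n0: "x + t *\<^sub>R axis i 1 \<noteq> 0"
   proof
    assume "x + t *\<^sub>R axis i 1 = 0"
    then have "(x + t *\<^sub>R axis i 1) $ k = 0" by (simp only: zero_index)
    then show False using elim by linarith
   qed
   then have "w t \<in> chemi k" using elim by (auto simp: w_def chemi_def intro!: mult_nonneg_nonneg)
   then show ?case using U(3) by (simp add: ext_def w_def)
  qed
  from has_derivative_cong_nhds[OF 1 this]
  have "((\<lambda>t. ext \<phi> (x + t *\<^sub>R axis i 1)) has_real_derivative ((\<chi> i. partial i \<Phi> x) \<bullet> (axis i 1 - (x $ i) *\<^sub>R x))) (at 0)"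
   unfolding has_field_derivative_def by (rule has_derivative_eq_rhs) (simp add: fun_eq_iff)
  then show ?thesis unfolding partial_def by (rule DERIV_imp_deriv)
 qed
 show thesis
 proof (rule that[of "2 * \<bar>M\<bar>"])
  fix x v :: "real^'m" assume x: "x \<in> hemi k"
  have nx: "norm x = 1" using x by (auto simp: hemi_def)
  define g where "g = (\<chi> i. partial i \<Phi> x)"
  have "(\<Sum>i\<in>UNIV. partial i (ext \<phi>) x * v $ i) = (\<Sum>i\<in>UNIV. g $ i * v $ i) - (g \<bullet> x) * (\<Sum>i\<in>UNIV. x $ i * v $ i)"
   unfolding pe[OF x] g_def[symmetric] by (simp add: inner_diff_right inner_axis sum_subtractf sum_distrib_left algebra_simps)
  also have "... = g \<bullet> v - (g \<bullet> x) * (x \<bullet> v)" by (simp add: inner_vec_def)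
  finally have eq: "(\<Sum>i\<in>UNIV. partial i (ext \<phi>) x * v $ i) = g \<bullet> v - (g \<bullet> x) * (x \<bullet> v)" .
  have "\<bar>g \<bullet> v\<bar> <= norm g * norm v" by (rule Cauchy_Schwarz_ineq2)
  moreover have "\<bar>(g \<bullet> x) * (x \<bullet> v)\<bar> <= norm g * norm v" unfolding abs_mult
   using Cauchy_Schwarz_ineq2[of g x] Cauchy_Schwarz_ineq2[of x v] nx by (intro mult_mono) auto
  ultimately have le: "\<bar>g \<bullet> v - (g \<bullet> x) * (x \<bullet> v)\<bar> <= 2 * (norm g * norm v)" by linarith
  have p: "2 / \<phi> x > 0" using pos[OF hc[OF x]] by simp
  have "\<bar>2 / \<phi> x * (\<Sum>i\<in>UNIV. partial i (ext \<phi>) x * v $ i)\<bar> = 2 / \<phi> x * \<bar>g \<bullet> v - (g \<bullet> x) * (x \<bullet> v)\<bar>"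
   unfolding eq abs_mult using p by simp
  also have "... <= 2 / \<phi> x * (2 * (norm g * norm v))" using le p by (intro mult_left_mono) auto
  also have "... = 2 * (2 / \<phi> x * norm g) * norm v" by simp
  also have "... <= 2 * \<bar>M\<bar> * norm v"
  proof -
   have "2 / \<phi> x * norm g <= \<bar>M\<bar>" using M[OF hc[OF x]] unfolding g_def real_norm_def by linarith
   then show ?thesis by (intro mult_right_mono mult_left_mono) auto
  qed
  finally show "\<bar>2 / \<phi> x * (\<Sum>i\<in>UNIV. partial i (ext \<phi>) x * v $ i)\<bar> <= 2 * \<bar>M\<bar> * norm v" .
 qed (use c\<phi> in auto)
qed

section \<open>The equation and the Neumann condition in a chart\<close>

locale cchart = chart k l k' \<iota> \<sigma> for k l :: "'m::finite" and k' :: "'n::finite" and \<iota> \<sigma> +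
 fixes \<phi> :: "real^'m => real" and \<beta>0 :: real
 assumes n3: "CARD('n) >= 3" and \<beta>0: "\<beta>0 >= 0"
  and \<phi>pos: "\<And>x. x \<in> chemi k ==> \<phi> x > 0" and \<phi>c: "continuous_on (chemi k) \<phi>"
  and \<phi>b: "\<And>x v. x \<in> hemi k ==> \<bar>2 / \<phi> x * (\<Sum>i\<in>UNIV. partial i (ext \<phi>) x * v $ i)\<bar> <= \<beta>0 * norm v"
begin

definition cv :: "(real^'m => real) => real^'n => real" where "cv u y = u (\<tau> (ab y))"
text \<open>Conformal factor of g in the chart: 4/(1+|y|^2)^2 from the stereographic projection and
  \<phi>^(4/(n-2)) from g, continued evenly across the hyperplane.\<close>

definition wt :: "real^'n => real" where
 "wt y = 4 / (1 + y \<bullet> y)^2 * \<phi> (\<tau> (ab y)) powr (4 / (dimn TYPE('m) - 2))"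
text \<open>4 \<beta>0 bounds the drift of the conformal factor, 2 n the one left by
  \<open>chart_hess\<close>, and 5 = 3 + 2 is the loss |y| + 2 on the ball of radius 3.\<close>

definition B :: real where "B = 5 * (4 * \<beta>0 + 2 * real CARD('n))"
definition chs :: "(real^'m => real) => (real^'m => real) => bool" where
 "chs u R \<longleftrightarrow> continuous_on (chemi k) u \<and> nsol (cv u) (ball 0 3) e 0 (\<lambda>y. wt y * R (\<tau> (ab y))) B"

lemma B0: "B >= 0" using \<beta>0 by (simp add: B_def)

lemma \<tau>_ab: "\<tau> (ab y) \<in> chemi k" by (rule \<tau>_chemi) (simp add: ab_e)

lemma wt_pos: "wt y > 0" unfolding wt_def using \<phi>pos[OF \<tau>_ab, of y] q1[of y] by simp

lemma cv_cont: "continuous_on (chemi k) u ==> continuous_on X (cv u)"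
 unfolding cv_def[abs_def] by (rule continuous_on_compose2[OF _ \<tau>_ab_cont]) (use \<tau>_ab in auto)

lemma wt_cont: "continuous_on X wt"
proof -
 have "continuous_on X (\<lambda>y. \<phi> (\<tau> (ab y)))" using cv_cont[OF \<phi>c, of X] by (simp add: cv_def[abs_def])
 then show ?thesis unfolding wt_def[abs_def]
  by (intro continuous_intros) (use \<phi>pos[OF \<tau>_ab] q1 in \<open>auto simp: less_imp_neq[symmetric]\<close>)
qed

text \<open>The equation is known at the unit vector \<open>\<tau> y\<close>, whereas the chart runs
  through the longer vector \<open>T y\<close>; homogeneity transports gradient and Hessian by the
  factors 1/r and 1/r^2.\<close>

lemma chart_interior:
 assumes u: "C2_on (hcone k) (ext u)" and eqn: "\<And>x. x \<in> hemi k ==> - lap_g \<phi> u x = R x"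
  and y: "y \<bullet> e > 0" "norm y < 3"
 obtains G H where "hess (cv u) y G H" "\<bar>tr H + wt y * R (\<tau> y)\<bar> <= B * norm (G y)"
proof -
 let ?n = "real CARD('n)"
 define r where "r = 1 + y \<bullet> y"
 have r: "r >= 1" by (simp add: r_def)
 have th: "\<tau> y \<in> hemi k" using \<tau>_hemi y by blast
 then have tc: "\<tau> y \<in> hcone k" by (auto simp: hemi_def hcone_def)
 have T\<tau>: "(1/r) *\<^sub>R T y = \<tau> y" by (simp add: \<tau>_def r_def divide_inverse)
 obtain H0 where H0: "hess (ext u) (\<tau> y) (\<lambda>x. \<chi> i. partial i (ext u) x) H0" "tr H0 = (\<Sum>i\<in>UNIV. partial i (partial i (ext u)) (\<tau> y))"
  using C2_on_hess[OF hcone_open tc u] .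
 define G0 where "G0 = (\<lambda>x. \<chi> i. partial i (ext u) x)"
 have "hess (ext u) (0 + (1/r) *\<^sub>R T y) G0 H0" using H0(1) T\<tau> by (simp add: G0_def)
 from hess_affine[OF this] have h1: "hess (\<lambda>x. ext u (0 + (1/r) *\<^sub>R x)) (T y) (\<lambda>x. (1/r) *\<^sub>R G0 (0 + (1/r) *\<^sub>R x)) (\<lambda>h. (1/r * (1/r)) *\<^sub>R H0 h)" .
 have "(\<lambda>x. ext u (0 + (1/r) *\<^sub>R x)) = ext u" using r by (auto simp: fun_eq_iff ext_scale)
 then have h2: "hess (ext u) (T y) (\<lambda>x. (1/r) *\<^sub>R G0 (0 + (1/r) *\<^sub>R x)) (\<lambda>h. (1/r * (1/r)) *\<^sub>R H0 h)" using h1 by simp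
 define Gx where "Gx = (1/r) *\<^sub>R G0 (\<tau> y)"
 obtain G2 H2 where h3: "hess (\<lambda>y. ext u (T y)) y G2 H2"
  and t3': "tr H2 = 4 * tr (\<lambda>h. (1/r * (1/r)) *\<^sub>R H0 h) + (4 - 2 * ?n) * ((1/r) *\<^sub>R G0 (0 + (1/r) *\<^sub>R T y) \<bullet> z)"
  and g3': "norm ((1/r) *\<^sub>R G0 (0 + (1/r) *\<^sub>R T y)) <= (norm y + 2) * norm (G2 y)"
  using chart_hess[OF h2 ext_scale] .
 have GG: "(1/r) *\<^sub>R G0 (0 + (1/r) *\<^sub>R T y) = Gx" unfolding Gx_def add_0 T\<tau> ..
 note t3 = t3'[unfolded GG] and g3 = g3'[unfolded GG]
 have "\<forall>\<^sub>F w in nhds y. w \<in> {w. w \<bullet> e > 0}" using y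
  by (intro eventually_nhds_in_open open_Collect_less continuous_intros) auto
 then have "\<forall>\<^sub>F w in nhds y. ext u (T w) = cv u w"
  by (rule eventually_mono) (auto simp: cv_def ab_pos ext_T)
 from hess_cong[OF h3 this] have h4: "hess (cv u) y G2 H2" .
 define P where "P = \<phi> (\<tau> y) powr (4 / (dimn TYPE('m) - 2))"
 have \<phi>p: "\<phi> (\<tau> y) > 0" using \<phi>pos \<tau>_chemi y by (simp add: less_imp_le)
 have "- lap_g \<phi> u (\<tau> y) = R (\<tau> y)" using eqn th by blast
 then have "P * R (\<tau> y) = - (tr H0 + 2 / \<phi> (\<tau> y) * (\<Sum>i\<in>UNIV. partial i (ext \<phi>) (\<tau> y) * partial i (ext u) (\<tau> y)))"
 proof -
  assume a: "- lap_g \<phi> u (\<tau> y) = R (\<tau> y)"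
  have "P * \<phi> (\<tau> y) powr (- 4 / (dimn TYPE('m) - 2)) = 1"
   unfolding P_def using \<phi>p by (simp flip: powr_add)
  then show ?thesis unfolding a[symmetric] lap_g_def H0(2) by (simp flip: mult.assoc)
 qed
 then have "\<bar>tr H0 + P * R (\<tau> y)\<bar> = \<bar>2 / \<phi> (\<tau> y) * (\<Sum>i\<in>UNIV. partial i (ext \<phi>) (\<tau> y) * G0 (\<tau> y) $ i)\<bar>" by (simp add: G0_def)
 also have "... <= \<beta>0 * norm (G0 (\<tau> y))" by (rule \<phi>b[OF th])
 also have "norm (G0 (\<tau> y)) = r * norm Gx" using r by (simp add: Gx_def)
 finally have L: "\<bar>tr H0 + P * R (\<tau> y)\<bar> <= \<beta>0 * (r * norm Gx)" .
 have abp: "ab y = y" using y by (simp add: ab_pos)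
 have wty: "wt y = 4 / r^2 * P" by (simp add: wt_def abp r_def P_def)
 have "tr H2 + wt y * R (\<tau> y) = 4 / r^2 * (tr H0 + P * R (\<tau> y)) + (4 - 2 * ?n) * (Gx \<bullet> z)"
  unfolding t3 wty tr_scale by (simp add: power2_eq_square algebra_simps)
 moreover have "\<bar>4 / r^2 * (tr H0 + P * R (\<tau> y))\<bar> <= 4 * \<beta>0 * norm Gx"
 proof -
  have "\<bar>4 / r^2 * (tr H0 + P * R (\<tau> y))\<bar> = 4 / r^2 * \<bar>tr H0 + P * R (\<tau> y)\<bar>" unfolding abs_mult by simp
  also have "... <= 4 / r^2 * (\<beta>0 * (r * norm Gx))" using L by (intro mult_left_mono) auto
  also have "... = 4 * \<beta>0 * norm Gx / r" using r by (simp add: power2_eq_square field_simps)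
  also have "... <= 4 * \<beta>0 * norm Gx / 1" using r \<beta>0 by (intro divide_left_mono) auto
  finally show ?thesis by simp
 qed
 moreover have "\<bar>(4 - 2 * ?n) * (Gx \<bullet> z)\<bar> <= 2 * ?n * norm Gx"
 proof -
  have "norm z = 1" using zz by (simp add: norm_eq_1)
  then have "\<bar>Gx \<bullet> z\<bar> <= norm Gx" using Cauchy_Schwarz_ineq2[of Gx z] by simp
  then show ?thesis unfolding abs_mult using n3 by (intro mult_mono) auto
 qed
 ultimately have "\<bar>tr H2 + wt y * R (\<tau> y)\<bar> <= 4 * \<beta>0 * norm Gx + 2 * ?n * norm Gx" by linarith
 also have "... = (4 * \<beta>0 + 2 * ?n) * norm Gx" by (simp add: algebra_simps)
 also have "... <= (4 * \<beta>0 + 2 * ?n) * (5 * norm (G2 y))"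
 proof (rule mult_left_mono)
  have "(norm y + 2) * norm (G2 y) <= 5 * norm (G2 y)" using y by (intro mult_right_mono) auto
  then show "norm Gx <= 5 * norm (G2 y)" using g3 by linarith
 qed (use \<beta>0 in simp)
 also have "... = B * norm (G2 y)" by (simp add: B_def)
 finally show thesis using that[OF h4] by blast
qed

text \<open>\<open>has_normal_deriv_g\<close> follows the great circle from Y towards e_k. The curve
  \<open>\<gamma>\<close> is its stereographic image, with \<open>P\<close> the chart coordinates
  and \<open>D\<close> the denominator 1 + (point . z); it leaves along \<open>e\<close>, and its
  mirror image serves the other side.\<close>

lemma chart_neum:
 assumes nd: "\<And>Y. Y \<in> bdry k ==> has_normal_deriv_g k \<phi> u Y 0" and y: "y \<bullet> e = 0"
 shows "neum (cv u) e y"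
proof -
 define q where "q = y \<bullet> y"
 have q: "q >= 0" by (simp add: q_def)
 define m where "m = (1 - q) / (1 + q)"
 have m1: "1 + m = 2 / (1 + q)" "m > -1" using q by (auto simp: m_def field_simps)
 define P where "P t = (cos t * (2 / (1 + q))) *\<^sub>R y + sin t *\<^sub>R e" for t :: real
 define D where "D t = 1 + cos t * m" for t :: real
 define \<gamma> where "\<gamma> t = P t /\<^sub>R D t" for t
 define Y where "Y = \<tau> y"
 have YJ: "Y = (2 / (1 + q)) *\<^sub>R J y + m *\<^sub>R z"
  unfolding Y_def \<tau>_def T_def q_def[symmetric] m_def by (simp add: scaleR_add_right divide_inverse mult.commute)
 have ev: "\<forall>\<^sub>F t in at_right (0::real). 0 < t \<and> t < 1" unfolding eventually_at_right[OF zero_less_one] by (intro exI[of _ 1]) auto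
 have Dp: "D t > 0" and st: "sin t > 0" if t: "0 < t" "t < 1" for t
 proof -
  have c: "cos t > 0" using t pi_gt3 by (intro cos_gt_zero_pi) auto
  show "sin t > 0" using t pi_gt3 by (intro sin_gt_zero) auto
  show "D t > 0"
  proof (cases "m >= 0")
   case True then have "cos t * m >= 0" using c by simp
   then show ?thesis by (simp add: D_def)
  next
   case False
   then have "cos t * m >= 1 * m" by (intro mult_right_mono_neg) auto
   then show ?thesis using m1(2) by (simp add: D_def)
  qed
 qed
 have g1: "(\<gamma> t - y) /\<^sub>R t = (((cos t - 1) / t) *\<^sub>R y + (sin t / t) *\<^sub>R e) /\<^sub>R D t" if t: "0 < t" "t < 1" for t
 proof -
  have "cos t * (2 / (1 + q)) - D t = cos t - 1" using m1(1)[symmetric] by (simp add: D_def algebra_simps)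
  then have "P t = D t *\<^sub>R y + ((cos t - 1) *\<^sub>R y + sin t *\<^sub>R e)"
   unfolding P_def by (metis (no_types, lifting) add.assoc diff_add_cancel add.commute scaleR_add_left)
  then have "\<gamma> t - y = ((cos t - 1) *\<^sub>R y + sin t *\<^sub>R e) /\<^sub>R D t" unfolding \<gamma>_def using Dp[OF t] by (simp add: scaleR_add_right)
  then show ?thesis by (simp add: scaleR_add_right divide_inverse mult_ac)
 qed
 have lc: "((\<lambda>t. (cos t - 1) / t) \<longlongrightarrow> 0) (at_right (0::real))"
 proof -
  have "(cos has_real_derivative 0) (at 0 within {0<..})" by (auto intro!: derivative_eq_intros)
  then show ?thesis by (simp add: has_field_derivative_iff)
 qed
 have ls: "((\<lambda>t. sin t / t) \<longlongrightarrow> 1) (at_right (0::real))"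
 proof -
  have "(sin has_real_derivative 1) (at 0 within {0<..})" by (auto intro!: derivative_eq_intros)
  then show ?thesis by (simp add: has_field_derivative_iff)
 qed
 have lD: "(D \<longlongrightarrow> 1 + m) (at_right 0)" unfolding D_def by (auto intro!: tendsto_eq_intros)
 have m0: "1 + m > 0" using m1(2) by simp
 have "((\<lambda>t. (((cos t - 1) / t) *\<^sub>R y + (sin t / t) *\<^sub>R e) /\<^sub>R D t) \<longlongrightarrow> (0 *\<^sub>R y + 1 *\<^sub>R e) /\<^sub>R (1 + m)) (at_right 0)"
  by (intro tendsto_intros lc ls lD) (use m0 in simp)
 moreover have "\<forall>\<^sub>F t in at_right 0. (((cos t - 1) / t) *\<^sub>R y + (sin t / t) *\<^sub>R e) /\<^sub>R D t = (\<gamma> t - y) /\<^sub>R t"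
  using ev by (rule eventually_mono) (metis g1)
 ultimately have lim1: "((\<lambda>t. (\<gamma> t - y) /\<^sub>R t) \<longlongrightarrow> inverse (1 + m) *\<^sub>R e) (at_right 0)"
  using Lim_transform_eventually by fastforce
 have \<tau>\<gamma>: "\<tau> (\<gamma> t) = cos t *\<^sub>R Y + sin t *\<^sub>R axis k 1" and ge: "\<gamma> t \<bullet> e > 0" if t: "0 < t" "t < 1" for t
 proof -
  define w where "w = cos t * m"
  have D: "D t = 1 + w" "1 + w > 0" using Dp[OF t] by (auto simp: D_def w_def)
  have PP: "P t \<bullet> P t = 1 - w^2"
  proof -
   have A: "P t \<bullet> P t = (cos t)^2 * ((2 / (1 + q))^2 * q) + (sin t)^2"
    unfolding P_def using y by (simp add: inner_add_left inner_add_right inner_commute[of e y] e1 q_def power2_eq_square)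
   have X: "(2 / (1 + q))^2 * q = 1 - m^2"
   proof -
    have "(1 + q)^2 \<noteq> 0" using q by simp
    moreover have "1 - b / c = (c - b) / c" if "c \<noteq> 0" for b c :: real using that by (simp add: diff_divide_distrib)
    ultimately have "1 - m^2 = ((1 + q)^2 - (1 - q)^2) / (1 + q)^2" unfolding m_def power_divide by blast
    also have "(1 + q)^2 - (1 - q)^2 = 4 * q" by (simp add: power2_eq_square algebra_simps)
    finally show ?thesis by (simp add: power_divide)
   qed
   show ?thesis unfolding A X using sin_cos_squared_add[of t] by (simp add: w_def power_mult_distrib right_diff_distrib)
  qed
  have gg: "\<gamma> t \<bullet> \<gamma> t = (1 - w) / (1 + w)"
  proof -
   have "\<gamma> t \<bullet> \<gamma> t = (1 - w^2) / (1 + w)^2" unfolding \<gamma>_def D using PP by (simp add: power2_eq_square divide_inverse)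
   also have "1 - w^2 = (1 - w) * (1 + w)" by (simp add: power2_eq_square algebra_simps)
   finally show ?thesis using D(2) by (simp add: power2_eq_square)
  qed
  have s1: "1 + \<gamma> t \<bullet> \<gamma> t = 2 / (1 + w)" "1 - \<gamma> t \<bullet> \<gamma> t = 2 * w / (1 + w)" unfolding gg using D(2) by (auto simp: field_simps)
  have "\<tau> (\<gamma> t) = ((1 + w) / 2) *\<^sub>R (2 *\<^sub>R J (\<gamma> t) + (2 * w / (1 + w)) *\<^sub>R z)"
   unfolding \<tau>_def T_def s1 using D(2) by simp
  also have "J (\<gamma> t) = J (P t) /\<^sub>R (1 + w)" unfolding \<gamma>_def D by (simp add: linear_cmul[OF J_linear])
  also have "((1 + w) / 2) *\<^sub>R (2 *\<^sub>R (J (P t) /\<^sub>R (1 + w)) + (2 * w / (1 + w)) *\<^sub>R z) = J (P t) + w *\<^sub>R z"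
   using D(2) by (simp add: scaleR_add_right)
  also have "J (P t) = (cos t * (2 / (1 + q))) *\<^sub>R J y + sin t *\<^sub>R axis k 1"
   unfolding P_def by (simp add: linear_add[OF J_linear] linear_cmul[OF J_linear] Je)
  also have "(cos t * (2 / (1 + q))) *\<^sub>R J y + sin t *\<^sub>R axis k 1 + w *\<^sub>R z = cos t *\<^sub>R Y + sin t *\<^sub>R axis k 1"
   unfolding YJ w_def by (simp add: scaleR_add_right)
  finally show "\<tau> (\<gamma> t) = cos t *\<^sub>R Y + sin t *\<^sub>R axis k 1" .
  have "\<gamma> t \<bullet> e = sin t / (1 + w)" unfolding \<gamma>_def P_def D using y by (simp add: inner_add_left e1 divide_inverse mult.commute)
  then show "\<gamma> t \<bullet> e > 0" using st[OF t] D(2) by simp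
 qed
 have YB: "Y \<in> bdry k" unfolding Y_def by (rule \<tau>_bdry[OF y])
 then have YC: "Y \<in> chemi k" by (auto simp: bdry_def chemi_def)
 obtain Dd where Dd: "((\<lambda>t. (u (cos t *\<^sub>R Y + sin t *\<^sub>R axis k 1) - u Y) / t) \<longlongrightarrow> Dd) (at_right 0)"
  "0 = - (\<phi> Y powr (- 2 / (dimn TYPE('m) - 2))) * Dd" using nd[OF YB] unfolding has_normal_deriv_g_def by blast
 have "Dd = 0" using Dd(2) \<phi>pos[OF YC] by simp
 then have lim2: "((\<lambda>t. (u (cos t *\<^sub>R Y + sin t *\<^sub>R axis k 1) - u Y) / t) \<longlongrightarrow> 0) (at_right 0)" using Dd(1) by simp
 have cvy: "cv u y = u Y" using y by (simp add: cv_def ab_pos Y_def)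
 have cvg: "cv u (\<gamma> t) = u (cos t *\<^sub>R Y + sin t *\<^sub>R axis k 1)" "cv u (rf (\<gamma> t)) = u (cos t *\<^sub>R Y + sin t *\<^sub>R axis k 1)" if t: "0 < t" "t < 1" for t
  using \<tau>\<gamma>[OF t] ge[OF t] by (auto simp: cv_def ab_rf ab_pos)
 have V1: "((\<lambda>t. (cv u (\<gamma> t) - cv u y) / t) \<longlongrightarrow> 0) (at_right 0)" and V2: "((\<lambda>t. (cv u (rf (\<gamma> t)) - cv u y) / t) \<longlongrightarrow> 0) (at_right 0)"
  by (rule Lim_transform_eventually[OF lim2], rule eventually_mono[OF ev], use cvg cvy in simp)+
 have ry: "rf y = y" using y by (simp add: rf_def)
 have "bounded_linear rf" using rf_linear linear_conv_bounded_linear by blast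
 from bounded_linear.tendsto[OF this lim1]
 have "((\<lambda>t. rf ((\<gamma> t - y) /\<^sub>R t)) \<longlongrightarrow> rf (inverse (1 + m) *\<^sub>R e)) (at_right 0)" .
 moreover have "rf ((\<gamma> t - y) /\<^sub>R t) = (rf (\<gamma> t) - y) /\<^sub>R t" for t
  by (simp add: linear_cmul[OF rf_linear] linear_diff[OF rf_linear] ry)
 moreover have "rf (inverse (1 + m) *\<^sub>R e) = (- 1 * inverse (1 + m)) *\<^sub>R e"
 proof -
  have "rf e = - e" by (simp add: rf_def e1 algebra_simps flip: scaleR_2)
  then show ?thesis by (simp add: linear_cmul[OF rf_linear])
 qed
 ultimately have lim3: "((\<lambda>t. (rf (\<gamma> t) - y) /\<^sub>R t) \<longlongrightarrow> (- 1 * inverse (1 + m)) *\<^sub>R e) (at_right 0)" by simp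
 show ?thesis unfolding neum_def
 proof
  fix s :: real assume s: "s \<in> {1, -1}"
  show "\<exists>\<gamma> c. 0 < c \<and> ((\<lambda>t. (\<gamma> t - y) /\<^sub>R t) \<longlongrightarrow> (s * c) *\<^sub>R e) (at_right 0) \<and> ((\<lambda>t. (cv u (\<gamma> t) - cv u y) / t) \<longlongrightarrow> 0) (at_right 0)"
  proof (cases "s = 1")
   case True
   then show ?thesis using lim1 V1 m0 by (intro exI[of _ \<gamma>] exI[of _ "inverse (1 + m)"]) simp
  next
   case False
   then have "s = -1" using s by simp
   then show ?thesis using lim3 V2 m0 by (intro exI[of _ "\<lambda>t. rf (\<gamma> t)"] exI[of _ "inverse (1 + m)"]) simp
  qed
 qed
qed

text \<open>Below the hyperplane the chart function is its own composition with the reflection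
  \<open>rf\<close>, under which the trace of the Hessian and the length of the gradient are
  unchanged.\<close>

lemma chart_chs:
 assumes ns: "neumann_sol k \<phi> u R"
 shows "chs u R"
proof -
 have cu: "continuous_on (chemi k) u" and c2: "C2_on (hcone k) (ext u)" and eqn: "\<And>x. x \<in> hemi k ==> - lap_g \<phi> u x = R x"
  and nd: "\<And>Y. Y \<in> bdry k ==> has_normal_deriv_g k \<phi> u Y 0" using ns unfolding neumann_sol_def by blast+
 have up: "\<exists>G H. hess (cv u) y G H \<and> \<bar>tr H + wt y * R (\<tau> (ab y))\<bar> <= B * norm (G y)" if y: "y \<bullet> e > 0" "norm y < 3" for y
 proof -
  obtain G H where "hess (cv u) y G H" "\<bar>tr H + wt y * R (\<tau> y)\<bar> <= B * norm (G y)" using chart_interior[OF c2 eqn y] .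
  moreover have "ab y = y" using y by (simp add: ab_pos)
  ultimately show ?thesis by auto
 qed
 have dn: "\<exists>G H. hess (cv u) y G H \<and> \<bar>tr H + wt y * R (\<tau> (ab y))\<bar> <= B * norm (G y)" if y: "y \<bullet> e < 0" "norm y < 3" for y
 proof -
  have "rf y \<bullet> e > 0" "norm (rf y) < 3" using y by (auto simp: rf_e rf_norm)
  from up[OF this] obtain G H where GH: "hess (cv u) (rf y) G H" "\<bar>tr H + wt (rf y) * R (\<tau> (ab (rf y)))\<bar> <= B * norm (G (rf y))" by blast
  have bl: "bounded_linear rf" using rf_linear linear_conv_bounded_linear by blast
  have dr: "(rf has_derivative rf) (at w)" for w using bounded_linear_imp_has_derivative[OF bl] .
  note hc = hess_compose[OF GH(1) always_eventually[of "\<lambda>w. (rf has_derivative rf) (at w)", OF allI[OF dr]] has_derivative_const]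
  have "(\<lambda>w. cv u (rf w)) = cv u" by (simp add: fun_eq_iff cv_def ab_rf)
  then have h: "hess (cv u) y (\<lambda>w. \<Sum>b\<in>Basis. (G (rf w) \<bullet> rf b) *\<^sub>R b) (\<lambda>k. \<Sum>b\<in>Basis. (G (rf y) \<bullet> 0 + H (rf k) \<bullet> rf b) *\<^sub>R b)"
   using hc(1) by simp
  have linH: "linear H" using GH(1) unfolding hess_def by (blast intro: has_derivative_linear)
  have t: "tr (\<lambda>k. \<Sum>b\<in>Basis. (G (rf y) \<bullet> 0 + H (rf k) \<bullet> rf b) *\<^sub>R b) = tr H"
   unfolding hc(2) using tr_reflect[OF linH e1(1)] by (simp add: rf_def)
  have "(\<Sum>b\<in>Basis. (G (rf y) \<bullet> rf b) *\<^sub>R b) = rf (G (rf y))"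
  proof (rule vector_eq_rdot[THEN iffD1], rule allI)
   fix h
   have "G (rf y) \<bullet> rf h = rf (G (rf y)) \<bullet> h" using rf_inner[of "rf (G (rf y))" h] by (simp add: rf_rf)
   then show "(\<Sum>b\<in>Basis. (G (rf y) \<bullet> rf b) *\<^sub>R b) \<bullet> h = rf (G (rf y)) \<bullet> h" using basis_adjoint[OF rf_linear] by simp
  qed
  then have g: "norm (\<Sum>b\<in>Basis. (G (rf y) \<bullet> rf b) *\<^sub>R b) = norm (G (rf y))" by (simp add: rf_norm)
  have w: "wt (rf y) = wt y" by (simp add: wt_def ab_rf rf_inner)
  have "\<bar>tr (\<lambda>k. \<Sum>b\<in>Basis. (G (rf y) \<bullet> 0 + H (rf k) \<bullet> rf b) *\<^sub>R b) + wt y * R (\<tau> (ab y))\<bar> <= B * norm (\<Sum>b\<in>Basis. (G (rf y) \<bullet> rf b) *\<^sub>R b)"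
   unfolding t g using GH(2) by (simp add: w ab_rf)
  with h show ?thesis by blast
 qed
 have "nsol (cv u) (ball 0 3) e 0 (\<lambda>y. wt y * R (\<tau> (ab y))) B" unfolding nsol_def
 proof (intro conjI ballI)
  show "continuous_on (ball 0 3) (cv u)" by (rule cv_cont[OF cu])
  fix y :: "real^'n" assume "y \<in> ball 0 3"
  then have n: "norm y < 3" by simp
  show "if y \<bullet> e = 0 then neum (cv u) e y else \<exists>G H. hess (cv u) y G H \<and> \<bar>tr H + wt y * R (\<tau> (ab y))\<bar> <= B * norm (G y)"
  proof (cases "y \<bullet> e = 0")
   case True
   then show ?thesis using chart_neum[OF nd True] by simp
  next
   case False
   have "\<exists>G H. hess (cv u) y G H \<and> \<bar>tr H + wt y * R (\<tau> (ab y))\<bar> <= B * norm (G y)"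
   proof (cases "y \<bullet> e > 0")
    case True show ?thesis by (rule up[OF True n])
   next
    case nl: False
    then have "y \<bullet> e < 0" using False by simp
    then show ?thesis by (rule dn[OF _ n])
   qed
   then show ?thesis using False by simp
  qed
 qed
 then show ?thesis using cu by (simp add: chs_def)
qed

end

section \<open>Equicontinuity and limits within one chart\<close>

lemma vsup_shift: "vsup \<beta> (\<lambda>z. w z - c) y a \<longleftrightarrow> vsup \<beta> w y a"
 unfolding vsup_def by simp

context cchart begin

text \<open>Stereographic projection, inverse to \<open>\<tau>\<close> away from the pole
  -z.\<close>

definition S :: "real^'m => real^'n" where "S x = Q x /\<^sub>R (1 + x \<bullet> z)"

text \<open>The half facing \<open>z\<close> lands in the closed unit ball, so two charts with
  opposite poles need only that ball each.\<close>

lemma S_inv: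
 assumes x: "x \<in> chemi k" and c: "1 + x \<bullet> z > 0"
 shows "\<tau> (S x) = x" "S x \<bullet> e >= 0" "x \<bullet> z >= 0 ==> norm (S x) <= 1"
proof -
 define a where "a = x \<bullet> z"
 have a: "1 + a > 0" using c by (simp add: a_def)
 have nx: "norm x = 1" and xk: "x $ k >= 0" using x by (auto simp: chemi_def)
 have "x \<bullet> x = x \<bullet> (J (Q x) + a *\<^sub>R z)" using decomp[of x] by (simp add: a_def)
 also have "... = Q x \<bullet> Q x + a * a" using J_inner[of "Q x" x] by (simp add: inner_add_right inner_commute a_def)
 finally have QQ: "Q x \<bullet> Q x = (1 - a) * (1 + a)" using nx by (simp add: dot_square_norm algebra_simps)
 have SS: "S x \<bullet> S x = (1 - a) / (1 + a)" unfolding S_def a_def[symmetric] using a by (simp add: QQ divide_inverse)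
 have s1: "1 + S x \<bullet> S x = 2 / (1 + a)" "1 - S x \<bullet> S x = 2 * a / (1 + a)" unfolding SS using a by (auto simp: field_simps)
 have "\<tau> (S x) = ((1 + a) / 2) *\<^sub>R (2 *\<^sub>R J (S x) + (2 * a / (1 + a)) *\<^sub>R z)"
  unfolding \<tau>_def T_def s1 using a by simp
 also have "J (S x) = J (Q x) /\<^sub>R (1 + a)" unfolding S_def a_def[symmetric] by (simp add: linear_cmul[OF J_linear])
 also have "((1 + a) / 2) *\<^sub>R (2 *\<^sub>R (J (Q x) /\<^sub>R (1 + a)) + (2 * a / (1 + a)) *\<^sub>R z) = J (Q x) + a *\<^sub>R z"
  using a by (simp add: scaleR_add_right)
 also have "... = x" using decomp[of x] by (simp add: a_def)
 finally show "\<tau> (S x) = x" .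
 have "S x \<bullet> e = x $ k / (1 + a)" unfolding S_def a_def[symmetric] by (simp add: ye Q_def kk divide_inverse mult.commute)
 then show "S x \<bullet> e >= 0" using xk a by simp
 assume "x \<bullet> z >= 0"
 then have "S x \<bullet> S x <= 1" unfolding SS using a by (simp add: a_def[symmetric] divide_le_eq)
 then show "norm (S x) <= 1" by (simp add: norm_eq_sqrt_inner real_sqrt_le_1_iff)
qed

lemma cv_S: "x \<in> chemi k ==> 1 + x \<bullet> z > 0 ==> cv u (S x) = u x"
 using S_inv by (simp add: cv_def ab_pos)

lemma S_isCont: "1 + x \<bullet> z > 0 ==> isCont S x"
proof -
 assume p: "1 + x \<bullet> z > 0"
 have "continuous_on UNIV Q" unfolding Q_def[abs_def] by (intro continuous_on_vec_lambda continuous_intros)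
 then have "isCont Q x" by (simp add: continuous_on_eq_continuous_at)
 then show ?thesis unfolding S_def[abs_def] using p by (intro continuous_intros) auto
qed

lemma wt_bound: "\<exists>Wb\<ge>0. \<forall>y\<in>ball 0 3. wt y <= Wb"
proof -
 have "bounded (wt ` cball 0 3)" by (intro compact_imp_bounded compact_continuous_image wt_cont compact_cball)
 then obtain Wb where "\<forall>y\<in>cball 0 3. norm (wt y) <= Wb" unfolding bounded_iff by blast
 then have "norm (wt y) <= Wb" if "y \<in> ball 0 3" for y using that by auto
 then have "\<forall>y\<in>ball 0 3. wt y <= \<bar>Wb\<bar>" by fastforce
 then show ?thesis by (intro exI[of _ "\<bar>Wb\<bar>"]) simp
qed

text \<open>\<open>d\<close> depends on the bounds but not on the solution, because the chart
  estimate is uniform and \<open>S\<close> is continuous at \<open>x\<close>.\<close>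

lemma equicontinuous_at:
 assumes Bu: "Bu >= 0" and Kr: "Kr >= 0" and x: "x \<in> chemi k" "x \<bullet> z >= 0" and \<nu>: "\<nu> > 0"
 shows "\<exists>d>0. \<forall>u R. chs u R --> (\<forall>x\<in>chemi k. \<bar>u x\<bar> <= Bu) --> (\<forall>x\<in>chemi k. \<bar>R x\<bar> <= Kr) -->
  (\<forall>x'\<in>chemi k. norm (x - x') < d --> \<bar>u x - u x'\<bar> < \<nu>)"
proof -
 obtain Wb where Wb: "Wb >= 0" "\<forall>y\<in>ball 0 3. wt y <= Wb" using wt_bound by blast
 have WK: "Wb * Kr >= 0" using Wb Kr by simp
 obtain L s where L: "L > 0" and s: "s > 0" and
  lip: "\<And>(v :: real^'n => real) \<Omega> e h F x z. nsol v \<Omega> e h F B ==> norm e = 1 ==> cball z 1 \<subseteq> \<Omega> ==>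
   \<forall>y\<in>\<Omega>. \<bar>v y\<bar> <= Bu ==> \<forall>y\<in>\<Omega>. \<bar>F y\<bar> <= Wb * Kr ==> x \<in> cball z s ==> \<bar>v x - v z\<bar> <= L * dist x z"
 proof (rule nsol_lipschitz[OF B0 Bu WK, where 'a = "real^'n"])
  fix L s assume "L > 0" "s > 0" "s <= 1/4"
   "\<And>(v :: real^'n => real) \<Omega> e h F x z. nsol v \<Omega> e h F B ==> norm e = 1 ==> cball z 1 \<subseteq> \<Omega> ==>
   \<forall>y\<in>\<Omega>. \<bar>v y\<bar> <= Bu ==> \<forall>y\<in>\<Omega>. \<bar>F y\<bar> <= Wb * Kr ==> x \<in> cball z s ==> \<bar>v x - v z\<bar> <= L * dist x z"
  then show thesis by (intro that[of L s])
 qed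
 have c1: "1 + x \<bullet> z > 0" using x by simp
 define \<delta> where "\<delta> = min s (\<nu> / (L + 1))"
 have \<delta>: "\<delta> > 0" "\<delta> <= s" "\<delta> <= \<nu> / (L + 1)" unfolding \<delta>_def using s L \<nu> by auto
 obtain d0 where d0: "d0 > 0" "\<And>x'. dist x' x < d0 ==> dist (S x') (S x) < \<delta>"
  using S_isCont[OF c1] \<delta>(1) unfolding continuous_at_eps_delta by metis
 define d where "d = min d0 (1/2)"
 have "\<bar>u x - u x'\<bar> < \<nu>" if ch: "chs u R" and ub: "\<forall>x\<in>chemi k. \<bar>u x\<bar> <= Bu" and Rb: "\<forall>x\<in>chemi k. \<bar>R x\<bar> <= Kr"
  and x': "x' \<in> chemi k" "norm (x - x') < d" for u R x'
 proof -
  have nz: "norm z = 1" using zz by (simp add: norm_eq_1)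
  have "\<bar>(x - x') \<bullet> z\<bar> <= norm (x - x')" using Cauchy_Schwarz_ineq2[of "x - x'" z] nz by simp
  then have "\<bar>x \<bullet> z - x' \<bullet> z\<bar> < 1/2" using x' by (simp add: d_def inner_diff_left)
  then have c2: "1 + x' \<bullet> z > 0" using x by linarith
  have dS: "dist (S x') (S x) < \<delta>" using d0(2)[of x'] x' by (simp add: d_def dist_norm norm_minus_commute)
  have nS: "norm (S x) <= 1" using S_inv(3)[OF x(1) c1 x(2)] .
  have cb: "cball (S x) 1 \<subseteq> ball 0 3"
  proof
   fix w assume "w \<in> cball (S x) 1"
   then show "w \<in> ball 0 3" using nS norm_triangle_ineq2[of w "S x"] by (simp add: dist_norm norm_minus_commute)
  qed
  have FB: "\<forall>y\<in>ball 0 3. \<bar>wt y * R (\<tau> (ab y))\<bar> <= Wb * Kr"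
  proof
   fix y :: "real^'n" assume "y \<in> ball 0 3"
   then have "wt y <= Wb" using Wb(2) by blast
   moreover have "\<bar>R (\<tau> (ab y))\<bar> <= Kr" using Rb \<tau>_ab by blast
   ultimately show "\<bar>wt y * R (\<tau> (ab y))\<bar> <= Wb * Kr"
    unfolding abs_mult using wt_pos[of y] Wb(1) by (intro mult_mono) auto
  qed
  have vB: "\<forall>y\<in>ball 0 3. \<bar>cv u y\<bar> <= Bu" using ub \<tau>_ab by (simp add: cv_def)
  have "\<bar>cv u (S x') - cv u (S x)\<bar> <= L * dist (S x') (S x)"
   by (rule lip[OF ch[unfolded chs_def, THEN conjunct2] e1(1) cb vB FB]) (use dS \<delta> in \<open>simp add: dist_commute\<close>)
  also have "... <= L * (\<nu> / (L + 1))" using dS \<delta> L by (intro mult_left_mono) auto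
  also have "... < \<nu>" using L \<nu> by (simp add: field_simps)
  finally show ?thesis using cv_S[OF x(1) c1] cv_S[OF x'(1) c2] by (simp add: abs_minus_commute)
 qed
 moreover have "d > 0" using d0 by (simp add: d_def)
 ultimately show ?thesis by blast
qed

text \<open>No derivative of the limit is available; \<open>vsup_lim\<close> supplies the
  supersolution property, equator points included, once the weighted right-hand sides are seen to
  converge uniformly.\<close>

lemma limit_vsup:
 fixes u R :: "nat => real^'m => real"
 assumes ch: "\<And>m. chs (u m) (R m)"
  and ug: "\<And>\<nu>. \<nu> > 0 ==> \<forall>\<^sub>F m in sequentially. \<forall>x\<in>chemi k. \<bar>u m x - g x\<bar> < \<nu>"
  and Rl: "\<And>\<nu>. \<nu> > 0 ==> \<forall>\<^sub>F m in sequentially. \<forall>x\<in>chemi k. \<bar>R m x - Rr x\<bar> < \<nu>"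
  and cR: "continuous_on (chemi k) Rr" and y: "y \<in> ball 0 3"
 shows "vsup B (cv g) y (wt y * Rr (\<tau> (ab y)))"
proof -
 define r where "r = (3 - norm y) / 2"
 have r: "r > 0" using y by (simp add: r_def)
 have cb: "cball y r \<subseteq> ball 0 3"
 proof
  fix w assume "w \<in> cball y r"
  then have "norm (w - y) <= (3 - norm y) / 2" by (simp add: dist_norm norm_minus_commute r_def)
  then show "w \<in> ball 0 3" using norm_triangle_ineq2[of w y] y by simp
 qed
 obtain Wb where Wb: "Wb >= 0" "\<forall>y\<in>ball 0 3. wt y <= Wb" using wt_bound by blast
 show ?thesis
 proof (rule vsup_lim[where w = "\<lambda>m. cv (u m)" and r = r and e = e and h = "\<lambda>m. 0"])
  show "\<forall>\<^sub>F m in sequentially. \<forall>w\<in>cball y r. \<bar>cv (u m) w - cv g w\<bar> < \<nu>" if "\<nu> > 0" for \<nu>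
   using ug[OF that] by (rule eventually_mono) (use \<tau>_ab in \<open>auto simp: cv_def\<close>)
  show "\<forall>\<^sub>F m in sequentially. continuous_on (cball y r) (cv (u m))"
   using cv_cont ch unfolding chs_def by (intro always_eventually allI) blast
  fix \<nu> :: real assume \<nu>: "\<nu> > 0"
  define F where "F w = wt w * Rr (\<tau> (ab w))" for w
  have "continuous_on UNIV F" unfolding F_def
   using cv_cont[OF cR, of UNIV] by (intro continuous_intros wt_cont) (simp add: cv_def[abs_def])
  then have "isCont F y" by (simp add: continuous_on_eq_continuous_at)
  then obtain d where d: "d > 0" "\<And>w. dist w y < d ==> dist (F w) (F y) < \<nu> / 2"
   using \<nu> unfolding continuous_at_eps_delta by (metis half_gt_zero)
  define \<nu>' where "\<nu>' = \<nu> / (2 * (Wb + 1))"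
  have \<nu>': "\<nu>' > 0" using \<nu> Wb by (simp add: \<nu>'_def)
  show "\<exists>d>0. \<forall>\<^sub>F m in sequentially. \<forall>w\<in>ball y d. if w \<bullet> e = 0 then neum (cv (u m)) e w
    else \<exists>G H. hess (cv (u m)) w G H \<and> tr H <= - (wt y * Rr (\<tau> (ab y))) + \<nu> + B * norm (G w)"
  proof (intro exI conjI)
   show "min d r > 0" using d r by simp
   show "\<forall>\<^sub>F m in sequentially. \<forall>w\<in>ball y (min d r). if w \<bullet> e = 0 then neum (cv (u m)) e w
    else \<exists>G H. hess (cv (u m)) w G H \<and> tr H <= - (wt y * Rr (\<tau> (ab y))) + \<nu> + B * norm (G w)"
    using Rl[OF \<nu>']
   proof eventually_elim
    case (elim m)
    show ?case
    proof
     fix w assume w: "w \<in> ball y (min d r)"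
     then have "w \<in> cball y r" by simp
     then have w3: "w \<in> ball 0 3" using cb by blast
     note ns = ch[of m, unfolded chs_def, THEN conjunct2]
     show "if w \<bullet> e = 0 then neum (cv (u m)) e w
      else \<exists>G H. hess (cv (u m)) w G H \<and> tr H <= - (wt y * Rr (\<tau> (ab y))) + \<nu> + B * norm (G w)"
     proof (cases "w \<bullet> e = 0")
      case True then show ?thesis using nsol_neum[OF ns w3] by simp
     next
      case False
      obtain G H where GH: "hess (cv (u m)) w G H" "\<bar>tr H + wt w * R m (\<tau> (ab w))\<bar> <= B * norm (G w)"
       using nsol_hess[OF ns w3 False] .
      have "\<bar>R m (\<tau> (ab w)) - Rr (\<tau> (ab w))\<bar> < \<nu>'" using elim \<tau>_ab by blast
      then have "\<bar>wt w * (R m (\<tau> (ab w)) - Rr (\<tau> (ab w)))\<bar> <= (Wb + 1) * \<nu>'"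
       unfolding abs_mult using wt_pos[of w] Wb(1) Wb(2)[rule_format, OF w3] by (intro mult_mono) auto
      moreover have "(Wb + 1) * \<nu>' = \<nu> / 2" using Wb by (simp add: \<nu>'_def divide_simps)
      moreover have "wt w * (R m (\<tau> (ab w)) - Rr (\<tau> (ab w))) = wt w * R m (\<tau> (ab w)) - F w" by (simp add: F_def right_diff_distrib)
      moreover have "\<bar>F w - F y\<bar> < \<nu> / 2" using d(2)[of w] w by (simp add: dist_real_def dist_commute)
      ultimately have "tr H <= - F y + \<nu> + B * norm (G w)" using GH(2) by linarith
      then have "\<exists>G H. hess (cv (u m)) w G H \<and> tr H <= - (wt y * Rr (\<tau> (ab y))) + \<nu> + B * norm (G w)"
       using GH(1) unfolding F_def by blast
      then show ?thesis using False by simp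
     qed
    qed
   qed
  qed
 qed (use e1 r B0 in auto)
qed

text \<open>A constant touches the limit at its minimum. On the equator the reflected chart makes
  this an interior minimum.\<close>

lemma limit_min_le:
 fixes u R :: "nat => real^'m => real"
 assumes ch: "\<And>m. chs (u m) (R m)"
  and ug: "\<And>\<nu>. \<nu> > 0 ==> \<forall>\<^sub>F m in sequentially. \<forall>x\<in>chemi k. \<bar>u m x - g x\<bar> < \<nu>"
  and Rl: "\<And>\<nu>. \<nu> > 0 ==> \<forall>\<^sub>F m in sequentially. \<forall>x\<in>chemi k. \<bar>R m x - Rr x\<bar> < \<nu>"
  and cR: "continuous_on (chemi k) Rr"
  and x0: "x0 \<in> chemi k" "x0 \<bullet> z >= 0" and mn: "\<And>x. x \<in> chemi k ==> g x0 <= g x"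
 shows "Rr x0 <= 0"
proof -
 have c: "1 + x0 \<bullet> z > 0" using x0 by simp
 have S3: "S x0 \<in> ball 0 3" using S_inv(3)[OF x0(1) c x0(2)] by simp
 have "wt (S x0) * Rr (\<tau> (ab (S x0))) <= 0"
 proof (rule vsup_const_min[OF limit_vsup[OF ch ug Rl cR S3] zero_less_one])
  fix w show "cv g (S x0) <= cv g w" unfolding cv_S[OF x0(1) c] using mn[OF \<tau>_ab, of w] by (simp add: cv_def)
 qed
 moreover have "\<tau> (ab (S x0)) = x0" using S_inv[OF x0(1) c] by (simp add: ab_pos)
 ultimately show ?thesis using wt_pos[of "S x0"] by (simp add: mult_le_0_iff)
qed

lemma limit_strong_min:
 fixes u R :: "nat => real^'m => real"
 assumes ch: "\<And>m. chs (u m) (R m)"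
  and ug: "\<And>\<nu>. \<nu> > 0 ==> \<forall>\<^sub>F m in sequentially. \<forall>x\<in>chemi k. \<bar>u m x - g x\<bar> < \<nu>"
  and Rl: "\<And>\<nu>. \<nu> > 0 ==> \<forall>\<^sub>F m in sequentially. \<forall>x\<in>chemi k. \<bar>R m x - Rr x\<bar> < \<nu>"
  and cR: "continuous_on (chemi k) Rr" and R0: "\<And>x. x \<in> chemi k ==> Rr x >= 0" and cg: "continuous_on (chemi k) g"
  and x0: "x0 \<in> chemi k" "x0 \<bullet> z >= 0" and mn: "\<And>x. x \<in> chemi k ==> g x0 <= g x"
  and x: "x \<in> chemi k" "x \<bullet> z >= 0"
 shows "g x = g x0"
proof -
 have c: "1 + x0 \<bullet> z > 0" "1 + x \<bullet> z > 0" using x0 x by auto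
 have "cv g (S x) - g x0 = 0"
 proof (rule vsup_strong_min[OF B0, of "ball 0 3" "\<lambda>y. cv g y - g x0" "S x0" "S x"])
  show "continuous_on (ball 0 3) (\<lambda>y. cv g y - g x0)" by (intro continuous_intros cv_cont cg)
  show "0 <= cv g y - g x0" for y using mn[OF \<tau>_ab] by (simp add: cv_def)
  show "vsup B (\<lambda>y. cv g y - g x0) y 0" if "y \<in> ball 0 3" for y
   unfolding vsup_shift
  proof (rule vsup_mono[OF limit_vsup[OF ch ug Rl cR that]])
   show "0 <= wt y * Rr (\<tau> (ab y))" by (intro mult_nonneg_nonneg R0 \<tau>_ab less_imp_le[OF wt_pos])
  qed auto
 qed (use cv_S[OF x0(1) c(1)] S_inv(3)[OF x0(1) c(1) x0(2)] S_inv(3)[OF x(1) c(2) x(2)] in auto)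
 then show ?thesis using cv_S[OF x(1) c(2)] by simp
qed

lemma chs_affine:
 assumes "chs u R" "M > 0"
 shows "chs (\<lambda>x. (u x - b) / M) (\<lambda>x. R x / M)"
proof -
 have n: "nsol (cv u) (ball 0 3) e 0 (\<lambda>y. wt y * R (\<tau> (ab y))) B" and c: "continuous_on (chemi k) u" using assms by (auto simp: chs_def)
 have "nsol (\<lambda>y. (cv u (0 + 1 *\<^sub>R y) - b) / M) (ball 0 3) e ((0 - 0 \<bullet> e) / 1) (\<lambda>y. 1^2 / M * (wt (0 + 1 *\<^sub>R y) * R (\<tau> (ab (0 + 1 *\<^sub>R y))))) (1 * B)"
  by (rule nsol_rescale[OF nsol_shift[OF n]]) (use assms in auto)
 then have "nsol (cv (\<lambda>x. (u x - b) / M)) (ball 0 3) e 0 (\<lambda>y. wt y * (R (\<tau> (ab y)) / M)) B"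
  by (simp add: cv_def[abs_def])
 then show ?thesis unfolding chs_def using c assms(2) by (auto intro!: continuous_intros)
qed

lemma chs_minus: "chs u R ==> chs (\<lambda>x. - u x) (\<lambda>x. - R x)"
 unfolding chs_def using nsol_minus[of "cv u" "ball 0 3" e 0 "\<lambda>y. wt y * R (\<tau> (ab y))" B]
 by (auto simp: cv_def[abs_def] intro: continuous_intros)

end

section \<open>Both charts together on the closed hemisphere\<close>

locale hemis = P: cchart k l k' \<iota> 1 \<phi> \<beta>0 + N: cchart k l k' \<iota> "-1" \<phi> \<beta>0
 for k l :: "'m::finite" and k' :: "'n::finite" and \<iota> \<phi> \<beta>0
begin

definition hs where "hs u R \<longleftrightarrow> P.chs u R \<and> N.chs u R"

lemma side: "x \<bullet> P.z >= 0 \<or> x \<bullet> N.z >= 0" using linear[of 0 "x $ l"] by (simp add: P.xz N.xz)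

lemma hs_of_sol: "neumann_sol k \<phi> u R ==> hs u R" unfolding hs_def using P.chart_chs N.chart_chs by blast

lemma hs_affine: "hs u R ==> M > 0 ==> hs (\<lambda>x. (u x - b) / M) (\<lambda>x. R x / M)"
 unfolding hs_def using P.chs_affine N.chs_affine by blast

lemma hs_minus: "hs u R ==> hs (\<lambda>x. - u x) (\<lambda>x. - R x)"
 unfolding hs_def using P.chs_minus N.chs_minus by blast

lemma hs_cont: "hs u R ==> continuous_on (chemi k) u" unfolding hs_def P.chs_def by blast

lemma chemi_ne: "axis k 1 \<in> chemi k" by (simp add: chemi_def axis_def norm_axis_1[unfolded axis_def])

text \<open>Two sequences are treated at once so that a single subsequence serves both components of
  a system.\<close>

lemma hs_compact:
 fixes u R u' R' :: "nat => real^'m => real"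
 assumes h: "\<And>m. hs (u m) (R m)" "\<And>m. hs (u' m) (R' m)" and Bu: "Bu >= 0" and Kr: "Kr >= 0"
  and ub: "\<And>m x. x \<in> chemi k ==> \<bar>u m x\<bar> <= Bu" "\<And>m x. x \<in> chemi k ==> \<bar>u' m x\<bar> <= Bu"
  and Rb: "\<And>m x. x \<in> chemi k ==> \<bar>R m x\<bar> <= Kr" "\<And>m x. x \<in> chemi k ==> \<bar>R' m x\<bar> <= Kr"
 obtains r g g' where "strict_mono (r :: nat => nat)" "continuous_on (chemi k) g" "continuous_on (chemi k) g'"
  "\<And>\<nu>. \<nu> > 0 ==> \<forall>\<^sub>F m in sequentially. \<forall>x\<in>chemi k. \<bar>u (r m) x - g x\<bar> < \<nu>"
  "\<And>\<nu>. \<nu> > 0 ==> \<forall>\<^sub>F m in sequentially. \<forall>x\<in>chemi k. \<bar>u' (r m) x - g' x\<bar> < \<nu>"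
proof -
 have eqc: "\<exists>d>0. \<forall>v V. hs v V --> (\<forall>x\<in>chemi k. \<bar>v x\<bar> <= Bu) --> (\<forall>x\<in>chemi k. \<bar>V x\<bar> <= Kr) -->
  (\<forall>x'\<in>chemi k. norm (x - x') < d --> \<bar>v x - v x'\<bar> < \<nu>)" if x: "x \<in> chemi k" and \<nu>: "\<nu> > 0" for x \<nu>
  using side[of x]
 proof
  assume "x \<bullet> P.z >= 0"
  from P.equicontinuous_at[OF Bu Kr x this \<nu>] show ?thesis unfolding hs_def by blast
 next
  assume "x \<bullet> N.z >= 0"
  from N.equicontinuous_at[OF Bu Kr x this \<nu>] show ?thesis unfolding hs_def by blast
 qed
 define F where "F m x = (u m x, u' m x)" for m x
 obtain G r where G: "continuous_on (chemi k) G" "strict_mono (r :: nat => nat)"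
  "\<And>\<nu>. 0 < \<nu> ==> \<exists>N. \<forall>n x. n >= N \<and> x \<in> chemi k --> norm (F (r n) x - G x) < \<nu>"
 proof (rule Arzela_Ascoli[OF chemi_compact[of k], of F "Bu + Bu"])
  show "norm (F n x) <= Bu + Bu" if "x \<in> chemi k" for n x
   unfolding F_def using norm_Pair_le[of "u n x" "u' n x"] ub(1)[OF that, of n] ub(2)[OF that, of n] by simp
  show "\<exists>d>0. \<forall>n y. y \<in> chemi k \<and> norm (x - y) < d --> norm (F n x - F n y) < \<nu>" if x: "x \<in> chemi k" and \<nu>: "0 < \<nu>" for x \<nu>
  proof -
   obtain d where d: "d > 0" "\<And>v V x'. hs v V ==> (\<forall>x\<in>chemi k. \<bar>v x\<bar> <= Bu) ==> (\<forall>x\<in>chemi k. \<bar>V x\<bar> <= Kr) ==> x' \<in> chemi k ==> norm (x - x') < d ==> \<bar>v x - v x'\<bar> < \<nu> / 2"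
    using eqc[OF x half_gt_zero[OF \<nu>]] by blast
   have "norm (F n x - F n y) < \<nu>" if y: "y \<in> chemi k" "norm (x - y) < d" for n y
   proof -
    have "\<bar>u n x - u n y\<bar> < \<nu> / 2" "\<bar>u' n x - u' n y\<bar> < \<nu> / 2"
     using d(2)[OF h(1)[of n] _ _ y] d(2)[OF h(2)[of n] _ _ y] ub Rb by blast+
    moreover have "norm (F n x - F n y) <= norm (u n x - u n y) + norm (u' n x - u' n y)"
     unfolding F_def using norm_Pair_le[of "u n x - u n y" "u' n x - u' n y"] by simp
    ultimately show ?thesis by simp
   qed
   then show ?thesis using d(1) by blast
  qed
 qed blast
 have cl: "\<forall>\<^sub>F m in sequentially. \<forall>x\<in>chemi k. \<bar>u (r m) x - fst (G x)\<bar> < \<nu> \<and> \<bar>u' (r m) x - snd (G x)\<bar> < \<nu>" if \<nu>: "\<nu> > 0" for \<nu>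
 proof -
  obtain N where N: "\<And>n x. n >= N ==> x \<in> chemi k ==> norm (F (r n) x - G x) < \<nu>" using G(3)[OF \<nu>] by blast
  have "\<bar>u (r n) x - fst (G x)\<bar> < \<nu> \<and> \<bar>u' (r n) x - snd (G x)\<bar> < \<nu>" if "n >= N" "x \<in> chemi k" for n x
  proof -
   have "F (r n) x - G x = (u (r n) x - fst (G x), u' (r n) x - snd (G x))" by (simp add: F_def prod_eq_iff)
   then show ?thesis using N[OF that] norm_fst_le[of "u (r n) x - fst (G x)" "u' (r n) x - snd (G x)"]
    norm_snd_le[of "u' (r n) x - snd (G x)" "u (r n) x - fst (G x)"] by simp
  qed
  then show ?thesis unfolding eventually_sequentially by blast
 qed
 show thesis
 proof (rule that[of r "\<lambda>x. fst (G x)" "\<lambda>x. snd (G x)"])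
  show "continuous_on (chemi k) (\<lambda>x. fst (G x))" by (rule continuous_on_fst[OF G(1)])
  show "continuous_on (chemi k) (\<lambda>x. snd (G x))" by (rule continuous_on_snd[OF G(1)])
  show "\<forall>\<^sub>F m in sequentially. \<forall>x\<in>chemi k. \<bar>u (r m) x - fst (G x)\<bar> < \<nu>" if "\<nu> > 0" for \<nu>
   using cl[OF that] by (rule eventually_mono) blast
  show "\<forall>\<^sub>F m in sequentially. \<forall>x\<in>chemi k. \<bar>u' (r m) x - snd (G x)\<bar> < \<nu>" if "\<nu> > 0" for \<nu>
   using cl[OF that] by (rule eventually_mono) blast
 qed (rule G(2))
qed

text \<open>For the second claim, constancy passes from one chart to the other at the top point e_k,
  whose \<open>l\<close>-coordinate is 0 and which therefore belongs to both halves.\<close>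

lemma hs_limit:
 fixes u R :: "nat => real^'m => real"
 assumes h: "\<And>m. hs (u m) (R m)"
  and ug: "\<And>\<nu>. \<nu> > 0 ==> \<forall>\<^sub>F m in sequentially. \<forall>x\<in>chemi k. \<bar>u m x - g x\<bar> < \<nu>"
  and Rl: "\<And>\<nu>. \<nu> > 0 ==> \<forall>\<^sub>F m in sequentially. \<forall>x\<in>chemi k. \<bar>R m x - Rr x\<bar> < \<nu>"
  and cR: "continuous_on (chemi k) Rr"
  and x0: "x0 \<in> chemi k" and mn: "\<And>x. x \<in> chemi k ==> g x0 <= g x"
 shows "Rr x0 <= 0"
  and "(\<And>x. x \<in> chemi k ==> Rr x >= 0) ==> continuous_on (chemi k) g ==> x \<in> chemi k ==> g x = g x0"
proof -
 have hP: "\<And>m. P.chs (u m) (R m)" and hN: "\<And>m. N.chs (u m) (R m)" using h by (auto simp: hs_def)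
 show "Rr x0 <= 0" using side[of x0] P.limit_min_le[OF hP ug Rl cR x0 _ mn] N.limit_min_le[OF hN ug Rl cR x0 _ mn] by blast
 assume R0: "\<And>x. x \<in> chemi k ==> Rr x >= 0" and cg: "continuous_on (chemi k) g" and x: "x \<in> chemi k"
 have ak: "axis k 1 \<bullet> P.z = 0" "axis k 1 \<bullet> N.z = 0" using P.kl by (auto simp: P.xz N.xz axis_def)
 have "g (axis k 1) = g x0" using side[of x0]
 proof
  assume "x0 \<bullet> P.z >= 0"
  from P.limit_strong_min[OF hP ug Rl cR R0 cg x0 this mn chemi_ne] show ?thesis using ak by simp
 next
  assume "x0 \<bullet> N.z >= 0"
  from N.limit_strong_min[OF hN ug Rl cR R0 cg x0 this mn chemi_ne] show ?thesis using ak by simp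
 qed
 then have mn': "g (axis k 1) <= g x" if "x \<in> chemi k" for x using mn[OF that] by simp
 have "g x = g (axis k 1)" using side[of x]
 proof
  assume "x \<bullet> P.z >= 0"
  from P.limit_strong_min[OF hP ug Rl cR R0 cg chemi_ne _ mn' x this] show ?thesis using ak by simp
 next
  assume "x \<bullet> N.z >= 0"
  from N.limit_strong_min[OF hN ug Rl cR R0 cg chemi_ne _ mn' x this] show ?thesis using ak by simp
 qed
 then show "g x = g x0" using \<open>g (axis k 1) = g x0\<close> by simp
qed

text \<open>A solution is the limit of a constant sequence, which gives the sign of the right-hand
  side at a minimum even if it lies on the equator.\<close>

lemma hs_min:
 assumes "hs u R" "continuous_on (chemi k) R" "x0 \<in> chemi k" "\<And>x. x \<in> chemi k ==> u x0 <= u x"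
 shows "R x0 <= 0"
 by (rule hs_limit(1)[of "\<lambda>m. u" "\<lambda>m. R" u R]) (use assms in auto)

lemma hs_max:
 assumes "hs u R" "continuous_on (chemi k) R" "x0 \<in> chemi k" "\<And>x. x \<in> chemi k ==> u x <= u x0"
 shows "R x0 >= 0"
 using hs_min[OF hs_minus[OF assms(1)] continuous_on_minus[OF assms(2)] assms(3)] assms(4) by simp

text \<open>Takes the place of a linear elliptic estimate, by compactness. If it failed, solutions
  normalised to oscillation 1 would have right-hand sides tending to 0; a uniform limit would be
  constant by the strong minimum principle and yet have oscillation 1.\<close>

lemma osc_bound:
 "\<exists>Co>0. \<forall>u R N. hs u R --> (\<forall>x\<in>chemi k. \<bar>R x\<bar> <= N) --> (\<forall>x\<in>chemi k. \<forall>x'\<in>chemi k. u x - u x' <= Co * N)"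
proof (rule ccontr)
 assume neg: "\<not> ?thesis"
 have "\<exists>u R N x x'. hs u R \<and> (\<forall>x\<in>chemi k. \<bar>R x\<bar> <= N) \<and> x \<in> chemi k \<and> x' \<in> chemi k \<and> u x - u x' > real (Suc m) * N" for m
 proof (rule ccontr)
  assume c: "\<not> ?thesis"
  have "\<forall>u R N. hs u R --> (\<forall>x\<in>chemi k. \<bar>R x\<bar> <= N) --> (\<forall>x\<in>chemi k. \<forall>x'\<in>chemi k. u x - u x' <= real (Suc m) * N)"
   using c not_le by blast
  then show False using neg by (metis of_nat_0_less_iff zero_less_Suc)
 qed
 then obtain u R N x x' where h: "\<And>m. hs (u m) (R m)" and RN: "\<And>m y. y \<in> chemi k ==> \<bar>R m y\<bar> <= N m"
  and xx: "\<And>m. x m \<in> chemi k" "\<And>m. x' m \<in> chemi k" and big: "\<And>m::nat. u m (x m) - u m (x' m) > real (Suc m) * N m" by metis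
 have ne: "chemi k \<noteq> {}" using chemi_ne by blast
 have "\<exists>a\<in>chemi k. \<forall>y\<in>chemi k. u m a <= u m y" for m by (rule continuous_attains_inf[OF chemi_compact ne hs_cont[OF h]])
 then obtain a where a: "\<And>m. a m \<in> chemi k" "\<And>m y. y \<in> chemi k ==> u m (a m) <= u m y" by metis
 have "\<exists>b\<in>chemi k. \<forall>y\<in>chemi k. u m y <= u m b" for m by (rule continuous_attains_sup[OF chemi_compact ne hs_cont[OF h]])
 then obtain b where b: "\<And>m. b m \<in> chemi k" "\<And>m y. y \<in> chemi k ==> u m y <= u m (b m)" by metis
 define M where "M m = u m (b m) - u m (a m)" for m
 have N0: "N m >= 0" for m using RN[OF chemi_ne, of m] by linarith
 have MN: "M m > real (Suc m) * N m" for m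
  using big[of m] a(2)[OF xx(2)[of m], of m] b(2)[OF xx(1)[of m], of m] unfolding M_def by linarith
 have M0: "M m > 0" for m using MN[of m] N0[of m] by (meson le_less_trans mult_nonneg_nonneg of_nat_0_le_iff)
 define w where "w m y = (u m y - u m (a m)) / M m" for m y
 define V where "V m y = R m y / M m" for m y
 have hw: "hs (w m) (V m)" for m unfolding w_def[abs_def] V_def[abs_def] by (rule hs_affine[OF h M0])
 have w01: "0 <= w m y" "w m y <= 1" if "y \<in> chemi k" for m y
  using a(2)[OF that, of m] b(2)[OF that, of m] M0[of m] by (auto simp: w_def M_def[symmetric] divide_le_eq) (simp add: M_def)
 have Vb: "\<bar>V m y\<bar> <= 1 / real (Suc m)" if "y \<in> chemi k" for m y
 proof -
  have "\<bar>R m y\<bar> * real (Suc m) <= N m * real (Suc m)" using RN[OF that, of m] by (intro mult_right_mono) auto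
  also have "... <= M m" using MN[of m] by (simp add: mult.commute)
  finally have "\<bar>R m y\<bar> <= M m / real (Suc m)" by (simp add: pos_le_divide_eq)
  then have "\<bar>R m y\<bar> / M m <= M m / real (Suc m) / M m" by (rule divide_right_mono) (use M0[of m] in simp)
  also have "... = 1 / real (Suc m)" using M0[of m] by simp
  finally show ?thesis using M0[of m] by (simp add: V_def)
 qed
 have Vb1: "\<bar>V m y\<bar> <= 1" if "y \<in> chemi k" for m y
 proof -
  have "1 / real (Suc m) <= 1" by simp
  then show ?thesis using Vb[OF that, of m] by linarith
 qed
 have wb: "\<bar>w m y\<bar> <= 1" if "y \<in> chemi k" for m y using w01[OF that, of m] by simp
 obtain r g where r: "strict_mono (r :: nat => nat)" and cg: "continuous_on (chemi k) g"
  and ug: "\<And>\<nu>. \<nu> > 0 ==> \<forall>\<^sub>F m in sequentially. \<forall>x\<in>chemi k. \<bar>w (r m) x - g x\<bar> < \<nu>"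
 proof (rule hs_compact[of w V w V 1 1])
  fix r g assume 1: "strict_mono (r :: nat => nat)" "continuous_on (chemi k) g"
   "\<And>\<nu>. \<nu> > 0 ==> \<forall>\<^sub>F m in sequentially. \<forall>x\<in>chemi k. \<bar>w (r m) x - g x\<bar> < \<nu>"
  show thesis by (rule that[OF 1(1,2)]) (rule 1(3))
 qed (use hw wb Vb1 in auto)
 have Vl: "\<forall>\<^sub>F m in sequentially. \<forall>x\<in>chemi k. \<bar>V (r m) x - 0\<bar> < \<nu>" if \<nu>: "\<nu> > 0" for \<nu>
 proof -
  have "(\<lambda>m. 1 / real (Suc m)) \<longlonglongrightarrow> 0" using LIMSEQ_inverse_real_of_nat by (simp add: inverse_eq_divide)
  then have "\<forall>\<^sub>F m in sequentially. 1 / real (Suc m) < \<nu>" using \<nu> by (rule order_tendstoD)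
  then have "\<forall>\<^sub>F m in sequentially. 1 / real (Suc (r m)) < \<nu>" using eventually_subseq[OF r] by blast
  then show ?thesis
  proof (rule eventually_mono)
   fix m assume m: "1 / real (Suc (r m)) < \<nu>"
   have "\<bar>V (r m) y\<bar> < \<nu>" if "y \<in> chemi k" for y using Vb[OF that, of "r m"] m by linarith
   then show "\<forall>x\<in>chemi k. \<bar>V (r m) x - 0\<bar> < \<nu>" by simp
  qed
 qed
 obtain x0 where x0: "x0 \<in> chemi k" "\<And>y. y \<in> chemi k ==> g x0 <= g y" using continuous_attains_inf[OF chemi_compact ne cg] by blast
 have gc: "g y = g x0" if "y \<in> chemi k" for y
  by (rule hs_limit(2)[of "\<lambda>m. w (r m)" "\<lambda>m. V (r m)" g "\<lambda>x. 0" x0 y])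
   (rule hw, erule ug, erule Vl, simp, rule x0(1), erule x0(2), simp, rule cg, rule that)
 obtain m where m: "\<forall>x\<in>chemi k. \<bar>w (r m) x - g x\<bar> < 1/2"
  using eventually_happens'[OF sequentially_bot ug[of "1/2"]] by auto
 have "w (r m) (a (r m)) = 0" by (simp add: w_def)
 moreover have "w (r m) (b (r m)) = 1" using M0[of "r m"] by (simp add: w_def M_def)
 ultimately have "\<bar>0 - g x0\<bar> < 1/2" "\<bar>1 - g x0\<bar> < 1/2"
  using m[rule_format, OF a(1)[of "r m"]] m[rule_format, OF b(1)[of "r m"]] gc[OF a(1)[of "r m"]] gc[OF b(1)[of "r m"]] by simp_all
 then show False by linarith
qed

end

section \<open>A priori bound, smallness and constancy for the system\<close>

locale hemisys = hemis k l k' \<iota> \<phi> \<beta>0 + nonlin G \<psi> p \<mu> C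
 for k l :: "'m::finite" and k' :: "'n::finite" and \<iota> \<phi> \<beta>0 G \<psi> p \<mu> C +
 assumes pa: "p * kexp TYPE(real^'n) < kexp TYPE(real^'n) + 2"
begin

definition rh where "rh A u j x = G j (u True x) (u False x) - (A j True * u True x + A j False * u False x)"

definition gsol :: "(bool => bool => real) => (bool => real^'m => real) => bool" where
 "gsol A u \<longleftrightarrow> (\<forall>j. hs (u j) (rh A u j)) \<and> (\<forall>j. \<forall>x\<in>chemi k. 0 <= u j x)"

lemma gsol_cont: "gsol A u ==> continuous_on (chemi k) (u j)"
 unfolding gsol_def using hs_cont by blast

text \<open>The condition on \<open>x0\<close> puts the maximum point into the closed unit ball of
  this chart, where \<open>chart_apriori\<close> applies.\<close>

lemma apriori_P:
 "\<exists>Kb. \<forall>A u x0. gsol A u --> (\<forall>j i. \<bar>A j i\<bar> <= 1) --> x0 \<in> chemi k --> x0 \<bullet> P.z >= 0 -->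
  (\<forall>x\<in>chemi k. u True x + u False x <= u True x0 + u False x0) --> u True x0 + u False x0 <= Kb"
proof -
 have n3: "DIM(real^'n) >= 3" using P.n3 by simp
 obtain Kb where Kb: "\<forall>A V y0. csol P.wt P.e P.B A V --> (\<forall>j i. \<bar>A j i\<bar> <= 1) --> y0 \<in> cball 0 1 -->
  (\<forall>y\<in>ball 0 3. V True y + V False y <= V True y0 + V False y0) --> V True y0 + V False y0 <= Kb"
  using chart_apriori[OF n3 pa P.e1(1) P.wt_cont P.wt_pos P.B0] by blast
 show ?thesis
 proof (intro exI allI impI)
  fix A u x0
  assume g: "gsol A u" and A: "\<forall>j i. \<bar>A j i\<bar> <= 1" and x0: "x0 \<in> chemi k" "x0 \<bullet> P.z >= 0"
   and mx: "\<forall>x\<in>chemi k. u True x + u False x <= u True x0 + u False x0"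
  have c: "1 + x0 \<bullet> P.z > 0" using x0 by simp
  have e: "P.cv h (P.S x0) = h x0" for h by (rule P.cv_S[OF x0(1) c])
  have "nsol (P.cv (u j)) (ball 0 3) P.e 0 (\<lambda>y. P.wt y * rh A u j (P.\<tau> (P.ab y))) P.B" for j
   using g unfolding gsol_def hs_def P.chs_def by blast
  then have "csol P.wt P.e P.B A (\<lambda>j. P.cv (u j))"
   using g P.\<tau>_ab unfolding csol_def gsol_def rh_def P.cv_def by blast
  then have "P.cv (u True) (P.S x0) + P.cv (u False) (P.S x0) <= Kb"
   using Kb[rule_format, of A "\<lambda>j. P.cv (u j)" "P.S x0"] A mx e P.\<tau>_ab P.S_inv(3)[OF x0(1) c x0(2)]
   by (simp add: e) (simp add: P.cv_def)
  then show "u True x0 + u False x0 <= Kb" by (simp add: e)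
 qed
qed

lemma apriori_N:
 "\<exists>Kb. \<forall>A u x0. gsol A u --> (\<forall>j i. \<bar>A j i\<bar> <= 1) --> x0 \<in> chemi k --> x0 \<bullet> N.z >= 0 -->
  (\<forall>x\<in>chemi k. u True x + u False x <= u True x0 + u False x0) --> u True x0 + u False x0 <= Kb"
proof -
 have n3: "DIM(real^'n) >= 3" using N.n3 by simp
 obtain Kb where Kb: "\<forall>A V y0. csol N.wt N.e N.B A V --> (\<forall>j i. \<bar>A j i\<bar> <= 1) --> y0 \<in> cball 0 1 -->
  (\<forall>y\<in>ball 0 3. V True y + V False y <= V True y0 + V False y0) --> V True y0 + V False y0 <= Kb"
  using chart_apriori[OF n3 pa N.e1(1) N.wt_cont N.wt_pos N.B0] by blast
 show ?thesis
 proof (intro exI allI impI)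
  fix A u x0
  assume g: "gsol A u" and A: "\<forall>j i. \<bar>A j i\<bar> <= 1" and x0: "x0 \<in> chemi k" "x0 \<bullet> N.z >= 0"
   and mx: "\<forall>x\<in>chemi k. u True x + u False x <= u True x0 + u False x0"
  have c: "1 + x0 \<bullet> N.z > 0" using x0 by simp
  have e: "N.cv h (N.S x0) = h x0" for h by (rule N.cv_S[OF x0(1) c])
  have "nsol (N.cv (u j)) (ball 0 3) N.e 0 (\<lambda>y. N.wt y * rh A u j (N.\<tau> (N.ab y))) N.B" for j
   using g unfolding gsol_def hs_def N.chs_def by blast
  then have "csol N.wt N.e N.B A (\<lambda>j. N.cv (u j))"
   using g N.\<tau>_ab unfolding csol_def gsol_def rh_def N.cv_def by blast
  then have "N.cv (u True) (N.S x0) + N.cv (u False) (N.S x0) <= Kb"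
   using Kb[rule_format, of A "\<lambda>j. N.cv (u j)" "N.S x0"] A mx e N.\<tau>_ab N.S_inv(3)[OF x0(1) c x0(2)]
   by (simp add: e) (simp add: N.cv_def)
  then show "u True x0 + u False x0 <= Kb" by (simp add: e)
 qed
qed

text \<open>A maximum point of the sum of the components lies in one of the two halves, so the
  larger of the two chart bounds works.\<close>

lemma apriori:
 "\<exists>Kb\<ge>0. \<forall>A u. gsol A u --> (\<forall>j i. \<bar>A j i\<bar> <= 1) --> (\<forall>x\<in>chemi k. u True x + u False x <= Kb)"
proof -
 obtain KP where KP: "\<And>A u x0. gsol A u ==> (\<forall>j i. \<bar>A j i\<bar> <= 1) ==> x0 \<in> chemi k ==> x0 \<bullet> P.z >= 0 ==>
  (\<forall>x\<in>chemi k. u True x + u False x <= u True x0 + u False x0) ==> u True x0 + u False x0 <= KP"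
  using apriori_P by blast
 obtain KN where KN: "\<And>A u x0. gsol A u ==> (\<forall>j i. \<bar>A j i\<bar> <= 1) ==> x0 \<in> chemi k ==> x0 \<bullet> N.z >= 0 ==>
  (\<forall>x\<in>chemi k. u True x + u False x <= u True x0 + u False x0) ==> u True x0 + u False x0 <= KN"
  using apriori_N by blast
 have "u True x + u False x <= max 0 (max KP KN)"
  if g: "gsol A u" and A: "\<forall>j i. \<bar>A j i\<bar> <= 1" and x: "x \<in> chemi k" for A u x
 proof -
  have "continuous_on (chemi k) (\<lambda>x. u True x + u False x)" by (intro continuous_intros gsol_cont[OF g])
  then obtain x0 where x0: "x0 \<in> chemi k" and mx: "\<forall>x\<in>chemi k. u True x + u False x <= u True x0 + u False x0"
   using continuous_attains_sup[OF chemi_compact] x by blast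
  have "u True x0 + u False x0 <= max KP KN"
   using side[of x0] KP[OF g A x0 _ mx] KN[OF g A x0 _ mx] by (auto simp: max_def)
  then show ?thesis using mx x by fastforce
 qed
 then show ?thesis by (intro exI[of _ "max 0 (max KP KN)"]) auto
qed

lemma G_cont:
 assumes c: "continuous_on X a" "continuous_on X b"
  and ab: "\<And>x. x \<in> X ==> 0 <= a x \<and> a x <= s" "\<And>x. x \<in> X ==> 0 <= b x \<and> b x <= s"
 shows "continuous_on X (\<lambda>x::real^'m. G j (a x) (b x))"
 unfolding continuous_on_def
proof
 fix x0 assume x0: "x0 \<in> X"
 let ?L = "C * (s powr \<mu> + s powr (p - 1))"
 have ta: "(a \<longlongrightarrow> a x0) (at x0 within X)" and tb: "(b \<longlongrightarrow> b x0) (at x0 within X)"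
  using c x0 by (auto simp: continuous_on_def)
 have "((\<lambda>x. ?L * (\<bar>a x - a x0\<bar> + \<bar>b x - b x0\<bar>)) \<longlongrightarrow> ?L * (\<bar>a x0 - a x0\<bar> + \<bar>b x0 - b x0\<bar>)) (at x0 within X)"
  by (intro tendsto_intros ta tb)
 then have t: "((\<lambda>x. ?L * (\<bar>a x - a x0\<bar> + \<bar>b x - b x0\<bar>)) \<longlongrightarrow> 0) (at x0 within X)" by simp
 have "((\<lambda>x. G j (a x) (b x) - G j (a x0) (b x0)) \<longlongrightarrow> 0) (at x0 within X)"
 proof (rule Lim_null_comparison[OF _ t])
  have "norm (G j (a x) (b x) - G j (a x0) (b x0)) <= ?L * (\<bar>a x - a x0\<bar> + \<bar>b x - b x0\<bar>)" if "x \<in> X" for x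
   using Glip[of "a x" s "b x" "a x0" "b x0" j] ab that x0 by simp
  then show "\<forall>\<^sub>F x in at x0 within X. norm (G j (a x) (b x) - G j (a x0) (b x0)) <= ?L * (\<bar>a x - a x0\<bar> + \<bar>b x - b x0\<bar>)"
   by (simp add: eventually_at_filter)
 qed
 then show "((\<lambda>x. G j (a x) (b x)) \<longlongrightarrow> G j (a x0) (b x0)) (at x0 within X)" by (rule LIM_zero_cancel)
qed

text \<open>Otherwise coefficients tending to 0 would come with solutions that stay away from 0
  somewhere. By the a priori bound a subsequence converges uniformly; its limit solves the problem
  without linear terms, is constant because the right-hand side is nonnegative, and is zero by
  \<open>Gpos\<close>.\<close>

lemma small:
 assumes \<nu>: "\<nu> > 0"
 shows "\<exists>lam>0. lam <= 1 \<and> (\<forall>A u. gsol A u --> (\<forall>j i. \<bar>A j i\<bar> <= lam) --> (\<forall>x\<in>chemi k. u True x + u False x < \<nu>))"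
proof (rule ccontr)
 assume neg: "\<not> ?thesis"
 have "\<exists>A u x. gsol A u \<and> (\<forall>j i. \<bar>A j i\<bar> <= 1 / real (Suc m)) \<and> x \<in> chemi k \<and> u True x + u False x >= \<nu>" for m
 proof (rule ccontr)
  assume c: "\<not> ?thesis"
  have "\<forall>A u. gsol A u --> (\<forall>j i. \<bar>A j i\<bar> <= 1 / real (Suc m)) --> (\<forall>x\<in>chemi k. u True x + u False x < \<nu>)"
   using c not_le by blast
  moreover have "1 / real (Suc m) > 0" "1 / real (Suc m) <= 1" by auto
  ultimately show False using neg by blast
 qed
 then obtain A u x where g: "\<And>m. gsol (A m) (u m)" and A: "\<And>m j i. \<bar>A m j i\<bar> <= 1 / real (Suc m)"
  and x: "\<And>m. x m \<in> chemi k" and ux: "\<And>m. u m True (x m) + u m False (x m) >= \<nu>" by metis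
 obtain Kb where Kb: "Kb >= 0" "\<And>A u x. gsol A u ==> (\<forall>j i. \<bar>A j i\<bar> <= 1) ==> x \<in> chemi k ==> u True x + u False x <= Kb"
  using apriori by blast
 have A1: "\<bar>A m j i\<bar> <= 1" for m j i
 proof -
  have "1 / real (Suc m) <= 1" by simp
  then show ?thesis using A[of m j i] by linarith
 qed
 have u0: "0 <= u m j y" if "y \<in> chemi k" for m j y using g[of m] that unfolding gsol_def by blast
 have uK: "u m True y + u m False y <= Kb" if "y \<in> chemi k" for m y using Kb(2)[OF g[of m] _ that] A1 by blast
 have u1: "u m j y <= Kb" if "y \<in> chemi k" for m j y
  using uK[OF that, of m] u0[OF that, of m True] u0[OF that, of m False] by (cases j) auto
 define L where "L = C * (Kb powr \<mu> + Kb powr (p - 1))"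
 have L0: "L >= 0" using C0 by (simp add: L_def)
 have lin: "\<bar>A m j True * u m True y + A m j False * u m False y\<bar> <= Kb / real (Suc m)" if y: "y \<in> chemi k" for m j y
 proof -
  have "\<bar>A m j i * u m i y\<bar> <= 1 / real (Suc m) * u m i y" for i
   unfolding abs_mult using A[of m j i] u0[OF y, of m i] by (intro mult_mono) auto
  from this[of True] this[of False]
  have "\<bar>A m j True * u m True y + A m j False * u m False y\<bar> <= 1 / real (Suc m) * (u m True y + u m False y)"
   unfolding distrib_left by linarith
  also have "... <= 1 / real (Suc m) * Kb" using uK[OF y] by (intro mult_left_mono) auto
  finally show ?thesis by simp
 qed
 define Kr where "Kr = \<bar>G True 0 0\<bar> + \<bar>G False 0 0\<bar> + L * (2 * Kb) + Kb"
 have Rb: "\<bar>rh (A m) (u m) j y\<bar> <= Kr" if y: "y \<in> chemi k" for m j y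
 proof -
  have "\<bar>G j (u m True y) (u m False y) - G j 0 0\<bar> <= L * (\<bar>u m True y - 0\<bar> + \<bar>u m False y - 0\<bar>)"
   unfolding L_def using u0[OF y] u1[OF y] Kb(1) by (intro Glip) auto
  also have "... <= L * (2 * Kb)" using L0 u0[OF y, of m] uK[OF y, of m] Kb(1) by (intro mult_left_mono) auto
  finally have 1: "\<bar>G j (u m True y) (u m False y) - G j 0 0\<bar> <= L * (2 * Kb)" .
  have "Kb / real (Suc m) <= Kb / 1" using Kb(1) by (intro divide_left_mono) auto
  then have 2: "\<bar>A m j True * u m True y + A m j False * u m False y\<bar> <= Kb" using lin[OF y, of m j] by simp
  have "\<bar>G j 0 0\<bar> <= \<bar>G True 0 0\<bar> + \<bar>G False 0 0\<bar>" by (cases j) auto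
  then show ?thesis using 1 2 unfolding rh_def Kr_def by linarith
 qed
 have hsj: "hs (u m j) (rh (A m) (u m) j)" for m j using g[of m] unfolding gsol_def by blast
 have Kr0: "Kr >= 0" using L0 Kb(1) by (simp add: Kr_def)
 have ua: "\<bar>u m j y\<bar> <= Kb" if "y \<in> chemi k" for m j y using u0[OF that, of m j] u1[OF that, of m j] by simp
 obtain r gT gF where r: "strict_mono (r :: nat => nat)" and gc': "continuous_on (chemi k) gT" "continuous_on (chemi k) gF"
  and gl': "\<And>\<nu>. \<nu> > 0 ==> \<forall>\<^sub>F m in sequentially. \<forall>x\<in>chemi k. \<bar>u (r m) True x - gT x\<bar> < \<nu>"
  "\<And>\<nu>. \<nu> > 0 ==> \<forall>\<^sub>F m in sequentially. \<forall>x\<in>chemi k. \<bar>u (r m) False x - gF x\<bar> < \<nu>"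
 proof (rule hs_compact[of "\<lambda>m. u m True" "\<lambda>m. rh (A m) (u m) True" "\<lambda>m. u m False" "\<lambda>m. rh (A m) (u m) False" Kb Kr])
  fix r gT gF assume 1: "strict_mono (r :: nat => nat)" "continuous_on (chemi k) gT" "continuous_on (chemi k) gF"
   "\<And>\<nu>. \<nu> > 0 ==> \<forall>\<^sub>F m in sequentially. \<forall>x\<in>chemi k. \<bar>u (r m) True x - gT x\<bar> < \<nu>"
   "\<And>\<nu>. \<nu> > 0 ==> \<forall>\<^sub>F m in sequentially. \<forall>x\<in>chemi k. \<bar>u (r m) False x - gF x\<bar> < \<nu>"
  show thesis by (rule that[OF 1(1-3)]) (erule 1(4), erule 1(5))
 qed (rule hsj Kb(1) Kr0 | erule ua Rb)+
 define g' where "g' j = (if j then gT else gF)" for j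
 have gc: "continuous_on (chemi k) (g' j)" for j using gc' by (simp add: g'_def)
 have gl: "\<forall>\<^sub>F m in sequentially. \<forall>x\<in>chemi k. \<bar>u (r m) j x - g' j x\<bar> < \<delta>" if "\<delta> > 0" for \<delta> j
  using gl'(1)[OF that] gl'(2)[OF that] by (cases j) (auto simp: g'_def)
 have gp: "(\<lambda>m. u (r m) j y) \<longlonglongrightarrow> g' j y" if "y \<in> chemi k" for j y
 proof (rule tendstoI)
  fix e :: real assume "e > 0"
  from gl[OF this, of j] show "\<forall>\<^sub>F m in sequentially. dist (u (r m) j y) (g' j y) < e"
   by (rule eventually_mono) (use that in \<open>auto simp: dist_real_def\<close>)
 qed
 have g0: "0 <= g' j y" "g' j y <= Kb" if "y \<in> chemi k" for j y
  using LIMSEQ_le_const[OF gp[OF that]] LIMSEQ_le_const2[OF gp[OF that]] u0[OF that] u1[OF that] by blast+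
 define Rr where "Rr j y = G j (g' True y) (g' False y)" for j y
 have cR: "continuous_on (chemi k) (Rr j)" for j
  unfolding Rr_def[abs_def] using g0 by (intro G_cont[where s=Kb] gc) auto
 have Rl: "\<forall>\<^sub>F m in sequentially. \<forall>y\<in>chemi k. \<bar>rh (A (r m)) (u (r m)) j y - Rr j y\<bar> < \<delta>" if \<delta>: "\<delta> > 0" for \<delta> j
 proof -
  define \<eta> where "\<eta> = \<delta> / (4 * (L + 1))"
  have \<eta>: "\<eta> > 0" "L * (2 * \<eta>) <= \<delta> / 2" using \<delta> L0 by (auto simp: \<eta>_def field_simps)
  have "(\<lambda>m. Kb / real (Suc m)) \<longlonglongrightarrow> 0" using LIMSEQ_Suc[OF lim_const_over_n[of Kb]] by simp
  then have "\<forall>\<^sub>F m in sequentially. Kb / real (Suc m) < \<delta> / 2" using \<delta> by (intro order_tendstoD(2)) auto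
  with gl[OF \<eta>(1), of True] gl[OF \<eta>(1), of False] show ?thesis
  proof eventually_elim
   case (elim m)
   show ?case
   proof
    fix y assume y: "y \<in> chemi k"
    have "\<bar>G j (u (r m) True y) (u (r m) False y) - Rr j y\<bar> <= L * (\<bar>u (r m) True y - g' True y\<bar> + \<bar>u (r m) False y - g' False y\<bar>)"
     unfolding L_def Rr_def using u0[OF y] u1[OF y] g0[OF y] by (intro Glip) auto
    also have "... <= L * (2 * \<eta>)" using elim y L0 by (intro mult_left_mono) fastforce+
    also have "... <= \<delta> / 2" by (rule \<eta>(2))
    finally have 1: "\<bar>G j (u (r m) True y) (u (r m) False y) - Rr j y\<bar> <= \<delta> / 2" .
    have "Kb / real (Suc (r m)) <= Kb / real (Suc m)"
     using seq_suble[OF r, of m] Kb(1) by (intro divide_left_mono) auto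
    then have "\<bar>A (r m) j True * u (r m) True y + A (r m) j False * u (r m) False y\<bar> < \<delta> / 2"
     using lin[OF y, of "r m" j] elim(3) by linarith
    then show "\<bar>rh (A (r m)) (u (r m)) j y - Rr j y\<bar> < \<delta>" using 1 unfolding rh_def by linarith
   qed
  qed
 qed
 have Rr0: "Rr j y >= 0" if "y \<in> chemi k" for j y unfolding Rr_def using g0[OF that] by (intro Gnn) auto
 have con: "g' j y = g' j y'" if y: "y \<in> chemi k" "y' \<in> chemi k" for j y y'
 proof -
  obtain x0 where x0: "x0 \<in> chemi k" "\<And>x. x \<in> chemi k ==> g' j x0 <= g' j x"
   using continuous_attains_inf[OF chemi_compact _ gc] chemi_ne by blast
  have "g' j y = g' j x0" if "y \<in> chemi k" for y
   by (rule hs_limit(2)[of "\<lambda>m. u (r m) j" "\<lambda>m. rh (A (r m)) (u (r m)) j" "g' j" "Rr j" x0 y, OF hsj gl Rl cR x0 Rr0 gc that])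
  then show ?thesis using y by metis
 qed
 have z: "g' True y + g' False y = 0" if y: "y \<in> chemi k" for y
 proof -
  have "Rr j y <= 0" for j
   by (rule hs_limit(1)[of "\<lambda>m. u (r m) j" "\<lambda>m. rh (A (r m)) (u (r m)) j" "g' j" "Rr j" y, OF hsj gl Rl cR y])
    (use con[OF y] in auto)
  from this[of True] this[of False] show ?thesis
   using Gpos[OF g0(1)[OF y, of True] g0(1)[OF y, of False]] g0(1)[OF y, of True] g0(1)[OF y, of False]
   unfolding Rr_def by fastforce
 qed
 have "\<nu> / 2 > 0" using \<nu> by simp
 from eventually_conj[OF gl[OF this, of True] gl[OF this, of False]]
 obtain m where m: "\<forall>x\<in>chemi k. \<bar>u (r m) True x - g' True x\<bar> < \<nu> / 2" "\<forall>x\<in>chemi k. \<bar>u (r m) False x - g' False x\<bar> < \<nu> / 2"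
  by (auto simp: eventually_sequentially)
 show False using m(1)[rule_format, OF x[of "r m"]] m(2)[rule_format, OF x[of "r m"]] ux[of "r m"] z[OF x[of "r m"]] by linarith
qed

text \<open>As \<open>rh\<close> is nonpositive at a minimum and nonnegative at a maximum of the
  component, its size is at most its oscillation, hence at most L + lam times the summed
  oscillations of the components. With Co (L + lam) <= 1/4 the oscillation of each component is at
  most a quarter of that sum, so both are zero.\<close>

lemma const_small:
 "\<exists>lam>0. \<forall>A u. gsol A u --> (\<forall>j i. \<bar>A j i\<bar> <= lam) --> (\<forall>j. (\<exists>c. \<forall>x\<in>chemi k. u j x = c) \<and> (\<forall>x\<in>chemi k. rh A u j x = 0))"
proof -
 obtain Co where Co: "Co > 0" and osc: "\<And>u R N x x'. hs u R ==> (\<forall>x\<in>chemi k. \<bar>R x\<bar> <= N) ==> x \<in> chemi k ==> x' \<in> chemi k ==> u x - u x' <= Co * N"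
  using osc_bound by blast
 \<comment> \<open>Controls both powers in the Lipschitz constant: \<nu>^\<mu> = d, and \<nu>^(p-1)
   <= d because \<nu> <= 1 and \<mu> <= p - 1. Hence L <= 2 C d <= 1 / (8 Co).\<close>
 define d where "d = min 1 (1 / (16 * (C + 1) * Co))"
 have d: "0 < d" "d <= 1" using Co C0 by (auto simp: d_def)
 define \<nu> where "\<nu> = d powr (1 / \<mu>)"
 have \<nu>: "\<nu> > 0" using d by (simp add: \<nu>_def)
 have \<nu>1: "\<nu> <= 1" unfolding \<nu>_def using powr_mono2[of "1 / \<mu>" d 1] d \<mu> by simp
 have \<nu>\<mu>: "\<nu> powr \<mu> = d" unfolding \<nu>_def using d \<mu> by (simp add: powr_powr)
 have \<nu>p: "\<nu> powr (p - 1) <= d" unfolding \<nu>\<mu>[symmetric] using \<nu> \<nu>1 \<mu> by (intro powr_mono') auto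
 define L where "L = C * (\<nu> powr \<mu> + \<nu> powr (p - 1))"
 have L0: "L >= 0" using C0 by (simp add: L_def)
 have "L <= C * (d + d)" unfolding L_def using \<nu>\<mu> \<nu>p C0 by (intro mult_left_mono) auto
 also have "... <= (C + 1) * (d + d)" using d by (intro mult_right_mono) auto
 also have "... <= (C + 1) * (2 * (1 / (16 * (C + 1) * Co)))"
  using C0 by (intro mult_left_mono) (auto simp: d_def)
 also have "... = 1 / (8 * Co)"
 proof -
  have "c * (2 * (1 / (16 * c * Co))) = 1 / (8 * Co)" if "c > 0" for c using that Co by (simp add: field_simps)
  then show ?thesis using C0 by (meson add_nonneg_pos zero_less_one)
 qed
 finally have L: "L <= 1 / (8 * Co)" .
 obtain lam0 where lam0: "lam0 > 0" and sm: "\<And>A u x. gsol A u ==> (\<forall>j i. \<bar>A j i\<bar> <= lam0) ==> x \<in> chemi k ==> u True x + u False x < \<nu>"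
  using small[OF \<nu>] by blast
 define lam where "lam = min lam0 (1 / (8 * Co))"
 have lam: "lam > 0" "lam <= lam0" "lam <= 1 / (8 * Co)" using lam0 Co by (auto simp: lam_def)
 have "(\<exists>c. \<forall>x\<in>chemi k. u j x = c) \<and> (\<forall>x\<in>chemi k. rh A u j x = 0)"
  if g: "gsol A u" and A: "\<forall>j i. \<bar>A j i\<bar> <= lam" for A u j
 proof -
  have A0: "\<forall>j i. \<bar>A j i\<bar> <= lam0" using A lam(2) order_trans by blast
  have u0: "0 <= u j x" if "x \<in> chemi k" for j x using g that unfolding gsol_def by blast
  have ue: "u j x <= \<nu>" if "x \<in> chemi k" for j x
   using sm[OF g A0 that] u0[OF that, of True] u0[OF that, of False] by (cases j) auto
  have h: "hs (u j) (rh A u j)" for j using g unfolding gsol_def by blast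
  have cR: "continuous_on (chemi k) (rh A u j)" for j
   unfolding rh_def[abs_def] using u0 ue by (intro continuous_intros G_cont[where s=\<nu>] gsol_cont[OF g]) auto
  have "\<exists>xm\<in>chemi k. \<forall>x\<in>chemi k. u j xm <= u j x" for j
   using continuous_attains_inf[OF chemi_compact _ gsol_cont[OF g]] chemi_ne by blast
  then obtain xm where xm: "\<And>j. xm j \<in> chemi k" "\<And>j x. x \<in> chemi k ==> u j (xm j) <= u j x" by metis
  have "\<exists>xM\<in>chemi k. \<forall>x\<in>chemi k. u j x <= u j xM" for j
   using continuous_attains_sup[OF chemi_compact _ gsol_cont[OF g]] chemi_ne by blast
  then obtain xM where xM: "\<And>j. xM j \<in> chemi k" "\<And>j x. x \<in> chemi k ==> u j x <= u j (xM j)" by metis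
  define D where "D j = u j (xM j) - u j (xm j)" for j
  define K where "K = (D True + D False) / (4 * Co)"
  have D0: "D j >= 0" for j unfolding D_def using xm(2)[OF xM(1)[of j], of j] by simp
  have uD: "\<bar>u j x - u j y\<bar> <= D j" if "x \<in> chemi k" "y \<in> chemi k" for j x y
   using xm(2)[OF that(1), of j] xm(2)[OF that(2), of j] xM(2)[OF that(1), of j] xM(2)[OF that(2), of j]
   unfolding D_def by linarith
  have diff: "\<bar>rh A u j x - rh A u j y\<bar> <= K" if x: "x \<in> chemi k" and y: "y \<in> chemi k" for j x y
  proof -
   let ?d = "\<bar>u True x - u True y\<bar> + \<bar>u False x - u False y\<bar>"
   have 1: "\<bar>G j (u True x) (u False x) - G j (u True y) (u False y)\<bar> <= L * ?d"
    unfolding L_def using u0[OF x] u0[OF y] ue[OF x] ue[OF y] by (intro Glip) auto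
   have "\<bar>A j i * (u i x - u i y)\<bar> <= lam * \<bar>u i x - u i y\<bar>" for i
    unfolding abs_mult using A by (intro mult_right_mono) auto
   from this[of True] this[of False]
   have 2: "\<bar>A j True * (u True x - u True y)\<bar> + \<bar>A j False * (u False x - u False y)\<bar> <= lam * ?d"
    unfolding distrib_left by linarith
   have "rh A u j x - rh A u j y = G j (u True x) (u False x) - G j (u True y) (u False y) -
    (A j True * (u True x - u True y) + A j False * (u False x - u False y))"
    unfolding rh_def by (simp add: algebra_simps)
   then have "\<bar>rh A u j x - rh A u j y\<bar> <= L * ?d + lam * ?d" using 1 2 by linarith
   also have "... = (L + lam) * ?d" by (simp add: distrib_right)
   also have "... <= (1 / (8 * Co) + 1 / (8 * Co)) * (D True + D False)"
    using L lam L0 Co uD[OF x y] by (intro mult_mono add_mono) auto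
   also have "... = K" using Co by (simp add: K_def field_simps)
   finally show ?thesis .
  qed
  have RK: "\<forall>x\<in>chemi k. \<bar>rh A u j x\<bar> <= K" for j
  proof
   fix x assume x: "x \<in> chemi k"
   have "rh A u j (xm j) <= 0" by (rule hs_min[OF h cR xm(1)]) (rule xm(2))
   moreover have "rh A u j (xM j) >= 0" by (rule hs_max[OF h cR xM(1)]) (rule xM(2))
   ultimately show "\<bar>rh A u j x\<bar> <= K" using diff[OF x xm(1), of j j] diff[OF x xM(1), of j j] by linarith
  qed
  have "D j <= (D True + D False) / 4" for j
  proof -
   have "D j <= Co * K" unfolding D_def by (rule osc[OF h RK xM(1) xm(1)])
   also have "... = (D True + D False) / 4" using Co by (simp add: K_def)
   finally show ?thesis .
  qed
  note D4 = this
  have "D True <= 0" using D4[of True] D4[of False] D0[of True] D0[of False] by argo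
  moreover have "D False <= 0" using D4[of True] D4[of False] D0[of True] D0[of False] by argo
  ultimately have z: "D True = 0 \<and> D False = 0" using D0 by (blast intro: order_antisym)
  then have "D j = 0" by (cases j) auto
  then have "u j x = u j (xm j)" if "x \<in> chemi k" for x using uD[OF that xm(1), of j j] by simp
  moreover have "rh A u j x = 0" if "x \<in> chemi k" for x using RK[of j] that z by (simp add: K_def)
  ultimately show ?thesis by blast
 qed
 then show ?thesis using lam(1) by blast
qed

end

text \<open>A type with one element fewer than the given one, indexing the coordinates of the stereographic charts.\<close>
typedef 'a drop1 = "{x::'a. x \<noteq> undefined \<or> (\<forall>y::'a. y = undefined)}" by blast

instance drop1 :: (finite) finite
proof
 show "finite (UNIV :: 'a drop1 set)"
  by (subst type_definition.univ[OF type_definition_drop1]) simp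
qed

lemma card_drop1:
 assumes "CARD('a::finite) >= 2"
 shows "CARD('a drop1) = CARD('a) - 1"
proof -
 have ex: "\<exists>y::'a. y \<noteq> undefined"
 proof (rule ccontr)
  assume "\<not> ?thesis"
  then have "(UNIV :: 'a set) = {undefined}" by auto
  then have "CARD('a) = 1" by (metis card_1_singleton_iff One_nat_def)
  then show False using assms by simp
 qed
 have "inj (Rep_drop1 :: 'a drop1 => 'a)" by (simp add: inj_on_def Rep_drop1_inject)
 then have "CARD('a drop1) = card (range (Rep_drop1 :: 'a drop1 => 'a))" by (simp add: card_image)
 also have "range (Rep_drop1 :: 'a drop1 => 'a) = UNIV - {undefined}"
  using type_definition.Rep_range[OF type_definition_drop1, where ?'a='a] ex by auto
 finally show ?thesis by (simp add: card_Diff_singleton)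
qed

section \<open>Constancy on the hemisphere for admissible nonlinearities\<close>

text \<open>Supplies the charts: an axis \<open>l\<close> other than \<open>k\<close>, an index type
  with one element fewer, and the drift bound for \<phi>. The subcriticality conditions agree, both
  reading p (n-2) < n + 2. That the right-hand side vanishes is kept in the conclusion because it
  later identifies the constant.\<close>

lemma neumann_sol_const:
 fixes k :: "'m::finite" and \<phi> :: "real^'m => real"
 assumes m4: "CARD('m) >= 4" and cf: "conf_factor k \<phi>" and nl: "nonlin G \<psi> p \<mu> C"
  and p: "p < (dimn TYPE('m) + 2) / (dimn TYPE('m) - 2)"
 shows "\<exists>lam>0. \<forall>A u. (\<forall>j. neumann_sol k \<phi> (u j) (\<lambda>x. G j (u True x) (u False x) - (A j True * u True x + A j False * u False x))) -->
  (\<forall>j. \<forall>x\<in>chemi k. 0 <= u j x) --> (\<forall>j i. \<bar>A j i\<bar> <= lam) -->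
  (\<forall>j. (\<exists>c. \<forall>x\<in>chemi k. u j x = c) \<and> (\<forall>x\<in>chemi k. G j (u True x) (u False x) - (A j True * u True x + A j False * u False x) = 0))"
proof -
 have "\<exists>l::'m. l \<noteq> k"
 proof (rule ccontr)
  assume "\<not> ?thesis"
  then have "(UNIV :: 'm set) = {k}" by auto
  then have "CARD('m) = 1" by (metis card_1_singleton_iff One_nat_def)
  then show False using m4 by simp
 qed
 then obtain l :: 'm where l: "l \<noteq> k" by blast
 have cd: "CARD('m drop1) = CARD('m) - 1" by (rule card_drop1) (use m4 in simp)
 then have "card (UNIV :: 'm drop1 set) = card (UNIV - {l})" by (simp add: card_Diff_singleton)
 then obtain \<iota> :: "'m drop1 => 'm" where \<iota>: "bij_betw \<iota> UNIV (UNIV - {l})"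
  using finite_same_card_bij[of "UNIV :: 'm drop1 set" "UNIV - {l}"] by auto
 then obtain k' where k': "\<iota> k' = k" using l unfolding bij_betw_def by (metis Diff_iff UNIV_I empty_iff imageE insert_iff)
 obtain \<beta> where \<beta>: "\<beta> >= 0" "\<And>x v. x \<in> hemi k ==> \<bar>2 / \<phi> x * (\<Sum>i\<in>UNIV. partial i (ext \<phi>) x * v $ i)\<bar> <= \<beta> * norm v"
  and \<phi>c: "continuous_on (chemi k) \<phi>"
 proof (rule conf_factor_bound[OF cf])
  fix \<beta> assume 1: "\<beta> >= 0" "\<And>x v. x \<in> hemi k ==> \<bar>2 / \<phi> x * (\<Sum>i\<in>UNIV. partial i (ext \<phi>) x * v $ i)\<bar> <= \<beta> * norm v"
   "continuous_on (chemi k) \<phi>"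
  show thesis by (rule that[OF 1(1) _ 1(3)]) (rule 1(2))
 qed
 have \<phi>p: "\<phi> x > 0" if "x \<in> chemi k" for x using cf that unfolding conf_factor_def by blast
 have cc: "cchart k l k' \<iota> \<sigma> \<phi> \<beta>" if "\<sigma> \<in> {1, -1}" for \<sigma> :: real
  by unfold_locales (use that \<iota> k' cd m4 \<beta> \<phi>c \<phi>p in auto)
 have pa: "p * kexp TYPE(real^'m drop1) < kexp TYPE(real^'m drop1) + 2"
 proof -
  have e: "kexp TYPE(real^'m drop1) = (dimn TYPE('m) - 2) / 2" using cd m4 by (simp add: kexp_def dimn_def)
  have "dimn TYPE('m) - 2 > 0" using m4 by (simp add: dimn_def)
  then have "p * (dimn TYPE('m) - 2) < dimn TYPE('m) + 2" using p by (simp add: pos_less_divide_eq)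
  then show ?thesis unfolding e by (simp add: field_simps)
 qed
 interpret hemisys k l k' \<iota> \<phi> \<beta> G \<psi> p \<mu> C
  by (intro hemisys.intro hemis.intro hemisys_axioms.intro cc nl pa) auto
 obtain lam where lam: "lam > 0" "\<forall>A u. gsol A u --> (\<forall>j i. \<bar>A j i\<bar> <= lam) -->
   (\<forall>j. (\<exists>c. \<forall>x\<in>chemi k. u j x = c) \<and> (\<forall>x\<in>chemi k. rh A u j x = 0))" using const_small by (elim exE conjE) (rule that)
 show ?thesis
 proof (rule exI[of _ lam], intro conjI allI impI lam(1), goal_cases)
  case (1 A u j)
  have "gsol A u" unfolding gsol_def rh_def[abs_def] using 1 hs_of_sol by blast
  from lam(2)[THEN spec[of _ A], THEN spec[of _ u], THEN mp, OF this, THEN mp, OF 1(3), THEN spec[of _ j]] show ?case by blast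
 next
  case (2 A u j)
  have "gsol A u" unfolding gsol_def rh_def[abs_def] using 2 hs_of_sol by blast
  from lam(2)[THEN spec[of _ A], THEN spec[of _ u], THEN mp, OF this, THEN mp, OF 2(3), THEN spec[of _ j]] show ?case unfolding rh_def by blast
 qed
qed

text \<open>Positivity is given on the open hemisphere only; a point of the equator is a limit along
  the great circle towards e_k.\<close>

lemma nonneg_chemi:
 fixes u :: "real^'m::finite => real"
 assumes c: "continuous_on (chemi k) u" and pos: "\<And>x. x \<in> hemi k ==> u x > 0" and x: "x \<in> chemi k"
 shows "0 <= u x"
proof (cases "x $ k = 0")
 case False
 then have "x \<in> hemi k" using x by (auto simp: chemi_def hemi_def)
 then show ?thesis using pos less_imp_le by blast
next
 case True
 define y where "y m = cos (1 / real (Suc m)) *\<^sub>R x + sin (1 / real (Suc m)) *\<^sub>R axis k (1::real)" for m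
 have n1: "x \<bullet> x = 1" using x by (simp add: chemi_def norm_eq_1)
 have yh: "y m \<in> hemi k" for m
 proof -
  let ?t = "1 / real (Suc m)"
  have t1: "?t <= 1" by simp
  have "sin ?t > 0" by (rule sin_gt_zero) (simp, use pi_gt3 t1 in linarith)
  moreover have "y m \<bullet> y m = (cos ?t)^2 + (sin ?t)^2"
   using n1 True by (simp add: y_def inner_add_left inner_add_right inner_axis inner_axis' power2_eq_square)
  then have "norm (y m) = 1" by (simp add: norm_eq_1)
  ultimately show ?thesis using True by (simp add: hemi_def y_def)
 qed
 have t0: "(\<lambda>m. 1 / real (Suc m)) \<longlonglongrightarrow> 0" using LIMSEQ_Suc[OF lim_const_over_n[of "1::real"]] by simp
 have "y \<longlonglongrightarrow> cos 0 *\<^sub>R x + sin 0 *\<^sub>R axis k (1::real)" unfolding y_def[abs_def] by (intro tendsto_intros t0)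
 then have "y \<longlonglongrightarrow> x" by simp
 from continuous_on_tendsto_compose[OF c this x] have "(\<lambda>m. u (y m)) \<longlonglongrightarrow> u x"
  using yh by (auto simp: hemi_def chemi_def less_imp_le)
 then show ?thesis using LIMSEQ_le_const pos[OF yh] less_imp_le by metis
qed

section \<open>The hypotheses on the nonlinearities\<close>

text \<open>The scalar equation is treated as a system with two equal components. The mean (a + b)/2
  returns \<open>f\<close> on the diagonal and makes \<open>G\<close> positive as soon as a + b >
  0.\<close>

lemma nonlin_scalar:
 assumes "hypH n f"
 obtains \<psi> p \<mu> C where "nonlin (\<lambda>j a b. f ((a + b) / 2)) \<psi> p \<mu> C" "p < (n + 2) / (n - 2)"
proof -
 note h = assms[unfolded hypH_def, THEN conjunct2]
 have f0: "f t >= 0" if "t >= 0" for t using h[THEN conjunct1] that by blast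
 have fp: "f t * t powr (- ((n+2)/(n-2))) > 0" if "t > 0" for t using h[THEN conjunct2, THEN conjunct1] that by blast
 obtain p c1 \<mu> C where p: "1 < p" "p < (n+2)/(n-2)" and c1: "c1 > 0" and lim: "((\<lambda>t. f t * t powr (- p)) \<longlongrightarrow> c1) at_top"
  and \<mu>: "0 < \<mu>" "\<mu> <= p - 1" and C: "C > 0"
  and H3': "\<forall>r t. 0 <= r \<and> r < t --> \<bar>(f t - f r) / (t - r)\<bar> <= C * (t powr \<mu> + t powr (p - 1))"
  using h[THEN conjunct2, THEN conjunct2, THEN conjunct2] by (elim exE conjE) (rule that)
 have H3: "\<bar>(f t - f r) / (t - r)\<bar> <= C * (t powr \<mu> + t powr (p - 1))" if "0 <= r" "r < t" for r t using H3' that by blast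
 have fpos: "f t > 0" if "t > 0" for t using fp[OF that] by (metis mult_nonpos_nonneg not_le powr_ge_zero)
 have fl1: "\<bar>f t - f r\<bar> <= C * (s powr \<mu> + s powr (p - 1)) * \<bar>t - r\<bar>" if "0 <= r" "r < t" "t <= s" for r t s
 proof -
  have "\<bar>f t - f r\<bar> = \<bar>(f t - f r) / (t - r)\<bar> * (t - r)" using that by (simp add: abs_divide)
  also have "... <= C * (t powr \<mu> + t powr (p - 1)) * (t - r)" using H3[OF that(1,2)] that by (intro mult_right_mono) auto
  also have "... <= C * (s powr \<mu> + s powr (p - 1)) * (t - r)"
   using that C \<mu> by (intro mult_right_mono mult_left_mono add_mono powr_mono2) auto
  finally show ?thesis using that by simp
 qed
 have fl: "\<bar>f t - f r\<bar> <= C * (s powr \<mu> + s powr (p - 1)) * \<bar>t - r\<bar>" if "0 <= r" "r <= s" "0 <= t" "t <= s" for r t s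
  using fl1[of r t s] fl1[of t r s] that by (cases r t rule: linorder_cases) (auto simp: abs_minus_commute)
 have "nonlin (\<lambda>j a b. f ((a + b) / 2)) (\<lambda>j a b. c1 * ((a + b) / 2) powr p) p \<mu> C"
 proof
  fix a b a' b' s :: real
  assume "0 <= a" "a <= s" "0 <= b" "b <= s" "0 <= a'" "a' <= s" "0 <= b'" "b' <= s"
  then have "\<bar>f ((a + b) / 2) - f ((a' + b') / 2)\<bar> <= C * (s powr \<mu> + s powr (p - 1)) * \<bar>(a + b) / 2 - (a' + b') / 2\<bar>"
   by (intro fl) auto
  also have "... <= C * (s powr \<mu> + s powr (p - 1)) * (\<bar>a - a'\<bar> + \<bar>b - b'\<bar>)"
  proof (rule mult_left_mono)
   have half: "X / 2 <= Y" if "X <= Y" "0 <= X" for X Y :: real using that by argo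
   have e: "(a + b) / 2 - (a' + b') / 2 = ((a - a') + (b - b')) / 2" by (simp add: field_simps)
   show "\<bar>(a + b) / 2 - (a' + b') / 2\<bar> <= \<bar>a - a'\<bar> + \<bar>b - b'\<bar>"
    unfolding e abs_divide abs_numeral by (rule half[OF abs_triangle_ineq abs_ge_zero])
  qed (use C in simp)
  finally show "\<bar>f ((a + b) / 2) - f ((a' + b') / 2)\<bar> <= C * (s powr \<mu> + s powr (p - 1)) * (\<bar>a - a'\<bar> + \<bar>b - b'\<bar>)" .
 next
  fix a b :: real assume ab: "0 <= a" "0 <= b"
  define c where "c = (a + b) / 2"
  have "((\<lambda>t. f (c * t) * t powr (- p)) \<longlongrightarrow> c1 * c powr p) at_top"
  proof (cases "c = 0")
   case True
   have "((\<lambda>t::real. t powr (- p)) \<longlongrightarrow> 0) at_top" using p by (intro tendsto_neg_powr filterlim_ident) auto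
   from tendsto_mult_right_zero[OF this, of "f 0"] show ?thesis using True p by simp
  next
   case False
   then have c: "c > 0" using ab by (simp add: c_def)
   have "filterlim (\<lambda>t. c * t) at_top at_top"
    by (rule filterlim_tendsto_pos_mult_at_top[OF tendsto_const c filterlim_ident])
   from filterlim_compose[OF lim this] have "((\<lambda>t. f (c * t) * (c * t) powr (- p)) \<longlongrightarrow> c1) at_top" .
   then have "((\<lambda>t. f (c * t) * (c * t) powr (- p) * c powr p) \<longlongrightarrow> c1 * c powr p) at_top" by (intro tendsto_intros)
   moreover have "\<forall>\<^sub>F t in at_top. f (c * t) * (c * t) powr (- p) * c powr p = f (c * t) * t powr (- p)"
    using eventually_gt_at_top[of 0] by eventually_elim (use c in \<open>simp add: powr_mult powr_minus\<close>)
   ultimately show ?thesis by (rule Lim_transform_eventually)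
  qed
  moreover have "(a * t + b * t) / 2 = c * t" for t by (simp add: c_def field_simps)
  ultimately show "((\<lambda>t. f ((a * t + b * t) / 2) * t powr (- p)) \<longlongrightarrow> c1 * ((a + b) / 2) powr p) at_top"
   by (simp add: c_def[symmetric])
 next
  fix a b a' b' :: real assume "0 <= a" "a <= a'" "0 <= b" "b <= b'"
  then show "c1 * ((a + b) / 2) powr p <= c1 * ((a' + b') / 2) powr p"
   using c1 p by (intro mult_left_mono powr_mono2) auto
 next
  fix a b :: real assume "0 < a + b"
  then show "0 < c1 * ((a + b) / 2) powr p + c1 * ((a + b) / 2) powr p" "0 < f ((a + b) / 2) + f ((a + b) / 2)"
   using c1 fpos[of "(a + b) / 2"] by (auto intro!: add_pos_pos mult_pos_pos)
 qed (use p \<mu> C f0 in auto)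
 then show thesis using that p by blast
qed

lemma hypF_singleD:
 assumes "hypF_single n p \<mu> C g"
 shows "0 <= r ==> 0 <= t ==> g r t >= 0"
  and "0 <= r ==> r <= r' ==> 0 <= t ==> g r t <= g r' t"
  and "0 <= t ==> t <= t' ==> 0 <= r ==> g r t <= g r t'"
  and "0 <= r ==> r <= r' ==> 0 <= t ==> 0 < r + t ==> g r' t * (r' + t) powr (- ((n+2)/(n-2))) <= g r t * (r + t) powr (- ((n+2)/(n-2)))"
  and "0 <= t ==> t <= t' ==> 0 <= r ==> 0 < r + t ==> g r t' * (r + t') powr (- ((n+2)/(n-2))) <= g r t * (r + t) powr (- ((n+2)/(n-2)))"
  and "r1 > r2 ==> r2 >= 0 ==> t1 > t2 ==> t2 >= 0 ==>
   \<bar>g r1 t1 - g r2 t2\<bar> / sqrt ((r1 - r2)^2 + (t1 - t2)^2) <= C * ((r1 + t1) powr \<mu> + (r1 + t1) powr (p - 1))"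
 subgoal using assms[unfolded hypF_single_def, THEN conjunct2, THEN conjunct1] by blast
 subgoal using assms[unfolded hypF_single_def, THEN conjunct2, THEN conjunct2, THEN conjunct1] by blast
 subgoal using assms[unfolded hypF_single_def, THEN conjunct2, THEN conjunct2, THEN conjunct2, THEN conjunct1] by blast
 subgoal using assms[unfolded hypF_single_def, THEN conjunct2, THEN conjunct2, THEN conjunct2, THEN conjunct2, THEN conjunct1] by blast
 subgoal using assms[unfolded hypF_single_def, THEN conjunct2, THEN conjunct2, THEN conjunct2, THEN conjunct2, THEN conjunct2, THEN conjunct1] by blast
 subgoal using assms[unfolded hypF_single_def, THEN conjunct2, THEN conjunct2, THEN conjunct2, THEN conjunct2, THEN conjunct2, THEN conjunct2] by blast
 done

text \<open>The given estimate compares only pairs that are strictly ordered in both variables.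
  Raising both larger arguments by a small \<delta> makes them so, monotonicity removes the shift
  again, and arbitrary pairs are compared through their componentwise maximum.\<close>

lemma hypF_single_lip:
 assumes h: "hypF_single n p \<mu> C g" and p: "1 < p" and \<mu>: "0 < \<mu>" "\<mu> < p - 1" and C: "C > 0"
  and ab: "0 <= a" "a <= s" "0 <= b" "b <= s" "0 <= a'" "a' <= s" "0 <= b'" "b' <= s"
 shows "\<bar>g a b - g a' b'\<bar> <= C * 4 powr p * (s powr \<mu> + s powr (p - 1)) * (\<bar>a - a'\<bar> + \<bar>b - b'\<bar>)"
proof (cases "s = 0")
 case True
 then show ?thesis using ab by simp
next
 case False
 then have s: "s > 0" using ab by linarith
 have m1: "g r t <= g r' t" if "0 <= r" "r <= r'" "0 <= t" for r r' t by (rule hypF_singleD(2)[OF h that])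
 have m2: "g r t <= g r t'" if "0 <= t" "t <= t'" "0 <= r" for r t t' by (rule hypF_singleD(3)[OF h that])
 have F3: "\<bar>g r1 t1 - g r2 t2\<bar> / sqrt ((r1 - r2)^2 + (t1 - t2)^2) <= C * ((r1 + t1) powr \<mu> + (r1 + t1) powr (p - 1))"
  if "r1 > r2" "r2 >= 0" "t1 > t2" "t2 >= 0" for r1 r2 t1 t2 by (rule hypF_singleD(6)[OF h that])
 \<comment> \<open>After the shift by \<delta> <= s the sum of the two arguments is at most 4 s; the
   powers of 4 are absorbed into 4^p at the end.\<close>
 define K where "K = C * ((4 * s) powr \<mu> + (4 * s) powr (p - 1))"
 have K0: "K >= 0" using C by (simp add: K_def)
 have mono: "g r t <= g r' t'" if "0 <= r" "r <= r'" "0 <= t" "t <= t'" for r r' t t'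
  using m1[of r r' t] m2[of t t' r'] that by linarith
 have up: "g r1 t1 - g r2 t2 <= K * ((r1 - r2) + (t1 - t2))"
  if r: "0 <= r2" "r2 <= r1" "r1 <= s" "0 <= t2" "t2 <= t1" "t1 <= s" for r1 r2 t1 t2
 proof (rule field_le_epsilon)
  fix e :: real assume e: "e > 0"
  define \<delta> where "\<delta> = min s (e / (2 * K + 1))"
  have \<delta>: "\<delta> > 0" "\<delta> <= s" using s e K0 by (auto simp: \<delta>_def)
  have "K * (2 * \<delta>) <= K * (2 * (e / (2 * K + 1)))" using K0 by (intro mult_left_mono) (auto simp: \<delta>_def)
  also have "... <= e" using K0 e by (simp add: field_simps)
  finally have Ke: "K * (2 * \<delta>) <= e" .
  let ?D = "sqrt ((r1 + \<delta> - r2)^2 + (t1 + \<delta> - t2)^2)"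
  have D: "?D > 0" using r \<delta> by (intro real_sqrt_gt_zero add_pos_pos) auto
  have "\<bar>g (r1 + \<delta>) (t1 + \<delta>) - g r2 t2\<bar> / ?D <= C * ((r1 + \<delta> + (t1 + \<delta>)) powr \<mu> + (r1 + \<delta> + (t1 + \<delta>)) powr (p - 1))"
   using r \<delta> by (intro F3) auto
  also have "... <= K" unfolding K_def using r \<delta> C \<mu> by (intro mult_left_mono add_mono powr_mono2) auto
  finally have "\<bar>g (r1 + \<delta>) (t1 + \<delta>) - g r2 t2\<bar> <= K * ?D" using D by (simp add: pos_divide_le_eq)
  also have "... <= K * ((r1 + \<delta> - r2) + (t1 + \<delta> - t2))"
   using K0 r \<delta> by (intro mult_left_mono sqrt_sum_squares_le_sum) auto
  also have "... = K * ((r1 - r2) + (t1 - t2)) + K * (2 * \<delta>)" by (simp add: algebra_simps)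
  finally show "g r1 t1 - g r2 t2 <= K * ((r1 - r2) + (t1 - t2)) + e"
   using mono[of r1 "r1 + \<delta>" t1 "t1 + \<delta>"] r \<delta> Ke by linarith
 qed
 define X where "X = \<bar>a - a'\<bar> + \<bar>b - b'\<bar>"
 have "g (max a a') (max b b') - g a b <= K * ((max a a' - a) + (max b b' - b))" using ab by (intro up) auto
 also have "... <= K * X" using K0 by (intro mult_left_mono) (auto simp: X_def)
 finally have 1: "g (max a a') (max b b') - g a b <= K * X" .
 have "g (max a a') (max b b') - g a' b' <= K * ((max a a' - a') + (max b b' - b'))" using ab by (intro up) auto
 also have "... <= K * X" using K0 by (intro mult_left_mono) (auto simp: X_def)
 finally have 2: "g (max a a') (max b b') - g a' b' <= K * X" .
 have "\<bar>g a b - g a' b'\<bar> <= K * X"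
  using 1 2 mono[of a "max a a'" b "max b b'"] mono[of a' "max a a'" b' "max b b'"] ab by fastforce
 also have "K <= C * (4 powr p * s powr \<mu> + 4 powr p * s powr (p - 1))"
  unfolding K_def using C s \<mu> p by (auto intro!: mult_left_mono add_mono mult_right_mono powr_mono simp: powr_mult)
 then have "K * X <= C * 4 powr p * (s powr \<mu> + s powr (p - 1)) * X"
  by (intro mult_right_mono) (auto simp: X_def distrib_left mult.assoc)
 finally show ?thesis unfolding X_def .
qed

text \<open>Two properties travel along rays: \<psi> inherits monotonicity from \<open>G\<close> in
  the limit, and \<open>G\<close> inherits positivity from \<psi> through the monotone
  quotient.\<close>

lemma nonlin_system:
 assumes "hypF n f1 f2"
 obtains \<psi> p \<mu> C where "nonlin (\<lambda>j. if j then f1 else f2) \<psi> p \<mu> C" "p < (n + 2) / (n - 2)"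
proof -
 from assms obtain p \<mu> C \<psi>1 \<psi>2 where p: "1 < p" "p < (n+2)/(n-2)" and \<mu>: "0 < \<mu>" "\<mu> < p - 1" and C: "C > 0"
  and h1: "hypF_single n p \<mu> C f1" and h2: "hypF_single n p \<mu> C f2"
  and lim: "\<forall>a1\<ge>0. \<forall>a2\<ge>0. ((\<lambda>t. f1 (a1 * t) (a2 * t) * t powr (- p)) \<longlongrightarrow> \<psi>1 a1 a2) at_top \<and>
       ((\<lambda>t. f2 (a1 * t) (a2 * t) * t powr (- p)) \<longlongrightarrow> \<psi>2 a1 a2) at_top"
  and \<psi>p: "\<forall>a1\<ge>0. \<forall>a2\<ge>0. a1 + a2 > 0 --> \<psi>1 a1 a2 + \<psi>2 a1 a2 > (0::real)"
  using assms unfolding hypF_def by (elim exE conjE) (rule that)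
 define G where "G = (\<lambda>j. if j then f1 else f2)"
 define \<psi> where "\<psi> = (\<lambda>j. if j then \<psi>1 else \<psi>2)"
 have h: "hypF_single n p \<mu> C (G j)" for j using h1 h2 by (simp add: G_def)
 have l: "((\<lambda>t. G j (a * t) (b * t) * t powr (- p)) \<longlongrightarrow> \<psi> j a b) at_top" if "0 <= a" "0 <= b" for j a b
  using lim[rule_format, OF that] by (cases j) (simp_all add: G_def \<psi>_def)
 have m1: "G j r t <= G j r' t" if "0 <= r" "r <= r'" "0 <= t" for j r r' t by (rule hypF_singleD(2)[OF h[of j] that])
 have m2: "G j r t <= G j r t'" if "0 <= t" "t <= t'" "0 <= r" for j r t t' by (rule hypF_singleD(3)[OF h[of j] that])
 have G0: "0 <= G j r t" if "0 <= r" "0 <= t" for j r t by (rule hypF_singleD(1)[OF h[of j] that])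
 have F2: "G j r' t * (r' + t) powr (- ((n+2)/(n-2))) <= G j r t * (r + t) powr (- ((n+2)/(n-2)))"
  if "0 <= r" "r <= r'" "0 <= t" "0 < r + t" for j r r' t by (rule hypF_singleD(4)[OF h[of j] that])
 have F2': "G j r t' * (r + t') powr (- ((n+2)/(n-2))) <= G j r t * (r + t) powr (- ((n+2)/(n-2)))"
  if "0 <= t" "t <= t'" "0 <= r" "0 < r + t" for j r t t' by (rule hypF_singleD(5)[OF h[of j] that])
 have \<psi>p': "\<psi> True a b + \<psi> False a b > 0" if "0 <= a" "0 <= b" "0 < a + b" for a b using \<psi>p[rule_format, OF that] by (simp add: \<psi>_def)
 \<comment> \<open>Far out on the ray \<open>G\<close> is positive because \<psi> is. The quotient
   by (r + t)^((n+2)/(n-2)) is nonincreasing, so positivity comes back to (a,b), one variable at a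
   time.\<close>
 have Gp: "G j a b > 0" if ab: "0 <= a" "0 <= b" "0 < a + b" and q: "\<psi> j a b > 0" for j a b
 proof -
  have "\<forall>\<^sub>F t in at_top. G j (a * t) (b * t) * t powr (- p) > 0 \<and> t >= (1::real)"
   by (intro eventually_conj order_tendstoD(1)[OF l[OF ab(1,2)] q] eventually_ge_at_top)
  then obtain t :: real where t: "G j (a * t) (b * t) * t powr (- p) > 0" "t >= 1" by (auto simp: eventually_at_top_linorder)
  then have Gt: "G j (a * t) (b * t) > 0" by (metis mult_nonpos_nonneg not_le powr_ge_zero)
  have at: "a <= a * t" "b <= b * t" using ab t(2) mult_left_mono[of 1 t a] mult_left_mono[of 1 t b] by auto
  have pw: "0 < (a * t + b * t) powr (- ((n+2)/(n-2)))" using ab at by simp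
  have "0 < G j (a * t) (b * t) * (a * t + b * t) powr (- ((n+2)/(n-2)))" using Gt pw by (rule mult_pos_pos)
  also have "... <= G j a (b * t) * (a + b * t) powr (- ((n+2)/(n-2)))" using ab at t by (intro F2) auto
  also have "... <= G j a b * (a + b) powr (- ((n+2)/(n-2)))" using ab at by (intro F2') auto
  finally show ?thesis by (metis mult_nonpos_nonneg not_le powr_ge_zero)
 qed
 have "nonlin G \<psi> p \<mu> (C * 4 powr p)"
 proof
  fix j and a b a' b' s :: real
  assume "0 <= a" "a <= s" "0 <= b" "b <= s" "0 <= a'" "a' <= s" "0 <= b'" "b' <= s"
  then show "\<bar>G j a b - G j a' b'\<bar> <= C * 4 powr p * (s powr \<mu> + s powr (p - 1)) * (\<bar>a - a'\<bar> + \<bar>b - b'\<bar>)"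
   by (intro hypF_single_lip[OF h p(1) \<mu> C])
 next
  fix j and a b a' b' :: real assume ab: "0 <= a" "a <= a'" "0 <= b" "b <= b'"
  have "\<forall>\<^sub>F t in at_top. G j (a * t) (b * t) * t powr (- p) <= G j (a' * t) (b' * t) * t powr (- p)"
   using eventually_ge_at_top[of 0]
  proof eventually_elim
   case (elim t)
   have "G j (a * t) (b * t) <= G j (a' * t) (b * t)" using ab elim by (intro m1 mult_right_mono mult_nonneg_nonneg) auto
   also have "... <= G j (a' * t) (b' * t)" using ab elim by (intro m2 mult_right_mono mult_nonneg_nonneg) auto
   finally show ?case by (intro mult_right_mono) auto
  qed
  then show "\<psi> j a b <= \<psi> j a' b'" using ab by (intro tendsto_le[OF _ l l]) auto
 next
  fix a b :: real assume ab: "0 <= a" "0 <= b" "0 < a + b"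
  then have "\<psi> True a b > 0 \<or> \<psi> False a b > 0" using \<psi>p'[OF ab] by linarith
  then show "0 < G True a b + G False a b"
   using Gp[OF ab] G0[OF ab(1,2), of True] G0[OF ab(1,2), of False] by (metis add_pos_nonneg add_nonneg_pos)
 qed (use p \<mu> C G0 l \<psi>p' in auto)
 then show thesis using that p unfolding G_def by blast
qed

text \<open>Witnesses c1 = 1, \<mu> = p - 1 and C = p. The mean value theorem gives the Lipschitz
  bound for r > 0; for r = 0 the quotient is t^(p-1) itself, as \<open>0 powr p\<close> is
  0.\<close>

lemma hypH_powr:
 assumes p: "1 < p" "p < (n + 2) / (n - 2)"
 shows "hypH n (\<lambda>t. t powr p)"
proof -
 let ?q = "(n + 2) / (n - 2)"
 have lip: "\<bar>(t powr p - r powr p) / (t - r)\<bar> <= p * (t powr (p - 1) + t powr (p - 1))" if r: "0 <= r" "r < t" for r t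
 proof (cases "r = 0")
  case True
  have "\<bar>(t powr p - r powr p) / (t - r)\<bar> = t powr (p - 1)" using r True p by (simp add: powr_diff)
  also have "... <= p * (t powr (p - 1) + t powr (p - 1))"
  proof -
   have "t powr (p - 1) <= p * t powr (p - 1)" using mult_right_mono[of 1 p "t powr (p - 1)"] p by simp
   moreover have "0 <= t powr (p - 1)" by simp
   ultimately show ?thesis unfolding distrib_left by linarith
  qed
  finally show ?thesis .
 next
  case False
  then have r0: "r > 0" using r by simp
  have "\<exists>z>r. z < t \<and> t powr p - r powr p = (t - r) * (p * z powr (p - 1))"
   by (rule MVT2[OF r(2)]) (use r0 in \<open>auto intro!: derivative_eq_intros\<close>)
  then obtain z where z: "r < z" "z < t" "t powr p - r powr p = (t - r) * (p * z powr (p - 1))" by blast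
  have "(t powr p - r powr p) / (t - r) = p * z powr (p - 1)" using z(3) r by simp
  then have "\<bar>(t powr p - r powr p) / (t - r)\<bar> = p * z powr (p - 1)" using p by simp
  also have "... <= p * (t powr (p - 1) + t powr (p - 1))"
  proof -
   have "z powr (p - 1) <= t powr (p - 1)" using z r0 p by (intro powr_mono2) auto
   moreover have "0 <= t powr (p - 1)" by simp
   ultimately have "z powr (p - 1) <= t powr (p - 1) + t powr (p - 1)" by linarith
   then show ?thesis using p by (intro mult_left_mono) auto
  qed
  finally show ?thesis .
 qed
 have "((\<lambda>t::real. t powr p * t powr (- p)) \<longlongrightarrow> 1) at_top"
 proof (rule Lim_transform_eventually[OF tendsto_const])
  show "\<forall>\<^sub>F t in at_top. 1 = t powr p * t powr (- p)"
   using eventually_gt_at_top[of "0::real"] by eventually_elim (simp add: powr_minus)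
 qed
 then have lim0: "((\<lambda>t::real. t powr p * t powr (- p)) \<longlongrightarrow> 1) at_top" .
 have lim: "\<exists>p' c1. 1 < p' \<and> p' < ?q \<and> c1 > 0 \<and> ((\<lambda>t. t powr p * t powr (- p')) \<longlongrightarrow> c1) at_top \<and>
    (\<exists>\<mu> C. 0 < \<mu> \<and> \<mu> <= p' - 1 \<and> C > 0 \<and>
     (\<forall>r t. 0 <= r \<and> r < t --> \<bar>(t powr p - r powr p) / (t - r)\<bar> <= C * (t powr \<mu> + t powr (p' - 1))))"
  by (rule exI[of _ p], rule exI[of _ "1::real"], intro conjI p lim0 zero_less_one, rule exI[of _ "p - 1"], rule exI[of _ p])
   (intro conjI allI impI lip; use p in simp)
 have mono: "t powr p * t powr (- ?q) <= s powr p * s powr (- ?q)" if "0 < s" "s <= t" for s t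
  unfolding powr_add[symmetric] using that p by (intro powr_mono2') auto
 have c: "continuous_on {0..} (\<lambda>t::real. t powr p)" by (intro continuous_on_powr' continuous_intros) (use p in auto)
 have pos: "\<forall>t>0. t powr p * t powr (- ?q) > 0" and nn: "\<forall>t\<ge>0. t powr p >= 0" by simp_all
 have mono': "\<forall>s t. 0 < s \<and> s <= t --> t powr p * t powr (- ?q) <= s powr p * s powr (- ?q)" using mono by blast
 show ?thesis unfolding hypH_def by (intro conjI c nn pos mono' lim)
qed

lemma const_pos_sol:
 assumes "c > 0" "f c = lam * c"
 shows "pos_sol_P k \<phi> f lam (\<lambda>x::real^'m::finite. c)"
proof -
 have e: "ext (\<lambda>x::real^'m. c) = (\<lambda>x. c)" by (simp add: ext_def fun_eq_iff)
 have pt: "partial i (\<lambda>x::real^'m. d) = (\<lambda>x. 0)" for i and d :: real by (simp add: partial_def fun_eq_iff)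
 have "has_normal_deriv_g k \<phi> (\<lambda>x. c) y 0" for y
  unfolding has_normal_deriv_g_def by (intro exI[of _ "0::real"]) simp
 then show ?thesis using assms unfolding pos_sol_P_def neumann_sol_def C2_on_def lap_g_def e pt
  by simp
qed

text \<open>The diagonal system with \<open>lam\<close> times the identity as coefficient matrix.
  Besides constancy the equation for the constant is retained, which the uniqueness claim for powers
  needs; evaluation at e_k shows c > 0.\<close>

lemma pos_sol_P_const:
 fixes k :: "'m::finite" and \<phi> :: "real^'m => real"
 assumes m4: "CARD('m) >= 4" and cf: "conf_factor k \<phi>" and f: "hypH (dimn TYPE('m)) f"
 shows "\<exists>lamS>0. \<forall>lam u. 0 < lam --> lam < lamS --> pos_sol_P k \<phi> f lam u -->
  (\<exists>c>0. (\<forall>x\<in>chemi k. u x = c) \<and> f c = lam * c)"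
proof -
 obtain \<psi> p \<mu> C where nl: "nonlin (\<lambda>j a b. f ((a + b) / 2)) \<psi> p \<mu> C" and p: "p < (dimn TYPE('m) + 2) / (dimn TYPE('m) - 2)"
  using nonlin_scalar[OF f] .
 obtain lamS where lamS: "lamS > 0" and H: "\<forall>A u. (\<forall>j. neumann_sol k \<phi> (u j) (\<lambda>x. f ((u True x + u False x) / 2) - (A j True * u True x + A j False * u False x))) -->
  (\<forall>j. \<forall>x\<in>chemi k. 0 <= u j x) --> (\<forall>j i. \<bar>A j i\<bar> <= lamS) -->
  (\<forall>j. (\<exists>c. \<forall>x\<in>chemi k. u j x = c) \<and> (\<forall>x\<in>chemi k. f ((u True x + u False x) / 2) - (A j True * u True x + A j False * u False x) = 0))"
  using neumann_sol_const[OF m4 cf nl p] by (elim exE conjE) (rule that)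
 show ?thesis
 proof (rule exI[of _ lamS], intro conjI allI impI lamS)
  fix lam u assume l: "0 < lam" "lam < lamS" and s: "pos_sol_P k \<phi> f lam u"
  have pos: "\<And>x. x \<in> hemi k ==> u x > 0" and ns: "neumann_sol k \<phi> u (\<lambda>x. f (u x) - lam * u x)"
   using s unfolding pos_sol_P_def by auto
  have c: "continuous_on (chemi k) u" using ns unfolding neumann_sol_def by blast
  define A where "A j i = (if j = i then lam else 0)" for j i :: bool
  have e: "f ((u x + u x) / 2) - (A j True * u x + A j False * u x) = f (u x) - lam * u x" for j x
   by (cases j) (simp_all add: A_def)
  have "(\<exists>c. \<forall>x\<in>chemi k. u x = c) \<and> (\<forall>x\<in>chemi k. f (u x) - lam * u x = 0)"
   
  proof -
   have 1: "\<forall>j::bool. neumann_sol k \<phi> u (\<lambda>x. f ((u x + u x) / 2) - (A j True * u x + A j False * u x))"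
    unfolding e using ns by blast
   have 2: "\<forall>j::bool. \<forall>x\<in>chemi k. 0 <= u x" using nonneg_chemi[OF c pos] by blast
   have 3: "\<forall>j i. \<bar>A j i\<bar> <= lamS" using l lamS by (simp add: A_def)
   show ?thesis
    using H[THEN spec[of _ A], THEN spec[of _ "\<lambda>j. u"], THEN mp, OF 1, THEN mp, OF 2, THEN mp, OF 3] unfolding e by blast
  qed
  then obtain c where c: "\<forall>x\<in>chemi k. u x = c" "\<forall>x\<in>chemi k. f (u x) - lam * u x = 0" by blast
  have k: "axis k (1::real) \<in> hemi k" "axis k (1::real) \<in> chemi k" by (simp_all add: hemi_def chemi_def)
  then have "c > 0" "f c = lam * c" using c pos[of "axis k 1"] by auto
  then show "\<exists>c>0. (\<forall>x\<in>chemi k. u x = c) \<and> f c = lam * c" using c by blast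
 qed
qed

text \<open>The common threshold is the smaller of those for the scalar equation and the system. The
  claim on powers concerns nonlinearities other than \<open>f\<close> and has a threshold for each
  exponent; there c^p = lam c leaves lam^(1/(p-1)) as the only positive constant, and that constant
  is checked to be a solution.\<close>

theorem theorem1p7:
  fixes k :: "'m::finite" and \<phi> :: "real^'m \<Rightarrow> real" and f :: "real \<Rightarrow> real"
    and f1 f2 :: "real \<Rightarrow> real \<Rightarrow> real"
  assumes "CARD('m) \<ge> 4"
    and "conf_factor k \<phi>"
    and "hypH (dimn TYPE('m)) f"
    and "hypF (dimn TYPE('m)) f1 f2"
  shows "(\<exists>lamS>0.
     (\<forall>lam. 0 < lam \<and> lam < lamS \<longrightarrow>
        (\<forall>u. pos_sol_P k \<phi> f lam u \<longrightarrow> (\<exists>c. \<forall>x\<in>chemi k. u x = c))) \<and>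
     (\<forall>A :: real^2^2. 0 < norm A \<and> norm A < lamS \<longrightarrow>
        (\<forall>u1 u2. pos_sol_S k \<phi> f1 f2 A u1 u2 \<longrightarrow>
           (\<exists>c1 c2. \<forall>x\<in>chemi k. u1 x = c1 \<and> u2 x = c2)))) \<and>
   (\<forall>p. 1 < p \<and> p < (dimn TYPE('m) + 2) / (dimn TYPE('m) - 2) \<longrightarrow>
     (\<exists>lam0>0. \<forall>lam. 0 < lam \<and> lam < lam0 \<longrightarrow>
        pos_sol_P k \<phi> (\<lambda>t. t powr p) lam (\<lambda>x. lam powr (1 / (p - 1))) \<and>
        (\<forall>u. pos_sol_P k \<phi> (\<lambda>t. t powr p) lam u \<longrightarrow>
           (\<forall>x\<in>chemi k. u x = lam powr (1 / (p - 1))))))"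
proof -
 obtain lH where lH: "lH > 0" and H: "\<forall>lam u. 0 < lam --> lam < lH --> pos_sol_P k \<phi> f lam u --> (\<exists>c>0. (\<forall>x\<in>chemi k. u x = c) \<and> f c = lam * c)"
  using pos_sol_P_const[OF assms(1-3)] by blast
 obtain \<psi> p \<mu> C where nl: "nonlin (\<lambda>j. if j then f1 else f2) \<psi> p \<mu> C" and p: "p < (dimn TYPE('m) + 2) / (dimn TYPE('m) - 2)"
  using nonlin_system[OF assms(4)] .
 let ?G = "\<lambda>j. if j then f1 else f2"
 obtain lF where lF: "lF > 0" and F: "\<forall>A u. (\<forall>j. neumann_sol k \<phi> (u j) (\<lambda>x. ?G j (u True x) (u False x) - (A j True * u True x + A j False * u False x))) -->
  (\<forall>j. \<forall>x\<in>chemi k. 0 <= u j x) --> (\<forall>j i. \<bar>A j i\<bar> <= lF) --> (\<forall>j. (\<exists>c. \<forall>x\<in>chemi k. u j x = c) \<and> (\<forall>x\<in>chemi k. ?G j (u True x) (u False x) - (A j True * u True x + A j False * u False x) = 0))"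
  using neumann_sol_const[OF assms(1,2) nl p] by (elim exE conjE) (rule that)
 have sys: "\<exists>c1 c2. \<forall>x\<in>chemi k. u1 x = c1 \<and> u2 x = c2"
  if A: "norm A < lF" and s: "pos_sol_S k \<phi> f1 f2 A u1 u2" for A :: "real^2^2" and u1 u2
 proof -
  define B where "B j i = A $ (if j then 1 else 2) $ (if i then 1 else 2)" for j i
  define u where "u j = (if j then u1 else u2)" for j
  have ns: "neumann_sol k \<phi> u1 (\<lambda>x. f1 (u1 x) (u2 x) - A$1$1 * u1 x - A$1$2 * u2 x)"
   "neumann_sol k \<phi> u2 (\<lambda>x. f2 (u1 x) (u2 x) - A$2$1 * u1 x - A$2$2 * u2 x)"
   and pos: "\<And>x. x \<in> hemi k ==> u1 x > 0" "\<And>x. x \<in> hemi k ==> u2 x > 0"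
   using s unfolding pos_sol_S_def by auto
  have c: "continuous_on (chemi k) u1" "continuous_on (chemi k) u2" using ns unfolding neumann_sol_def by auto
  have 3: "\<forall>j i. \<bar>B j i\<bar> <= lF"
  proof (intro allI)
   fix j i
   have "\<bar>B j i\<bar> <= norm (A $ (if j then 1 else 2))"
    unfolding B_def using Finite_Cartesian_Product.norm_nth_le[of "A $ (if j then 1 else 2)"] by simp
   also have "... <= norm A" by (rule Finite_Cartesian_Product.norm_nth_le)
   finally show "\<bar>B j i\<bar> <= lF" using A by simp
  qed
  have 1: "\<forall>j. neumann_sol k \<phi> (u j) (\<lambda>x. ?G j (u True x) (u False x) - (B j True * u True x + B j False * u False x))"
  proof
   fix j
   show "neumann_sol k \<phi> (u j) (\<lambda>x. ?G j (u True x) (u False x) - (B j True * u True x + B j False * u False x))"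
    using ns by (cases j) (simp_all add: u_def B_def diff_diff_eq)
  qed
  have 2: "\<forall>j. \<forall>x\<in>chemi k. 0 <= u j x"
   using nonneg_chemi[OF c(1) pos(1)] nonneg_chemi[OF c(2) pos(2)] by (auto simp: u_def)
  have "\<exists>c. \<forall>x\<in>chemi k. u j x = c" for j
   using F[THEN spec[of _ B], THEN spec[of _ u], THEN mp, OF 1, THEN mp, OF 2, THEN mp, OF 3, THEN spec[of _ j]] by blast
  from this[of True] this[of False] show ?thesis by (auto simp: u_def)
 qed
 have pw: "\<exists>lam0>0. \<forall>lam. 0 < lam \<and> lam < lam0 -->
    pos_sol_P k \<phi> (\<lambda>t. t powr p) lam (\<lambda>x. lam powr (1 / (p - 1))) \<and>
    (\<forall>u. pos_sol_P k \<phi> (\<lambda>t. t powr p) lam u --> (\<forall>x\<in>chemi k. u x = lam powr (1 / (p - 1))))"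
  if p: "1 < p" "p < (dimn TYPE('m) + 2) / (dimn TYPE('m) - 2)" for p
 proof -
  obtain l0 where l0: "l0 > 0" and U: "\<forall>lam u. 0 < lam --> lam < l0 --> pos_sol_P k \<phi> (\<lambda>t. t powr p) lam u --> (\<exists>c>0. (\<forall>x\<in>chemi k. u x = c) \<and> c powr p = lam * c)"
   using pos_sol_P_const[OF assms(1,2) hypH_powr[OF p]] by blast
  have e: "1 / (p - 1) * p = 1 + 1 / (p - 1)" using p by (simp add: field_simps)
  have sol: "(lam powr (1 / (p - 1))) powr p = lam * lam powr (1 / (p - 1))" if "lam > 0" for lam
   unfolding powr_powr e powr_add using that by simp
  have uniq: "c = lam powr (1 / (p - 1))" if c: "c > 0" "c powr p = lam * c" for c lam
  proof -
   have "lam = c powr (p - 1)" using c by (simp add: powr_diff)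
   then show ?thesis using c p by (simp add: powr_powr)
  qed
  show ?thesis
  proof (intro exI[of _ l0] conjI allI impI ballI l0, goal_cases)
   case (1 lam)
   then show ?case using sol[of lam] by (intro const_pos_sol) auto
  next
   case (2 lam u x)
   then obtain c where c: "c > 0" "\<forall>x\<in>chemi k. u x = c" "c powr p = lam * c" using U by blast
   then show ?case using uniq[OF c(1,3)] 2 by simp
  qed
 qed
 have a: "0 < min lH lF" using lH lF by simp
 have b: "\<forall>lam. 0 < lam \<and> lam < min lH lF --> (\<forall>u. pos_sol_P k \<phi> f lam u --> (\<exists>c. \<forall>x\<in>chemi k. u x = c))"
 proof (intro allI impI)
  fix lam u assume 1: "0 < lam \<and> lam < min lH lF" and 2: "pos_sol_P k \<phi> f lam u"
  then have "lam < lH" by simp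
  then show "\<exists>c. \<forall>x\<in>chemi k. u x = c" using H 1 2 by blast
 qed
 have c: "\<forall>A :: real^2^2. 0 < norm A \<and> norm A < min lH lF -->
   (\<forall>u1 u2. pos_sol_S k \<phi> f1 f2 A u1 u2 --> (\<exists>c1 c2. \<forall>x\<in>chemi k. u1 x = c1 \<and> u2 x = c2))"
 proof (intro allI impI)
  fix A :: "real^2^2" and u1 u2
  assume "0 < norm A \<and> norm A < min lH lF" "pos_sol_S k \<phi> f1 f2 A u1 u2"
  then show "\<exists>c1 c2. \<forall>x\<in>chemi k. u1 x = c1 \<and> u2 x = c2" by (intro sys[of A]) auto
 qed
 show ?thesis by (rule conjI, rule exI[of _ "min lH lF"], rule conjI[OF a conjI[OF b c]]) (intro allI impI, elim conjE, rule pw)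
qed

end
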